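(* Let $\ell$ be a non-degenerate left integral in the symmetrized Hopf algebroid $\mathcal A=(\mathcal A_L,\mathcal A_R,S)$. Then the left bialgebroids $\mathcal A^*_L$, ${}^*\mathcal A_L$, $(\mathcal A_{*R})^{op}_{cop}$ and $({}_*\mathcal A_R)^{op}_{cop}$ (dual bialgebroids, defined in the context) are isomorphic via the isomorphisms of left bialgebroids $$(\ell_R^{-1}\circ\ell_L,\ \nu):(\mathcal A_{*R})^{op}_{cop}\to\mathcal A^*_L,\qquad({}_R\ell^{-1}\circ{}_L\ell,\ \mu):({}_*\mathcal A_R)^{op}_{cop}\to{}^*\mathcal A_L,$$ $$({}_R\ell^{-1}\circ\xi^{-1}\circ\ell_R,\ \theta_R^{-1}):\mathcal A^*_L\to{}^*\mathcal A_L,\qquad({}_L\ell^{-1}\circ\xi^{-1}\circ\ell_L,\ \mathrm{id}_L):(\mathcal A_{*R})^{op}_{cop}\to({}_*\mathcal A_R)^{op}_{cop}.$$ Here $\xi(a)=S((\lambda^*\leftharpoonup\ell)\rightharpoonup a)$ with $\lambda^*=\ell_R^{-1}(1_A)$ (a ring anti-automorphism of $A$), $\nu=\pi_R\circ s_L$, $\mu=\pi_R\circ t_L$ (ring isomorphisms $L^{op}\to R$) and $\theta_R=\nu\circ\mu^{-1}$.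
   Context: All rings are associative and unital. A left bialgebroid $\mathcal A_L=(A,L,s_L,t_L,\gamma_L,\pi_L)$: ring homomorphisms $s_L:L\to A$, $t_L:L^{op}\to A$ with commuting images; $A$ is an $L$-$L$-bimodule via $l\cdot a\cdot l'=s_L(l)t_L(l')a$ (left and right modules ${}_LA$, $A_L$) and a comonoid in $L$-$L$-bimodules via $\gamma_L(a)=a_{(1)}\otimes a_{(2)}\in A_L\otimes{}_LA$, $\pi_L:A\to L$; moreover $a_{(1)}t_L(l)\otimes a_{(2)}=a_{(1)}\otimes a_{(2)}s_L(l)$, $\gamma_L$ is unital and multiplicative, $\pi_L(1)=1$, $\pi_L(as_L(\pi_L(b)))=\pi_L(ab)=\pi_L(at_L(\pi_L(b)))$. A right bialgebroid $\mathcal A_R=(A,R,s_R,t_R,\gamma_R,\pi_R)$: ring homomorphisms $s_R:R\to A$, $t_R:R^{op}\to A$ with commuting images; $A$ is an $R$-$R$-bimodule via $r\cdot a\cdot r'=as_R(r')t_R(r)$ (left and right modules ${}^RA$, $A^R$) and a comonoid in $R$-$R$-bimodules via $\gamma_R(a)=a^{(1)}\otimes a^{(2)}\in A^R\otimes{}^RA$, $\pi_R:A\to R$; moreover $s_R(r)a^{(1)}\otimes a^{(2)}=a^{(1)}\otimes t_R(r)a^{(2)}$, $\gamma_R$ is unital and multiplicative, $\pi_R(1)=1$, $\pi_R(s_R(\pi_R(a))b)=\pi_R(ab)=\pi_R(t_R(\pi_R(a))b)$. For a right bialgebroid $(A,K,s,t,\gamma,\pi)$, $(\ )^{op}_{cop}$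 denotes the left bialgebroid $(A^{op},K^{op},s,t,\gamma^{op},\pi)$. An isomorphism of left bialgebroids is a pair $(\Phi,\phi)$ of ring isomorphisms of total and base rings with $s'\phi=\Phi s$, $t'\phi=\Phi t$, $\pi'\Phi=\phi\pi$, $\gamma'\Phi=(\Phi\otimes\Phi)\gamma$. A symmetrized Hopf algebroid is a triple $(\mathcal A_L,\mathcal A_R,S)$ of a left and a right bialgebroid on the same total ring $A$ with $R\simeq L^{op}$, and a bijection $S:A\to A$ of additive groups, such that: $s_L(L)=t_R(R)$, $t_L(L)=s_R(R)$; $(\gamma_L\otimes\mathrm{id})\gamma_R=(\mathrm{id}\otimes\gamma_R)\gamma_L$, $(\gamma_R\otimes\mathrm{id})\gamma_L=(\mathrm{id}\otimes\gamma_L)\gamma_R$; $S(t_L(l)at_L(l'))=s_L(l')S(a)s_L(l)$, $S(t_R(r')at_R(r))=s_R(r)S(a)s_R(r')$; $S(a_{(1)})a_{(2)}=s_R\pi_R(a)$, $a^{(1)}S(a^{(2)})=s_L\pi_L(a)$. ($S$ is then automatically a ring anti-automorphism.) Duals: $\mathcal A_*=\mathrm{Hom}(A_L,L_L)$, ${}_*\mathcal A=\mathrm{Hom}({}_LA,{}_LL)$, $\mathcal A^*=\mathrm{Hom}(A^R,R^R)$, ${}^*\mathcal A=\mathrm{Hom}({}^RA,{}^RR)$, which are rings via $(\phi\psi)(a)=\psi(s_L(\phi(a_{(1)}))a_{(2)})$ in $\mathcal A_*$; $(\phi\psi)(a)=\psi(t_L(\phi(a_{(2)}))a_{(1)})$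 in ${}_*\mathcal A$; $(\phi\psi)(a)=\phi(a^{(2)}t_R(\psi(a^{(1)})))$ in $\mathcal A^*$; $(\phi\psi)(a)=\phi(a^{(1)}s_R(\psi(a^{(2)})))$ in ${}^*\mathcal A$. Actions of $A$ on the duals: $(a\rightharpoonup\phi)(b)=\phi(ba)$ on $\mathcal A_*$, $(a\rightharpoondown\phi)(b)=\phi(ba)$ on ${}_*\mathcal A$, $(\phi\leftharpoonup a)(b)=\phi(ab)$ on $\mathcal A^*$, $(\phi\leftharpoondown a)(b)=\phi(ab)$ on ${}^*\mathcal A$. Actions on $A$: $a\leftharpoonup\phi=s_L(\phi(a_{(1)}))a_{(2)}$ ($\phi\in\mathcal A_*$), $a\leftharpoondown\phi=t_L(\phi(a_{(2)}))a_{(1)}$ ($\phi\in{}_*\mathcal A$), $\phi\rightharpoonup a=a^{(2)}t_R(\phi(a^{(1)}))$ ($\phi\in\mathcal A^*$), $\phi\rightharpoondown a=a^{(1)}s_R(\phi(a^{(2)}))$ ($\phi\in{}^*\mathcal A$). A left integral is an $\ell\in A$ with $a\ell=s_L(\pi_L(a))\ell$ for all $a$; it is non-degenerate if both $\ell_R:\mathcal A^*\to A$, $\phi\mapsto\phi\rightharpoonup\ell$, and ${}_R\ell:{}^*\mathcal A\to A$, $\phi\mapsto\phi\rightharpoondown\ell$, are bijective. Then also $\ell_L:\mathcal A_*\to A$, $\phi\mapsto\ell\leftharpoonup\phi$, and ${}_L\ell:{}_*\mathcal A\to A$, $\phi\mapsto\ell\leftharpoondown\phi$, are bijective, the modules $A^R,{}^RA,A_L,{}_LA$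 are finitely generated projective, and the duals are bialgebroids (left bialgebroids $\mathcal A^*_L$, ${}^*\mathcal A_L$ over $R$; right bialgebroids $\mathcal A_{*R}$, ${}_*\mathcal A_R$ over $L$) with structure maps: $\mathcal A^*_L$: $s(r)(a)=r\pi_R(a)$, $t(r)(a)=\pi_R(s_R(r)a)$, $\gamma(\phi)=\phi\leftharpoonup\ell^{(1)}\otimes\ell_R^{-1}(\ell^{(2)})$, $\pi(\phi)=\phi(1_A)$; ${}^*\mathcal A_L$: $s(r)(a)=\pi_R(t_R(r)a)$, $t(r)(a)=\pi_R(a)r$, $\gamma(\phi)={}_R\ell^{-1}(\ell^{(1)})\otimes\phi\leftharpoondown\ell^{(2)}$, $\pi(\phi)=\phi(1_A)$; $\mathcal A_{*R}$: $s(l)(a)=\pi_L(as_L(l))$, $t(l)(a)=l\pi_L(a)$, $\gamma(\phi)=\ell_{(1)}\rightharpoonup\phi\otimes\ell_L^{-1}(\ell_{(2)})$, $\pi(\phi)=\phi(1_A)$; ${}_*\mathcal A_R$: $s(l)(a)=\pi_L(a)l$, $t(l)(a)=\pi_L(at_L(l))$, $\gamma(\phi)={}_L\ell^{-1}(\ell_{(1)})\otimes\ell_{(2)}\rightharpoondown\phi$, $\pi(\phi)=\phi(1_A)$. *)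

theory Defs
  imports "HOL-Algebra.QuotRing" "HOL-Algebra.Free_Abelian_Groups"
begin

section \<open>Opposite rings\<close>

definition opp_ring :: "('a, 'm) ring_scheme \<Rightarrow> ('a, 'm) ring_scheme" where
  "opp_ring R = R\<lparr>mult := (\<lambda>x y. y \<otimes>\<^bsub>R\<^esub> x)\<rparr>"


section \<open>Balanced tensor products\<close>

text \<open>
  The base rings are noncommutative, so the tensor product of a right and a left
  module is just an abelian group: the free abelian group on pairs modulo
  biadditivity and the balancing relation. It is written multiplicatively, because this
  is how quotient groups are written in the library; its elements are cosets of formal
  integer combinations. Both factors are the additive group of one ring \<open>A\<close>; the
  module structures are given by \<open>\<rho> k x\<close> (that is \<open>x \<cdot> k\<close>, left factor)
  and \<open>\<sigma> k y\<close> (that is \<open>k \<cdot> y\<close>, right factor) for \<open>k \<in> K\<close>.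
\<close>

type_synonym 'z frag = "'z \<Rightarrow>\<^sub>0 int"

definition tensor2_rels ::
  "'a ring \<Rightarrow> 'k set \<Rightarrow> ('k \<Rightarrow> 'a \<Rightarrow> 'a) \<Rightarrow> ('k \<Rightarrow> 'a \<Rightarrow> 'a) \<Rightarrow> ('a \<times> 'a) frag set" where
  "tensor2_rels A K \<rho> \<sigma> =
     {frag_of (x \<oplus>\<^bsub>A\<^esub> x', y) - frag_of (x, y) - frag_of (x', y) | x x' y.
        x \<in> carrier A \<and> x' \<in> carrier A \<and> y \<in> carrier A}
   \<union> {frag_of (x, y \<oplus>\<^bsub>A\<^esub> y') - frag_of (x, y) - frag_of (x, y') | x y y'.
        x \<in> carrier A \<and> y \<in> carrier A \<and> y' \<in> carrier A}
   \<union> {frag_of (\<rho> k x, y) - frag_of (x, \<sigma> k y) | k x y.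
        k \<in> K \<and> x \<in> carrier A \<and> y \<in> carrier A}"

definition tensor2_null ::
  "'a ring \<Rightarrow> 'k set \<Rightarrow> ('k \<Rightarrow> 'a \<Rightarrow> 'a) \<Rightarrow> ('k \<Rightarrow> 'a \<Rightarrow> 'a) \<Rightarrow> ('a \<times> 'a) frag set" where
  "tensor2_null A K \<rho> \<sigma> =
     generate (free_Abelian_group (carrier A \<times> carrier A)) (tensor2_rels A K \<rho> \<sigma>)"

definition tensor2 ::
  "'a ring \<Rightarrow> 'k set \<Rightarrow> ('k \<Rightarrow> 'a \<Rightarrow> 'a) \<Rightarrow> ('k \<Rightarrow> 'a \<Rightarrow> 'a) \<Rightarrow> ('a \<times> 'a) frag set monoid" where
  "tensor2 A K \<rho> \<sigma> =
     free_Abelian_group (carrier A \<times> carrier A) Mod tensor2_null A K \<rho> \<sigma>"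

definition tens2 ::
  "'a ring \<Rightarrow> 'k set \<Rightarrow> ('k \<Rightarrow> 'a \<Rightarrow> 'a) \<Rightarrow> ('k \<Rightarrow> 'a \<Rightarrow> 'a) \<Rightarrow> 'a \<Rightarrow> 'a \<Rightarrow> ('a \<times> 'a) frag set" where
  "tens2 A K \<rho> \<sigma> x y =
     tensor2_null A K \<rho> \<sigma> #>\<^bsub>free_Abelian_group (carrier A \<times> carrier A)\<^esub> frag_of (x, y)"

text \<open>
  Threefold tensor products, with possibly different base rings \<open>K\<close> (between the
  first two factors) and \<open>K'\<close> (between the last two). They are formed in one step, so
  that no associativity isomorphism is needed to state (mixed) coassociativity.
\<close>

definition tensor3_rels ::
  "'a ring \<Rightarrow> 'k set \<Rightarrow> ('k \<Rightarrow> 'a \<Rightarrow> 'a) \<Rightarrow> ('k \<Rightarrow> 'a \<Rightarrow> 'a)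
    \<Rightarrow> 'h set \<Rightarrow> ('h \<Rightarrow> 'a \<Rightarrow> 'a) \<Rightarrow> ('h \<Rightarrow> 'a \<Rightarrow> 'a) \<Rightarrow> ('a \<times> 'a \<times> 'a) frag set" where
  "tensor3_rels A K \<rho> \<sigma> K' \<rho>' \<sigma>' =
     {frag_of (x \<oplus>\<^bsub>A\<^esub> x', y, z) - frag_of (x, y, z) - frag_of (x', y, z) | x x' y z.
        x \<in> carrier A \<and> x' \<in> carrier A \<and> y \<in> carrier A \<and> z \<in> carrier A}
   \<union> {frag_of (x, y \<oplus>\<^bsub>A\<^esub> y', z) - frag_of (x, y, z) - frag_of (x, y', z) | x y y' z.
        x \<in> carrier A \<and> y \<in> carrier A \<and> y' \<in> carrier A \<and> z \<in> carrier A}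
   \<union> {frag_of (x, y, z \<oplus>\<^bsub>A\<^esub> z') - frag_of (x, y, z) - frag_of (x, y, z') | x y z z'.
        x \<in> carrier A \<and> y \<in> carrier A \<and> z \<in> carrier A \<and> z' \<in> carrier A}
   \<union> {frag_of (\<rho> k x, y, z) - frag_of (x, \<sigma> k y, z) | k x y z.
        k \<in> K \<and> x \<in> carrier A \<and> y \<in> carrier A \<and> z \<in> carrier A}
   \<union> {frag_of (x, \<rho>' k y, z) - frag_of (x, y, \<sigma>' k z) | k x y z.
        k \<in> K' \<and> x \<in> carrier A \<and> y \<in> carrier A \<and> z \<in> carrier A}"

definition tensor3_null ::
  "'a ring \<Rightarrow> 'k set \<Rightarrow> ('k \<Rightarrow> 'a \<Rightarrow> 'a) \<Rightarrow> ('k \<Rightarrow> 'a \<Rightarrow> 'a)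
    \<Rightarrow> 'h set \<Rightarrow> ('h \<Rightarrow> 'a \<Rightarrow> 'a) \<Rightarrow> ('h \<Rightarrow> 'a \<Rightarrow> 'a) \<Rightarrow> ('a \<times> 'a \<times> 'a) frag set" where
  "tensor3_null A K \<rho> \<sigma> K' \<rho>' \<sigma>' =
     generate (free_Abelian_group (carrier A \<times> carrier A \<times> carrier A))
       (tensor3_rels A K \<rho> \<sigma> K' \<rho>' \<sigma>')"

definition tensor3 ::
  "'a ring \<Rightarrow> 'k set \<Rightarrow> ('k \<Rightarrow> 'a \<Rightarrow> 'a) \<Rightarrow> ('k \<Rightarrow> 'a \<Rightarrow> 'a)
    \<Rightarrow> 'h set \<Rightarrow> ('h \<Rightarrow> 'a \<Rightarrow> 'a) \<Rightarrow> ('h \<Rightarrow> 'a \<Rightarrow> 'a) \<Rightarrow> ('a \<times> 'a \<times> 'a) frag set monoid" where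
  "tensor3 A K \<rho> \<sigma> K' \<rho>' \<sigma>' =
     free_Abelian_group (carrier A \<times> carrier A \<times> carrier A)
       Mod tensor3_null A K \<rho> \<sigma> K' \<rho>' \<sigma>'"

definition tens3 ::
  "'a ring \<Rightarrow> 'k set \<Rightarrow> ('k \<Rightarrow> 'a \<Rightarrow> 'a) \<Rightarrow> ('k \<Rightarrow> 'a \<Rightarrow> 'a)
    \<Rightarrow> 'h set \<Rightarrow> ('h \<Rightarrow> 'a \<Rightarrow> 'a) \<Rightarrow> ('h \<Rightarrow> 'a \<Rightarrow> 'a)
    \<Rightarrow> 'a \<Rightarrow> 'a \<Rightarrow> 'a \<Rightarrow> ('a \<times> 'a \<times> 'a) frag set" where
  "tens3 A K \<rho> \<sigma> K' \<rho>' \<sigma>' x y z =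
     tensor3_null A K \<rho> \<sigma> K' \<rho>' \<sigma>'
       #>\<^bsub>free_Abelian_group (carrier A \<times> carrier A \<times> carrier A)\<^esub> frag_of (x, y, z)"

text \<open>
  \<open>tensor_lift G f\<close> is the homomorphism into the commutative group \<open>G\<close> induced by a
  biadditive balanced map \<open>f\<close>. It plays the role of Sweedler notation: if \<open>\<gamma> a\<close> is
  written \<open>a\<^sub>1 \<otimes> a\<^sub>2\<close>, then \<open>tensor_lift G (\<lambda>(x, y). f x y) (\<gamma> a)\<close> is \<open>f a\<^sub>1 a\<^sub>2\<close>.
  If \<open>f\<close> is not balanced, the value is unspecified.
\<close>

definition frag_hom :: "'x monoid \<Rightarrow> ('z \<Rightarrow> 'x) \<Rightarrow> 'z frag \<Rightarrow> 'x" where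
  "frag_hom G f p =
     finprod G (\<lambda>z. f z [^]\<^bsub>G\<^esub> Poly_Mapping.lookup p z) (Poly_Mapping.keys p)"

definition tensor_lift :: "'x monoid \<Rightarrow> ('z \<Rightarrow> 'x) \<Rightarrow> 'z frag set \<Rightarrow> 'x" where
  "tensor_lift G f T = the_elem (frag_hom G f ` T)"

text \<open>
  The maps \<open>\<gamma> \<otimes> id\<close> and \<open>id \<otimes> \<gamma>\<close> into a threefold tensor product \<open>G\<close>, where
  \<open>e\<close> forms its elementary tensors.
\<close>

definition coprod_fst ::
  "'y frag set monoid \<Rightarrow> ('a \<Rightarrow> 'a \<Rightarrow> 'a \<Rightarrow> 'y frag set) \<Rightarrow> ('a \<Rightarrow> ('a \<times> 'a) frag set)
    \<Rightarrow> ('a \<times> 'a) frag set \<Rightarrow> 'y frag set" where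
  "coprod_fst G e \<gamma> = tensor_lift G (\<lambda>(x, y). tensor_lift G (\<lambda>(u, v). e u v y) (\<gamma> x))"

definition coprod_snd ::
  "'y frag set monoid \<Rightarrow> ('a \<Rightarrow> 'a \<Rightarrow> 'a \<Rightarrow> 'y frag set) \<Rightarrow> ('a \<Rightarrow> ('a \<times> 'a) frag set)
    \<Rightarrow> ('a \<times> 'a) frag set \<Rightarrow> 'y frag set" where
  "coprod_snd G e \<gamma> = tensor_lift G (\<lambda>(x, y). tensor_lift G (\<lambda>(u, v). e x u v) (\<gamma> y))"


section \<open>Left and right bialgebroids\<close>

record ('a, 'k) bialgebroid =
  Tot :: "'a ring"
  Bas :: "'k ring"
  src :: "'k \<Rightarrow> 'a"
  tgt :: "'k \<Rightarrow> 'a"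
  cop :: "'a \<Rightarrow> ('a \<times> 'a) frag set"
  cou :: "'a \<Rightarrow> 'k"

text \<open>
  \<open>A\<^sub>L \<otimes> \<^sub>LA\<close>: here \<open>a \<cdot> l = t l a\<close> and \<open>l \<cdot> a = s l a\<close>. The coproduct is not used in
  forming it, so the tensor product depends only on the ring \<open>A\<close>, the base and \<open>s\<close>, \<open>t\<close>.
\<close>

definition ltensor ::
  "'a ring \<Rightarrow> 'k ring \<Rightarrow> ('k \<Rightarrow> 'a) \<Rightarrow> ('k \<Rightarrow> 'a) \<Rightarrow> ('a \<times> 'a) frag set monoid" where
  "ltensor A L s t = tensor2 A (carrier L) (\<lambda>l a. t l \<otimes>\<^bsub>A\<^esub> a) (\<lambda>l a. s l \<otimes>\<^bsub>A\<^esub> a)"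

definition ltens ::
  "'a ring \<Rightarrow> 'k ring \<Rightarrow> ('k \<Rightarrow> 'a) \<Rightarrow> ('k \<Rightarrow> 'a) \<Rightarrow> 'a \<Rightarrow> 'a \<Rightarrow> ('a \<times> 'a) frag set" where
  "ltens A L s t = tens2 A (carrier L) (\<lambda>l a. t l \<otimes>\<^bsub>A\<^esub> a) (\<lambda>l a. s l \<otimes>\<^bsub>A\<^esub> a)"

text \<open>\<open>A\<^sup>R \<otimes> \<^sup>RA\<close>: here \<open>a \<cdot> r = a s r\<close> and \<open>r \<cdot> a = a t r\<close>.\<close>

definition rtensor ::
  "'a ring \<Rightarrow> 'k ring \<Rightarrow> ('k \<Rightarrow> 'a) \<Rightarrow> ('k \<Rightarrow> 'a) \<Rightarrow> ('a \<times> 'a) frag set monoid" where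
  "rtensor A R s t = tensor2 A (carrier R) (\<lambda>r a. a \<otimes>\<^bsub>A\<^esub> s r) (\<lambda>r a. a \<otimes>\<^bsub>A\<^esub> t r)"

definition rtens ::
  "'a ring \<Rightarrow> 'k ring \<Rightarrow> ('k \<Rightarrow> 'a) \<Rightarrow> ('k \<Rightarrow> 'a) \<Rightarrow> 'a \<Rightarrow> 'a \<Rightarrow> ('a \<times> 'a) frag set" where
  "rtens A R s t = tens2 A (carrier R) (\<lambda>r a. a \<otimes>\<^bsub>A\<^esub> s r) (\<lambda>r a. a \<otimes>\<^bsub>A\<^esub> t r)"

definition ltensor3 ::
  "'a ring \<Rightarrow> 'k ring \<Rightarrow> ('k \<Rightarrow> 'a) \<Rightarrow> ('k \<Rightarrow> 'a) \<Rightarrow> ('a \<times> 'a \<times> 'a) frag set monoid" where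
  "ltensor3 A L s t =
     tensor3 A (carrier L) (\<lambda>l a. t l \<otimes>\<^bsub>A\<^esub> a) (\<lambda>l a. s l \<otimes>\<^bsub>A\<^esub> a)
               (carrier L) (\<lambda>l a. t l \<otimes>\<^bsub>A\<^esub> a) (\<lambda>l a. s l \<otimes>\<^bsub>A\<^esub> a)"

definition ltens3 ::
  "'a ring \<Rightarrow> 'k ring \<Rightarrow> ('k \<Rightarrow> 'a) \<Rightarrow> ('k \<Rightarrow> 'a)
    \<Rightarrow> 'a \<Rightarrow> 'a \<Rightarrow> 'a \<Rightarrow> ('a \<times> 'a \<times> 'a) frag set" where
  "ltens3 A L s t =
     tens3 A (carrier L) (\<lambda>l a. t l \<otimes>\<^bsub>A\<^esub> a) (\<lambda>l a. s l \<otimes>\<^bsub>A\<^esub> a)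
             (carrier L) (\<lambda>l a. t l \<otimes>\<^bsub>A\<^esub> a) (\<lambda>l a. s l \<otimes>\<^bsub>A\<^esub> a)"

definition rtensor3 ::
  "'a ring \<Rightarrow> 'k ring \<Rightarrow> ('k \<Rightarrow> 'a) \<Rightarrow> ('k \<Rightarrow> 'a) \<Rightarrow> ('a \<times> 'a \<times> 'a) frag set monoid" where
  "rtensor3 A R s t =
     tensor3 A (carrier R) (\<lambda>r a. a \<otimes>\<^bsub>A\<^esub> s r) (\<lambda>r a. a \<otimes>\<^bsub>A\<^esub> t r)
               (carrier R) (\<lambda>r a. a \<otimes>\<^bsub>A\<^esub> s r) (\<lambda>r a. a \<otimes>\<^bsub>A\<^esub> t r)"

definition rtens3 ::
  "'a ring \<Rightarrow> 'k ring \<Rightarrow> ('k \<Rightarrow> 'a) \<Rightarrow> ('k \<Rightarrow> 'a)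
    \<Rightarrow> 'a \<Rightarrow> 'a \<Rightarrow> 'a \<Rightarrow> ('a \<times> 'a \<times> 'a) frag set" where
  "rtens3 A R s t =
     tens3 A (carrier R) (\<lambda>r a. a \<otimes>\<^bsub>A\<^esub> s r) (\<lambda>r a. a \<otimes>\<^bsub>A\<^esub> t r)
             (carrier R) (\<lambda>r a. a \<otimes>\<^bsub>A\<^esub> s r) (\<lambda>r a. a \<otimes>\<^bsub>A\<^esub> t r)"

text \<open>
  The assumptions \<open>coprod_add\<close> to \<open>counit_right\<close> say that \<open>(A, \<gamma>, \<pi>)\<close> is a
  comonoid in bimodules. The product in \<open>coprod_mult\<close> is the factorwise product
  \<open>a\<^sub>1 b\<^sub>1 \<otimes> a\<^sub>2 b\<^sub>2\<close>; right multiplication by a pair is well defined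
  on \<open>A\<^sub>L \<otimes> \<^sub>LA\<close>, and the outer lift is well defined by \<open>takeuchi\<close>. This is why the
  lifts are nested in this order (and in the other order for right bialgebroids).
\<close>

locale left_bialgebroid_ops =
  fixes A :: "'a ring" and L :: "'l ring"
    and s t :: "'l \<Rightarrow> 'a" and \<gamma> :: "'a \<Rightarrow> ('a \<times> 'a) frag set" and \<pi> :: "'a \<Rightarrow> 'l"
  assumes ring_total: "ring A"
    and ring_base: "ring L"
    and src_hom: "s \<in> ring_hom L A"
    and tgt_hom: "t \<in> ring_hom (opp_ring L) A"
    and src_tgt_comm: "\<lbrakk>l \<in> carrier L; l' \<in> carrier L\<rbrakk> \<Longrightarrow> s l \<otimes>\<^bsub>A\<^esub> t l' = t l' \<otimes>\<^bsub>A\<^esub> s l"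
    and coprod_add: "\<gamma> \<in> hom (add_monoid A) (ltensor A L s t)"
    and coprod_bimod: "\<lbrakk>a \<in> carrier A; l \<in> carrier L; l' \<in> carrier L\<rbrakk> \<Longrightarrow>
      \<gamma> (s l \<otimes>\<^bsub>A\<^esub> t l' \<otimes>\<^bsub>A\<^esub> a) =
        tensor_lift (ltensor A L s t)
          (\<lambda>(x, y). ltens A L s t (s l \<otimes>\<^bsub>A\<^esub> x) (t l' \<otimes>\<^bsub>A\<^esub> y)) (\<gamma> a)"
    and counit_add: "\<pi> \<in> hom (add_monoid A) (add_monoid L)"
    and counit_bimod: "\<lbrakk>a \<in> carrier A; l \<in> carrier L; l' \<in> carrier L\<rbrakk> \<Longrightarrow>
      \<pi> (s l \<otimes>\<^bsub>A\<^esub> t l' \<otimes>\<^bsub>A\<^esub> a) = l \<otimes>\<^bsub>L\<^esub> \<pi> a \<otimes>\<^bsub>L\<^esub> l'"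
    and coassoc: "a \<in> carrier A \<Longrightarrow>
      coprod_fst (ltensor3 A L s t) (ltens3 A L s t) \<gamma> (\<gamma> a) =
      coprod_snd (ltensor3 A L s t) (ltens3 A L s t) \<gamma> (\<gamma> a)"
    and counit_left: "a \<in> carrier A \<Longrightarrow>
      tensor_lift (add_monoid A) (\<lambda>(x, y). s (\<pi> x) \<otimes>\<^bsub>A\<^esub> y) (\<gamma> a) = a"
    and counit_right: "a \<in> carrier A \<Longrightarrow>
      tensor_lift (add_monoid A) (\<lambda>(x, y). t (\<pi> y) \<otimes>\<^bsub>A\<^esub> x) (\<gamma> a) = a"
    and takeuchi: "\<lbrakk>a \<in> carrier A; l \<in> carrier L\<rbrakk> \<Longrightarrow>
      tensor_lift (ltensor A L s t) (\<lambda>(x, y). ltens A L s t (x \<otimes>\<^bsub>A\<^esub> t l) y) (\<gamma> a) =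
      tensor_lift (ltensor A L s t) (\<lambda>(x, y). ltens A L s t x (y \<otimes>\<^bsub>A\<^esub> s l)) (\<gamma> a)"
    and coprod_one: "\<gamma> \<one>\<^bsub>A\<^esub> = ltens A L s t \<one>\<^bsub>A\<^esub> \<one>\<^bsub>A\<^esub>"
    and coprod_mult: "\<lbrakk>a \<in> carrier A; b \<in> carrier A\<rbrakk> \<Longrightarrow>
      \<gamma> (a \<otimes>\<^bsub>A\<^esub> b) =
        tensor_lift (ltensor A L s t) (\<lambda>(x', y').
          tensor_lift (ltensor A L s t) (\<lambda>(x, y).
            ltens A L s t (x \<otimes>\<^bsub>A\<^esub> x') (y \<otimes>\<^bsub>A\<^esub> y')) (\<gamma> a)) (\<gamma> b)"
    and counit_one: "\<pi> \<one>\<^bsub>A\<^esub> = \<one>\<^bsub>L\<^esub>"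
    and counit_src: "\<lbrakk>a \<in> carrier A; b \<in> carrier A\<rbrakk> \<Longrightarrow> \<pi> (a \<otimes>\<^bsub>A\<^esub> s (\<pi> b)) = \<pi> (a \<otimes>\<^bsub>A\<^esub> b)"
    and counit_tgt: "\<lbrakk>a \<in> carrier A; b \<in> carrier A\<rbrakk> \<Longrightarrow> \<pi> (a \<otimes>\<^bsub>A\<^esub> t (\<pi> b)) = \<pi> (a \<otimes>\<^bsub>A\<^esub> b)"

locale right_bialgebroid_ops =
  fixes A :: "'a ring" and R :: "'r ring"
    and s t :: "'r \<Rightarrow> 'a" and \<gamma> :: "'a \<Rightarrow> ('a \<times> 'a) frag set" and \<pi> :: "'a \<Rightarrow> 'r"
  assumes ring_total: "ring A"
    and ring_base: "ring R"
    and src_hom: "s \<in> ring_hom R A"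
    and tgt_hom: "t \<in> ring_hom (opp_ring R) A"
    and src_tgt_comm: "\<lbrakk>r \<in> carrier R; r' \<in> carrier R\<rbrakk> \<Longrightarrow> s r \<otimes>\<^bsub>A\<^esub> t r' = t r' \<otimes>\<^bsub>A\<^esub> s r"
    and coprod_add: "\<gamma> \<in> hom (add_monoid A) (rtensor A R s t)"
    and coprod_bimod: "\<lbrakk>a \<in> carrier A; r \<in> carrier R; r' \<in> carrier R\<rbrakk> \<Longrightarrow>
      \<gamma> (a \<otimes>\<^bsub>A\<^esub> s r' \<otimes>\<^bsub>A\<^esub> t r) =
        tensor_lift (rtensor A R s t)
          (\<lambda>(x, y). rtens A R s t (x \<otimes>\<^bsub>A\<^esub> t r) (y \<otimes>\<^bsub>A\<^esub> s r')) (\<gamma> a)"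
    and counit_add: "\<pi> \<in> hom (add_monoid A) (add_monoid R)"
    and counit_bimod: "\<lbrakk>a \<in> carrier A; r \<in> carrier R; r' \<in> carrier R\<rbrakk> \<Longrightarrow>
      \<pi> (a \<otimes>\<^bsub>A\<^esub> s r' \<otimes>\<^bsub>A\<^esub> t r) = r \<otimes>\<^bsub>R\<^esub> \<pi> a \<otimes>\<^bsub>R\<^esub> r'"
    and coassoc: "a \<in> carrier A \<Longrightarrow>
      coprod_fst (rtensor3 A R s t) (rtens3 A R s t) \<gamma> (\<gamma> a) =
      coprod_snd (rtensor3 A R s t) (rtens3 A R s t) \<gamma> (\<gamma> a)"
    and counit_left: "a \<in> carrier A \<Longrightarrow>
      tensor_lift (add_monoid A) (\<lambda>(x, y). y \<otimes>\<^bsub>A\<^esub> t (\<pi> x)) (\<gamma> a) = a"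
    and counit_right: "a \<in> carrier A \<Longrightarrow>
      tensor_lift (add_monoid A) (\<lambda>(x, y). x \<otimes>\<^bsub>A\<^esub> s (\<pi> y)) (\<gamma> a) = a"
    and takeuchi: "\<lbrakk>a \<in> carrier A; r \<in> carrier R\<rbrakk> \<Longrightarrow>
      tensor_lift (rtensor A R s t) (\<lambda>(x, y). rtens A R s t (s r \<otimes>\<^bsub>A\<^esub> x) y) (\<gamma> a) =
      tensor_lift (rtensor A R s t) (\<lambda>(x, y). rtens A R s t x (t r \<otimes>\<^bsub>A\<^esub> y)) (\<gamma> a)"
    and coprod_one: "\<gamma> \<one>\<^bsub>A\<^esub> = rtens A R s t \<one>\<^bsub>A\<^esub> \<one>\<^bsub>A\<^esub>"
    and coprod_mult: "\<lbrakk>a \<in> carrier A; b \<in> carrier A\<rbrakk> \<Longrightarrow>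
      \<gamma> (a \<otimes>\<^bsub>A\<^esub> b) =
        tensor_lift (rtensor A R s t) (\<lambda>(x, y).
          tensor_lift (rtensor A R s t) (\<lambda>(x', y').
            rtens A R s t (x \<otimes>\<^bsub>A\<^esub> x') (y \<otimes>\<^bsub>A\<^esub> y')) (\<gamma> b)) (\<gamma> a)"
    and counit_one: "\<pi> \<one>\<^bsub>A\<^esub> = \<one>\<^bsub>R\<^esub>"
    and counit_src: "\<lbrakk>a \<in> carrier A; b \<in> carrier A\<rbrakk> \<Longrightarrow> \<pi> (s (\<pi> a) \<otimes>\<^bsub>A\<^esub> b) = \<pi> (a \<otimes>\<^bsub>A\<^esub> b)"
    and counit_tgt: "\<lbrakk>a \<in> carrier A; b \<in> carrier A\<rbrakk> \<Longrightarrow> \<pi> (t (\<pi> a) \<otimes>\<^bsub>A\<^esub> b) = \<pi> (a \<otimes>\<^bsub>A\<^esub> b)"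

definition left_bialgebroid :: "('a, 'l) bialgebroid \<Rightarrow> bool" where
  "left_bialgebroid B \<longleftrightarrow>
     left_bialgebroid_ops (Tot B) (Bas B) (src B) (tgt B) (cop B) (cou B)"

definition right_bialgebroid :: "('a, 'r) bialgebroid \<Rightarrow> bool" where
  "right_bialgebroid B \<longleftrightarrow>
     right_bialgebroid_ops (Tot B) (Bas B) (src B) (tgt B) (cop B) (cou B)"

text \<open>\<open>( )\<^sup>o\<^sup>p\<close> with coopposite coproduct, from right to left bialgebroids.\<close>

definition op_cop :: "('a, 'k) bialgebroid \<Rightarrow> ('a, 'k) bialgebroid" where
  "op_cop B =
    \<lparr>Tot = opp_ring (Tot B), Bas = opp_ring (Bas B), src = src B, tgt = tgt B,
     cop = (\<lambda>a. tensor_lift (ltensor (opp_ring (Tot B)) (opp_ring (Bas B)) (src B) (tgt B))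
       (\<lambda>(x, y). ltens (opp_ring (Tot B)) (opp_ring (Bas B)) (src B) (tgt B) y x) (cop B a)),
     cou = cou B\<rparr>"

definition left_bialgebroid_iso ::
  "('a, 'k) bialgebroid \<Rightarrow> ('b, 'h) bialgebroid \<Rightarrow> ('a \<Rightarrow> 'b) \<Rightarrow> ('k \<Rightarrow> 'h) \<Rightarrow> bool" where
  "left_bialgebroid_iso B B' \<Phi> \<phi> \<longleftrightarrow>
     left_bialgebroid B \<and> left_bialgebroid B' \<and>
     \<Phi> \<in> ring_iso (Tot B) (Tot B') \<and> \<phi> \<in> ring_iso (Bas B) (Bas B') \<and>
     (\<forall>k \<in> carrier (Bas B). src B' (\<phi> k) = \<Phi> (src B k)) \<and>
     (\<forall>k \<in> carrier (Bas B). tgt B' (\<phi> k) = \<Phi> (tgt B k)) \<and>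
     (\<forall>a \<in> carrier (Tot B). cou B' (\<Phi> a) = \<phi> (cou B a)) \<and>
     (\<forall>a \<in> carrier (Tot B). cop B' (\<Phi> a) =
        tensor_lift (ltensor (Tot B') (Bas B') (src B') (tgt B'))
          (\<lambda>(x, y). ltens (Tot B') (Bas B') (src B') (tgt B') (\<Phi> x) (\<Phi> y)) (cop B a))"


section \<open>Symmetrized Hopf algebroids\<close>

text \<open>The mixed tensor products \<open>A\<^sub>L \<otimes> \<^sub>LA\<^sup>R \<otimes> \<^sup>RA\<close> and \<open>A\<^sup>R \<otimes> \<^sup>RA\<^sub>L \<otimes> \<^sub>LA\<close>.\<close>

definition lr_tensor3 ::
  "('a, 'l) bialgebroid \<Rightarrow> ('a, 'r) bialgebroid \<Rightarrow> ('a \<times> 'a \<times> 'a) frag set monoid" where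
  "lr_tensor3 AL AR = (let A = Tot AL in
     tensor3 A (carrier (Bas AL)) (\<lambda>l a. tgt AL l \<otimes>\<^bsub>A\<^esub> a) (\<lambda>l a. src AL l \<otimes>\<^bsub>A\<^esub> a)
               (carrier (Bas AR)) (\<lambda>r a. a \<otimes>\<^bsub>A\<^esub> src AR r) (\<lambda>r a. a \<otimes>\<^bsub>A\<^esub> tgt AR r))"

definition lr_tens3 ::
  "('a, 'l) bialgebroid \<Rightarrow> ('a, 'r) bialgebroid \<Rightarrow> 'a \<Rightarrow> 'a \<Rightarrow> 'a \<Rightarrow> ('a \<times> 'a \<times> 'a) frag set" where
  "lr_tens3 AL AR = (let A = Tot AL in
     tens3 A (carrier (Bas AL)) (\<lambda>l a. tgt AL l \<otimes>\<^bsub>A\<^esub> a) (\<lambda>l a. src AL l \<otimes>\<^bsub>A\<^esub> a)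
             (carrier (Bas AR)) (\<lambda>r a. a \<otimes>\<^bsub>A\<^esub> src AR r) (\<lambda>r a. a \<otimes>\<^bsub>A\<^esub> tgt AR r))"

definition rl_tensor3 ::
  "('a, 'l) bialgebroid \<Rightarrow> ('a, 'r) bialgebroid \<Rightarrow> ('a \<times> 'a \<times> 'a) frag set monoid" where
  "rl_tensor3 AL AR = (let A = Tot AL in
     tensor3 A (carrier (Bas AR)) (\<lambda>r a. a \<otimes>\<^bsub>A\<^esub> src AR r) (\<lambda>r a. a \<otimes>\<^bsub>A\<^esub> tgt AR r)
               (carrier (Bas AL)) (\<lambda>l a. tgt AL l \<otimes>\<^bsub>A\<^esub> a) (\<lambda>l a. src AL l \<otimes>\<^bsub>A\<^esub> a))"

definition rl_tens3 ::
  "('a, 'l) bialgebroid \<Rightarrow> ('a, 'r) bialgebroid \<Rightarrow> 'a \<Rightarrow> 'a \<Rightarrow> 'a \<Rightarrow> ('a \<times> 'a \<times> 'a) frag set" where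
  "rl_tens3 AL AR = (let A = Tot AL in
     tens3 A (carrier (Bas AR)) (\<lambda>r a. a \<otimes>\<^bsub>A\<^esub> src AR r) (\<lambda>r a. a \<otimes>\<^bsub>A\<^esub> tgt AR r)
             (carrier (Bas AL)) (\<lambda>l a. tgt AL l \<otimes>\<^bsub>A\<^esub> a) (\<lambda>l a. src AL l \<otimes>\<^bsub>A\<^esub> a))"

locale symmetrized_hopf_algebroid =
  fixes AL :: "('a, 'l) bialgebroid" and AR :: "('a, 'r) bialgebroid" and S :: "'a \<Rightarrow> 'a"
  assumes left: "left_bialgebroid AL"
    and right: "right_bialgebroid AR"
    and same_total: "Tot AR = Tot AL"
    and base_opp: "Bas AR \<simeq> opp_ring (Bas AL)"
    and antipode_bij: "S \<in> iso (add_monoid (Tot AL)) (add_monoid (Tot AL))"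
    and src_left_tgt_right: "src AL ` carrier (Bas AL) = tgt AR ` carrier (Bas AR)"
    and tgt_left_src_right: "tgt AL ` carrier (Bas AL) = src AR ` carrier (Bas AR)"
    and mixed_coassoc_lr: "a \<in> carrier (Tot AL) \<Longrightarrow>
      coprod_fst (lr_tensor3 AL AR) (lr_tens3 AL AR) (cop AL) (cop AR a) =
      coprod_snd (lr_tensor3 AL AR) (lr_tens3 AL AR) (cop AR) (cop AL a)"
    and mixed_coassoc_rl: "a \<in> carrier (Tot AL) \<Longrightarrow>
      coprod_fst (rl_tensor3 AL AR) (rl_tens3 AL AR) (cop AR) (cop AL a) =
      coprod_snd (rl_tensor3 AL AR) (rl_tens3 AL AR) (cop AL) (cop AR a)"
    and antipode_left: "\<lbrakk>a \<in> carrier (Tot AL); l \<in> carrier (Bas AL); l' \<in> carrier (Bas AL)\<rbrakk> \<Longrightarrow>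
      S (tgt AL l \<otimes>\<^bsub>Tot AL\<^esub> a \<otimes>\<^bsub>Tot AL\<^esub> tgt AL l') =
        src AL l' \<otimes>\<^bsub>Tot AL\<^esub> S a \<otimes>\<^bsub>Tot AL\<^esub> src AL l"
    and antipode_right: "\<lbrakk>a \<in> carrier (Tot AL); r \<in> carrier (Bas AR); r' \<in> carrier (Bas AR)\<rbrakk> \<Longrightarrow>
      S (tgt AR r' \<otimes>\<^bsub>Tot AL\<^esub> a \<otimes>\<^bsub>Tot AL\<^esub> tgt AR r) =
        src AR r \<otimes>\<^bsub>Tot AL\<^esub> S a \<otimes>\<^bsub>Tot AL\<^esub> src AR r'"
    and antipode_counit_right: "a \<in> carrier (Tot AL) \<Longrightarrow>
      tensor_lift (add_monoid (Tot AL)) (\<lambda>(x, y). S x \<otimes>\<^bsub>Tot AL\<^esub> y) (cop AL a) =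
        src AR (cou AR a)"
    and antipode_counit_left: "a \<in> carrier (Tot AL) \<Longrightarrow>
      tensor_lift (add_monoid (Tot AL)) (\<lambda>(x, y). x \<otimes>\<^bsub>Tot AL\<^esub> S y) (cop AR a) =
        src AL (cou AL a)"


section \<open>Dual rings and their actions\<close>

text \<open>
  The four duals are named after the position of the star and of the module structure:
  \<open>lr\<close> is \<open>\<A>\<^sub>* = Hom(A\<^sub>L, L\<^sub>L)\<close>, \<open>ll\<close> is \<open>\<^sub>*\<A> = Hom(\<^sub>LA, \<^sub>LL)\<close>,
  \<open>ur\<close> is \<open>\<A>\<^sup>* = Hom(A\<^sup>R, R\<^sup>R)\<close>, \<open>ul\<close> is \<open>\<^sup>*\<A> = Hom(\<^sup>RA, \<^sup>RR)\<close>. Lower duals belong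
  to the left bialgebroid, upper duals to the right one. Elements of the duals are
  extensional functions, so that they are determined by their values on the carrier.
\<close>

definition hom_lr :: "('a, 'l) bialgebroid \<Rightarrow> ('a \<Rightarrow> 'l) set" where
  "hom_lr B = {\<phi> \<in> carrier (Tot B) \<rightarrow>\<^sub>E carrier (Bas B).
     \<phi> \<in> hom (add_monoid (Tot B)) (add_monoid (Bas B)) \<and>
     (\<forall>a \<in> carrier (Tot B). \<forall>l \<in> carrier (Bas B).
        \<phi> (tgt B l \<otimes>\<^bsub>Tot B\<^esub> a) = \<phi> a \<otimes>\<^bsub>Bas B\<^esub> l)}"

definition hom_ll :: "('a, 'l) bialgebroid \<Rightarrow> ('a \<Rightarrow> 'l) set" where
  "hom_ll B = {\<phi> \<in> carrier (Tot B) \<rightarrow>\<^sub>E carrier (Bas B).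
     \<phi> \<in> hom (add_monoid (Tot B)) (add_monoid (Bas B)) \<and>
     (\<forall>a \<in> carrier (Tot B). \<forall>l \<in> carrier (Bas B).
        \<phi> (src B l \<otimes>\<^bsub>Tot B\<^esub> a) = l \<otimes>\<^bsub>Bas B\<^esub> \<phi> a)}"

definition hom_ur :: "('a, 'r) bialgebroid \<Rightarrow> ('a \<Rightarrow> 'r) set" where
  "hom_ur B = {\<phi> \<in> carrier (Tot B) \<rightarrow>\<^sub>E carrier (Bas B).
     \<phi> \<in> hom (add_monoid (Tot B)) (add_monoid (Bas B)) \<and>
     (\<forall>a \<in> carrier (Tot B). \<forall>r \<in> carrier (Bas B).
        \<phi> (a \<otimes>\<^bsub>Tot B\<^esub> src B r) = \<phi> a \<otimes>\<^bsub>Bas B\<^esub> r)}"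

definition hom_ul :: "('a, 'r) bialgebroid \<Rightarrow> ('a \<Rightarrow> 'r) set" where
  "hom_ul B = {\<phi> \<in> carrier (Tot B) \<rightarrow>\<^sub>E carrier (Bas B).
     \<phi> \<in> hom (add_monoid (Tot B)) (add_monoid (Bas B)) \<and>
     (\<forall>a \<in> carrier (Tot B). \<forall>r \<in> carrier (Bas B).
        \<phi> (a \<otimes>\<^bsub>Tot B\<^esub> tgt B r) = r \<otimes>\<^bsub>Bas B\<^esub> \<phi> a)}"

text \<open>
  Actions of the duals on \<open>A\<close>: \<open>a \<leftharpoonup> \<phi>\<close>, \<open>a \<leftharpoondown> \<phi>\<close>,
  \<open>\<phi> \<rightharpoonup> a\<close> and \<open>\<phi> \<rightharpoondown> a\<close>, in this order.
\<close>

definition act_lr :: "('a, 'l) bialgebroid \<Rightarrow> 'a \<Rightarrow> ('a \<Rightarrow> 'l) \<Rightarrow> 'a" where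
  "act_lr B a \<phi> =
     tensor_lift (add_monoid (Tot B)) (\<lambda>(x, y). src B (\<phi> x) \<otimes>\<^bsub>Tot B\<^esub> y) (cop B a)"

definition act_ll :: "('a, 'l) bialgebroid \<Rightarrow> 'a \<Rightarrow> ('a \<Rightarrow> 'l) \<Rightarrow> 'a" where
  "act_ll B a \<phi> =
     tensor_lift (add_monoid (Tot B)) (\<lambda>(x, y). tgt B (\<phi> y) \<otimes>\<^bsub>Tot B\<^esub> x) (cop B a)"

definition act_ur :: "('a, 'r) bialgebroid \<Rightarrow> ('a \<Rightarrow> 'r) \<Rightarrow> 'a \<Rightarrow> 'a" where
  "act_ur B \<phi> a =
     tensor_lift (add_monoid (Tot B)) (\<lambda>(x, y). y \<otimes>\<^bsub>Tot B\<^esub> tgt B (\<phi> x)) (cop B a)"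

definition act_ul :: "('a, 'r) bialgebroid \<Rightarrow> ('a \<Rightarrow> 'r) \<Rightarrow> 'a \<Rightarrow> 'a" where
  "act_ul B \<phi> a =
     tensor_lift (add_monoid (Tot B)) (\<lambda>(x, y). x \<otimes>\<^bsub>Tot B\<^esub> src B (\<phi> y)) (cop B a)"

text \<open>
  Actions of \<open>A\<close> on the duals: \<open>shift_lower\<close> is \<open>(a \<rightharpoonup> \<phi>)(b) = \<phi>(b a)\<close>, and also
  \<open>a \<rightharpoondown> \<phi>\<close>; \<open>shift_upper\<close> is \<open>(\<phi> \<leftharpoonup> a)(b) = \<phi>(a b)\<close>, and also \<open>\<phi> \<leftharpoondown> a\<close>.
\<close>

definition shift_lower :: "('a, 'l) bialgebroid \<Rightarrow> 'a \<Rightarrow> ('a \<Rightarrow> 'l) \<Rightarrow> ('a \<Rightarrow> 'l)" where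
  "shift_lower B a \<phi> = (\<lambda>b \<in> carrier (Tot B). \<phi> (b \<otimes>\<^bsub>Tot B\<^esub> a))"

definition shift_upper :: "('a, 'r) bialgebroid \<Rightarrow> ('a \<Rightarrow> 'r) \<Rightarrow> 'a \<Rightarrow> ('a \<Rightarrow> 'r)" where
  "shift_upper B \<phi> a = (\<lambda>b \<in> carrier (Tot B). \<phi> (a \<otimes>\<^bsub>Tot B\<^esub> b))"

text \<open>
  The dual rings. For example the product in \<open>\<A>\<^sub>*\<close> is
  \<open>(\<phi> \<psi>)(a) = \<psi>(s\<^sub>L(\<phi>(a\<^sub>1)) a\<^sub>2)\<close>, whose argument is \<open>a \<leftharpoonup> \<phi>\<close>. The unit of each
  of these rings is the counit.
\<close>

definition dual_ring ::
  "('a, 'k) bialgebroid \<Rightarrow> ('a \<Rightarrow> 'k) set \<Rightarrow> (('a \<Rightarrow> 'k) \<Rightarrow> ('a \<Rightarrow> 'k) \<Rightarrow> 'a \<Rightarrow> 'k)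
    \<Rightarrow> ('a \<Rightarrow> 'k) ring" where
  "dual_ring B H m =
    \<lparr>carrier = H,
     monoid.mult = (\<lambda>\<phi> \<psi>. \<lambda>a \<in> carrier (Tot B). m \<phi> \<psi> a),
     monoid.one = (\<lambda>a \<in> carrier (Tot B). cou B a),
     ring.zero = (\<lambda>a \<in> carrier (Tot B). \<zero>\<^bsub>Bas B\<^esub>),
     ring.add = (\<lambda>\<phi> \<psi>. \<lambda>a \<in> carrier (Tot B). \<phi> a \<oplus>\<^bsub>Bas B\<^esub> \<psi> a)\<rparr>"

definition ring_lr :: "('a, 'l) bialgebroid \<Rightarrow> ('a \<Rightarrow> 'l) ring" where
  "ring_lr B = dual_ring B (hom_lr B) (\<lambda>\<phi> \<psi> a. \<psi> (act_lr B a \<phi>))"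

definition ring_ll :: "('a, 'l) bialgebroid \<Rightarrow> ('a \<Rightarrow> 'l) ring" where
  "ring_ll B = dual_ring B (hom_ll B) (\<lambda>\<phi> \<psi> a. \<psi> (act_ll B a \<phi>))"

definition ring_ur :: "('a, 'r) bialgebroid \<Rightarrow> ('a \<Rightarrow> 'r) ring" where
  "ring_ur B = dual_ring B (hom_ur B) (\<lambda>\<phi> \<psi> a. \<phi> (act_ur B \<psi> a))"

definition ring_ul :: "('a, 'r) bialgebroid \<Rightarrow> ('a \<Rightarrow> 'r) ring" where
  "ring_ul B = dual_ring B (hom_ul B) (\<lambda>\<phi> \<psi> a. \<phi> (act_ul B \<psi> a))"


section \<open>Integrals and dual bialgebroids\<close>

definition left_integral :: "('a, 'l) bialgebroid \<Rightarrow> 'a \<Rightarrow> bool" where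
  "left_integral AL ell \<longleftrightarrow> ell \<in> carrier (Tot AL) \<and>
     (\<forall>a \<in> carrier (Tot AL). a \<otimes>\<^bsub>Tot AL\<^esub> ell = src AL (cou AL a) \<otimes>\<^bsub>Tot AL\<^esub> ell)"

text \<open>
  \<open>ell\<^sub>L\<close>, \<open>\<^sub>Lell\<close>, \<open>ell\<^sub>R\<close> and \<open>\<^sub>Rell\<close>, followed by their inverses.
\<close>

definition ell_lr :: "('a, 'l) bialgebroid \<Rightarrow> 'a \<Rightarrow> ('a \<Rightarrow> 'l) \<Rightarrow> 'a" where
  "ell_lr AL ell \<phi> = act_lr AL ell \<phi>"

definition ell_ll :: "('a, 'l) bialgebroid \<Rightarrow> 'a \<Rightarrow> ('a \<Rightarrow> 'l) \<Rightarrow> 'a" where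
  "ell_ll AL ell \<phi> = act_ll AL ell \<phi>"

definition ell_ur :: "('a, 'r) bialgebroid \<Rightarrow> 'a \<Rightarrow> ('a \<Rightarrow> 'r) \<Rightarrow> 'a" where
  "ell_ur AR ell \<phi> = act_ur AR \<phi> ell"

definition ell_ul :: "('a, 'r) bialgebroid \<Rightarrow> 'a \<Rightarrow> ('a \<Rightarrow> 'r) \<Rightarrow> 'a" where
  "ell_ul AR ell \<phi> = act_ul AR \<phi> ell"

definition inv_ell_lr :: "('a, 'l) bialgebroid \<Rightarrow> 'a \<Rightarrow> 'a \<Rightarrow> ('a \<Rightarrow> 'l)" where
  "inv_ell_lr AL ell = inv_into (hom_lr AL) (ell_lr AL ell)"

definition inv_ell_ll :: "('a, 'l) bialgebroid \<Rightarrow> 'a \<Rightarrow> 'a \<Rightarrow> ('a \<Rightarrow> 'l)" where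
  "inv_ell_ll AL ell = inv_into (hom_ll AL) (ell_ll AL ell)"

definition inv_ell_ur :: "('a, 'r) bialgebroid \<Rightarrow> 'a \<Rightarrow> 'a \<Rightarrow> ('a \<Rightarrow> 'r)" where
  "inv_ell_ur AR ell = inv_into (hom_ur AR) (ell_ur AR ell)"

definition inv_ell_ul :: "('a, 'r) bialgebroid \<Rightarrow> 'a \<Rightarrow> 'a \<Rightarrow> ('a \<Rightarrow> 'r)" where
  "inv_ell_ul AR ell = inv_into (hom_ul AR) (ell_ul AR ell)"

definition nondegenerate_left_integral ::
  "('a, 'l) bialgebroid \<Rightarrow> ('a, 'r) bialgebroid \<Rightarrow> 'a \<Rightarrow> bool" where
  "nondegenerate_left_integral AL AR ell \<longleftrightarrow> left_integral AL ell \<and>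
     bij_betw (ell_ur AR ell) (hom_ur AR) (carrier (Tot AR)) \<and>
     bij_betw (ell_ul AR ell) (hom_ul AR) (carrier (Tot AR))"

text \<open>
  The dual bialgebroids \<open>\<A>\<^sup>*\<^sub>L\<close> and \<open>\<^sup>*\<A>\<^sub>L\<close> (left, over \<open>R\<close>), then \<open>\<A>\<^sub>*\<^sub>R\<close> and
  \<open>\<^sub>*\<A>\<^sub>R\<close> (right, over \<open>L\<close>).
\<close>

definition src_ur :: "('a, 'r) bialgebroid \<Rightarrow> 'r \<Rightarrow> ('a \<Rightarrow> 'r)" where
  "src_ur AR r = (\<lambda>a \<in> carrier (Tot AR). r \<otimes>\<^bsub>Bas AR\<^esub> cou AR a)"

definition tgt_ur :: "('a, 'r) bialgebroid \<Rightarrow> 'r \<Rightarrow> ('a \<Rightarrow> 'r)" where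
  "tgt_ur AR r = (\<lambda>a \<in> carrier (Tot AR). cou AR (src AR r \<otimes>\<^bsub>Tot AR\<^esub> a))"

definition dual_ur :: "('a, 'r) bialgebroid \<Rightarrow> 'a \<Rightarrow> ('a \<Rightarrow> 'r, 'r) bialgebroid" where
  "dual_ur AR ell =
    \<lparr>Tot = ring_ur AR, Bas = Bas AR, src = src_ur AR, tgt = tgt_ur AR,
     cop = (\<lambda>\<phi>. tensor_lift (ltensor (ring_ur AR) (Bas AR) (src_ur AR) (tgt_ur AR))
       (\<lambda>(x, y). ltens (ring_ur AR) (Bas AR) (src_ur AR) (tgt_ur AR)
          (shift_upper AR \<phi> x) (inv_ell_ur AR ell y)) (cop AR ell)),
     cou = (\<lambda>\<phi>. \<phi> \<one>\<^bsub>Tot AR\<^esub>)\<rparr>"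

definition src_ul :: "('a, 'r) bialgebroid \<Rightarrow> 'r \<Rightarrow> ('a \<Rightarrow> 'r)" where
  "src_ul AR r = (\<lambda>a \<in> carrier (Tot AR). cou AR (tgt AR r \<otimes>\<^bsub>Tot AR\<^esub> a))"

definition tgt_ul :: "('a, 'r) bialgebroid \<Rightarrow> 'r \<Rightarrow> ('a \<Rightarrow> 'r)" where
  "tgt_ul AR r = (\<lambda>a \<in> carrier (Tot AR). cou AR a \<otimes>\<^bsub>Bas AR\<^esub> r)"

definition dual_ul :: "('a, 'r) bialgebroid \<Rightarrow> 'a \<Rightarrow> ('a \<Rightarrow> 'r, 'r) bialgebroid" where
  "dual_ul AR ell =
    \<lparr>Tot = ring_ul AR, Bas = Bas AR, src = src_ul AR, tgt = tgt_ul AR,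
     cop = (\<lambda>\<phi>. tensor_lift (ltensor (ring_ul AR) (Bas AR) (src_ul AR) (tgt_ul AR))
       (\<lambda>(x, y). ltens (ring_ul AR) (Bas AR) (src_ul AR) (tgt_ul AR)
          (inv_ell_ul AR ell x) (shift_upper AR \<phi> y)) (cop AR ell)),
     cou = (\<lambda>\<phi>. \<phi> \<one>\<^bsub>Tot AR\<^esub>)\<rparr>"

definition src_lr :: "('a, 'l) bialgebroid \<Rightarrow> 'l \<Rightarrow> ('a \<Rightarrow> 'l)" where
  "src_lr AL l = (\<lambda>a \<in> carrier (Tot AL). cou AL (a \<otimes>\<^bsub>Tot AL\<^esub> src AL l))"

definition tgt_lr :: "('a, 'l) bialgebroid \<Rightarrow> 'l \<Rightarrow> ('a \<Rightarrow> 'l)" where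
  "tgt_lr AL l = (\<lambda>a \<in> carrier (Tot AL). l \<otimes>\<^bsub>Bas AL\<^esub> cou AL a)"

definition dual_lr :: "('a, 'l) bialgebroid \<Rightarrow> 'a \<Rightarrow> ('a \<Rightarrow> 'l, 'l) bialgebroid" where
  "dual_lr AL ell =
    \<lparr>Tot = ring_lr AL, Bas = Bas AL, src = src_lr AL, tgt = tgt_lr AL,
     cop = (\<lambda>\<phi>. tensor_lift (rtensor (ring_lr AL) (Bas AL) (src_lr AL) (tgt_lr AL))
       (\<lambda>(x, y). rtens (ring_lr AL) (Bas AL) (src_lr AL) (tgt_lr AL)
          (shift_lower AL x \<phi>) (inv_ell_lr AL ell y)) (cop AL ell)),
     cou = (\<lambda>\<phi>. \<phi> \<one>\<^bsub>Tot AL\<^esub>)\<rparr>"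

definition src_ll :: "('a, 'l) bialgebroid \<Rightarrow> 'l \<Rightarrow> ('a \<Rightarrow> 'l)" where
  "src_ll AL l = (\<lambda>a \<in> carrier (Tot AL). cou AL a \<otimes>\<^bsub>Bas AL\<^esub> l)"

definition tgt_ll :: "('a, 'l) bialgebroid \<Rightarrow> 'l \<Rightarrow> ('a \<Rightarrow> 'l)" where
  "tgt_ll AL l = (\<lambda>a \<in> carrier (Tot AL). cou AL (a \<otimes>\<^bsub>Tot AL\<^esub> tgt AL l))"

definition dual_ll :: "('a, 'l) bialgebroid \<Rightarrow> 'a \<Rightarrow> ('a \<Rightarrow> 'l, 'l) bialgebroid" where
  "dual_ll AL ell =
    \<lparr>Tot = ring_ll AL, Bas = Bas AL, src = src_ll AL, tgt = tgt_ll AL,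
     cop = (\<lambda>\<phi>. tensor_lift (rtensor (ring_ll AL) (Bas AL) (src_ll AL) (tgt_ll AL))
       (\<lambda>(x, y). rtens (ring_ll AL) (Bas AL) (src_ll AL) (tgt_ll AL)
          (inv_ell_ll AL ell x) (shift_lower AL y \<phi>)) (cop AL ell)),
     cou = (\<lambda>\<phi>. \<phi> \<one>\<^bsub>Tot AL\<^esub>)\<rparr>"


section \<open>The comparison maps\<close>

text \<open>\<open>\<xi>(a) = S((\<lambda>\<^sup>* \<leftharpoonup> ell) \<rightharpoonup> a)\<close> with \<open>\<lambda>\<^sup>* = ell\<^sub>R\<^sup>-\<^sup>1(1)\<close>.\<close>

definition xi :: "('a, 'r) bialgebroid \<Rightarrow> ('a \<Rightarrow> 'a) \<Rightarrow> 'a \<Rightarrow> 'a \<Rightarrow> 'a" where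
  "xi AR S ell a = S (act_ur AR (shift_upper AR (inv_ell_ur AR ell \<one>\<^bsub>Tot AR\<^esub>) ell) a)"

definition inv_xi :: "('a, 'r) bialgebroid \<Rightarrow> ('a \<Rightarrow> 'a) \<Rightarrow> 'a \<Rightarrow> 'a \<Rightarrow> 'a" where
  "inv_xi AR S ell = inv_into (carrier (Tot AR)) (xi AR S ell)"

definition nu :: "('a, 'l) bialgebroid \<Rightarrow> ('a, 'r) bialgebroid \<Rightarrow> 'l \<Rightarrow> 'r" where
  "nu AL AR = cou AR \<circ> src AL"

definition mu :: "('a, 'l) bialgebroid \<Rightarrow> ('a, 'r) bialgebroid \<Rightarrow> 'l \<Rightarrow> 'r" where
  "mu AL AR = cou AR \<circ> tgt AL"

definition theta_R :: "('a, 'l) bialgebroid \<Rightarrow> ('a, 'r) bialgebroid \<Rightarrow> 'r \<Rightarrow> 'r" where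
  "theta_R AL AR = nu AL AR \<circ> inv_into (carrier (Bas AL)) (mu AL AR)"

end

theory Submission
  imports Defs
begin

text \<open>
  All four duals act on \<open>A\<close>, and every one of them is compared with the ring of functionals
  \<open>\<A>^*\<close>. For \<open>\<psi> \<in> \<A>_*\<close>, mixed coassociativity shows that the operator \<open>a \<mapsto> a \<leftharpoonup> \<psi>\<close>
  equals \<open>a \<mapsto> \<phi> \<rightharpoonup> a\<close> for the functional \<open>\<phi>(a) = \<pi>_R(a \<leftharpoonup> \<psi>)\<close>, so \<open>\<phi>\<close> is
  \<open>inv ell_R (ell_L \<psi>)\<close> and \<open>\<psi> \<mapsto> \<phi>\<close> reverses products; the coopposite version compares
  \<open>_*\<A>\<close> with \<open>^*\<A>\<close>. Composition with \<open>inv S\<close> leads from \<open>^*\<A>\<close> to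
  \<open>\<A>_*\<close>, since \<open>S\<close> reverses products and coproducts, and Frobenius-type identities for
  \<open>\<lambda>^* = inv ell_R 1\<close> identify this map with the one given by \<open>\<xi>\<close>.

  The elements \<open>ell^{(1)}\<close> and \<open>inv ell_R ell^{(2)}\<close> are a dual basis of \<open>A^R\<close>. Hence a tensor
  of functionals is determined by the map \<open>x, y \<mapsto> \<phi>_1(\<phi>_2(x) y)\<close>, and each of the four
  coproducts is the one tensor which evaluates to \<open>\<phi>(x y)\<close>. This gives the bialgebroid
  axioms of the duals and the compatibility of the comparison maps with the coproducts at
  the same time.
\<close>

section \<open>Rings with unconditional laws and finite Sweedler sums\<close>

text \<open>Coproducts live in tensor products over noncommutative rings, where the legs of a
  coproduct are not elements. All calculations therefore use a list chosen to represent a coproduct,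
  and compare sums over such lists only under balanced maps with values in \<open>A\<close> itself.
  Values in \<open>A\<close> suffice: the results concern elements of \<open>A\<close> or
  functionals, and tensors of functionals are separated by evaluations in \<open>A\<close>. The two
  bases have different types, so their functionals have different codomains. Replacing each base
  element by its image in \<open>A\<close> turns the functionals of all four duals into additive
  maps from \<open>A\<close> to \<open>A\<close>. Operators from different duals can then be
  compared by plain equations, and \<open>lam\<close> can be a functional for the right and the left
  bialgebroid at once. Two symmetries reduce the four orientations to one theory of right
  bialgebroids: a left bialgebroid is a right one on the opposite ring, and flipping a coproduct
  exchanges source and target. The antipode is given only as an additive bijection with base
  relations. That it reverses products and coproducts has to be derived before composition with its
  inverse can connect the duals.\<close>

text \<open>
  A ring whose operations are composed with the projection \<open>rt\<close> of the type onto the carrier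
  satisfies the ring laws for all elements of the type, except that \<open>x \<oplus> \<zero>\<close> and \<open>\<one> \<otimes> x\<close> are
  \<open>rt x\<close> instead of \<open>x\<close>. This makes the calculations below free of membership conditions.
\<close>

definition rt :: "'a ring \<Rightarrow> 'a \<Rightarrow> 'a" where
  "rt A x = (if x \<in> carrier A then x else \<zero>\<^bsub>A\<^esub>)"

definition tot :: "'a ring \<Rightarrow> 'a ring" where
  "tot A = \<lparr>carrier = carrier A, monoid.mult = (\<lambda>x y. rt A x \<otimes>\<^bsub>A\<^esub> rt A y), monoid.one = \<one>\<^bsub>A\<^esub>,
     ring.zero = \<zero>\<^bsub>A\<^esub>, ring.add = (\<lambda>x y. rt A x \<oplus>\<^bsub>A\<^esub> rt A y)\<rparr>"

lemma opp_ring_simps [simp]: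
  "carrier (opp_ring R) = carrier R" "monoid.one (opp_ring R) = monoid.one R" "ring.zero (opp_ring R) = ring.zero R"
  "ring.add (opp_ring R) = ring.add R" "monoid.mult (opp_ring R) x y = monoid.mult R y x"
  by (simp_all add: opp_ring_def)

lemma opp_ring_opp_ring [simp]: "opp_ring (opp_ring R) = R"
  by (simp add: opp_ring_def)

lemma tot_opp_ring: "tot (opp_ring A) = opp_ring (tot A)"
  by (simp add: tot_def opp_ring_def rt_def fun_eq_iff)

fun pair_sum :: "'a ring \<Rightarrow> ('b \<times> 'c) list \<Rightarrow> ('b \<Rightarrow> 'c \<Rightarrow> 'a) \<Rightarrow> 'a" where
  "pair_sum A [] f = \<zero>\<^bsub>A\<^esub>"
| "pair_sum A ((x, y) # l) f = f x y \<oplus>\<^bsub>A\<^esub> pair_sum A l f"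

lemma pair_sum_opp_ring [simp]: "pair_sum (opp_ring A) l f = pair_sum A l f"
  by (induction l) auto

lemma pair_sum_map:
  "pair_sum A (map (\<lambda>(x, y). (h x y, k x y)) l) f = pair_sum A l (\<lambda>x y. f (h x y) (k x y))"
  by (induction l) auto

lemma pair_sum_map_swap [simp]: "pair_sum A (map prod.swap l) f = pair_sum A l (\<lambda>x y. f y x)"
  by (induction l) auto

lemma pair_sum_cong:
  "(\<And>x y. (x, y) \<in> set l \<Longrightarrow> f x y = g x y) \<Longrightarrow> pair_sum A l f = pair_sum A l g"
  by (induction l) auto

definition additive :: "'a ring \<Rightarrow> ('a \<Rightarrow> 'a) \<Rightarrow> bool" where
  "additive A g \<longleftrightarrow> g \<zero>\<^bsub>A\<^esub> = \<zero>\<^bsub>A\<^esub> \<and> (\<forall>x y. g (x \<oplus>\<^bsub>A\<^esub> y) = g x \<oplus>\<^bsub>A\<^esub> g y)"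

lemma additive_opp_ring [simp]: "additive (opp_ring A) = additive A"
  by (simp add: additive_def fun_eq_iff)

text \<open>The scalar \<open>r\<close> ranges over the whole type. In all uses \<open>m\<close> and
  \<open>n\<close> see it only through projections such as \<open>P r\<close> and
  \<open>Q r\<close>, so no base ring has to be mentioned. The target is the ring itself, where all
  sums take their values.\<close>

definition balanced :: "'a ring \<Rightarrow> ('a \<Rightarrow> 'a \<Rightarrow> 'a) \<Rightarrow> ('a \<Rightarrow> 'a \<Rightarrow> 'a) \<Rightarrow> ('a \<Rightarrow> 'a \<Rightarrow> 'a) \<Rightarrow> bool" where
  "balanced A m n f \<longleftrightarrow> (\<forall>y. additive A (\<lambda>x. f x y)) \<and> (\<forall>x. additive A (f x)) \<and>
     (\<forall>r x y. f (m r x) y = f x (n r y))"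

definition balanced3 :: "'a ring \<Rightarrow> ('a \<Rightarrow> 'a \<Rightarrow> 'a) \<Rightarrow> ('a \<Rightarrow> 'a \<Rightarrow> 'a) \<Rightarrow> ('a \<Rightarrow> 'a \<Rightarrow> 'a) \<Rightarrow> ('a \<Rightarrow> 'a \<Rightarrow> 'a)
    \<Rightarrow> ('a \<Rightarrow> 'a \<Rightarrow> 'a \<Rightarrow> 'a) \<Rightarrow> bool" where
  "balanced3 A m n m' n' f \<longleftrightarrow> (\<forall>y z. additive A (\<lambda>x. f x y z)) \<and> (\<forall>x z. additive A (\<lambda>y. f x y z)) \<and>
     (\<forall>x y. additive A (f x y)) \<and> (\<forall>r x y z. f (m r x) y z = f x (n r y) z) \<and>
     (\<forall>r x y z. f x (m' r y) z = f x y (n' r z))"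

text \<open>Adding \<open>\<zero>\<close> is the projection onto the carrier, so
  \<open>x \<oplus> \<zero> = x\<close> is how membership is expressed here. The axioms named
  \<open>closed\<close> say that every operation lands in the carrier even for arguments outside of
  it.\<close>

locale total_ring =
  fixes A :: "'a ring" (structure)
  assumes add_assoc: "(x \<oplus> y) \<oplus> z = x \<oplus> (y \<oplus> z)"
    and add_comm: "x \<oplus> y = y \<oplus> x"
    and add_closed [simp]: "(x \<oplus> y) \<oplus> \<zero> = x \<oplus> y"
    and zero_closed [simp]: "\<zero> \<oplus> \<zero> = \<zero>"
    and mult_assoc: "(x \<otimes> y) \<otimes> z = x \<otimes> (y \<otimes> z)"
    and distrib_right [simp]: "(x \<oplus> y) \<otimes> z = x \<otimes> z \<oplus> y \<otimes> z"
    and distrib_left [simp]: "x \<otimes> (y \<oplus> z) = x \<otimes> y \<oplus> x \<otimes> z"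
    and mult_zero_left [simp]: "\<zero> \<otimes> x = \<zero>"
    and mult_zero_right [simp]: "x \<otimes> \<zero> = \<zero>"
    and mult_closed [simp]: "x \<otimes> y \<oplus> \<zero> = x \<otimes> y"
    and one_left [simp]: "\<one> \<otimes> x = x \<oplus> \<zero>"
    and one_right [simp]: "x \<otimes> \<one> = x \<oplus> \<zero>"
    and one_closed [simp]: "\<one> \<oplus> \<zero> = \<one>"
begin

lemma add_left_commute: "x \<oplus> (y \<oplus> z) = y \<oplus> (x \<oplus> z)"
  by (metis add_assoc add_comm)

lemmas add_ac = add_assoc add_comm add_left_commute

lemma add_closed_assoc [simp]: "x \<oplus> (y \<oplus> \<zero>) = x \<oplus> y"
  using add_assoc add_closed by metis

lemma zero_add: "\<zero> \<oplus> x = x \<oplus> \<zero>"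
  by (rule add_comm)

lemma add_zero_add [simp]: "x \<oplus> (\<zero> \<oplus> y) = x \<oplus> y"
  by (simp add: zero_add)

section \<open>Calculus of finite sums over lists of pairs\<close>

abbreviation ps :: "('b \<times> 'c) list \<Rightarrow> ('b \<Rightarrow> 'c \<Rightarrow> 'a) \<Rightarrow> 'a" where
  "ps \<equiv> pair_sum A"

lemma ps_closed [simp]: "ps l f \<oplus> \<zero> = ps l f"
  by (induction l) auto

lemma zero_add_ps [simp]: "\<zero> \<oplus> ps l f = ps l f"
  by (simp add: zero_add)

lemma ps_zero [simp]: "ps l (\<lambda>_ _. \<zero>) = \<zero>"
  by (induction l) auto

lemma ps_add: "ps l (\<lambda>x y. f x y \<oplus> g x y) = ps l f \<oplus> ps l g"
  by (induction l) (auto simp: add_ac)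

lemma ps_add_zero [simp]: "ps l (\<lambda>x y. f x y \<oplus> \<zero>) = ps l f"
  by (simp add: ps_add)

lemma ps_mult_left: "a \<otimes> ps l f = ps l (\<lambda>x y. a \<otimes> f x y)"
  by (induction l) auto

lemma ps_mult_right: "ps l f \<otimes> a = ps l (\<lambda>x y. f x y \<otimes> a)"
  by (induction l) auto

lemma additive_ps: "additive A g \<Longrightarrow> g (ps l f) = ps l (\<lambda>x y. g (f x y))"
  by (induction l) (auto simp: additive_def)

lemma ps_commute:
  "ps l (\<lambda>x y. ps l' (\<lambda>u v. f x y u v)) = ps l' (\<lambda>u v. ps l (\<lambda>x y. f x y u v))"
  by (induction l) (auto simp: ps_add)

lemma ps_append: "ps (l @ l') f = ps l f \<oplus> ps l' f"
  by (induction l) (auto simp: add_assoc)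

lemma ps_concat:
  "ps (concat (map (\<lambda>(x, y). g x y) l)) f = ps l (\<lambda>x y. ps (g x y) f)"
  by (induction l) (auto simp: ps_append)

end

lemma total_ring_tot:
  assumes "ring (R :: 'a ring)" shows "total_ring (tot R)"
proof -
  interpret ring R by fact
  show ?thesis
  proof
    show "x \<oplus>\<^bsub>tot R\<^esub> y = y \<oplus>\<^bsub>tot R\<^esub> x" for x y
      by (simp add: tot_def rt_def a_comm)
  qed (simp_all add: tot_def rt_def a_assoc m_assoc l_distr r_distr)
qed

section \<open>Right bialgebroids in Sweedler form\<close>

text \<open>
  The base ring is eliminated: \<open>P = s \<circ> \<pi>\<close> and \<open>Q = t \<circ> \<pi>\<close> are projections of the total ring onto
  the images of the source and target maps, and a functional \<open>\<phi>\<close> with values in the base is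
  represented by \<open>s \<circ> \<phi>\<close>. The list \<open>c a\<close> represents the coproduct of \<open>a\<close>. A left
  bialgebroid is the same thing on the opposite ring, with \<open>t\<close> as source map.
\<close>

locale right_sweedler = total_ring +
  fixes P Q :: "'a \<Rightarrow> 'a" and c :: "'a \<Rightarrow> ('a \<times> 'a) list"
  assumes P_add [simp]: "P (x \<oplus> y) = P x \<oplus> P y" and P_zero [simp]: "P \<zero> = \<zero>"
    and Q_add [simp]: "Q (x \<oplus> y) = Q x \<oplus> Q y" and Q_zero [simp]: "Q \<zero> = \<zero>"
    and P_closed [simp]: "P x \<oplus> \<zero> = P x" and Q_closed [simp]: "Q x \<oplus> \<zero> = Q x"
    and PP [simp]: "P (P x) = P x" and PQ [simp]: "P (Q x) = P x"
    and QP [simp]: "Q (P x) = Q x" and QQ [simp]: "Q (Q x) = Q x"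
    and P_one [simp]: "P \<one> = \<one>" and Q_one [simp]: "Q \<one> = \<one>"
    and P_Q_comm: "P x \<otimes> Q y = Q y \<otimes> P x"
    and P_mult_P: "P (a \<otimes> P b) = P a \<otimes> P b" and P_mult_Q: "P (a \<otimes> Q b) = P b \<otimes> P a"
    and Q_mult_P: "Q (a \<otimes> P b) = Q b \<otimes> Q a" and Q_mult_Q: "Q (a \<otimes> Q b) = Q a \<otimes> Q b"
    and P_P_mult: "P (P a \<otimes> b) = P (a \<otimes> b)" and P_Q_mult: "P (Q a \<otimes> b) = P (a \<otimes> b)"
    and cop_add: "balanced A (\<lambda>r x. x \<otimes> P r) (\<lambda>r y. y \<otimes> Q r) f \<Longrightarrow>
      ps (c (a \<oplus> b)) f = ps (c a) f \<oplus> ps (c b) f"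
    and cop_zero: "balanced A (\<lambda>r x. x \<otimes> P r) (\<lambda>r y. y \<otimes> Q r) f \<Longrightarrow> ps (c \<zero>) f = \<zero>"
    and cop_mult_P: "balanced A (\<lambda>r x. x \<otimes> P r) (\<lambda>r y. y \<otimes> Q r) f \<Longrightarrow>
      ps (c (a \<otimes> P r)) f = ps (c a) (\<lambda>x y. f x (y \<otimes> P r))"
    and cop_mult_Q: "balanced A (\<lambda>r x. x \<otimes> P r) (\<lambda>r y. y \<otimes> Q r) f \<Longrightarrow>
      ps (c (a \<otimes> Q r)) f = ps (c a) (\<lambda>x y. f (x \<otimes> Q r) y)"
    and cop_takeuchi: "balanced A (\<lambda>r x. x \<otimes> P r) (\<lambda>r y. y \<otimes> Q r) f \<Longrightarrow>
      ps (c a) (\<lambda>x y. f (P r \<otimes> x) y) = ps (c a) (\<lambda>x y. f x (Q r \<otimes> y))"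
    and cop_one: "balanced A (\<lambda>r x. x \<otimes> P r) (\<lambda>r y. y \<otimes> Q r) f \<Longrightarrow> ps (c \<one>) f = f \<one> \<one> \<oplus> \<zero>"
    and cop_mult: "balanced A (\<lambda>r x. x \<otimes> P r) (\<lambda>r y. y \<otimes> Q r) f \<Longrightarrow>
      ps (c (a \<otimes> b)) f = ps (c a) (\<lambda>x y. ps (c b) (\<lambda>x' y'. f (x \<otimes> x') (y \<otimes> y')))"
    and counit_Q: "ps (c a) (\<lambda>x y. y \<otimes> Q x) = a \<oplus> \<zero>"
    and counit_P: "ps (c a) (\<lambda>x y. x \<otimes> P y) = a \<oplus> \<zero>"
    and cop_coassoc: "balanced3 A (\<lambda>r x. x \<otimes> P r) (\<lambda>r y. y \<otimes> Q r) (\<lambda>r x. x \<otimes> P r) (\<lambda>r y. y \<otimes> Q r) g \<Longrightarrow>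
      ps (c a) (\<lambda>x y. ps (c x) (\<lambda>u v. g u v y)) = ps (c a) (\<lambda>x y. ps (c y) (\<lambda>u v. g x u v))"
begin

abbreviation bal :: "('a \<Rightarrow> 'a \<Rightarrow> 'a) \<Rightarrow> bool" where
  "bal \<equiv> balanced A (\<lambda>r x. x \<otimes> P r) (\<lambda>r y. y \<otimes> Q r)"

lemma Q_P_mult: "Q (P a \<otimes> b) = Q (a \<otimes> b)" and Q_Q_mult: "Q (Q a \<otimes> b) = Q (a \<otimes> b)"
  by (metis P_P_mult QP, metis P_Q_mult QP)

lemma balI:
  assumes "\<And>x x' y. f (x \<oplus> x') y = f x y \<oplus> f x' y" "\<And>y. f \<zero> y = \<zero>"
    "\<And>x y y'. f x (y \<oplus> y') = f x y \<oplus> f x y'" "\<And>x. f x \<zero> = \<zero>"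
    "\<And>r x y. f (x \<otimes> P r) y = f x (y \<otimes> Q r)"
  shows "bal f"
  using assms by (auto simp: balanced_def additive_def)

lemma balD:
  assumes "bal f"
  shows "f (x \<oplus> x') y = f x y \<oplus> f x' y" "f \<zero> y = \<zero>"
    "f x (y \<oplus> y') = f x y \<oplus> f x y'" "f x \<zero> = \<zero>"
    "f (x \<otimes> P r) y = f x (y \<otimes> Q r)"
  using assms by (auto simp: balanced_def additive_def)

text \<open>The axioms control only right multiplication by the base. Left multiplication follows
  from multiplicativity: the coproduct of \<open>P r\<close> is \<open>\<one> \<otimes> P r\<close>,
  and it may be inserted into the product formula because the Takeuchi condition for
  \<open>a\<close> makes the remaining sum balanced.\<close>

lemma cop_P_mult:
  assumes f: "bal f" shows "ps (c (P r \<otimes> a)) f = ps (c a) (\<lambda>x y. f x (P r \<otimes> y))"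
proof -
  have eq: "ps (c (P r)) g = g \<one> (P r) \<oplus> \<zero>" if g: "bal g" for g
  proof -
    have "ps (c (P r)) g = ps (c (\<one> \<otimes> P r)) g" by simp
    also have "\<dots> = ps (c \<one>) (\<lambda>x y. g x (y \<otimes> P r))" by (rule cop_mult_P[OF g])
    also have "\<dots> = g \<one> (\<one> \<otimes> P r) \<oplus> \<zero>"
      by (rule cop_one, rule balI) (simp_all add: balD[OF g] mult_assoc P_Q_comm)
    finally show ?thesis by simp
  qed
  have "ps (c (P r \<otimes> a)) f = ps (c (P r)) (\<lambda>x y. ps (c a) (\<lambda>x' y'. f (x \<otimes> x') (y \<otimes> y')))"
    by (rule cop_mult[OF f])
  also have "\<dots> = ps (c a) (\<lambda>x' y'. f (\<one> \<otimes> x') (P r \<otimes> y')) \<oplus> \<zero>"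
  proof (rule eq, rule balI)
    fix r x y
    have "bal (\<lambda>x' y'. f (x \<otimes> x') (y \<otimes> y'))"
      by (rule balI) (simp_all add: balD[OF f] flip: mult_assoc)
    from cop_takeuchi[OF this]
    show "ps (c a) (\<lambda>x' y'. f (x \<otimes> P r \<otimes> x') (y \<otimes> y')) = ps (c a) (\<lambda>x' y'. f (x \<otimes> x') (y \<otimes> Q r \<otimes> y'))"
      by (simp add: mult_assoc)
  qed (simp_all add: balD[OF f] ps_add)
  also have "\<dots> = ps (c a) (\<lambda>x y. f x (P r \<otimes> y) \<oplus> \<zero>)"
    by (simp add: balD[OF f] del: ps_add_zero) (simp add: balD[OF f])?
  finally show ?thesis by simp
qed

text \<open>Flipping the coproduct and exchanging source and target gives a right bialgebroid over
  the opposite base, which is invisible once the base is eliminated. Each result on functionals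
  thereby has a mirror image for the other module structure.\<close>

lemma swap: "right_sweedler A Q P (\<lambda>a. map prod.swap (c a))"
proof -
  have B: "balanced A (\<lambda>r x. x \<otimes> Q r) (\<lambda>r y. y \<otimes> P r) f \<Longrightarrow> bal (\<lambda>x y. f y x)" for f
    by (auto simp: balanced_def)
  show ?thesis
  proof
    fix a g
    assume "balanced3 A (\<lambda>r x. x \<otimes> Q r) (\<lambda>r y. y \<otimes> P r) (\<lambda>r x. x \<otimes> Q r) (\<lambda>r y. y \<otimes> P r) g"
    then have "balanced3 A (\<lambda>r x. x \<otimes> P r) (\<lambda>r y. y \<otimes> Q r) (\<lambda>r x. x \<otimes> P r) (\<lambda>r y. y \<otimes> Q r)
        (\<lambda>x y z. g z y x)"
      by (auto simp: balanced3_def)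
    from cop_coassoc[OF this] 
    show "ps (map prod.swap (c a)) (\<lambda>x y. ps (map prod.swap (c x)) (\<lambda>u v. g u v y)) =
       ps (map prod.swap (c a)) (\<lambda>x y. ps (map prod.swap (c y)) (\<lambda>u v. g x u v))" by simp
  next
    fix f a b assume "balanced A (\<lambda>r x. x \<otimes> Q r) (\<lambda>r y. y \<otimes> P r) f"
    from cop_mult[OF B[OF this]]
    show "ps (map prod.swap (c (a \<otimes> b))) f = ps (map prod.swap (c a))
         (\<lambda>x y. ps (map prod.swap (c b)) (\<lambda>x' y'. f (x \<otimes> x') (y \<otimes> y')))" by simp
  next
    fix f a r assume *: "balanced A (\<lambda>r x. x \<otimes> Q r) (\<lambda>r y. y \<otimes> P r) f"
    from cop_mult_P[OF B[OF *], of a r] cop_mult_Q[OF B[OF *], of a r] cop_one[OF B[OF *]]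
      cop_takeuchi[OF B[OF *], of a r, symmetric]
    show "ps (map prod.swap (c (a \<otimes> P r))) f = ps (map prod.swap (c a)) (\<lambda>x y. f (x \<otimes> P r) y)"
      "ps (map prod.swap (c (a \<otimes> Q r))) f = ps (map prod.swap (c a)) (\<lambda>x y. f x (y \<otimes> Q r))"
      "ps (map prod.swap (c \<one>)) f = f \<one> \<one> \<oplus> \<zero>"
      "ps (map prod.swap (c a)) (\<lambda>x y. f (Q r \<otimes> x) y) = ps (map prod.swap (c a)) (\<lambda>x y. f x (P r \<otimes> y))"
      by simp_all
  qed (simp_all add: cop_add cop_zero B P_mult_P P_mult_Q Q_mult_P Q_mult_Q Q_P_mult Q_Q_mult
      counit_P counit_Q P_Q_comm)
qed

section \<open>Functionals and their action on the ring\<close>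

definition functional :: "('a \<Rightarrow> 'a) \<Rightarrow> bool" where
  "functional f \<longleftrightarrow> additive A f \<and> (\<forall>x. P (f x) = f x) \<and> (\<forall>x r. f (x \<otimes> P r) = f x \<otimes> P r)"

lemma functionalI:
  assumes "\<And>x y. f (x \<oplus> y) = f x \<oplus> f y" "f \<zero> = \<zero>" "\<And>x. P (f x) = f x" "\<And>x r. f (x \<otimes> P r) = f x \<otimes> P r"
  shows "functional f"
  using assms by (auto simp: functional_def additive_def)

lemma functionalD:
  assumes "functional f"
  shows "f (x \<oplus> y) = f x \<oplus> f y" "f \<zero> = \<zero>" "P (f x) = f x" "f (x \<otimes> P r) = f x \<otimes> P r"
    "f x \<oplus> \<zero> = f x" "f (x \<otimes> f y) = f x \<otimes> f y" "additive A f"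
  using assms unfolding functional_def additive_def by auto (metis P_closed)+

lemma functional_closed: "functional f \<Longrightarrow> f (x \<oplus> \<zero>) = f x"
  by (simp add: functionalD)

lemma functional_eqI: "functional f \<Longrightarrow> functional g \<Longrightarrow> (\<And>x. x \<oplus> \<zero> = x \<Longrightarrow> f x = g x) \<Longrightarrow> f = g"
  by (metis add_closed ext functional_closed)

text \<open>This is the action \<open>\<phi> \<rightharpoonup> a\<close>: for
  \<open>f = s \<circ> \<phi>\<close>, applying \<open>Q\<close> turns the value \<open>s r\<close>
  into \<open>t r\<close>.\<close>

definition hit :: "('a \<Rightarrow> 'a) \<Rightarrow> 'a \<Rightarrow> 'a" where
  "hit f a = ps (c a) (\<lambda>x y. y \<otimes> Q (f x))"

lemma bal_hit: "functional f \<Longrightarrow> bal (\<lambda>x y. y \<otimes> Q (f x))"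
  by (rule balI) (simp_all add: functionalD Q_mult_P mult_assoc)

lemma bal_hit_left: "functional f \<Longrightarrow> bal (\<lambda>x y. a \<otimes> y \<otimes> Q (f x))"
  by (rule balI) (simp_all add: functionalD Q_mult_P mult_assoc)

lemma hit_add: "functional f \<Longrightarrow> hit f (a \<oplus> b) = hit f a \<oplus> hit f b"
  unfolding hit_def by (rule cop_add[OF bal_hit])

lemma hit_zero: "functional f \<Longrightarrow> hit f \<zero> = \<zero>"
  unfolding hit_def by (rule cop_zero[OF bal_hit])

lemma hit_closed [simp]: "hit f a \<oplus> \<zero> = hit f a"
  by (simp add: hit_def)

lemma additive_hit: "functional f \<Longrightarrow> additive A (hit f)"
  by (simp add: additive_def hit_add hit_zero)

lemma hit_arg_closed: "functional f \<Longrightarrow> hit f (a \<oplus> \<zero>) = hit f a"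
  by (simp add: hit_add hit_zero)

lemma hit_mult_P: "functional f \<Longrightarrow> hit f (a \<otimes> P r) = hit f a \<otimes> P r"
  by (simp add: hit_def cop_mult_P bal_hit ps_mult_right mult_assoc P_Q_comm)

lemma hit_P_mult: "functional f \<Longrightarrow> hit f (P r \<otimes> a) = P r \<otimes> hit f a"
  by (simp add: hit_def cop_P_mult bal_hit ps_mult_left mult_assoc)

lemma hit_functional_mult: "functional f \<Longrightarrow> functional g \<Longrightarrow> hit f (g x \<otimes> a) = g x \<otimes> hit f a"
  by (metis hit_P_mult functionalD(3))

text \<open>Counitality recovers a functional from its operator. Hence two functionals, even of
  different duals, can be identified by comparing the operators they define.\<close>

lemma P_hit:
  assumes f: "functional f" shows "P (hit f a) = f a"
proof -
  have "P (hit f a) = ps (c a) (\<lambda>x y. f x \<otimes> P y)"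
    unfolding hit_def by (subst additive_ps) (simp_all add: additive_def P_mult_Q functionalD[OF f])
  also have "\<dots> = f (ps (c a) (\<lambda>x y. x \<otimes> P y))"
    by (simp add: additive_ps[OF functionalD(7)[OF f]] functionalD[OF f])
  finally show ?thesis by (simp add: counit_P functionalD[OF f])
qed

lemma functional_comp: "functional f \<Longrightarrow> functional g \<Longrightarrow> functional (\<lambda>a. f (hit g a))"
  by (rule functionalI) (simp_all add: functionalD hit_add hit_zero hit_mult_P)

text \<open>The composite \<open>\<lambda>a. f (hit g a)\<close> is the product in the dual ring, so
  the ring becomes a module over its dual. Coassociativity moves the inner coproduct from the second
  leg to the first, where it reassembles to \<open>hit g x\<close>.\<close>

lemma hit_hit:
  assumes f: "functional f" and g: "functional g"
  shows "hit f (hit g a) = hit (\<lambda>a. f (hit g a)) a"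
proof -
  have "hit f (hit g a) = ps (c a) (\<lambda>x y. hit f (y \<otimes> Q (g x)))"
    unfolding hit_def[of g] by (rule additive_ps[OF additive_hit[OF f]])
  also have "\<dots> = ps (c a) (\<lambda>x y. ps (c y) (\<lambda>u v. v \<otimes> Q (f (u \<otimes> Q (g x)))))"
    unfolding hit_def by (simp add: cop_mult_Q[OF bal_hit[OF f]])
  also have "\<dots> = ps (c a) (\<lambda>x y. ps (c x) (\<lambda>u v. y \<otimes> Q (f (v \<otimes> Q (g u)))))"
  proof (rule cop_coassoc[symmetric])
    have "f (y \<otimes> P r \<otimes> Q (g x)) = f (y \<otimes> Q (g x)) \<otimes> P r" for x y r
      by (metis f functionalD(4) mult_assoc P_Q_comm)
    then show "balanced3 A (\<lambda>r x. x \<otimes> P r) (\<lambda>r y. y \<otimes> Q r) (\<lambda>r x. x \<otimes> P r) (\<lambda>r y. y \<otimes> Q r)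
        (\<lambda>u v y. y \<otimes> Q (f (v \<otimes> Q (g u))))"
      by (simp add: balanced3_def additive_def functionalD[OF f] functionalD[OF g] Q_mult_P mult_assoc)
  qed
  also have "\<dots> = ps (c a) (\<lambda>x y. y \<otimes> Q (f (hit g x)))"
    by (simp add: hit_def additive_ps[OF functionalD(7)[OF f]] ps_mult_left 
        additive_ps[of Q] additive_def)
  finally show ?thesis by (simp add: hit_def)
qed

section \<open>Unit, source, target and linear structure of the functionals\<close>

lemma functional_P: "functional P"
  by (rule functionalI) (simp_all add: P_mult_P)

lemma hit_P: "hit P a = a \<oplus> \<zero>"
  by (simp add: hit_def counit_Q)

lemma functional_source: "functional (\<lambda>x. P r \<otimes> P x)"
  by (rule functionalI) (simp_all add: P_mult_P mult_assoc)

lemma functional_target: "functional (\<lambda>x. P (P r \<otimes> x))"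
  by (rule functionalI) (simp_all add: P_mult_P flip: mult_assoc)

lemma functional_shift: "functional f \<Longrightarrow> functional (\<lambda>x. f (a \<otimes> x))"
  by (rule functionalI) (simp_all add: functionalD flip: mult_assoc)

lemma functional_scale: "functional f \<Longrightarrow> functional (\<lambda>x. P r \<otimes> f x)"
  by (rule functionalI) (simp_all add: functionalD P_mult_P mult_assoc, metis P_mult_P PP functionalD(3))

lemma functional_add: "functional f \<Longrightarrow> functional g \<Longrightarrow> functional (\<lambda>x. f x \<oplus> g x)"
  by (rule functionalI) (simp_all add: functionalD add_ac)

lemma functional_zero: "functional (\<lambda>x. \<zero>)"
  by (rule functionalI) simp_all

lemma hit_scale: "functional f \<Longrightarrow> hit (\<lambda>x. P r \<otimes> f x) a = hit f a \<otimes> Q r"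
proof -
  assume f: "functional f"
  have "Q (P r \<otimes> f x) = Q (f x) \<otimes> Q r" for x
    using Q_mult_P[of "P r" "f x"] functionalD(3)[OF f] by simp
  then show ?thesis by (simp add: hit_def ps_mult_right mult_assoc)
qed

lemma hit_source: "hit (\<lambda>x. P r \<otimes> P x) a = a \<otimes> Q r"
  by (simp add: hit_scale functional_P hit_P)

text \<open>The Takeuchi condition trades \<open>P r\<close> in front of the first leg for
  \<open>Q r\<close> in front of the second, and the counit then removes the coproduct. Source and
  target of the dual thus act as right and left multiplication by \<open>Q r\<close>.\<close>

lemma hit_target: "hit (\<lambda>x. P (P r \<otimes> x)) a = Q r \<otimes> a"
proof -
  have "hit (\<lambda>x. P (P r \<otimes> x)) a = ps (c a) (\<lambda>x y. y \<otimes> Q (P r \<otimes> x))" by (simp add: hit_def)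
  also have "\<dots> = ps (c a) (\<lambda>x y. (Q r \<otimes> y) \<otimes> Q x)"
    using cop_takeuchi[of "\<lambda>x y. y \<otimes> Q x" a r] bal_hit[OF functional_P] by simp
  also have "\<dots> = Q r \<otimes> a" by (simp add: mult_assoc counit_Q flip: ps_mult_left)
  finally show ?thesis .
qed

lemma hit_add_functional: "hit (\<lambda>x. f x \<oplus> g x) a = hit f a \<oplus> hit g a"
  by (simp add: hit_def ps_add)

end

section \<open>Functionals for the target map and their pairing with those for the source
  map\<close>

context right_sweedler
begin

lemma cop_Q_mult:
  assumes f: "bal f" shows "ps (c (Q r \<otimes> a)) f = ps (c a) (\<lambda>x y. f (Q r \<otimes> x) y)"
proof -
  interpret co: right_sweedler A Q P "\<lambda>a. map prod.swap (c a)" by (rule swap)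
  have "co.bal (\<lambda>x y. f y x)" using f by (auto simp: balanced_def)
  from co.cop_P_mult[OF this, of r a] show ?thesis by simp
qed

abbreviation cofunctional :: "('a \<Rightarrow> 'a) \<Rightarrow> bool" where
  "cofunctional \<equiv> right_sweedler.functional A Q"

abbreviation cohit :: "('a \<Rightarrow> 'a) \<Rightarrow> 'a \<Rightarrow> 'a" where
  "cohit \<equiv> right_sweedler.hit A P (\<lambda>a. map prod.swap (c a))"

lemma cohit_def: "cohit g a = ps (c a) (\<lambda>x y. x \<otimes> P (g y))"
proof -
  interpret co: right_sweedler A Q P "\<lambda>a. map prod.swap (c a)" by (rule swap)
  show ?thesis by (simp add: co.hit_def)
qed

text \<open>Both sides pair \<open>f\<close> with the first and \<open>g\<close> with the second leg
  of the coproduct of \<open>a\<close>. This adjunction is what makes the two kinds of functionals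
  informative about each other.\<close>

lemma P_cofunctional_hit:
  assumes f: "functional f" and g: "cofunctional g" shows "P (g (hit f a)) = f (cohit g a)"
proof -
  interpret co: right_sweedler A Q P "\<lambda>a. map prod.swap (c a)" by (rule swap)
  have "P (g (hit f a)) = ps (c a) (\<lambda>x y. P (g (y \<otimes> Q (f x))))"
    unfolding hit_def by (rule additive_ps[of "\<lambda>x. P (g x)"]) (simp add: additive_def co.functionalD[OF g])
  also have "\<dots> = ps (c a) (\<lambda>x y. f (x \<otimes> P (g y)))"
    by (simp add: co.functionalD[OF g] functionalD[OF f] P_mult_Q)
  also have "\<dots> = f (cohit g a)" unfolding cohit_def
    by (rule additive_ps[symmetric]) (rule functionalD[OF f])
  finally show ?thesis .
qed

end

section \<open>Non-degenerate elements and dual bases\<close>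

text \<open>These are the bijectivity of \<open>ell_R\<close> and of its counterpart for the other
  module structure, in terms of functionals with values in the ring. The values are written
  \<open>a \<oplus> \<zero>\<close> because only carrier elements are attained.\<close>

locale nondegenerate_sweedler = right_sweedler +
  fixes ell :: 'a
  assumes hit_surj: "\<exists>f. functional f \<and> hit f ell = a \<oplus> \<zero>"
    and hit_inj: "functional f \<Longrightarrow> functional f' \<Longrightarrow> hit f ell = hit f' ell \<Longrightarrow> f = f'"
    and cohit_surj: "\<exists>g. cofunctional g \<and> cohit g ell = a \<oplus> \<zero>"
    and cohit_inj: "cofunctional g \<Longrightarrow> cofunctional g' \<Longrightarrow> cohit g ell = cohit g' ell \<Longrightarrow> g = g'"
begin

lemma nondegenerate_swap: "nondegenerate_sweedler A Q P (\<lambda>a. map prod.swap (c a)) ell"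
proof -
  interpret co: right_sweedler A Q P "\<lambda>a. map prod.swap (c a)" by (rule swap)
  have *: "co.cohit f a = hit f a" for f a
    by (simp add: co.cohit_def hit_def)
  show ?thesis
    by unfold_locales (auto simp only: * intro: hit_inj cohit_inj cohit_surj hit_surj)
qed

definition hit_inv :: "'a \<Rightarrow> 'a \<Rightarrow> 'a" where
  "hit_inv a = (SOME f. functional f \<and> hit f ell = a \<oplus> \<zero>)"

lemma functional_hit_inv: "functional (hit_inv a)" and hit_hit_inv: "hit (hit_inv a) ell = a \<oplus> \<zero>"
  using someI_ex[OF hit_surj[of a]] by (auto simp: hit_inv_def)

lemma hit_inv_eqI: "functional f \<Longrightarrow> hit f ell = a \<oplus> \<zero> \<Longrightarrow> hit_inv a = f"
  by (rule hit_inj) (simp_all add: functional_hit_inv hit_hit_inv)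

lemma hit_inv_hit: "functional f \<Longrightarrow> hit_inv (hit f ell) = f"
  by (rule hit_inv_eqI) simp_all

lemma hit_inv_add: "hit_inv (a \<oplus> b) = (\<lambda>x. hit_inv a x \<oplus> hit_inv b x)"
  by (rule hit_inv_eqI)
    (simp_all add: functional_add functional_hit_inv hit_add_functional hit_hit_inv add_assoc)

lemma hit_inv_zero: "hit_inv \<zero> = (\<lambda>x. \<zero>)"
  by (rule hit_inv_eqI) (simp_all add: functional_zero hit_def)

lemma hit_inv_mult_Q: "hit_inv (a \<otimes> Q r) = (\<lambda>x. P r \<otimes> hit_inv a x)"
  by (rule hit_inv_eqI) (simp_all add: functional_scale functional_hit_inv hit_scale hit_hit_inv)

text \<open>Write \<open>a\<close> and \<open>b\<close> as \<open>cohit g ell\<close> and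
  \<open>cohit h ell\<close>. By the adjunction, \<open>f a\<close> is the value of \<open>g\<close>
  at \<open>hit f ell\<close>, up to the projection \<open>P\<close>; as \<open>f\<close> varies,
  \<open>hit f ell\<close> runs through the carrier. So the values of all functionals at
  \<open>a\<close> determine \<open>g\<close>, and hence \<open>a\<close>.\<close>

lemma functional_separation:
  assumes "\<And>f. functional f \<Longrightarrow> f a = f b" shows "a \<oplus> \<zero> = b \<oplus> \<zero>"
proof -
  interpret co: right_sweedler A Q P "\<lambda>a. map prod.swap (c a)" by (rule swap)
  obtain g h where g: "cofunctional g" "cohit g ell = a \<oplus> \<zero>" and h: "cofunctional h" "cohit h ell = b \<oplus> \<zero>"
    using cohit_surj by metis
  have "g x = h x" if x: "x \<oplus> \<zero> = x" for x
  proof -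
    obtain f where f: "functional f" "hit f ell = x" using hit_surj[of x] x by auto
    have "P (g x) = f a"
      using P_cofunctional_hit[OF f(1) g(1), of ell] g f by (simp add: functional_closed)
    moreover have "P (h x) = f b"
      using P_cofunctional_hit[OF f(1) h(1), of ell] h f by (simp add: functional_closed)
    \<comment> \<open>The values of cofunctionals are fixed by \<open>Q\<close>, and
      \<open>Q (P y) = Q y\<close>, so no information was lost by applying \<open>P\<close>.\<close>
    ultimately have "Q (P (g x)) = Q (P (h x))" using assms[OF f(1)] by simp
    then show ?thesis by (simp add: co.functionalD[OF g(1)] co.functionalD[OF h(1)])
  qed
  then have "g = h" by (intro co.functional_eqI g h)
  then show ?thesis using g h by simp
qed

text \<open>By separation it suffices to apply a functional \<open>f\<close>. Since
  \<open>hit_inv\<close> is linear, \<open>f x\<close> can be moved into its argument, and the sum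
  becomes \<open>hit_inv (hit f ell) b\<close>, which is \<open>f b\<close>. Bijectivity of the
  second map enters through separation.\<close>

lemma dual_basis: "ps (c ell) (\<lambda>x y. x \<otimes> hit_inv y b) = b \<oplus> \<zero>"
proof -
  have "ps (c ell) (\<lambda>x y. x \<otimes> hit_inv y b) \<oplus> \<zero> = b \<oplus> \<zero>"
  proof (rule functional_separation)
    fix f assume f: "functional f"
    have "P r \<otimes> hit_inv y b = hit_inv (y \<otimes> Q r) b" for y r by (simp add: hit_inv_mult_Q)
    then have *: "f x \<otimes> hit_inv y b = hit_inv (y \<otimes> Q (f x)) b" for x y
      by (metis f functionalD(3))
    have **: "f (x \<otimes> hit_inv y b) = f x \<otimes> hit_inv y b" for x y
      by (metis functionalD(3,4) f functional_hit_inv)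
    have "f (ps (c ell) (\<lambda>x y. x \<otimes> hit_inv y b)) = ps (c ell) (\<lambda>x y. hit_inv (y \<otimes> Q (f x)) b)"
      by (simp add: additive_ps[OF functionalD(7)[OF f]] ** *)
    also have "\<dots> = hit_inv (hit f ell) b" unfolding hit_def
      by (rule additive_ps[of "\<lambda>a. hit_inv a b", symmetric])
        (simp add: additive_def hit_inv_add hit_inv_zero)
    finally show "f (ps (c ell) (\<lambda>x y. x \<otimes> hit_inv y b)) = f b" by (simp add: hit_inv_hit f)
  qed
  then show ?thesis by simp
qed

end

section \<open>Pairs of a left and a right bialgebroid\<close>

text \<open>The left bialgebroid enters as a right one on the opposite ring, with source map
  \<open>t_L\<close>: so \<open>P'\<close> is \<open>t_L \<circ> \<pi>_L\<close> and
  \<open>Q'\<close> is \<open>s_L \<circ> \<pi>_L\<close>. The four equations say that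
  \<open>P\<close> and \<open>P'\<close> have the same image and \<open>Q\<close> and
  \<open>Q'\<close> too, which encodes \<open>t_L(L) = s_R(R)\<close> and
  \<open>s_L(L) = t_R(R)\<close>.\<close>

locale sweedler_pair = right_sweedler +
  fixes P' Q' :: "'a \<Rightarrow> 'a" and c' :: "'a \<Rightarrow> ('a \<times> 'a) list"
  assumes left: "right_sweedler (opp_ring A) P' Q' c'"
    and PP': "P (P' x) = P' x" and P'P: "P' (P x) = P x" and QQ': "Q (Q' x) = Q' x" and Q'Q: "Q' (Q x) = Q x"
    and mixed_lr: "balanced3 A (\<lambda>r x. P' r \<otimes> x) (\<lambda>r y. Q' r \<otimes> y) (\<lambda>r y. y \<otimes> P r) (\<lambda>r z. z \<otimes> Q r) g \<Longrightarrow>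
      ps (c a) (\<lambda>x y. ps (c' x) (\<lambda>u v. g u v y)) = ps (c' a) (\<lambda>x y. ps (c y) (\<lambda>u v. g x u v))"
    and mixed_rl: "balanced3 A (\<lambda>r x. x \<otimes> P r) (\<lambda>r y. y \<otimes> Q r) (\<lambda>r y. P' r \<otimes> y) (\<lambda>r z. Q' r \<otimes> z) g \<Longrightarrow>
      ps (c' a) (\<lambda>x y. ps (c x) (\<lambda>u v. g u v y)) = ps (c a) (\<lambda>x y. ps (c' y) (\<lambda>u v. g x u v))"
begin

text \<open>The rewrites express the facts about the opposite ring by the operations of
  \<open>A\<close>, with the factors of every product reversed.\<close>

sublocale L: right_sweedler "opp_ring A" P' Q' c'
  rewrites "monoid.mult (opp_ring A) = (\<lambda>x y. y \<otimes> x)" and "ring.add (opp_ring A) = ring.add A"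
    and "monoid.one (opp_ring A) = \<one>" and "ring.zero (opp_ring A) = \<zero>"
    and "pair_sum (opp_ring A) = (pair_sum A :: ('a \<times> 'a) list \<Rightarrow> _)" and "additive (opp_ring A) = additive A"
    and "balanced (opp_ring A) = balanced A" and "balanced3 (opp_ring A) = balanced3 A"
  using left by (auto simp: fun_eq_iff balanced_def balanced3_def)

text \<open>Passing to the opposite ring exchanges the two bialgebroids and the two mixed
  coassociativity laws. Together with \<open>pair_swap\<close>, which flips both coproducts, this
  lets one argument serve several duals.\<close>

lemma pair_opp: "sweedler_pair (opp_ring A) P' Q' c' P Q c"
proof -
  have "right_sweedler A P Q c" by unfold_locales
  then show ?thesis
    by (simp add: sweedler_pair_def sweedler_pair_axioms_def left PP' P'P QQ' Q'Q
        balanced3_def flip: mixed_lr mixed_rl)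
qed

lemma pair_swap:
  "sweedler_pair A Q P (\<lambda>a. map prod.swap (c a)) Q' P' (\<lambda>a. map prod.swap (c' a))"
proof -
  have "right_sweedler (opp_ring A) Q' P' (\<lambda>a. map prod.swap (c' a))"
    using right_sweedler.swap[OF left] .
  moreover have "ps (map prod.swap (c a)) (\<lambda>x y. ps (map prod.swap (c' x)) (\<lambda>u v. g u v y)) =
      ps (map prod.swap (c' a)) (\<lambda>x y. ps (map prod.swap (c y)) (\<lambda>u v. g x u v))"
    if "balanced3 A (\<lambda>r x. Q' r \<otimes> x) (\<lambda>r y. P' r \<otimes> y) (\<lambda>r y. y \<otimes> Q r) (\<lambda>r z. z \<otimes> P r) g" for a g
    using that by (simp, intro mixed_rl[symmetric, of "\<lambda>x y z. g z y x"]) (auto simp: balanced3_def)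
  moreover have "ps (map prod.swap (c' a)) (\<lambda>x y. ps (map prod.swap (c x)) (\<lambda>u v. g u v y)) =
      ps (map prod.swap (c a)) (\<lambda>x y. ps (map prod.swap (c' y)) (\<lambda>u v. g x u v))"
    if "balanced3 A (\<lambda>r x. x \<otimes> Q r) (\<lambda>r y. y \<otimes> P r) (\<lambda>r y. Q' r \<otimes> y) (\<lambda>r z. P' r \<otimes> z) g" for a g
    using that by (simp, intro mixed_lr[symmetric, of "\<lambda>x y z. g z y x"]) (auto simp: balanced3_def)
  ultimately show ?thesis
    by (simp add: sweedler_pair_def sweedler_pair_axioms_def swap PP' P'P QQ' Q'Q)
qed

abbreviation "lfunctional \<equiv> right_sweedler.functional (opp_ring A) P'"
abbreviation "lhit \<equiv> right_sweedler.hit (opp_ring A) Q' c'"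

text \<open>
  A functional and its image under \<open>raise\<close> act on the ring by the same operator, see \<open>hit_raise\<close>.
\<close>

definition raise :: "('a \<Rightarrow> 'a) \<Rightarrow> 'a \<Rightarrow> 'a" where "raise f a = P (lhit f a)"
definition lower :: "('a \<Rightarrow> 'a) \<Rightarrow> 'a \<Rightarrow> 'a" where "lower f a = P' (hit f a)"

lemma lhit_mult_P: "lfunctional f \<Longrightarrow> lhit f (a \<otimes> P r) = lhit f a \<otimes> P r"
  by (metis L.hit_P_mult P'P)

lemma lhit_P_mult: "lfunctional f \<Longrightarrow> lhit f (P r \<otimes> a) = P r \<otimes> lhit f a"
  by (metis L.hit_mult_P P'P)

lemma functional_raise: "lfunctional f \<Longrightarrow> functional (raise f)"
  by (rule functionalI) (simp_all add: raise_def L.hit_add L.hit_zero lhit_mult_P P_mult_P)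

text \<open>Mixed coassociativity allows the left coproduct to be taken first. The inner sum over
  \<open>c y\<close> then contains \<open>Q' (f x)\<close>, which lies in the image of
  \<open>Q\<close> and so multiplies \<open>y\<close> from the left; counitality collapses the sum
  to \<open>Q' (f x) \<otimes> y\<close>.\<close>

lemma hit_raise:
  assumes f: "lfunctional f" shows "hit (raise f) a = lhit f a"
proof -
  have fP: "f (P' r \<otimes> x) = P' r \<otimes> f x" for r x by (rule L.functionalD[OF f])
  have fQ: "Q' (P' r \<otimes> f x) = Q' (f x) \<otimes> Q' r" for r x by (rule L.Q_mult_P)
  have "hit (raise f) a = ps (c a) (\<lambda>x y. ps (c' x) (\<lambda>u v. y \<otimes> Q (Q' (f u) \<otimes> v)))"
    by (simp add: hit_def raise_def L.hit_def ps_mult_left additive_ps[of Q] additive_def)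
  also have "\<dots> = ps (c' a) (\<lambda>x y. ps (c y) (\<lambda>u v. v \<otimes> Q (Q' (f x) \<otimes> u)))"
    by (rule mixed_lr) (auto simp: balanced3_def additive_def L.functionalD[OF f] fP fQ Q_mult_P
        mult_assoc, metis mult_assoc Q_mult_P)
  also have "\<dots> = ps (c' a) (\<lambda>x y. Q' (f x) \<otimes> y)"
  proof (rule pair_sum_cong)
    fix x y
    have "ps (c y) (\<lambda>u v. v \<otimes> Q (Q' (f x) \<otimes> u)) = ps (c (Q (Q' (f x)) \<otimes> y)) (\<lambda>u v. v \<otimes> Q u)"
      by (subst cop_Q_mult) (simp_all add: bal_hit functional_P QQ' bal_hit[OF functional_P, simplified])
    then show "ps (c y) (\<lambda>u v. v \<otimes> Q (Q' (f x) \<otimes> u)) = Q' (f x) \<otimes> y"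
      by (simp add: counit_Q QQ')
  qed
  finally show ?thesis by (simp add: L.hit_def)
qed

text \<open>In the opposite pair the roles of the two bialgebroids are exchanged and
  \<open>raise\<close> becomes \<open>lower\<close>.\<close>

lemma lfunctional_lower: "functional f \<Longrightarrow> lfunctional (lower f)"
  and lhit_lower: "functional f \<Longrightarrow> lhit (lower f) a = hit f a"
proof -
  interpret op: sweedler_pair "opp_ring A" P' Q' c' P Q c by (rule pair_opp)
  have "op.raise = lower" by (simp add: op.raise_def[abs_def] lower_def[abs_def])
  then show "functional f \<Longrightarrow> lfunctional (lower f)" "functional f \<Longrightarrow> lhit (lower f) a = hit f a"
    using op.functional_raise[of f] op.hit_raise[of f a] by simp_all
qed

lemma raise_lower: "functional f \<Longrightarrow> raise (lower f) = f"
  by (rule ext) (simp add: raise_def lhit_lower P_hit)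

lemma lower_raise: "lfunctional f \<Longrightarrow> lower (raise f) = f"
  by (rule ext) (simp add: lower_def hit_raise L.P_hit)

text \<open>Both sides are \<open>P\<close> applied to the composite of the two operators. On the
  left side \<open>f (lhit g a)\<close> is the product of \<open>\<A>_*\<close> in reversed order,
  so \<open>raise\<close> is multiplicative on the opposite ring.\<close>

lemma raise_comp:
  "lfunctional f \<Longrightarrow> lfunctional g \<Longrightarrow> raise (\<lambda>a. f (lhit g a)) = (\<lambda>a. raise f (hit (raise g) a))"
  by (rule ext) (simp add: raise_def[of f] raise_def[of "\<lambda>a. f (lhit g a)"] hit_raise flip: L.hit_hit)

lemma raise_add: "raise (\<lambda>x. f x \<oplus> g x) = (\<lambda>x. raise f x \<oplus> raise g x)"
  by (rule ext) (simp add: raise_def L.hit_add_functional)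

text \<open>Equal operators again: a target functional of the left structure on the opposite ring
  acts by right multiplication with \<open>Q' r\<close>, which is how a source functional of the
  right structure acts. So \<open>raise\<close> exchanges source and target.\<close>

lemma raise_source: "raise (\<lambda>x. P' (x \<otimes> Q' r)) = (\<lambda>x. P (Q' r) \<otimes> P x)"
proof
  fix x
  have "raise (\<lambda>x. P' (x \<otimes> P' r)) x = P (x \<otimes> Q' r)"
    using L.hit_target[of r x] by (simp add: raise_def)
  moreover have "P' (x \<otimes> P' r) = P' (x \<otimes> Q' r)" for x using L.P_P_mult L.P_Q_mult by metis
  moreover have "P (x \<otimes> Q' r) = P (Q' r) \<otimes> P x" by (metis P_mult_Q QQ')
  ultimately show "raise (\<lambda>x. P' (x \<otimes> Q' r)) x = P (Q' r) \<otimes> P x" by simp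
qed

lemma raise_target: "raise (\<lambda>x. P' x \<otimes> P' r) = (\<lambda>x. P (Q' r \<otimes> x))"
  using L.hit_source[of r] by (simp add: raise_def fun_eq_iff)

text \<open>The list stands for a tensor of functionals known through its evaluations, and the claim
  transports this knowledge along \<open>raise\<close>. The left side of the conclusion is
  \<open>P\<close> of products \<open>lhit g x \<otimes> lhit f y\<close>; once expanded, the
  hypothesis applies to the functional factor, and multiplicativity of the left coproduct
  reassembles \<open>lhit h (x \<otimes> y)\<close>.\<close>

lemma raise_eval:
  assumes l: "\<And>f g. (f, g) \<in> set l \<Longrightarrow> lfunctional f \<and> lfunctional g" and h: "lfunctional h"
    and e: "\<And>x y. ps l (\<lambda>f g. g (x \<otimes> f y)) = h (x \<otimes> y)"
  shows "ps l (\<lambda>f g. raise f (raise g x \<otimes> y)) = raise h (x \<otimes> y)"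
proof -
  have "ps l (\<lambda>f g. raise f (raise g x \<otimes> y)) =
      ps l (\<lambda>f g. ps (c' y) (\<lambda>u v. ps (c' x) (\<lambda>u' v'. P (Q' (g (u' \<otimes> f u)) \<otimes> v' \<otimes> v))))"
  proof (rule pair_sum_cong)
    fix f g assume "(f, g) \<in> set l"
    then have f: "lfunctional f" and g: "lfunctional g" using l by auto
    \<comment> \<open>The value \<open>raise g x\<close> lies in the image of \<open>P\<close>, so
      it passes through the operator of \<open>f\<close>, and under the outer \<open>P\<close> it
      may be replaced by \<open>lhit g x\<close>.\<close>
    have "raise f (raise g x \<otimes> y) = P (lhit g x \<otimes> lhit f y)"
      by (simp add: raise_def lhit_P_mult f P_P_mult)
    also have "\<dots> = ps (c' y) (\<lambda>u v. ps (c' x) (\<lambda>u' v'. P (Q' (g u') \<otimes> (v' \<otimes> Q' (f u)) \<otimes> v)))"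
      by (simp add: L.hit_def ps_mult_left ps_mult_right additive_ps[of P] additive_def mult_assoc)
    \<comment> \<open>The Takeuchi condition replaces \<open>Q' (f u)\<close> behind the second leg
      of \<open>x\<close> by \<open>f u\<close> behind the first, inside the argument of
      \<open>g\<close>, as the hypothesis requires.\<close>
    also have "\<dots> = ps (c' y) (\<lambda>u v. ps (c' x) (\<lambda>u' v'. P (Q' (g (u' \<otimes> f u)) \<otimes> v' \<otimes> v)))"
    proof (rule pair_sum_cong)
      fix u v
      have "Q' (P' r \<otimes> g x) = Q' (g x) \<otimes> Q' r" for r x by (rule L.Q_mult_P)
      then have "balanced A (\<lambda>r x. P' r \<otimes> x) (\<lambda>r y. Q' r \<otimes> y) (\<lambda>x y. P (Q' (g x) \<otimes> y \<otimes> v))"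
        by (intro L.balI) (simp_all add: L.functionalD[OF g] mult_assoc)
      from L.cop_takeuchi[OF this, of x "f u"]
      show "ps (c' x) (\<lambda>u' v'. P (Q' (g u') \<otimes> (v' \<otimes> Q' (f u)) \<otimes> v)) =
        ps (c' x) (\<lambda>u' v'. P (Q' (g (u' \<otimes> f u)) \<otimes> v' \<otimes> v))"
        by (simp add: L.functionalD[OF f])
    qed
    finally show "raise f (raise g x \<otimes> y) =
      ps (c' y) (\<lambda>u v. ps (c' x) (\<lambda>u' v'. P (Q' (g (u' \<otimes> f u)) \<otimes> v' \<otimes> v)))" .
  qed
  also have "\<dots> = ps (c' y) (\<lambda>u v. ps (c' x) (\<lambda>u' v'. ps l (\<lambda>f g. P (Q' (g (u' \<otimes> f u)) \<otimes> v' \<otimes> v))))"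
    by (simp only: ps_commute[of l])
  also have "\<dots> = ps (c' y) (\<lambda>u v. ps (c' x) (\<lambda>u' v'. P (Q' (h (u' \<otimes> u)) \<otimes> (v' \<otimes> v))))"
  proof -
    have "ps l (\<lambda>f g. P (Q' (g (u' \<otimes> f u)) \<otimes> v' \<otimes> v)) = P (Q' (h (u' \<otimes> u)) \<otimes> (v' \<otimes> v))" for u u' v v'
      using additive_ps[of "\<lambda>z. P (Q' z \<otimes> (v' \<otimes> v))" l "\<lambda>f g. g (u' \<otimes> f u)"]
      by (simp add: additive_def e mult_assoc)
    then show ?thesis by simp
  qed
  also have "\<dots> = P (lhit h (x \<otimes> y))"
    by (simp add: L.hit_def L.cop_mult[OF L.bal_hit[OF h]] additive_ps[of P] additive_def)
  finally show ?thesis by (simp add: raise_def)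
qed

end

section \<open>The antipode\<close>

locale sweedler_hopf = sweedler_pair +
  fixes S :: "'a \<Rightarrow> 'a"
  assumes S_add [simp]: "S (x \<oplus> y) = S x \<oplus> S y" and S_zero [simp]: "S \<zero> = \<zero>"
    and S_closed [simp]: "S x \<oplus> \<zero> = S x"
    and S_inj: "S x = S y \<Longrightarrow> x \<oplus> \<zero> = y \<oplus> \<zero>" and S_surj: "\<exists>x. S x = y \<oplus> \<zero>"
    and S_P'_mult: "S (P' r \<otimes> a) = S a \<otimes> Q' r" and S_mult_P': "S (a \<otimes> P' r) = Q' r \<otimes> S a"
    and S_Q_mult: "S (Q r \<otimes> a) = S a \<otimes> P r" and S_mult_Q: "S (a \<otimes> Q r) = P r \<otimes> S a"
    and antipode_left: "ps (c' a) (\<lambda>x y. S x \<otimes> y) = P a"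
    and antipode_right: "ps (c a) (\<lambda>x y. x \<otimes> S y) = Q' a"
begin

abbreviation lbal :: "('a \<Rightarrow> 'a \<Rightarrow> 'a) \<Rightarrow> bool" where
  "lbal \<equiv> balanced A (\<lambda>r x. P' r \<otimes> x) (\<lambda>r y. Q' r \<otimes> y)"

lemma S_mult_P: "S (a \<otimes> P r) = Q' (P r) \<otimes> S a"
  by (metis S_mult_P' P'P)

lemma lbal_S_left: "lbal (\<lambda>x y. S x \<otimes> y)" "lbal (\<lambda>x y. S x \<otimes> y \<otimes> b)"
  by (rule L.balI; simp add: S_P'_mult mult_assoc)+

lemma additive_S [simp]: "additive A S"
  by (simp add: additive_def)

lemma S_one [simp]: "S \<one> = \<one>"
  using antipode_left[of \<one>] L.cop_one[OF lbal_S_left(1)] by simp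

lemma antipode_left_mult: "ps (c' a) (\<lambda>x y. S x \<otimes> (y \<otimes> b)) = P a \<otimes> b"
  by (simp flip: antipode_left mult_assoc ps_mult_right)

lemma antipode_right_mult': "ps (c a) (\<lambda>x y. x \<otimes> (S y \<otimes> d)) = Q' a \<otimes> d"
  by (simp flip: antipode_right mult_assoc ps_mult_right)

lemma P_Q'_comm: "P x \<otimes> Q' y = Q' y \<otimes> P x"
  by (metis P_Q_comm QQ')

lemma P_Q'_comm_assoc: "P x \<otimes> (Q' y \<otimes> z) = Q' y \<otimes> (P x \<otimes> z)"
  by (simp add: P_Q'_comm flip: mult_assoc)

text \<open>This follows the pattern of the Hopf algebra proof. The product
  \<open>S (a \<otimes> b)\<close> is completed by \<open>Q'\<close> of the second legs, which the
  antipode axiom expands first for \<open>a\<close> and then for \<open>b\<close>. Mixed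
  coassociativity brings \<open>S\<close> of a product next to the product itself, the other
  antipode axiom cancels it, and counits leave \<open>S b \<otimes> S a\<close>. Each move needs a
  balanced sum, which dictates that \<open>a\<close> is expanded before \<open>b\<close>.\<close>

lemma S_mult: "S (a \<otimes> b) = S b \<otimes> S a"
proof -
  have l1: "lbal (\<lambda>x y. S x \<otimes> (y \<otimes> d))" for d
    by (rule L.balI) (simp_all add: S_P'_mult mult_assoc)
  have "S (a \<otimes> b) = ps (c' (a \<otimes> b)) (\<lambda>x y. S (P' y \<otimes> x))"
    using L.counit_P[of "a \<otimes> b"] additive_ps[OF additive_S, of "c' (a \<otimes> b)" "\<lambda>x y. P' y \<otimes> x"] by simp
  also have "\<dots> = ps (c' (a \<otimes> b)) (\<lambda>x y. S x \<otimes> Q' y)"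
    by (simp add: S_P'_mult)
  also have "\<dots> = ps (c' b) (\<lambda>z w. ps (c' a) (\<lambda>x y. S (x \<otimes> z) \<otimes> Q' (y \<otimes> w)))"
    by (rule L.cop_mult, rule L.balI) (simp_all add: S_P'_mult L.Q_mult_Q mult_assoc)
  \<comment> \<open>First expansion: \<open>Q' (y \<otimes> w)\<close> equals
    \<open>Q' (y \<otimes> Q' w)\<close>, and the antipode axiom for \<open>y \<otimes> Q' w\<close>
    places \<open>Q' w\<close> between the legs of \<open>y\<close>.\<close>
  also have "\<dots> = ps (c' b) (\<lambda>z w. ps (c' a) (\<lambda>x y. ps (c y) (\<lambda>u v. S (x \<otimes> z) \<otimes> (u \<otimes> (Q' w \<otimes> S v)))))"
  proof (intro pair_sum_cong)
    fix z w x y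
    have "ps (c (y \<otimes> Q (Q' w))) (\<lambda>u v. u \<otimes> S v) = ps (c y) (\<lambda>u v. u \<otimes> Q (Q' w) \<otimes> S v)"
      by (rule cop_mult_Q, rule balI) (simp_all add: S_mult_Q mult_assoc)
    then have "ps (c y) (\<lambda>u v. u \<otimes> (Q' w \<otimes> S v)) = Q' (y \<otimes> w)"
      by (simp add: antipode_right QQ' mult_assoc L.Q_Q_mult)
    then show "S (x \<otimes> z) \<otimes> Q' (y \<otimes> w) = ps (c y) (\<lambda>u v. S (x \<otimes> z) \<otimes> (u \<otimes> (Q' w \<otimes> S v)))"
      by (metis ps_mult_left)
  qed
  also have "\<dots> = ps (c' b) (\<lambda>z w. ps (c a) (\<lambda>x y. ps (c' x) (\<lambda>u v. S (u \<otimes> z) \<otimes> (v \<otimes> (Q' w \<otimes> S y)))))"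
    by (rule pair_sum_cong, rule mixed_lr[symmetric])
      (simp add: balanced3_def additive_def S_P'_mult S_mult_Q mult_assoc P_Q'_comm_assoc)
  \<comment> \<open>Second expansion: the element \<open>Q' w\<close> left in the middle is itself
    written by the antipode axiom.\<close>
  also have "\<dots> = ps (c' b) (\<lambda>z w. ps (c a) (\<lambda>x y. ps (c' x) (\<lambda>u v. ps (c w) (\<lambda>p q.
      S (u \<otimes> z) \<otimes> (v \<otimes> (p \<otimes> (S q \<otimes> S y)))))))"
    by (simp add: antipode_right_mult' flip: ps_mult_left)
  also have "\<dots> = ps (c a) (\<lambda>x y. ps (c' b) (\<lambda>z w. ps (c w) (\<lambda>p q. ps (c' x) (\<lambda>u v. 
      S (u \<otimes> z) \<otimes> (v \<otimes> (p \<otimes> (S q \<otimes> S y)))))))"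
    by (subst ps_commute[of "c' b"], subst ps_commute[of "c' _" "c _"], rule refl)
  also have "\<dots> = ps (c a) (\<lambda>x y. ps (c b) (\<lambda>w q. ps (c' w) (\<lambda>z p. ps (c' x) (\<lambda>u v. 
      S (u \<otimes> z) \<otimes> (v \<otimes> (p \<otimes> (S q \<otimes> S y)))))))"
  proof (rule pair_sum_cong, rule mixed_lr[symmetric])
    fix x y
    have "ps (c' x) (\<lambda>u v. S (u \<otimes> P' r \<otimes> z) \<otimes> (v \<otimes> (p \<otimes> (S q \<otimes> S y)))) =
       ps (c' x) (\<lambda>u v. S (u \<otimes> z) \<otimes> (v \<otimes> Q' r \<otimes> (p \<otimes> (S q \<otimes> S y))))" for r z p q
      by (rule L.cop_takeuchi, rule L.balI) (simp_all add: S_P'_mult mult_assoc)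
    then show "balanced3 A (\<lambda>r x. P' r \<otimes> x) (\<lambda>r y. Q' r \<otimes> y) (\<lambda>r y. y \<otimes> P r) (\<lambda>r z. z \<otimes> Q r)
       (\<lambda>z p q. ps (c' x) (\<lambda>u v. S (u \<otimes> z) \<otimes> (v \<otimes> (p \<otimes> (S q \<otimes> S y)))))"
      by (simp add: balanced3_def additive_def ps_add S_mult_Q mult_assoc)
  qed
  \<comment> \<open>After both shifts the two inner left coproducts form the coproduct of
    \<open>x \<otimes> z\<close>, with \<open>S\<close> on the first leg.\<close>
  also have "\<dots> = ps (c a) (\<lambda>x y. ps (c b) (\<lambda>z w. P (x \<otimes> z) \<otimes> (S w \<otimes> S y)))"
  proof (intro pair_sum_cong)
    fix x y z w
    have "ps (c' (x \<otimes> z)) (\<lambda>u v. S u \<otimes> (v \<otimes> (S w \<otimes> S y))) =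
       ps (c' z) (\<lambda>p q. ps (c' x) (\<lambda>u v. S (u \<otimes> p) \<otimes> (v \<otimes> q \<otimes> (S w \<otimes> S y))))"
      by (rule L.cop_mult[OF l1])
    then show "ps (c' z) (\<lambda>p q. ps (c' x) (\<lambda>u v. S (u \<otimes> p) \<otimes> (v \<otimes> (q \<otimes> (S w \<otimes> S y))))) =
       P (x \<otimes> z) \<otimes> (S w \<otimes> S y)"
      by (simp add: antipode_left_mult mult_assoc)
  qed
  \<comment> \<open>Under \<open>P\<close> the factor \<open>x\<close> may be replaced by
    \<open>P x\<close>, and the Takeuchi condition moves it as \<open>Q x\<close> to the second leg
    of \<open>b\<close>. The two sums are then separate counit sums.\<close>
  also have "\<dots> = ps (c a) (\<lambda>x y. ps (c b) (\<lambda>z w. P z \<otimes> (S (Q x \<otimes> w) \<otimes> S y)))"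
  proof (rule pair_sum_cong)
    fix x y
    have "ps (c b) (\<lambda>z w. P (P x \<otimes> z) \<otimes> (S w \<otimes> S y)) = ps (c b) (\<lambda>z w. P z \<otimes> (S (Q x \<otimes> w) \<otimes> S y))"
      by (rule cop_takeuchi, rule balI) (simp_all add: P_mult_P S_mult_Q mult_assoc)
    then show "ps (c b) (\<lambda>z w. P (x \<otimes> z) \<otimes> (S w \<otimes> S y)) = ps (c b) (\<lambda>z w. P z \<otimes> (S (Q x \<otimes> w) \<otimes> S y))"
      by (simp add: P_P_mult)
  qed
  also have "\<dots> = ps (c a) (\<lambda>x y. ps (c b) (\<lambda>z w. S (w \<otimes> Q z) \<otimes> S (y \<otimes> Q x)))"
    by (simp add: S_Q_mult S_mult_Q mult_assoc)
  also have "\<dots> = S b \<otimes> S a"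
    using additive_ps[OF additive_S, of "c a" "\<lambda>x y. y \<otimes> Q x"] additive_ps[OF additive_S, of "c b" "\<lambda>x y. y \<otimes> Q x"]
    by (simp add: counit_Q flip: ps_mult_left ps_mult_right)
  finally show ?thesis .
qed

text \<open>Apply \<open>P'\<close> to the left antipode axiom. Under \<open>P'\<close> the second
  leg may be replaced by its \<open>Q'\<close> part, which moves into the argument of
  \<open>S\<close> and is absorbed by the counit.\<close>

lemma P'_S: "P' (S a) = P a"
proof -
  have "P a = P' (ps (c' a) (\<lambda>x y. S x \<otimes> y))" by (simp add: antipode_left P'P)
  also have "\<dots> = ps (c' a) (\<lambda>x y. P' (S x \<otimes> y))" by (rule additive_ps) (simp add: additive_def)
  also have "\<dots> = ps (c' a) (\<lambda>x y. P' (S (P' y \<otimes> x)))" by (simp add: S_P'_mult L.P_Q_mult)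
  also have "\<dots> = P' (S (ps (c' a) (\<lambda>x y. P' y \<otimes> x)))"
    by (rule additive_ps[of "\<lambda>x. P' (S x)", symmetric]) (simp add: additive_def)
  finally show ?thesis by (simp add: L.counit_P)
qed

text \<open>The argument is uniqueness of convolution inverses: the coproduct of \<open>S a\<close>
  and the flipped image of the right coproduct under \<open>S\<close> both invert the left
  coproduct. The local \<open>claim\<close> is the inverse property of the second one; the antipode
  axiom gives it for the first.\<close>

lemma S_comult:
  assumes f: "lbal f" shows "ps (c' (S a)) f = ps (c a) (\<lambda>x y. f (S y) (S x))"
proof -
  note fD = L.balD[OF f]
  have fext: "f (x \<oplus> x') = (\<lambda>y. f x y \<oplus> f x' y)" "f \<zero> = (\<lambda>y. \<zero>)" for x x'
    by (simp_all add: fD fun_eq_iff)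
  have fP: "f (P r \<otimes> x) y = f x (Q' (P r) \<otimes> y)" for r x y by (metis fD(5) P'P)
  have lb: "lbal (\<lambda>m n. f (m \<otimes> x) (n \<otimes> y))" for x y
    by (rule L.balI) (simp_all add: fD mult_assoc)
  have cP: "ps (c' (w \<otimes> P r)) g = ps (c' w) (\<lambda>x y. g x (y \<otimes> P r))" if "lbal g" for w r g
    using L.cop_P_mult[OF that, of w "P r"] by (simp add: P'P)
  \<comment> \<open>The extra left factor \<open>z\<close> leaves room for \<open>S x\<close> later.
    The legs of \<open>y\<close> cancel in two rounds, the inner pair first, since their images
    under \<open>S\<close> appear in reversed order.\<close>
  have claim: "ps (c y) (\<lambda>u v. ps (c v) (\<lambda>p q. ps (c' (z \<otimes> u)) (\<lambda>m n. f (m \<otimes> S q) (n \<otimes> S p)))) =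
      ps (c' (z \<otimes> Q' y)) f" for z y
  proof -
    have "ps (c y) (\<lambda>u v. ps (c v) (\<lambda>p q. ps (c' (z \<otimes> u)) (\<lambda>m n. f (m \<otimes> S q) (n \<otimes> S p)))) =
      ps (c y) (\<lambda>u q. ps (c u) (\<lambda>w p. ps (c' (z \<otimes> w)) (\<lambda>m n. f (m \<otimes> S q) (n \<otimes> S p))))"
    proof (rule cop_coassoc[symmetric])
      have 1: "ps (c' (z \<otimes> (w \<otimes> P r))) (\<lambda>m n. f (m \<otimes> S q) (n \<otimes> S p)) =
         ps (c' (z \<otimes> w)) (\<lambda>m n. f (m \<otimes> S q) (n \<otimes> S (p \<otimes> Q r)))" for w r p q
        using cP[OF lb, of "z \<otimes> w" r] by (simp add: S_mult_Q mult_assoc)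
      have 2: "ps (c' (z \<otimes> w)) (\<lambda>m n. f (m \<otimes> S q) (n \<otimes> S (p \<otimes> P r))) =
         ps (c' (z \<otimes> w)) (\<lambda>m n. f (m \<otimes> S (q \<otimes> Q r)) (n \<otimes> S p))" for w r p q
        using L.cop_takeuchi[OF lb, of "z \<otimes> w" "P r"] by (simp add: S_mult_Q S_mult_P mult_assoc P'P)
      show "balanced3 A (\<lambda>r x. x \<otimes> P r) (\<lambda>r y. y \<otimes> Q r) (\<lambda>r x. x \<otimes> P r) (\<lambda>r y. y \<otimes> Q r)
         (\<lambda>w p q. ps (c' (z \<otimes> w)) (\<lambda>m n. f (m \<otimes> S q) (n \<otimes> S p)))"
        unfolding balanced3_def additive_def
        by (simp add: 1 2 fD ps_add L.cop_add[OF lb] L.cop_zero[OF lb])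
    qed
    also have "\<dots> = ps (c y) (\<lambda>u q. ps (c u) (\<lambda>w p. ps (c' w) (\<lambda>a b. ps (c' z) (\<lambda>z1 z2.
        f (z1 \<otimes> a \<otimes> S q) (z2 \<otimes> b \<otimes> S p)))))"
      by (simp only: L.cop_mult[OF lb])
    also have "\<dots> = ps (c y) (\<lambda>u q. ps (c' u) (\<lambda>a w. ps (c w) (\<lambda>b p. ps (c' z) (\<lambda>z1 z2.
        f (z1 \<otimes> a \<otimes> S q) (z2 \<otimes> b \<otimes> S p)))))"
    proof (rule pair_sum_cong, rule mixed_lr)
      fix q
      have "ps (c' z) (\<lambda>z1 z2. f (z1 \<otimes> P' r \<otimes> (a \<otimes> S q)) (z2 \<otimes> (b \<otimes> S p))) =
        ps (c' z) (\<lambda>z1 z2. f (z1 \<otimes> (a \<otimes> S q)) (z2 \<otimes> Q' r \<otimes> (b \<otimes> S p)))" for r a b p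
        by (rule L.cop_takeuchi[OF lb])
      then show "balanced3 A (\<lambda>r x. P' r \<otimes> x) (\<lambda>r y. Q' r \<otimes> y) (\<lambda>r y. y \<otimes> P r) (\<lambda>r z. z \<otimes> Q r)
        (\<lambda>a b p. ps (c' z) (\<lambda>z1 z2. f (z1 \<otimes> a \<otimes> S q) (z2 \<otimes> b \<otimes> S p)))"
        by (simp add: balanced3_def additive_def fD ps_add mult_assoc S_mult_Q)
    qed
    \<comment> \<open>First round: in the second slot \<open>b \<otimes> S p\<close> sums to
      \<open>Q' w\<close>.\<close>
    also have "\<dots> = ps (c y) (\<lambda>u q. ps (c' u) (\<lambda>a w. ps (c' z) (\<lambda>z1 z2. f (z1 \<otimes> (a \<otimes> S q)) (z2 \<otimes> Q' w))))"
    proof (intro pair_sum_cong)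
      fix q a w
      have "ps (c w) (\<lambda>b p. ps (c' z) (\<lambda>z1 z2. f (z1 \<otimes> a \<otimes> S q) (z2 \<otimes> b \<otimes> S p))) =
         ps (c' z) (\<lambda>z1 z2. ps (c w) (\<lambda>b p. f (z1 \<otimes> a \<otimes> S q) (z2 \<otimes> (b \<otimes> S p))))"
        by (subst ps_commute) (simp add: mult_assoc)
      also have "\<dots> = ps (c' z) (\<lambda>z1 z2. f (z1 \<otimes> a \<otimes> S q) (z2 \<otimes> ps (c w) (\<lambda>b p. b \<otimes> S p)))"
      proof (rule pair_sum_cong)
        fix z1 z2
        show "ps (c w) (\<lambda>b p. f (z1 \<otimes> a \<otimes> S q) (z2 \<otimes> (b \<otimes> S p))) =
            f (z1 \<otimes> a \<otimes> S q) (z2 \<otimes> ps (c w) (\<lambda>b p. b \<otimes> S p))"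
          by (rule additive_ps[of "\<lambda>x. f (z1 \<otimes> a \<otimes> S q) (z2 \<otimes> x)", symmetric]) (simp add: additive_def fD)
      qed
      finally show "ps (c w) (\<lambda>b p. ps (c' z) (\<lambda>z1 z2. f (z1 \<otimes> a \<otimes> S q) (z2 \<otimes> b \<otimes> S p))) =
         ps (c' z) (\<lambda>z1 z2. f (z1 \<otimes> (a \<otimes> S q)) (z2 \<otimes> Q' w))"
        by (simp add: antipode_right mult_assoc)
    qed
    \<comment> \<open>The Takeuchi condition for \<open>z\<close> transfers \<open>Q' w\<close> to
      the first slot as \<open>P' w\<close>, where the counit restores \<open>u\<close>. The second
      round \<open>u \<otimes> S q\<close> can then follow.\<close>
    also have "\<dots> = ps (c y) (\<lambda>u q. ps (c' u) (\<lambda>a w. ps (c' z) (\<lambda>z1 z2. f (z1 \<otimes> (P' w \<otimes> a \<otimes> S q)) z2)))"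
    proof (rule pair_sum_cong, rule pair_sum_cong)
      fix q a w
      have "lbal (\<lambda>m n. f (m \<otimes> (a \<otimes> S q)) n)" by (rule L.balI) (simp_all add: fD mult_assoc)
      from L.cop_takeuchi[OF this, of z w]
      show "ps (c' z) (\<lambda>z1 z2. f (z1 \<otimes> (a \<otimes> S q)) (z2 \<otimes> Q' w)) =
         ps (c' z) (\<lambda>z1 z2. f (z1 \<otimes> (P' w \<otimes> a \<otimes> S q)) z2)"
        by (simp add: mult_assoc)
    qed
    also have "\<dots> = ps (c y) (\<lambda>u q. ps (c' z) (\<lambda>z1 z2. f (z1 \<otimes> (u \<otimes> S q)) z2))"
    proof (intro pair_sum_cong)
      fix u q
      have "ps (c' u) (\<lambda>a w. ps (c' z) (\<lambda>z1 z2. f (z1 \<otimes> (P' w \<otimes> a \<otimes> S q)) z2)) =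
         ps (c' z) (\<lambda>z1 z2. f (z1 \<otimes> (ps (c' u) (\<lambda>a w. P' w \<otimes> a) \<otimes> S q)) z2)"
        by (rule additive_ps[of "\<lambda>x. ps (c' z) (\<lambda>z1 z2. f (z1 \<otimes> (x \<otimes> S q)) z2)", symmetric])
          (simp add: additive_def fext ps_add)
      then show "ps (c' u) (\<lambda>a w. ps (c' z) (\<lambda>z1 z2. f (z1 \<otimes> (P' w \<otimes> a \<otimes> S q)) z2)) =
        ps (c' z) (\<lambda>z1 z2. f (z1 \<otimes> (u \<otimes> S q)) z2)"
        by (simp add: L.counit_P)
    qed
    also have "\<dots> = ps (c' z) (\<lambda>z1 z2. f (z1 \<otimes> ps (c y) (\<lambda>u q. u \<otimes> S q)) z2)"
      by (rule additive_ps[of "\<lambda>x. ps (c' z) (\<lambda>z1 z2. f (z1 \<otimes> x) z2)", symmetric])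
        (simp add: additive_def fext ps_add)
    also have "\<dots> = ps (c' (z \<otimes> Q' y)) f"
      by (simp add: antipode_right L.cop_Q_mult[OF f])
    finally show ?thesis .
  qed
  \<comment> \<open>This is the left coproduct of \<open>w\<close> times the flipped image of the
    right coproduct of \<open>v\<close> under \<open>S\<close>, as seen by \<open>f\<close>. The
    claim says that \<open>?K (z \<otimes> u) v\<close>, summed over the coproduct of
    \<open>y\<close>, gives the coproduct of \<open>z \<otimes> Q' y\<close>.\<close>
  let ?K = "\<lambda>w v. ps (c v) (\<lambda>p q. ps (c' w) (\<lambda>m n. f (m \<otimes> S q) (n \<otimes> S p)))"
  have K_add: "additive A (\<lambda>w. ?K w v)" for v
    unfolding additive_def by (simp add: L.cop_add[OF lb] L.cop_zero[OF lb] ps_add)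
  have balK: "bal (\<lambda>p q. ps (c' w) (\<lambda>m n. f (m \<otimes> S q) (n \<otimes> S p)))" for w
  proof (rule balI)
    fix r p q
    show "ps (c' w) (\<lambda>m n. f (m \<otimes> S q) (n \<otimes> S (p \<otimes> P r))) = ps (c' w) (\<lambda>m n. f (m \<otimes> S (q \<otimes> Q r)) (n \<otimes> S p))"
      using L.cop_takeuchi[OF lb, of w "P r"] by (simp add: S_mult_Q S_mult_P mult_assoc P'P)
  qed (simp_all add: fD ps_add)
  have "ps (c' (S a)) f = ps (c' (S (ps (c' a) (\<lambda>x y. P' y \<otimes> x)))) f"
    by (simp add: L.counit_P L.cop_add[OF f] L.cop_zero[OF f])
  also have "\<dots> = ps (c' a) (\<lambda>x y. ps (c' (S (P' y \<otimes> x))) f)"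
    by (rule additive_ps[of "\<lambda>x. ps (c' (S x)) f"]) (simp add: additive_def L.cop_add[OF f] L.cop_zero[OF f])
  \<comment> \<open>\<open>S (P' y \<otimes> x)\<close> is \<open>S x \<otimes> Q' y\<close>, so the
    claim is read from right to left with \<open>z = S x\<close>. Mixed coassociativity then pairs
    \<open>S\<close> with the next leg.\<close>
  also have "\<dots> = ps (c' a) (\<lambda>x y. ps (c y) (\<lambda>u v. ?K (S x \<otimes> u) v))"
    by (simp add: claim S_P'_mult)
  also have "\<dots> = ps (c a) (\<lambda>x y. ps (c' x) (\<lambda>u v. ?K (S u \<otimes> v) y))"
  proof (rule mixed_lr[symmetric])
    have "?K (w \<otimes> P r) v = ?K w (v \<otimes> Q r)" for w r v
      by (simp add: cP[OF lb] cop_mult_Q[OF balK] S_mult_Q mult_assoc)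
    then show "balanced3 A (\<lambda>r x. P' r \<otimes> x) (\<lambda>r y. Q' r \<otimes> y) (\<lambda>r y. y \<otimes> P r) (\<lambda>r z. z \<otimes> Q r)
        (\<lambda>x u v. ?K (S x \<otimes> u) v)"
      unfolding balanced3_def additive_def
      by (simp add: L.cop_add[OF lb] L.cop_zero[OF lb] ps_add S_P'_mult mult_assoc
          cop_add[OF balK] cop_zero[OF balK] flip: mult_assoc)
  qed
  also have "\<dots> = ps (c a) (\<lambda>x y. ?K (P x) y)"
    by (simp add: additive_ps[OF K_add, symmetric] antipode_left)
  \<comment> \<open>The left coproduct of \<open>P x\<close> is \<open>\<one> \<otimes> P x\<close>,
    so \<open>?K (P x) y\<close> is the flipped image of the coproduct of \<open>y\<close> with
    \<open>P x\<close> before \<open>S p\<close>. This factor goes into the argument of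
    \<open>S\<close> as \<open>Q x\<close>, ready for the counit.\<close>
  also have "\<dots> = ps (c a) (\<lambda>x y. ps (c y) (\<lambda>p q. f (S q) (S (p \<otimes> Q x))))"
  proof (intro pair_sum_cong)
    fix x p q
    have "ps (c' (\<one> \<otimes> P x)) (\<lambda>m n. f (m \<otimes> S q) (n \<otimes> S p)) =
       ps (c' \<one>) (\<lambda>m n. f (m \<otimes> S q) (n \<otimes> P x \<otimes> S p))"
      by (rule cP[OF lb])
    also have "\<dots> = f (\<one> \<otimes> S q) (\<one> \<otimes> P x \<otimes> S p) \<oplus> \<zero>"
      by (rule L.cop_one, rule L.balI) (simp_all add: fD mult_assoc)
    also have "\<dots> = f (S q) (S (p \<otimes> Q x))"
      by (simp add: S_mult_Q) (metis fD(1,2) S_closed)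
    finally show "ps (c' (P x)) (\<lambda>m n. f (m \<otimes> S q) (n \<otimes> S p)) = f (S q) (S (p \<otimes> Q x))" by simp
  qed
  also have "\<dots> = ps (c a) (\<lambda>x y. ps (c x) (\<lambda>u v. f (S y) (S (v \<otimes> Q u))))"
  proof (rule cop_coassoc[symmetric])
    show "balanced3 A (\<lambda>r x. x \<otimes> P r) (\<lambda>r y. y \<otimes> Q r) (\<lambda>r x. x \<otimes> P r) (\<lambda>r y. y \<otimes> Q r)
         (\<lambda>u v y. f (S y) (S (v \<otimes> Q u)))"
      by (simp add: balanced3_def additive_def fD fP P_mult_P S_mult_P P_Q'_comm_assoc S_mult_Q mult_assoc)
  qed
  also have "\<dots> = ps (c a) (\<lambda>x y. f (S y) (S (ps (c x) (\<lambda>u v. v \<otimes> Q u))))"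
  proof (rule pair_sum_cong)
    fix x y
    show "ps (c x) (\<lambda>u v. f (S y) (S (v \<otimes> Q u))) = f (S y) (S (ps (c x) (\<lambda>u v. v \<otimes> Q u)))"
      by (rule additive_ps[of "\<lambda>x. f (S y) (S x)", symmetric]) (simp add: additive_def fD)
  qed
  finally show ?thesis by (simp add: counit_Q fD)
qed

end

section \<open>The inverse antipode and the functionals composed with it\<close>

context sweedler_hopf
begin

definition S_inv :: "'a \<Rightarrow> 'a" where
  "S_inv y = (SOME x. x \<oplus> \<zero> = x \<and> S x = y \<oplus> \<zero>)"

lemma S_inv_closed [simp]: "S_inv y \<oplus> \<zero> = S_inv y" and S_S_inv [simp]: "S (S_inv y) = y \<oplus> \<zero>"
proof -
  obtain x where "S x = y \<oplus> \<zero>" using S_surj by blast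
  then have "x \<oplus> \<zero> \<oplus> \<zero> = x \<oplus> \<zero> \<and> S (x \<oplus> \<zero>) = y \<oplus> \<zero>" by simp
  from someI[of "\<lambda>x. x \<oplus> \<zero> = x \<and> S x = y \<oplus> \<zero>", OF this]
  show "S_inv y \<oplus> \<zero> = S_inv y" "S (S_inv y) = y \<oplus> \<zero>" by (simp_all add: S_inv_def)
qed

lemma S_inv_eqI: "S x = y \<oplus> \<zero> \<Longrightarrow> S_inv y = x \<oplus> \<zero>"
  by (metis S_S_inv S_inj S_inv_closed)

lemma S_inv_S [simp]: "S_inv (S x) = x \<oplus> \<zero>"
  by (rule S_inv_eqI) simp

lemma S_inv_add [simp]: "S_inv (x \<oplus> y) = S_inv x \<oplus> S_inv y"
  using S_inv_eqI[of "S_inv x \<oplus> S_inv y" "x \<oplus> y"] by (simp add: add_assoc)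

lemma S_inv_zero [simp]: "S_inv \<zero> = \<zero>"
  using S_inv_eqI[of \<zero> \<zero>] by simp

lemma S_inv_mult: "S_inv (x \<otimes> y) = S_inv y \<otimes> S_inv x"
  using S_inv_eqI[of "S_inv y \<otimes> S_inv x" "x \<otimes> y"] by (simp add: S_mult)

lemma S_inv_P_mult: "S_inv (P r \<otimes> y) = S_inv y \<otimes> Q r"
  using S_inv_eqI[of "S_inv y \<otimes> Q r" "P r \<otimes> y"] by (simp add: S_mult_Q)

lemma S_inv_mult_P: "S_inv (y \<otimes> P r) = Q r \<otimes> S_inv y"
  using S_inv_eqI[of "Q r \<otimes> S_inv y" "y \<otimes> P r"] by (simp add: S_Q_mult)

lemma P_S_inv: "P (S_inv y) = P' y"
  using P'_S[of "S_inv y"] by simp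

text \<open>This is composition with the inverse antipode, from \<open>^*\<A>\<close> to
  \<open>\<A>_*\<close>. The outer \<open>P\<close> only moves the values from the image of
  \<open>Q\<close> to that of \<open>P\<close>; \<open>untwist\<close> uses \<open>Q\<close> to move
  them back.\<close>

definition twist :: "('a \<Rightarrow> 'a) \<Rightarrow> 'a \<Rightarrow> 'a" where
  "twist g y = P (g (S_inv y))"

definition untwist :: "('a \<Rightarrow> 'a) \<Rightarrow> 'a \<Rightarrow> 'a" where
  "untwist f x = Q (f (S x))"

lemma cofunctionalD:
  assumes "cofunctional g"
  shows "g (x \<oplus> y) = g x \<oplus> g y" "g \<zero> = \<zero>" "Q (g x) = g x" "g (x \<otimes> Q r) = g x \<otimes> Q r"
    "g x \<oplus> \<zero> = g x" "additive A g"
  by (rule right_sweedler.functionalD[OF swap assms])+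

lemma lfunctional_twist:
  assumes g: "cofunctional g" shows "lfunctional (twist g)"
proof (rule L.functionalI)
  fix r x
  have "P' r \<otimes> x = P (P' r) \<otimes> x" by (simp add: PP')
  then show "twist g (P' r \<otimes> x) = P' r \<otimes> twist g x"
    unfolding twist_def by (simp only: S_inv_P_mult cofunctionalD[OF g] P_mult_Q) (simp add: PP')
qed (simp_all add: twist_def cofunctionalD[OF g] P'P)

lemma cofunctional_untwist:
  assumes f: "lfunctional f" shows "cofunctional (untwist f)"
proof -
  interpret co: right_sweedler A Q P "\<lambda>a. map prod.swap (c a)" by (rule swap)
  note fD = L.functionalD[OF f]
  show ?thesis
  proof (rule co.functionalI)
    fix x r
    have "f (P r \<otimes> S x) = P r \<otimes> f (S x)" by (metis fD(4) P'P)
    moreover have "Q (P r \<otimes> P y) = Q (P y) \<otimes> Q (P r)" for y by (simp add: Q_mult_P)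
    moreover have "P (f y) = f y" for y by (metis fD(3) PP')
    ultimately show "untwist f (x \<otimes> Q r) = untwist f x \<otimes> Q r"
      unfolding untwist_def S_mult_Q by (metis QP)
  qed (simp_all add: untwist_def fD)
qed

lemma twist_untwist: "lfunctional f \<Longrightarrow> twist (untwist f) = f"
proof
  fix y assume f: "lfunctional f"
  note fD = L.functionalD[OF f]
  have "P (f y) = f y" by (metis fD(3) PP')
  then show "twist (untwist f) y = f y" by (simp add: twist_def untwist_def fD)
qed

lemma untwist_twist: "cofunctional g \<Longrightarrow> untwist (twist g) = g"
  by (rule ext) (simp add: twist_def untwist_def cofunctionalD)

text \<open>Since \<open>S\<close> flips the coproduct, conjugation by it turns the operator of
  \<open>g\<close> into the operator of \<open>twist g\<close>. Multiplicativity of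
  \<open>twist\<close> is a consequence.\<close>

lemma lhit_twist:
  assumes g: "cofunctional g" shows "lhit (twist g) (S a) = S (cohit g a)"
proof -
  have "lhit (twist g) (S a) = ps (c a) (\<lambda>x y. Q' (P (g (y \<oplus> \<zero>))) \<otimes> S x)"
    unfolding L.hit_def
    by (subst S_comult[OF L.bal_hit[OF lfunctional_twist[OF g]]]) (simp add: twist_def)
  also have "\<dots> = ps (c a) (\<lambda>x y. S (x \<otimes> P (g y)))"
    by (simp add: cofunctionalD[OF g] S_mult_P)
  finally show ?thesis by (simp add: cohit_def additive_ps)
qed

lemma twist_comp:
  assumes "cofunctional g" "cofunctional h"
  shows "twist (\<lambda>a. g (cohit h a)) = (\<lambda>y. twist g (lhit (twist h) y))"
proof
  fix y
  have "lhit (twist h) y = S (cohit h (S_inv y))"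
    using lhit_twist[OF assms(2), of "S_inv y"] L.hit_arg_closed[OF lfunctional_twist[OF assms(2)], of y]
    by simp
  then show "twist (\<lambda>a. g (cohit h a)) y = twist g (lhit (twist h) y)"
    using assms by (simp add: twist_def cofunctionalD)
qed

lemma twist_add: "twist (\<lambda>x. f x \<oplus> g x) = (\<lambda>x. twist f x \<oplus> twist g x)"
  by (simp add: twist_def fun_eq_iff)

lemma twist_source: "twist (\<lambda>x. Q (Q r \<otimes> x)) = (\<lambda>y. P' (y \<otimes> Q' (P r)))"
proof
  fix y
  have "P' (y \<otimes> Q' (P r)) = P' (y \<otimes> P r)" by (metis L.P_P_mult L.P_Q_mult P'P)
  also have "\<dots> = P (Q r \<otimes> S_inv y)" by (simp flip: P_S_inv add: S_inv_mult_P)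
  finally show "twist (\<lambda>x. Q (Q r \<otimes> x)) y = P' (y \<otimes> Q' (P r))" by (simp add: twist_def)
qed

lemma twist_target: "twist (\<lambda>x. Q r \<otimes> Q x) = (\<lambda>y. P' y \<otimes> P' (P r))"
  by (rule ext) (simp add: twist_def P_mult_Q P_S_inv P'P)

text \<open>The counterpart of \<open>raise_eval\<close>: the inverse antipode reverses the product
  \<open>x \<otimes> y\<close>, so the hypothesis applies with the two arguments exchanged.\<close>

lemma twist_eval:
  assumes l: "\<And>f g. (f, g) \<in> set l \<Longrightarrow> cofunctional f \<and> cofunctional g" and h: "cofunctional h"
    and e: "\<And>x y. ps l (\<lambda>f g. g (f x \<otimes> y)) = h (x \<otimes> y)"
  shows "ps l (\<lambda>f g. twist g (x \<otimes> twist f y)) = twist h (x \<otimes> y)"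
proof -
  have "ps l (\<lambda>f g. twist g (x \<otimes> twist f y)) = ps l (\<lambda>f g. P (g (f (S_inv y) \<otimes> S_inv x)))"
    by (rule pair_sum_cong) (simp add: twist_def S_inv_mult_P, metis cofunctionalD(3) l)
  also have "\<dots> = P (h (S_inv y \<otimes> S_inv x))"
    by (simp add: additive_ps[of P, symmetric] additive_def e)
  finally show ?thesis by (simp add: twist_def S_inv_mult)
qed

end

section \<open>Integrals\<close>

locale integral_hopf = sweedler_hopf + nondegenerate_sweedler +
  assumes left_integral: "a \<otimes> ell = Q' a \<otimes> ell"
begin

definition lam :: "'a \<Rightarrow> 'a" where "lam = hit_inv \<one>"

lemma functional_lam: "functional lam" and hit_lam_ell: "hit lam ell = \<one>"
  using functional_hit_inv[of \<one>] hit_hit_inv[of \<one>] by (simp_all add: lam_def)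

lemmas lamD = functionalD[OF functional_lam]

text \<open>In words, \<open>lam\<close> is an integral of the dual. For each \<open>f\<close>, the
  functionals \<open>\<lambda>x. f (hit lam x)\<close> and
  \<open>\<lambda>x. P (f \<one>) \<otimes> lam x\<close> have the same value on \<open>ell\<close>,
  so they are equal; separation then removes \<open>f\<close>.\<close>

lemma hit_lam: "hit lam a = lam a"
proof -
  have "hit lam a \<oplus> \<zero> = lam a \<oplus> \<zero>"
  proof (rule functional_separation)
    fix f assume f: "functional f"
    note fD = functionalD[OF f]
    have "hit f \<one> = Q (f \<one>)"
      by (simp add: hit_def cop_one[OF bal_hit[OF f]])
    moreover have "hit (\<lambda>x. P (f \<one>) \<otimes> lam x) ell = Q (f \<one>)"
      by (simp add: hit_scale functional_lam hit_lam_ell)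
    \<comment> \<open>Both operators send \<open>ell\<close> to \<open>Q (f \<one>)\<close>: the
      first because \<open>hit lam ell\<close> is \<open>\<one>\<close>, the second by scaling
      \<open>lam\<close>.\<close>
    ultimately have "(\<lambda>x. f (hit lam x)) = (\<lambda>x. P (f \<one>) \<otimes> lam x)"
      by (intro hit_inj functional_comp f functional_lam functional_scale)
        (simp add: hit_lam_ell functional_lam f flip: hit_hit)
    then have "f (hit lam a) = f \<one> \<otimes> P (lam a)" by (metis fD(3) lamD(3))
    also have "\<dots> = f (\<one> \<otimes> P (lam a))" by (rule fD(4)[symmetric])
    finally show "f (hit lam a) = f (lam a)" by (simp add: lamD)
  qed
  then show ?thesis by (simp add: lamD)
qed

text \<open>The operator of \<open>lam\<close> already takes values in the common image of
  \<open>P\<close> and \<open>P'\<close>, so lowering leaves \<open>lam\<close> unchanged. It is a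
  functional for both bialgebroids with the same operator.\<close>

lemma lfunctional_lam: "lfunctional lam" and lhit_lam: "lhit lam a = lam a"
proof -
  have "lower lam = lam" by (rule ext) (metis hit_lam lower_def lamD(3) P'P)
  then show "lfunctional lam" "lhit lam a = lam a"
    using lfunctional_lower[OF functional_lam] lhit_lower[OF functional_lam] hit_lam by auto
qed

text \<open>The Frobenius identity for integrals. Write \<open>b\<close> by the left counit, so that
  \<open>S b\<close> carries a factor \<open>Q' v\<close>; the integral property turns it into the
  product \<open>v \<otimes> m\<close>, whose coproduct puts the legs of \<open>v\<close> in both
  slots. Mixed coassociativity and the antipode axiom cancel the first slot and leave
  \<open>b\<close> in the second.\<close>

lemma integral_cop:
  assumes m: "\<And>b. b \<otimes> m = Q' b \<otimes> m" and f: "bal f"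
  shows "ps (c m) (\<lambda>x y. f (S b \<otimes> x) y) = ps (c m) (\<lambda>x y. f x (b \<otimes> y))"
proof -
  note fD = balD[OF f]
  have b1: "bal (\<lambda>x y. f (d \<otimes> x) y)" for d
    by (rule balI) (simp_all add: fD flip: mult_assoc)
  have b2: "bal (\<lambda>x y. f (d \<otimes> x) (e \<otimes> y))" for d e
    by (rule balI) (simp_all add: fD flip: mult_assoc)
  have fext: "f (x \<oplus> x') = (\<lambda>y. f x y \<oplus> f x' y)" "f \<zero> = (\<lambda>y. \<zero>)" for x x'
    by (simp_all add: fD fun_eq_iff)
  have "ps (c m) (\<lambda>x y. f (S b \<otimes> x) y) = ps (c m) (\<lambda>x y. f (S (ps (c' b) (\<lambda>u v. P' v \<otimes> u)) \<otimes> x) y)"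
    by (simp add: L.counit_P)
  also have "\<dots> = ps (c' b) (\<lambda>u v. ps (c m) (\<lambda>x y. f (S (P' v \<otimes> u) \<otimes> x) y))"
    by (rule additive_ps[of "\<lambda>z. ps (c m) (\<lambda>x y. f (S z \<otimes> x) y)"])
      (simp add: additive_def fext ps_add)
  \<comment> \<open>The integral property is used backwards: \<open>Q' v\<close>, which multiplies
    the first leg of \<open>m\<close>, is absorbed as the product
    \<open>v \<otimes> m\<close>.\<close>
  also have "\<dots> = ps (c' b) (\<lambda>u v. ps (c (v \<otimes> m)) (\<lambda>x y. f (S u \<otimes> x) y))"
  proof (rule pair_sum_cong)
    fix u v
    have "ps (c (v \<otimes> m)) (\<lambda>x y. f (S u \<otimes> x) y) = ps (c (Q (Q' v) \<otimes> m)) (\<lambda>x y. f (S u \<otimes> x) y)"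
      by (subst m) (simp add: QQ')
    also have "\<dots> = ps (c m) (\<lambda>x y. f (S u \<otimes> (Q' v \<otimes> x)) y)"
      by (subst cop_Q_mult[OF b1]) (simp add: QQ')
    finally show "ps (c m) (\<lambda>x y. f (S (P' v \<otimes> u) \<otimes> x) y) = ps (c (v \<otimes> m)) (\<lambda>x y. f (S u \<otimes> x) y)"
      by (simp add: S_P'_mult mult_assoc)
  qed
  also have "\<dots> = ps (c' b) (\<lambda>d e. ps (c e) (\<lambda>u v. ps (c m) (\<lambda>x y. f (S d \<otimes> (u \<otimes> x)) (v \<otimes> y))))"
    by (simp only: cop_mult[OF b1])
  also have "\<dots> = ps (c b) (\<lambda>d e. ps (c' d) (\<lambda>u v. ps (c m) (\<lambda>x y. f (S u \<otimes> (v \<otimes> x)) (e \<otimes> y))))"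
  proof (rule mixed_lr[symmetric])
    have "ps (c m) (\<lambda>x y. f (S u \<otimes> (v \<otimes> (P r \<otimes> x))) (e \<otimes> y)) =
       ps (c m) (\<lambda>x y. f (S u \<otimes> (v \<otimes> x)) (e \<otimes> (Q r \<otimes> y)))" for u v e r
      using cop_takeuchi[OF b2[of "S u \<otimes> v" e], of m r] by (simp add: mult_assoc)
    then show "balanced3 A (\<lambda>r x. P' r \<otimes> x) (\<lambda>r y. Q' r \<otimes> y) (\<lambda>r y. y \<otimes> P r) (\<lambda>r z. z \<otimes> Q r)
      (\<lambda>d u v. ps (c m) (\<lambda>x y. f (S d \<otimes> (u \<otimes> x)) (v \<otimes> y)))"
      by (simp add: balanced3_def additive_def fD fext ps_add S_P'_mult mult_assoc)
  qed
  \<comment> \<open>The antipode axiom produces \<open>P d\<close> in the first slot, and the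
    Takeuchi condition for \<open>m\<close> carries it as \<open>Q d\<close> to the second, where
    the counit of \<open>b\<close> is waiting.\<close>
  also have "\<dots> = ps (c b) (\<lambda>d e. ps (c m) (\<lambda>x y. f x (e \<otimes> Q d \<otimes> y)))"
  proof (rule pair_sum_cong)
    fix d e
    have "ps (c' d) (\<lambda>u v. ps (c m) (\<lambda>x y. f (S u \<otimes> (v \<otimes> x)) (e \<otimes> y))) =
       ps (c m) (\<lambda>x y. ps (c' d) (\<lambda>u v. f (S u \<otimes> v \<otimes> x) (e \<otimes> y)))"
      by (subst ps_commute) (simp add: mult_assoc)
    also have "\<dots> = ps (c m) (\<lambda>x y. f (P d \<otimes> x) (e \<otimes> y))"
      using additive_ps[of "\<lambda>z. f (z \<otimes> _) (e \<otimes> _)" "c' d" "\<lambda>u v. S u \<otimes> v", symmetric]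
      by (simp add: additive_def fD antipode_left)
    also have "\<dots> = ps (c m) (\<lambda>x y. f x (e \<otimes> (Q d \<otimes> y)))"
      by (rule cop_takeuchi, rule balI) (simp_all add: fD flip: mult_assoc)
    finally show "ps (c' d) (\<lambda>u v. ps (c m) (\<lambda>x y. f (S u \<otimes> (v \<otimes> x)) (e \<otimes> y))) =
      ps (c m) (\<lambda>x y. f x (e \<otimes> Q d \<otimes> y))" by (simp add: mult_assoc)
  qed
  also have "\<dots> = ps (c m) (\<lambda>x y. f x (ps (c b) (\<lambda>d e. e \<otimes> Q d) \<otimes> y))"
    by (rule additive_ps[of "\<lambda>z. ps (c m) (\<lambda>x y. f x (z \<otimes> y))", symmetric])
      (simp add: additive_def fD ps_add)
  finally show ?thesis by (simp add: counit_Q)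
qed

text \<open>Take the action of \<open>lam\<close> in the Frobenius identity. For
  \<open>m = ell\<close>, where \<open>lam ell = \<one>\<close>, it shows that
  \<open>\<lambda>x. lam (S b \<otimes> x)\<close> is the functional sent to \<open>b\<close>, an
  explicit formula for \<open>hit_inv b\<close>.\<close>

lemma hit_lam_S:
  assumes m: "\<And>b. b \<otimes> m = Q' b \<otimes> m" shows "hit (\<lambda>x. lam (S b \<otimes> x)) m = b \<otimes> lam m"
proof -
  have "hit (\<lambda>x. lam (S b \<otimes> x)) m = b \<otimes> hit lam m"
    using integral_cop[OF m bal_hit[OF functional_lam], of b]
    by (simp add: hit_def ps_mult_left mult_assoc)
  then show ?thesis by (simp add: hit_lam)
qed

lemma lam_ell: "lam ell = \<one>"
  using hit_lam[of ell] hit_lam_ell by simp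

text \<open>The functionals \<open>\<lambda>x. lam (S ell \<otimes> x)\<close> and \<open>P\<close>
  have the same value \<open>ell\<close> under the bijection given by \<open>ell\<close>, so they
  agree. Comparing their operators at \<open>m\<close> instead of \<open>ell\<close> yields the
  formula.\<close>

lemma left_integral_eq:
  assumes m: "\<And>b. b \<otimes> m = Q' b \<otimes> m" shows "m \<oplus> \<zero> = ell \<otimes> lam m"
proof -
  have "(\<lambda>x. lam (S ell \<otimes> x)) = P"
    by (rule hit_inj) (simp_all add: functional_shift functional_lam functional_P hit_P lam_ell
        hit_lam_S[OF left_integral])
  then show ?thesis using hit_lam_S[OF m, of ell] by (simp add: hit_P)
qed

text \<open>The adjunction of the two actions, applied to the explicit functional from
  \<open>hit_lam_S\<close>, recovers \<open>g\<close> from the element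
  \<open>cohit g ell\<close>.\<close>

lemma cofunctional_lam:
  assumes g: "cofunctional g" shows "P (g b) = lam (S b \<otimes> cohit g ell)"
  using P_cofunctional_hit[OF functional_shift[OF functional_lam] g, of "S b" ell]
  by (simp add: hit_lam_S[OF left_integral] lam_ell cofunctionalD[OF g])

definition alpha :: "'a \<Rightarrow> 'a" where "alpha x = lam (ell \<otimes> x)"

lemma functional_alpha: "functional alpha"
  using functional_shift[OF functional_lam, of ell] by (simp add: alpha_def[abs_def])

text \<open>A right multiple \<open>ell \<otimes> x\<close> is again a left integral, hence equals
  \<open>ell \<otimes> alpha x\<close> by \<open>left_integral_eq\<close>. So \<open>alpha\<close>
  plays the role of the modular character.\<close>

lemma alpha_mult: "alpha (x \<otimes> y) = alpha (alpha x \<otimes> y)"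
proof -
  have "(ell \<otimes> x) \<oplus> \<zero> = ell \<otimes> lam (ell \<otimes> x)"
    by (rule left_integral_eq) (metis left_integral mult_assoc)
  then show ?thesis by (simp add: alpha_def flip: mult_assoc)
qed

text \<open>The character property of \<open>alpha\<close> leaves \<open>alpha x\<close> in front of
  the first leg of \<open>b\<close>, and the Takeuchi condition moves it to the second leg, where
  the double sum factors. Hence \<open>xi_map\<close> is anti-multiplicative.\<close>

lemma hit_alpha_mult: "hit alpha (a \<otimes> b) = hit alpha a \<otimes> hit alpha b"
proof -
  have "hit alpha (a \<otimes> b) = ps (c a) (\<lambda>x y. ps (c b) (\<lambda>x' y'. y \<otimes> y' \<otimes> Q (alpha (alpha x \<otimes> x'))))"
    by (simp add: hit_def cop_mult[OF bal_hit[OF functional_alpha]] flip: alpha_mult)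
  also have "\<dots> = ps (c a) (\<lambda>x y. ps (c b) (\<lambda>x' y'. y \<otimes> Q (alpha x) \<otimes> (y' \<otimes> Q (alpha x'))))"
  proof (rule pair_sum_cong)
    fix x y
    show "ps (c b) (\<lambda>x' y'. y \<otimes> y' \<otimes> Q (alpha (alpha x \<otimes> x'))) =
       ps (c b) (\<lambda>x' y'. y \<otimes> Q (alpha x) \<otimes> (y' \<otimes> Q (alpha x')))"
      using cop_takeuchi[OF bal_hit_left[OF functional_alpha, of y], of b "alpha x"]
      by (simp add: functionalD[OF functional_alpha] mult_assoc)
  qed
  finally show ?thesis by (simp add: hit_def ps_mult_left ps_mult_right) (rule ps_commute)
qed

definition xi_map :: "'a \<Rightarrow> 'a" where "xi_map a = S (hit alpha a)"

lemma xi_map_mult: "xi_map (a \<otimes> b) = xi_map b \<otimes> xi_map a"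
  by (simp add: xi_map_def hit_alpha_mult S_mult)

lemma xi_map_one: "xi_map \<one> = \<one>"
proof -
  have "hit alpha \<one> = Q (alpha \<one>)" by (simp add: hit_def cop_one[OF bal_hit[OF functional_alpha]])
  then show ?thesis by (simp add: xi_map_def alpha_def lam_ell lamD)
qed

lemma xi_map_add: "xi_map (a \<oplus> b) = xi_map a \<oplus> xi_map b"
  by (simp add: xi_map_def hit_add functional_alpha)

text \<open>This identity ties \<open>\<xi>\<close> to the inverse antipode on functionals: under
  the bijections given by \<open>ell\<close>, applying \<open>\<xi>\<close> is \<open>twist\<close>.
  It follows by expanding \<open>lam\<close> at \<open>ell \<otimes> x\<close> with the left
  coproduct, cancelling the legs of the argument by the antipode, and recognising
  \<open>twist g\<close> through \<open>cofunctional_lam\<close>.\<close>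

lemma xi_map_cohit:
  assumes g: "cofunctional g" shows "xi_map (cohit g ell) = lhit (twist g) ell"
proof -
  let ?a = "cohit g ell"
  have Q'm: "Q' (P' r \<otimes> x) = Q' x \<otimes> Q' r" for r x by (rule L.Q_mult_P)
  have lb: "lbal (\<lambda>p q. Q' (lam (p \<otimes> d)) \<otimes> (q \<otimes> e))" for d e
  proof (rule L.balI)
    fix r p q
    have "lam (P' r \<otimes> p \<otimes> d) = P' r \<otimes> lam (p \<otimes> d)"
      using L.functionalD(4)[OF lfunctional_lam] by (simp add: mult_assoc)
    then show "Q' (lam (P' r \<otimes> p \<otimes> d)) \<otimes> (q \<otimes> e) = Q' (lam (p \<otimes> d)) \<otimes> (Q' r \<otimes> q \<otimes> e)"
      by (simp add: Q'm mult_assoc)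
  qed (simp_all add: lamD)
  have lb0: "lbal (\<lambda>p q. Q' (lam p) \<otimes> (q \<otimes> e))" for e
    by (rule L.balI) (simp_all add: lamD L.functionalD(4)[OF lfunctional_lam] Q'm mult_assoc)
  have mult_fun: "(\<otimes>) (x \<oplus> y) = (\<lambda>z. x \<otimes> z \<oplus> y \<otimes> z)" "(\<otimes>) \<zero> = (\<lambda>z. \<zero>)" for x y
    by (simp_all add: fun_eq_iff)
  have "xi_map ?a = ps (c ?a) (\<lambda>x y. S (y \<otimes> Q (alpha x)))"
    unfolding xi_map_def hit_def by (simp add: additive_ps)
  \<comment> \<open>The value \<open>lam (ell \<otimes> x)\<close> is written as
    \<open>lhit lam (ell \<otimes> x)\<close>, which holds because \<open>lam\<close> is an integral
    for the left structure too. This brings in the left coproducts of \<open>ell\<close> and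
    \<open>x\<close>.\<close>
  also have "\<dots> = ps (c ?a) (\<lambda>x y. lhit lam (ell \<otimes> x) \<otimes> S y)"
    by (simp add: S_mult_Q alpha_def lhit_lam lamD)
  also have "\<dots> = ps (c ?a) (\<lambda>x y. ps (c' x) (\<lambda>u v. ps (c' ell) (\<lambda>p q.
      Q' (lam (p \<otimes> u)) \<otimes> (q \<otimes> (v \<otimes> S y)))))"
    by (simp add: L.hit_def ps_mult_right mult_assoc L.cop_mult[OF lb0])
  also have "\<dots> = ps (c' ?a) (\<lambda>x y. ps (c y) (\<lambda>u v. ps (c' ell) (\<lambda>p q.
      Q' (lam (p \<otimes> x)) \<otimes> (q \<otimes> (u \<otimes> S v)))))"
  proof (rule mixed_lr)
    have "ps (c' ell) (\<lambda>p q. Q' (lam (p \<otimes> (P' r \<otimes> u))) \<otimes> (q \<otimes> e)) =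
      ps (c' ell) (\<lambda>p q. Q' (lam (p \<otimes> u)) \<otimes> (q \<otimes> (Q' r \<otimes> e)))" for r u e
      using L.cop_takeuchi[OF lb, of ell r] by (simp add: mult_assoc)
    then show "balanced3 A (\<lambda>r x. P' r \<otimes> x) (\<lambda>r y. Q' r \<otimes> y) (\<lambda>r y. y \<otimes> P r) (\<lambda>r z. z \<otimes> Q r)
     (\<lambda>u v y. ps (c' ell) (\<lambda>p q. Q' (lam (p \<otimes> u)) \<otimes> (q \<otimes> (v \<otimes> S y))))"
      by (simp add: balanced3_def additive_def lamD ps_add S_mult_Q mult_assoc)
  qed
  also have "\<dots> = ps (c' ?a) (\<lambda>x y. ps (c' ell) (\<lambda>p q. ps (c y) (\<lambda>u v.
      Q' (lam (p \<otimes> x)) \<otimes> (q \<otimes> (u \<otimes> S v)))))"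
    by (subst ps_commute) (rule refl)
  also have "\<dots> = ps (c' ?a) (\<lambda>x y. ps (c' ell) (\<lambda>p q. Q' (lam (p \<otimes> x)) \<otimes> (q \<otimes> Q' y)))"
    by (simp add: antipode_right flip: ps_mult_left)
  \<comment> \<open>After the antipode has left \<open>Q' y\<close>, the Takeuchi condition for
    \<open>ell\<close> carries it into the argument of \<open>lam\<close>, where the counit restores
    \<open>?a\<close>.\<close>
  also have "\<dots> = ps (c' ?a) (\<lambda>x y. ps (c' ell) (\<lambda>p q. Q' (lam (p \<otimes> (P' y \<otimes> x))) \<otimes> q))"
  proof (rule pair_sum_cong)
    fix x y
    show "ps (c' ell) (\<lambda>p q. Q' (lam (p \<otimes> x)) \<otimes> (q \<otimes> Q' y)) =
      ps (c' ell) (\<lambda>p q. Q' (lam (p \<otimes> (P' y \<otimes> x))) \<otimes> q)"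
      using L.cop_takeuchi[OF lb[of x \<one>], of ell y] by (simp add: mult_assoc)
  qed
  also have "\<dots> = ps (c' ell) (\<lambda>p q. Q' (lam (p \<otimes> ps (c' ?a) (\<lambda>x y. P' y \<otimes> x))) \<otimes> q)"
    by (rule additive_ps[of "\<lambda>z. ps (c' ell) (\<lambda>p q. Q' (lam (p \<otimes> z)) \<otimes> q)", symmetric])
      (simp add: additive_def lamD mult_fun ps_add)
  \<comment> \<open>\<open>cofunctional_lam\<close> is used at the preimage of \<open>p\<close>
    under the antipode, so that its factor \<open>S b\<close> becomes \<open>p\<close>.\<close>
  also have "\<dots> = ps (c' ell) (\<lambda>p q. Q' (twist g p) \<otimes> q)"
    by (simp add: L.counit_P twist_def cofunctional_lam[OF g] lamD)
  finally show ?thesis by (simp add: L.hit_def)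
qed

end

section \<open>Nondegeneracy of the maps from the lower duals\<close>

context sweedler_pair
begin

text \<open>\<open>raise\<close> and \<open>lower\<close> are inverse to each other and do not
  change the operator on \<open>ell\<close>. Bijectivity therefore passes from the two upper duals
  to the two lower ones, with the same element \<open>ell\<close>.\<close>

lemma nondegenerate_left:
  assumes "nondegenerate_sweedler A P Q c ell" shows "nondegenerate_sweedler (opp_ring A) P' Q' c' ell"
proof -
  interpret N: nondegenerate_sweedler A P Q c ell by fact
  interpret co: sweedler_pair A Q P "\<lambda>a. map prod.swap (c a)" Q' P' "\<lambda>a. map prod.swap (c' a)"
    by (rule pair_swap)
  interpret coN: nondegenerate_sweedler A Q P "\<lambda>a. map prod.swap (c a)" ell
    by (rule N.nondegenerate_swap)
  show ?thesis
  proof (intro nondegenerate_sweedler.intro left nondegenerate_sweedler_axioms.intro)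
    fix a f f' :: "'a \<Rightarrow> 'a" and b
    show "\<exists>f. lfunctional f \<and> lhit f ell = b \<oplus>\<^bsub>opp_ring A\<^esub> \<zero>\<^bsub>opp_ring A\<^esub>"
      using N.hit_surj[of b] by (auto intro: lfunctional_lower simp: lhit_lower)
    show "\<exists>f. co.lfunctional f \<and> co.lhit f ell = b \<oplus>\<^bsub>opp_ring A\<^esub> \<zero>\<^bsub>opp_ring A\<^esub>"
      using coN.hit_surj[of b] by (auto intro: co.lfunctional_lower simp: co.lhit_lower)
    show "f = f'" if "lfunctional f" "lfunctional f'" "lhit f ell = lhit f' ell"
      using that N.hit_inj[of "raise f" "raise f'"] by (metis functional_raise hit_raise lower_raise)
    show "f = f'" if "co.lfunctional f" "co.lfunctional f'" "co.lhit f ell = co.lhit f' ell"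
      using that coN.hit_inj[of "co.raise f" "co.raise f'"]
      by (metis co.functional_raise co.hit_raise co.lower_raise)
  qed
qed

end

section \<open>Balanced tensor products and their universal property\<close>

text \<open>Tensor groups are written multiplicatively, so sums of elementary tensors over a list
  are products there.\<close>

fun group_sum :: "'g monoid \<Rightarrow> ('b \<times> 'c) list \<Rightarrow> ('b \<Rightarrow> 'c \<Rightarrow> 'g) \<Rightarrow> 'g" where
  "group_sum G [] f = \<one>\<^bsub>G\<^esub>"
| "group_sum G ((x, y) # l) f = f x y \<otimes>\<^bsub>G\<^esub> group_sum G l f"

lemma group_sum_closed:
  assumes "monoid G" "\<And>x y. (x, y) \<in> set l \<Longrightarrow> f x y \<in> carrier G"
  shows "group_sum G l f \<in> carrier G"
proof -
  interpret monoid G by fact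
  show ?thesis using assms(2) by (induction l) auto
qed

lemma group_sum_cong:
  "(\<And>x y. (x, y) \<in> set l \<Longrightarrow> f x y = g x y) \<Longrightarrow> group_sum G l f = group_sum G l g"
  by (induction l) auto

lemma group_sum_map [simp]:
  "group_sum G (map (\<lambda>(x, y). (h x y, k x y)) l) f = group_sum G l (\<lambda>x y. f (h x y) (k x y))"
  by (induction l) auto

lemma group_sum_map_swap [simp]: "group_sum G (map prod.swap l) f = group_sum G l (\<lambda>x y. f y x)"
  by (induction l) auto

lemma group_sum_hom:
  assumes h: "group_hom G H h" and f: "\<And>x y. (x, y) \<in> set l \<Longrightarrow> f x y \<in> carrier G"
  shows "h (group_sum G l f) = group_sum H l (\<lambda>x y. h (f x y))"
proof -
  interpret group_hom G H h by fact
  show ?thesis using f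
    by (induction l) (auto simp: group_sum_closed[OF G.monoid_axioms])
qed

lemma group_sum_mult:
  assumes "comm_group G" "\<And>x y. (x, y) \<in> set l \<Longrightarrow> f x y \<in> carrier G" "\<And>x y. (x, y) \<in> set l \<Longrightarrow> g x y \<in> carrier G"
  shows "group_sum G l (\<lambda>x y. f x y \<otimes>\<^bsub>G\<^esub> g x y) = group_sum G l f \<otimes>\<^bsub>G\<^esub> group_sum G l g"
proof -
  interpret comm_group G by fact
  show ?thesis using assms(2,3)
    by (induction l) (auto simp: group_sum_closed[OF monoid_axioms] m_ac)
qed

lemma group_sum_one [simp]: "group G \<Longrightarrow> group_sum G l (\<lambda>_ _. \<one>\<^bsub>G\<^esub>) = \<one>\<^bsub>G\<^esub>"
  by (induction l) (auto simp: group.is_monoid monoid.l_one)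

lemma group_sum_commute:
  assumes "comm_group G" "\<And>x y u v. (x, y) \<in> set l \<Longrightarrow> (u, v) \<in> set l' \<Longrightarrow> f x y u v \<in> carrier G"
  shows "group_sum G l (\<lambda>x y. group_sum G l' (f x y)) = group_sum G l' (\<lambda>u v. group_sum G l (\<lambda>x y. f x y u v))"
proof -
  interpret comm_group G by fact
  show ?thesis using assms(2)
  proof (induction l)
    case (Cons p l)
    obtain x y where p: "p = (x, y)" by force
    have "group_sum G l' (\<lambda>u v. f x y u v \<otimes>\<^bsub>G\<^esub> group_sum G l (\<lambda>x y. f x y u v)) =
      group_sum G l' (f x y) \<otimes>\<^bsub>G\<^esub> group_sum G l' (\<lambda>u v. group_sum G l (\<lambda>x y. f x y u v))"
      by (rule group_sum_mult) (auto intro!: comm_group_axioms group_sum_closed is_monoid Cons.prems simp: p)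
    then show ?case using Cons by (simp add: p)
  qed (simp add: is_group)
qed

lemma group_sum_append:
  assumes "monoid G" "\<And>x y. (x, y) \<in> set l \<union> set l' \<Longrightarrow> f x y \<in> carrier G"
  shows "group_sum G (l @ l') f = group_sum G l f \<otimes>\<^bsub>G\<^esub> group_sum G l' f"
proof -
  interpret monoid G by fact
  show ?thesis using assms(2)
    by (induction l) (auto simp: group_sum_closed[OF monoid_axioms] m_assoc)
qed

lemma group_sum_concat:
  assumes "monoid G" "\<And>x y u v. (x, y) \<in> set l \<Longrightarrow> (u, v) \<in> set (g x y) \<Longrightarrow> f u v \<in> carrier G"
  shows "group_sum G (concat (map (\<lambda>(x, y). g x y) l)) f = group_sum G l (\<lambda>x y. group_sum G (g x y) f)"
  using assms(2)
proof (induction l)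
  case (Cons p l)
  obtain x y where p: "p = (x, y)" by force
  have IH: "group_sum G (concat (map (\<lambda>(x, y). g x y) l)) f = group_sum G l (\<lambda>x y. group_sum G (g x y) f)"
    by (rule Cons.IH) (meson Cons.prems list.set_intros(2))
  have fc: "f u v \<in> carrier G" if "(u, v) \<in> set (g x y) \<union> set (concat (map (\<lambda>(x, y). g x y) l))" for u v
    using that Cons.prems by (auto simp: p)
  have "group_sum G (g x y @ concat (map (\<lambda>(x, y). g x y) l)) f =
     group_sum G (g x y) f \<otimes>\<^bsub>G\<^esub> group_sum G (concat (map (\<lambda>(x, y). g x y) l)) f"
    by (rule group_sum_append[OF assms(1)]) (erule fc)
  then show ?case by (simp add: p IH)
qed simp

lemma group_sum_add_monoid:
  fixes A :: "'a ring" and l :: "('b \<times> 'c) list" and f :: "'b \<Rightarrow> 'c \<Rightarrow> 'a"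
  shows "group_sum (add_monoid A) l f = pair_sum A l f"
  by (induction l) auto

lemma group_sum_add_monoid' [simp]:
  fixes A :: "'a ring" and l :: "('b \<times> 'c) list" and f :: "'b \<Rightarrow> 'c \<Rightarrow> 'a"
  shows "group_sum \<lparr>carrier = carrier A, monoid.mult = (\<oplus>\<^bsub>A\<^esub>), monoid.one = \<zero>\<^bsub>A\<^esub>\<rparr> l f = pair_sum A l f"
  by (induction l) auto

lemma frag_hom_frag_of:
  assumes "comm_group G" "f z \<in> carrier G" shows "frag_hom G f (frag_of z) = f z"
proof -
  interpret comm_group G by fact
  have "finprod G (\<lambda>y. f y [^]\<^bsub>G\<^esub> Poly_Mapping.lookup (frag_of z) y) {z} = f z"
    using assms(2) by (subst finprod_insert) (auto simp: int_pow_1)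
  then show ?thesis by (simp add: frag_hom_def keys_frag_of)
qed

lemma frag_hom_hom:
  assumes "comm_group G" and f: "f \<in> Z \<rightarrow> carrier G"
  shows "frag_hom G f \<in> hom (free_Abelian_group Z) G"
proof -
  interpret comm_group G by fact
  \<comment> \<open>Keys may cancel in a sum, so all products are compared over the union of the two
    supports, where the additional factors have exponent zero.\<close>
  have eq: "frag_hom G f x = finprod G (\<lambda>z. f z [^]\<^bsub>G\<^esub> Poly_Mapping.lookup x z) U"
    if "Poly_Mapping.keys x \<subseteq> U" "finite U" "U \<subseteq> Z" for x U
    unfolding frag_hom_def
    by (rule finprod_mono_neutral_cong_left) (use that f in \<open>auto simp: in_keys_iff\<close>)
  show ?thesis
  proof (rule homI)
    fix x assume "x \<in> carrier (free_Abelian_group Z)"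
    then show "frag_hom G f x \<in> carrier G"
      using f by (auto simp: frag_hom_def intro!: finprod_closed)
  next
    fix x y assume xy: "x \<in> carrier (free_Abelian_group Z)" "y \<in> carrier (free_Abelian_group Z)"
    let ?U = "Poly_Mapping.keys x \<union> Poly_Mapping.keys y"
    have U: "Poly_Mapping.keys x \<subseteq> ?U" "Poly_Mapping.keys y \<subseteq> ?U" "Poly_Mapping.keys (x + y) \<subseteq> ?U"
      "finite ?U" "?U \<subseteq> Z"
      using xy by (auto dest: Poly_Mapping.keys_add[THEN subsetD])
    have "frag_hom G f (x + y) =
       finprod G (\<lambda>z. f z [^]\<^bsub>G\<^esub> Poly_Mapping.lookup x z \<otimes>\<^bsub>G\<^esub> f z [^]\<^bsub>G\<^esub> Poly_Mapping.lookup y z) ?U"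
      unfolding eq[OF U(3-5)]
      by (rule finprod_cong') (use U(5) f in \<open>auto simp: lookup_add int_pow_mult Pi_iff\<close>)
    also have "\<dots> = frag_hom G f x \<otimes>\<^bsub>G\<^esub> frag_hom G f y"
      unfolding eq[OF U(1,4,5)] eq[OF U(2,4,5)]
      by (rule finprod_multf) (use U(5) f in auto)
    finally show "frag_hom G f (x \<otimes>\<^bsub>free_Abelian_group Z\<^esub> y) = frag_hom G f x \<otimes>\<^bsub>G\<^esub> frag_hom G f y"
      by simp
  qed
qed

section \<open>Abelian groups given by generators and relations\<close>

locale presented_group =
  fixes Z :: "'z set" and rels :: "'z frag set"
  assumes rels: "rels \<subseteq> carrier (free_Abelian_group Z)"
begin

abbreviation "N \<equiv> generate (free_Abelian_group Z) rels"
abbreviation "T \<equiv> free_Abelian_group Z Mod N"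
abbreviation "coset p \<equiv> N #>\<^bsub>free_Abelian_group Z\<^esub> p"

sublocale F: comm_group "free_Abelian_group Z"
  by (rule abelian_free_Abelian_group)

lemma subgroup_N: "subgroup N (free_Abelian_group Z)"
  by (rule F.generate_is_subgroup[OF rels])

sublocale N: normal N "free_Abelian_group Z"
  by (rule F.subgroup_imp_normal[OF subgroup_N])

lemma comm_group_T: "comm_group T"
  by (rule F.abelian_FactGroup[OF subgroup_N])

sublocale T: comm_group T by (rule comm_group_T)

lemma coset_add:
  "p \<in> carrier (free_Abelian_group Z) \<Longrightarrow> q \<in> carrier (free_Abelian_group Z) \<Longrightarrow>
    coset (p + q) = coset p \<otimes>\<^bsub>T\<^esub> coset q"
  using N.rcos_sum[of p q] by simp

lemma coset_carrier: "p \<in> carrier (free_Abelian_group Z) \<Longrightarrow> coset p \<in> carrier T"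
  by (simp add: carrier_FactGroup)

lemma coset_eqI:
  assumes "p - q \<in> rels" "q \<in> carrier (free_Abelian_group Z)"
  shows "coset p = coset q"
proof -
  have c: "p - q \<in> carrier (free_Abelian_group Z)" using assms(1) rels by blast
  have "coset (p - q) = N"
    by (rule F.coset_join2[OF c subgroup_N generate.incl[OF assms(1)]])
  moreover have "coset ((p - q) + q) = coset (p - q) \<otimes>\<^bsub>T\<^esub> coset q"
    by (rule coset_add[OF c assms(2)])
  ultimately show ?thesis
    using T.l_one[OF coset_carrier[OF assms(2)]] by simp
qed

text \<open>The lift is defined as the only element of the image of a coset. That image is a
  singleton because the induced homomorphism is trivial on the subgroup generated by the
  relations.\<close>

lemma tensor_lift_coset:
  assumes G: "comm_group G" and f: "f \<in> Z \<rightarrow> carrier G" and r: "\<And>r. r \<in> rels \<Longrightarrow> frag_hom G f r = \<one>\<^bsub>G\<^esub>"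
    and p: "p \<in> carrier (free_Abelian_group Z)"
  shows "tensor_lift G f (coset p) = frag_hom G f p"
proof -
  interpret G: comm_group G by fact
  interpret h: group_hom "free_Abelian_group Z" G "frag_hom G f"
    by unfold_locales (rule frag_hom_hom[OF G f])
  have N1: "frag_hom G f n = \<one>\<^bsub>G\<^esub>" if "n \<in> N" for n
    using that
  proof (induction rule: generate.induct)
    case (inv n)
    then have "n \<in> carrier (free_Abelian_group Z)" using rels by blast
    then have "frag_hom G f (inv\<^bsub>free_Abelian_group Z\<^esub> n) = inv\<^bsub>G\<^esub> frag_hom G f n"
      by (rule h.hom_inv)
    then show ?case using inv r by simp
  next
    case (eng h1 h2)
    then have "h1 \<in> carrier (free_Abelian_group Z)" "h2 \<in> carrier (free_Abelian_group Z)"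
      using subgroup.subset[OF subgroup_N] by blast+
    then have "frag_hom G f (h1 \<otimes>\<^bsub>free_Abelian_group Z\<^esub> h2) = frag_hom G f h1 \<otimes>\<^bsub>G\<^esub> frag_hom G f h2"
      by (rule h.hom_mult)
    then show ?case using eng by simp
  qed (use r h.hom_one in auto)
  have "frag_hom G f ` coset p = {frag_hom G f p}"
  proof -
    have "frag_hom G f (n + p) = frag_hom G f p" if "n \<in> N" for n
      using h.hom_mult[of n p] that p N1[OF that] subgroup.subset[OF subgroup_N] h.hom_closed[OF p]
      by (auto simp del: carrier_free_Abelian_group_iff)
    moreover have "0 \<in> N" using subgroup.one_closed[OF subgroup_N] by simp
    ultimately show ?thesis by (force simp: r_coset_def)
  qed
  then show ?thesis by (simp add: tensor_lift_def)
qed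

lemma tensor_lift_hom:
  assumes G: "comm_group G" and f: "f \<in> Z \<rightarrow> carrier G" and r: "\<And>r. r \<in> rels \<Longrightarrow> frag_hom G f r = \<one>\<^bsub>G\<^esub>"
  shows "group_hom T G (tensor_lift G f)"
proof -
  interpret G: comm_group G by fact
  note h = frag_hom_hom[OF G f]
  show ?thesis
  proof (unfold_locales, rule homI)
    fix x assume "x \<in> carrier T"
    then obtain p where "p \<in> carrier (free_Abelian_group Z)" "x = coset p"
      by (auto simp: carrier_FactGroup)
    then show "tensor_lift G f x \<in> carrier G"
      using tensor_lift_coset[OF G f r] h by (auto simp: hom_def)
  next
    fix x y assume "x \<in> carrier T" "y \<in> carrier T"
    then obtain p q where pq: "p \<in> carrier (free_Abelian_group Z)" "x = coset p"
       "q \<in> carrier (free_Abelian_group Z)" "y = coset q"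
      by (auto simp: carrier_FactGroup)
    then have "x \<otimes>\<^bsub>T\<^esub> y = coset (p + q)" by (simp only: coset_add)
    moreover have "p + q \<in> carrier (free_Abelian_group Z)"
      using pq F.m_closed[of p q] by simp
    moreover have "frag_hom G f (p + q) = frag_hom G f p \<otimes>\<^bsub>G\<^esub> frag_hom G f q"
      using hom_mult[OF h pq(1,3)] by simp
    ultimately show "tensor_lift G f (x \<otimes>\<^bsub>T\<^esub> y) = tensor_lift G f x \<otimes>\<^bsub>G\<^esub> tensor_lift G f y"
      using tensor_lift_coset[OF G f r] pq by simp
  qed
qed

lemma tensor_lift_frag_of:
  assumes G: "comm_group G" and f: "f \<in> Z \<rightarrow> carrier G" and r: "\<And>r. r \<in> rels \<Longrightarrow> frag_hom G f r = \<one>\<^bsub>G\<^esub>"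
    and z: "z \<in> Z"
  shows "tensor_lift G f (coset (frag_of z)) = f z"
  using tensor_lift_coset[OF G f r, of "frag_of z"] z f G
  by (auto simp: frag_hom_frag_of[OF G] Pi_iff)

text \<open>The two shapes of defining relations: a difference of three generators for biadditivity,
  and of two generators for balancing.\<close>

lemma frag_hom_eqI:
  assumes G: "comm_group G" and f: "f \<in> Z \<rightarrow> carrier G" and z: "a \<in> Z" "b \<in> Z" "d \<in> Z"
  shows "f a = f b \<otimes>\<^bsub>G\<^esub> f d \<Longrightarrow> frag_hom G f (frag_of a - frag_of b - frag_of d) = \<one>\<^bsub>G\<^esub>"
    and "f a = f b \<Longrightarrow> frag_hom G f (frag_of a - frag_of b) = \<one>\<^bsub>G\<^esub>"
proof -
  interpret G: comm_group G by fact
  interpret h: group_hom "free_Abelian_group Z" G "frag_hom G f"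
    by unfold_locales (rule frag_hom_hom[OF G f])
  have fc: "f a \<in> carrier G" "f b \<in> carrier G" "f d \<in> carrier G" using f z by auto
  have c: "frag_of a \<in> carrier (free_Abelian_group Z)" "frag_of b \<in> carrier (free_Abelian_group Z)"
    "frag_of d \<in> carrier (free_Abelian_group Z)" using z by auto
  have m: "x - y \<in> carrier (free_Abelian_group Z)"
    if "x \<in> carrier (free_Abelian_group Z)" "y \<in> carrier (free_Abelian_group Z)" for x y
    using that keys_diff[of x y] by auto
  have d: "frag_hom G f (x - y) \<otimes>\<^bsub>G\<^esub> frag_hom G f y = frag_hom G f x"
    if "x \<in> carrier (free_Abelian_group Z)" "y \<in> carrier (free_Abelian_group Z)" for x y
    using h.hom_mult[OF m[OF that] that(2)] by simp
  have v: "frag_hom G f (frag_of a) = f a" "frag_hom G f (frag_of b) = f b" "frag_hom G f (frag_of d) = f d"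
    using fc by (simp_all add: frag_hom_frag_of[OF G])
  show "frag_hom G f (frag_of a - frag_of b) = \<one>\<^bsub>G\<^esub>" if "f a = f b"
    using d[OF c(1,2)] that fc h.hom_closed[OF m[OF c(1,2)]] by (simp add: v)
  show "frag_hom G f (frag_of a - frag_of b - frag_of d) = \<one>\<^bsub>G\<^esub>" if "f a = f b \<otimes>\<^bsub>G\<^esub> f d"
  proof -
    have "frag_hom G f (frag_of a - frag_of b - frag_of d) \<otimes>\<^bsub>G\<^esub> (f d \<otimes>\<^bsub>G\<^esub> f b) = f a"
      using d[OF c(1,2)] d[OF m[OF c(1,2)] c(3)] fc h.hom_closed[OF m[OF m[OF c(1,2)] c(3)]]
      by (simp add: v flip: G.m_assoc)
    then show ?thesis
      using that fc h.hom_closed[OF m[OF m[OF c(1,2)] c(3)]] by (simp add: G.m_comm)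
  qed
qed

end

text \<open>The counterpart of \<open>balanced\<close> with explicit carriers and an arbitrary
  target group. It is needed to lift maps whose values are themselves tensors.\<close>

definition balanced_map ::
  "'a ring \<Rightarrow> 'k set \<Rightarrow> ('k \<Rightarrow> 'a \<Rightarrow> 'a) \<Rightarrow> ('k \<Rightarrow> 'a \<Rightarrow> 'a) \<Rightarrow> 'g monoid \<Rightarrow> ('a \<Rightarrow> 'a \<Rightarrow> 'g) \<Rightarrow> bool" where
  "balanced_map A K \<rho> \<sigma> G f \<longleftrightarrow>
     (\<forall>x\<in>carrier A. \<forall>y\<in>carrier A. f x y \<in> carrier G) \<and>
     (\<forall>x\<in>carrier A. \<forall>x'\<in>carrier A. \<forall>y\<in>carrier A. f (x \<oplus>\<^bsub>A\<^esub> x') y = f x y \<otimes>\<^bsub>G\<^esub> f x' y) \<and>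
     (\<forall>x\<in>carrier A. \<forall>y\<in>carrier A. \<forall>y'\<in>carrier A. f x (y \<oplus>\<^bsub>A\<^esub> y') = f x y \<otimes>\<^bsub>G\<^esub> f x y') \<and>
     (\<forall>k\<in>K. \<forall>x\<in>carrier A. \<forall>y\<in>carrier A. f (\<rho> k x) y = f x (\<sigma> k y))"

definition balanced_map3 ::
  "'a ring \<Rightarrow> 'k set \<Rightarrow> ('k \<Rightarrow> 'a \<Rightarrow> 'a) \<Rightarrow> ('k \<Rightarrow> 'a \<Rightarrow> 'a) \<Rightarrow> 'h set \<Rightarrow> ('h \<Rightarrow> 'a \<Rightarrow> 'a) \<Rightarrow> ('h \<Rightarrow> 'a \<Rightarrow> 'a)
    \<Rightarrow> 'g monoid \<Rightarrow> ('a \<Rightarrow> 'a \<Rightarrow> 'a \<Rightarrow> 'g) \<Rightarrow> bool" where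
  "balanced_map3 A K \<rho> \<sigma> K' \<rho>' \<sigma>' G f \<longleftrightarrow>
     (\<forall>x\<in>carrier A. \<forall>y\<in>carrier A. \<forall>z\<in>carrier A. f x y z \<in> carrier G) \<and>
     (\<forall>x\<in>carrier A. \<forall>x'\<in>carrier A. \<forall>y\<in>carrier A. \<forall>z\<in>carrier A. f (x \<oplus>\<^bsub>A\<^esub> x') y z = f x y z \<otimes>\<^bsub>G\<^esub> f x' y z) \<and>
     (\<forall>x\<in>carrier A. \<forall>y\<in>carrier A. \<forall>y'\<in>carrier A. \<forall>z\<in>carrier A. f x (y \<oplus>\<^bsub>A\<^esub> y') z = f x y z \<otimes>\<^bsub>G\<^esub> f x y' z) \<and>
     (\<forall>x\<in>carrier A. \<forall>y\<in>carrier A. \<forall>z\<in>carrier A. \<forall>z'\<in>carrier A. f x y (z \<oplus>\<^bsub>A\<^esub> z') = f x y z \<otimes>\<^bsub>G\<^esub> f x y z') \<and>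
     (\<forall>k\<in>K. \<forall>x\<in>carrier A. \<forall>y\<in>carrier A. \<forall>z\<in>carrier A. f (\<rho> k x) y z = f x (\<sigma> k y) z) \<and>
     (\<forall>k\<in>K'. \<forall>x\<in>carrier A. \<forall>y\<in>carrier A. \<forall>z\<in>carrier A. f x (\<rho>' k y) z = f x y (\<sigma>' k z))"

section \<open>Universal properties of twofold and threefold tensor products\<close>

lemma tensor2_relsI:
  "\<lbrakk>x \<in> carrier A; x' \<in> carrier A; y \<in> carrier A\<rbrakk> \<Longrightarrow>
    frag_of (x \<oplus>\<^bsub>A\<^esub> x', y) - frag_of (x, y) - frag_of (x', y) \<in> tensor2_rels A K \<rho> \<sigma>"
  "\<lbrakk>x \<in> carrier A; y \<in> carrier A; y' \<in> carrier A\<rbrakk> \<Longrightarrow>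
    frag_of (x, y \<oplus>\<^bsub>A\<^esub> y') - frag_of (x, y) - frag_of (x, y') \<in> tensor2_rels A K \<rho> \<sigma>"
  "\<lbrakk>k \<in> K; x \<in> carrier A; y \<in> carrier A\<rbrakk> \<Longrightarrow>
    frag_of (\<rho> k x, y) - frag_of (x, \<sigma> k y) \<in> tensor2_rels A K \<rho> \<sigma>"
  unfolding tensor2_rels_def by blast+

lemma tensor3_relsI:
  "\<lbrakk>x \<in> carrier A; x' \<in> carrier A; y \<in> carrier A; z \<in> carrier A\<rbrakk> \<Longrightarrow>
    frag_of (x \<oplus>\<^bsub>A\<^esub> x', y, z) - frag_of (x, y, z) - frag_of (x', y, z) \<in> tensor3_rels A K \<rho> \<sigma> K' \<rho>' \<sigma>'"
  "\<lbrakk>x \<in> carrier A; y \<in> carrier A; y' \<in> carrier A; z \<in> carrier A\<rbrakk> \<Longrightarrow>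
    frag_of (x, y \<oplus>\<^bsub>A\<^esub> y', z) - frag_of (x, y, z) - frag_of (x, y', z) \<in> tensor3_rels A K \<rho> \<sigma> K' \<rho>' \<sigma>'"
  "\<lbrakk>x \<in> carrier A; y \<in> carrier A; z \<in> carrier A; z' \<in> carrier A\<rbrakk> \<Longrightarrow>
    frag_of (x, y, z \<oplus>\<^bsub>A\<^esub> z') - frag_of (x, y, z) - frag_of (x, y, z') \<in> tensor3_rels A K \<rho> \<sigma> K' \<rho>' \<sigma>'"
  "\<lbrakk>k \<in> K; x \<in> carrier A; y \<in> carrier A; z \<in> carrier A\<rbrakk> \<Longrightarrow>
    frag_of (\<rho> k x, y, z) - frag_of (x, \<sigma> k y, z) \<in> tensor3_rels A K \<rho> \<sigma> K' \<rho>' \<sigma>'"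
  "\<lbrakk>h \<in> K'; x \<in> carrier A; y \<in> carrier A; z \<in> carrier A\<rbrakk> \<Longrightarrow>
    frag_of (x, \<rho>' h y, z) - frag_of (x, y, \<sigma>' h z) \<in> tensor3_rels A K \<rho> \<sigma> K' \<rho>' \<sigma>'"
  unfolding tensor3_rels_def by blast+

locale balanced_tensor =
  fixes A :: "'a ring" and K :: "'k set" and \<rho> \<sigma> :: "'k \<Rightarrow> 'a \<Rightarrow> 'a"
  assumes abelian: "abelian_group A"
    and \<rho>: "k \<in> K \<Longrightarrow> x \<in> carrier A \<Longrightarrow> \<rho> k x \<in> carrier A"
    and \<sigma>: "k \<in> K \<Longrightarrow> x \<in> carrier A \<Longrightarrow> \<sigma> k x \<in> carrier A"
begin

interpretation A: abelian_group A by (rule abelian)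

sublocale Q: presented_group "carrier A \<times> carrier A" "tensor2_rels A K \<rho> \<sigma>"
  by unfold_locales
    (auto simp: tensor2_rels_def \<rho> \<sigma> keys_frag_of dest!: Poly_Mapping.keys_diff[THEN subsetD])

abbreviation "T2 \<equiv> tensor2 A K \<rho> \<sigma>"
abbreviation "e2 \<equiv> tens2 A K \<rho> \<sigma>"

lemma T2_eq: "T2 = Q.T" and e2_eq: "e2 x y = Q.coset (frag_of (x, y))"
  by (simp_all add: tensor2_def tensor2_null_def tens2_def)

lemma comm_group_T2: "comm_group T2"
  unfolding T2_eq by (rule Q.comm_group_T)

sublocale T: comm_group T2 by (rule comm_group_T2)

lemma balanced_e2: "balanced_map A K \<rho> \<sigma> T2 e2"
proof -
  have add: "Q.coset p = Q.coset q \<otimes>\<^bsub>T2\<^esub> Q.coset r"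
    if "p - q - r \<in> tensor2_rels A K \<rho> \<sigma>" "q \<in> carrier (free_Abelian_group (carrier A \<times> carrier A))"
      "r \<in> carrier (free_Abelian_group (carrier A \<times> carrier A))" for p q r
    unfolding T2_eq Q.coset_add[OF that(2,3), symmetric]
    by (rule Q.coset_eqI) (use that Q.F.m_closed[OF that(2,3)] in \<open>auto simp: diff_diff_add\<close>)
  show ?thesis
    unfolding balanced_map_def e2_eq
  proof (intro conjI ballI)
    fix x y assume "x \<in> carrier A" "y \<in> carrier A"
    then show "Q.coset (frag_of (x, y)) \<in> carrier T2"
      unfolding T2_eq by (intro Q.coset_carrier) simp
  next
    fix x x' y assume "x \<in> carrier A" "x' \<in> carrier A" "y \<in> carrier A"
    then show "Q.coset (frag_of (x \<oplus>\<^bsub>A\<^esub> x', y)) = Q.coset (frag_of (x, y)) \<otimes>\<^bsub>T2\<^esub> Q.coset (frag_of (x', y))"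
      by (intro add tensor2_relsI) simp_all
  next
    fix x y y' assume "x \<in> carrier A" "y \<in> carrier A" "y' \<in> carrier A"
    then show "Q.coset (frag_of (x, y \<oplus>\<^bsub>A\<^esub> y')) = Q.coset (frag_of (x, y)) \<otimes>\<^bsub>T2\<^esub> Q.coset (frag_of (x, y'))"
      by (intro add tensor2_relsI) simp_all
  next
    fix k x y assume "k \<in> K" "x \<in> carrier A" "y \<in> carrier A"
    then show "Q.coset (frag_of (\<rho> k x, y)) = Q.coset (frag_of (x, \<sigma> k y))"
      by (intro Q.coset_eqI tensor2_relsI) (simp_all add: \<sigma>)
  qed
qed

lemma e2_closed: "x \<in> carrier A \<Longrightarrow> y \<in> carrier A \<Longrightarrow> e2 x y \<in> carrier T2"
  using balanced_e2 by (simp add: balanced_map_def)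

lemma lift_rels:
  assumes "comm_group G" and f: "balanced_map A K \<rho> \<sigma> G f"
  shows "(\<lambda>(x, y). f x y) \<in> carrier A \<times> carrier A \<rightarrow> carrier G"
    and "r \<in> tensor2_rels A K \<rho> \<sigma> \<Longrightarrow> frag_hom G (\<lambda>(x, y). f x y) r = \<one>\<^bsub>G\<^esub>"
proof -
  show F: "(\<lambda>(x, y). f x y) \<in> carrier A \<times> carrier A \<rightarrow> carrier G"
    using f by (auto simp: balanced_map_def)
  show "r \<in> tensor2_rels A K \<rho> \<sigma> \<Longrightarrow> frag_hom G (\<lambda>(x, y). f x y) r = \<one>\<^bsub>G\<^esub>"
    unfolding tensor2_rels_def
    using f by (auto simp: balanced_map_def \<rho> \<sigma> intro!: Q.frag_hom_eqI[OF assms(1) F])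
qed

lemma lift_hom:
  "comm_group G \<Longrightarrow> balanced_map A K \<rho> \<sigma> G f \<Longrightarrow> group_hom T2 G (tensor_lift G (\<lambda>(x, y). f x y))"
  unfolding T2_eq by (rule Q.tensor_lift_hom[OF _ lift_rels])

lemma lift_e2:
  assumes "comm_group G" "balanced_map A K \<rho> \<sigma> G f" "x \<in> carrier A" "y \<in> carrier A"
  shows "tensor_lift G (\<lambda>(x, y). f x y) (e2 x y) = f x y"
  unfolding e2_eq by (subst Q.tensor_lift_frag_of[OF assms(1) lift_rels[OF assms(1,2)]]) (use assms in auto)

lemma lift_sum:
  assumes G: "comm_group G" and f: "balanced_map A K \<rho> \<sigma> G f" and l: "set l \<subseteq> carrier A \<times> carrier A"
  shows "tensor_lift G (\<lambda>(x, y). f x y) (group_sum T2 l e2) = group_sum G l f"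
proof -
  have "tensor_lift G (\<lambda>(x, y). f x y) (group_sum T2 l e2) =
     group_sum G l (\<lambda>x y. tensor_lift G (\<lambda>(x, y). f x y) (e2 x y))"
    by (rule group_sum_hom[OF lift_hom[OF G f]]) (use l in \<open>auto intro: e2_closed\<close>)
  also have "\<dots> = group_sum G l f"
    by (rule group_sum_cong) (use l lift_e2[OF G f] in auto)
  finally show ?thesis .
qed

lemma sum_closed: "set l \<subseteq> carrier A \<times> carrier A \<Longrightarrow> group_sum T2 l e2 \<in> carrier T2"
  by (rule group_sum_closed) (auto intro: e2_closed T.is_monoid)

lemma e2_zero: "y \<in> carrier A \<Longrightarrow> e2 \<zero>\<^bsub>A\<^esub> y = \<one>\<^bsub>T2\<^esub>" "x \<in> carrier A \<Longrightarrow> e2 x \<zero>\<^bsub>A\<^esub> = \<one>\<^bsub>T2\<^esub>"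
proof -
  have "e2 (\<zero>\<^bsub>A\<^esub> \<oplus>\<^bsub>A\<^esub> \<zero>\<^bsub>A\<^esub>) y = e2 \<zero>\<^bsub>A\<^esub> y \<otimes>\<^bsub>T2\<^esub> e2 \<zero>\<^bsub>A\<^esub> y" if "y \<in> carrier A"
    using balanced_e2 that unfolding balanced_map_def by blast
  then show "y \<in> carrier A \<Longrightarrow> e2 \<zero>\<^bsub>A\<^esub> y = \<one>\<^bsub>T2\<^esub>"
    using e2_closed[of "\<zero>\<^bsub>A\<^esub>" y] by (auto simp: T.r_cancel_one')
  have "e2 x (\<zero>\<^bsub>A\<^esub> \<oplus>\<^bsub>A\<^esub> \<zero>\<^bsub>A\<^esub>) = e2 x \<zero>\<^bsub>A\<^esub> \<otimes>\<^bsub>T2\<^esub> e2 x \<zero>\<^bsub>A\<^esub>" if "x \<in> carrier A"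
    using balanced_e2 that unfolding balanced_map_def by blast
  then show "x \<in> carrier A \<Longrightarrow> e2 x \<zero>\<^bsub>A\<^esub> = \<one>\<^bsub>T2\<^esub>"
    using e2_closed[of x "\<zero>\<^bsub>A\<^esub>"] by (auto simp: T.r_cancel_one')
qed

text \<open>Lists without coefficients represent all tensors, by induction over the free abelian
  group; only differences require care, because a list has no negative entries.\<close>

lemma ex_rep:
  assumes "u \<in> carrier T2" shows "\<exists>l. set l \<subseteq> carrier A \<times> carrier A \<and> u = group_sum T2 l e2"
proof -
  obtain p where p: "Poly_Mapping.keys p \<subseteq> carrier A \<times> carrier A" "u = Q.coset p"
    using assms by (auto simp: T2_eq carrier_FactGroup)
  have "\<exists>l. set l \<subseteq> carrier A \<times> carrier A \<and> Q.coset p = group_sum T2 l e2"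
    using p(1)
  proof (induction rule: free_Abelian_group_induct[consumes 1, case_names zero diff one])
    case zero
    have "Q.coset 0 = \<one>\<^bsub>T2\<^esub>"
      using Q.F.coset_join2[of 0, OF _ Q.subgroup_N] subgroup.one_closed[OF Q.subgroup_N] by (simp add: T2_eq)
    then show ?case by (intro exI[of _ "[]"]) simp
  next
    case (one z)
    then show ?case
      by (intro exI[of _ "[z]"], cases z) (auto simp: e2_closed e2_eq[symmetric])
  next
    case (diff a b)
    then obtain l l' where l: "set l \<subseteq> carrier A \<times> carrier A" "Q.coset a = group_sum T2 l e2"
      and l': "set l' \<subseteq> carrier A \<times> carrier A" "Q.coset b = group_sum T2 l' e2" by blast
    \<comment> \<open>The minus sign of \<open>b\<close> is absorbed into the first factor of each
      of its elementary tensors.\<close>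
    let ?m = "map (\<lambda>(x, y). (\<ominus>\<^bsub>A\<^esub> x, y)) l'"
    have m: "set ?m \<subseteq> carrier A \<times> carrier A" using l' by auto
    have inv: "e2 (\<ominus>\<^bsub>A\<^esub> x) y \<otimes>\<^bsub>T2\<^esub> e2 x y = \<one>\<^bsub>T2\<^esub>" if "x \<in> carrier A" "y \<in> carrier A" for x y
      using balanced_e2 that e2_zero(1)[OF that(2)] A.l_neg[OF that(1)]
      unfolding balanced_map_def by (metis A.a_inv_closed)
    have c: "group_sum T2 ?m e2 \<otimes>\<^bsub>T2\<^esub> group_sum T2 l' e2 = \<one>\<^bsub>T2\<^esub>"
      using l'(1)
    proof (induction l')
      case (Cons z l')
      obtain x y where z: "z = (x, y)" by force
      let ?g = "group_sum T2 (map (\<lambda>(x, y). (\<ominus>\<^bsub>A\<^esub> x, y)) l') e2"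
      have "set (map (\<lambda>(x, y). (\<ominus>\<^bsub>A\<^esub> x, y)) l') \<subseteq> carrier A \<times> carrier A" using Cons.prems by auto
      then have "?g \<in> carrier T2" by (rule sum_closed)
      moreover have "group_sum T2 l' e2 \<in> carrier T2" "e2 (\<ominus>\<^bsub>A\<^esub> x) y \<in> carrier T2" "e2 x y \<in> carrier T2"
        using Cons.prems by (auto simp: z intro!: sum_closed e2_closed)
      ultimately have c: "?g \<in> carrier T2" "group_sum T2 l' e2 \<in> carrier T2" "e2 (\<ominus>\<^bsub>A\<^esub> x) y \<in> carrier T2"
        "e2 x y \<in> carrier T2" by blast+
      have "e2 (\<ominus>\<^bsub>A\<^esub> x) y \<otimes>\<^bsub>T2\<^esub> ?g \<otimes>\<^bsub>T2\<^esub> (e2 x y \<otimes>\<^bsub>T2\<^esub> group_sum T2 l' e2) =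
         (e2 (\<ominus>\<^bsub>A\<^esub> x) y \<otimes>\<^bsub>T2\<^esub> e2 x y) \<otimes>\<^bsub>T2\<^esub> (?g \<otimes>\<^bsub>T2\<^esub> group_sum T2 l' e2)"
        using c by (simp add: T.m_ac)
      then show ?case using Cons inv[of x y] by (simp add: z)
    qed simp
    have ab: "a \<in> carrier (free_Abelian_group (carrier A \<times> carrier A))" "b \<in> carrier (free_Abelian_group (carrier A \<times> carrier A))"
      "a - b \<in> carrier (free_Abelian_group (carrier A \<times> carrier A))"
      using diff keys_diff[of a b] by auto
    have *: "Q.coset a = Q.coset (a - b) \<otimes>\<^bsub>T2\<^esub> Q.coset b"
      using Q.coset_add[OF ab(3,2)] by (simp add: T2_eq)
    have cc: "Q.coset (a - b) \<in> carrier T2" "Q.coset b \<in> carrier T2"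
      unfolding T2_eq by (rule Q.coset_carrier[OF ab(3)], rule Q.coset_carrier[OF ab(2)])
    have mm: "group_sum T2 ?m e2 \<in> carrier T2" by (rule sum_closed[OF m])
    have "Q.coset a \<otimes>\<^bsub>T2\<^esub> group_sum T2 ?m e2 = Q.coset (a - b) \<otimes>\<^bsub>T2\<^esub> (group_sum T2 ?m e2 \<otimes>\<^bsub>T2\<^esub> Q.coset b)"
      unfolding * using cc mm by (simp add: T.m_ac)
    then have "Q.coset (a - b) = group_sum T2 l e2 \<otimes>\<^bsub>T2\<^esub> group_sum T2 ?m e2"
      using c cc l l' by simp
    also have "\<dots> = group_sum T2 (l @ ?m) e2"
      by (rule group_sum_append[symmetric]) (use l m in \<open>auto intro!: e2_closed T.is_monoid\<close>)
    finally show ?case using l m by (intro exI[of _ "l @ ?m"]) auto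
  qed
  then show ?thesis using p by simp
qed

end

locale balanced_tensor3 =
  fixes A :: "'a ring" and K :: "'k set" and \<rho> \<sigma> :: "'k \<Rightarrow> 'a \<Rightarrow> 'a" and K' :: "'h set" and \<rho>' \<sigma>' :: "'h \<Rightarrow> 'a \<Rightarrow> 'a"
  assumes abelian: "abelian_group A"
    and \<rho>: "k \<in> K \<Longrightarrow> x \<in> carrier A \<Longrightarrow> \<rho> k x \<in> carrier A"
    and \<sigma>: "k \<in> K \<Longrightarrow> x \<in> carrier A \<Longrightarrow> \<sigma> k x \<in> carrier A"
    and \<rho>': "h \<in> K' \<Longrightarrow> x \<in> carrier A \<Longrightarrow> \<rho>' h x \<in> carrier A"
    and \<sigma>': "h \<in> K' \<Longrightarrow> x \<in> carrier A \<Longrightarrow> \<sigma>' h x \<in> carrier A"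
begin

interpretation A: abelian_group A by (rule abelian)

sublocale Q: presented_group "carrier A \<times> carrier A \<times> carrier A" "tensor3_rels A K \<rho> \<sigma> K' \<rho>' \<sigma>'"
  by unfold_locales
    (auto simp: tensor3_rels_def \<rho> \<sigma> \<rho>' \<sigma>' keys_frag_of dest!: Poly_Mapping.keys_diff[THEN subsetD])

abbreviation "T3 \<equiv> tensor3 A K \<rho> \<sigma> K' \<rho>' \<sigma>'"
abbreviation "e3 \<equiv> tens3 A K \<rho> \<sigma> K' \<rho>' \<sigma>'"

lemma T3_eq: "T3 = Q.T" and e3_eq: "e3 x y z = Q.coset (frag_of (x, y, z))"
  by (simp_all add: tensor3_def tensor3_null_def tens3_def)

lemma comm_group_T3: "comm_group T3"
  unfolding T3_eq by (rule Q.comm_group_T)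

sublocale T: comm_group T3 by (rule comm_group_T3)

lemma balanced_e3: "balanced_map3 A K \<rho> \<sigma> K' \<rho>' \<sigma>' T3 e3"
proof -
  have add: "Q.coset p = Q.coset q \<otimes>\<^bsub>T3\<^esub> Q.coset r"
    if "p - q - r \<in> tensor3_rels A K \<rho> \<sigma> K' \<rho>' \<sigma>'" "q \<in> carrier (free_Abelian_group (carrier A \<times> carrier A \<times> carrier A))"
      "r \<in> carrier (free_Abelian_group (carrier A \<times> carrier A \<times> carrier A))" for p q r
    unfolding T3_eq Q.coset_add[OF that(2,3), symmetric]
    by (rule Q.coset_eqI) (use that Q.F.m_closed[OF that(2,3)] in \<open>auto simp: diff_diff_add\<close>)
  show ?thesis
    unfolding balanced_map3_def e3_eq
  proof (intro conjI ballI)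
    fix x y z assume *: "x \<in> carrier A" "y \<in> carrier A" "z \<in> carrier A"
    then show "Q.coset (frag_of (x, y, z)) \<in> carrier T3"
      unfolding T3_eq by (intro Q.coset_carrier) simp
    fix x' assume "x' \<in> carrier A"
    with * show "Q.coset (frag_of (x, y, z \<oplus>\<^bsub>A\<^esub> x')) = Q.coset (frag_of (x, y, z)) \<otimes>\<^bsub>T3\<^esub> Q.coset (frag_of (x, y, x'))"
      by (intro add tensor3_relsI) simp_all
  next
    fix x x' y z assume "x \<in> carrier A" "x' \<in> carrier A" "y \<in> carrier A" "z \<in> carrier A"
    then show "Q.coset (frag_of (x \<oplus>\<^bsub>A\<^esub> x', y, z)) = Q.coset (frag_of (x, y, z)) \<otimes>\<^bsub>T3\<^esub> Q.coset (frag_of (x', y, z))"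
      by (intro add tensor3_relsI) simp_all
  next
    fix x y y' z assume "x \<in> carrier A" "y \<in> carrier A" "y' \<in> carrier A" "z \<in> carrier A"
    then show "Q.coset (frag_of (x, y \<oplus>\<^bsub>A\<^esub> y', z)) = Q.coset (frag_of (x, y, z)) \<otimes>\<^bsub>T3\<^esub> Q.coset (frag_of (x, y', z))"
      by (intro add tensor3_relsI) simp_all
  next
    fix k x y z assume "k \<in> K" "x \<in> carrier A" "y \<in> carrier A" "z \<in> carrier A"
    then show "Q.coset (frag_of (\<rho> k x, y, z)) = Q.coset (frag_of (x, \<sigma> k y, z))"
      by (intro Q.coset_eqI tensor3_relsI) (simp_all add: \<sigma>)
  next
    fix k x y z assume "k \<in> K'" "x \<in> carrier A" "y \<in> carrier A" "z \<in> carrier A"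
    then show "Q.coset (frag_of (x, \<rho>' k y, z)) = Q.coset (frag_of (x, y, \<sigma>' k z))"
      by (intro Q.coset_eqI tensor3_relsI) (simp_all add: \<sigma>')
  qed
qed

lemma e3_closed: "x \<in> carrier A \<Longrightarrow> y \<in> carrier A \<Longrightarrow> z \<in> carrier A \<Longrightarrow> e3 x y z \<in> carrier T3"
  using balanced_e3 by (simp add: balanced_map3_def)

lemma lift_rels:
  assumes "comm_group G" and f: "balanced_map3 A K \<rho> \<sigma> K' \<rho>' \<sigma>' G f"
  shows "(\<lambda>(x, y, z). f x y z) \<in> carrier A \<times> carrier A \<times> carrier A \<rightarrow> carrier G"
    and "r \<in> tensor3_rels A K \<rho> \<sigma> K' \<rho>' \<sigma>' \<Longrightarrow> frag_hom G (\<lambda>(x, y, z). f x y z) r = \<one>\<^bsub>G\<^esub>"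
proof -
  show F: "(\<lambda>(x, y, z). f x y z) \<in> carrier A \<times> carrier A \<times> carrier A \<rightarrow> carrier G"
    using f by (auto simp: balanced_map3_def)
  show "r \<in> tensor3_rels A K \<rho> \<sigma> K' \<rho>' \<sigma>' \<Longrightarrow> frag_hom G (\<lambda>(x, y, z). f x y z) r = \<one>\<^bsub>G\<^esub>"
    unfolding tensor3_rels_def
    using f by (auto simp: balanced_map3_def \<rho> \<sigma> \<rho>' \<sigma>' intro!: Q.frag_hom_eqI[OF assms(1) F])
qed

lemma lift_hom:
  "comm_group G \<Longrightarrow> balanced_map3 A K \<rho> \<sigma> K' \<rho>' \<sigma>' G f \<Longrightarrow> group_hom T3 G (tensor_lift G (\<lambda>(x, y, z). f x y z))"
  unfolding T3_eq by (rule Q.tensor_lift_hom[OF _ lift_rels])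

lemma lift_e3:
  assumes "comm_group G" "balanced_map3 A K \<rho> \<sigma> K' \<rho>' \<sigma>' G f" "x \<in> carrier A" "y \<in> carrier A" "z \<in> carrier A"
  shows "tensor_lift G (\<lambda>(x, y, z). f x y z) (e3 x y z) = f x y z"
  unfolding e3_eq by (subst Q.tensor_lift_frag_of[OF assms(1) lift_rels[OF assms(1,2)]]) (use assms in auto)

end

section \<open>Concrete bialgebroids in Sweedler form\<close>

context
  fixes A :: "'a ring" assumes A: "ring A"
begin

interpretation A: ring A by (rule A)

lemma rt_carrier [simp]: "rt A x \<in> carrier A" and rt_id [simp]: "x \<in> carrier A \<Longrightarrow> rt A x = x"
  and rt_rt [simp]: "rt A (rt A x) = rt A x"
  by (auto simp: rt_def)

lemma tot_simps [simp]:
  "carrier (tot A) = carrier A" "x \<otimes>\<^bsub>tot A\<^esub> y = rt A x \<otimes>\<^bsub>A\<^esub> rt A y" "x \<oplus>\<^bsub>tot A\<^esub> y = rt A x \<oplus>\<^bsub>A\<^esub> rt A y"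
  "\<one>\<^bsub>tot A\<^esub> = \<one>\<^bsub>A\<^esub>" "\<zero>\<^bsub>tot A\<^esub> = \<zero>\<^bsub>A\<^esub>"
  by (simp_all add: tot_def)

lemma pair_sum_closed: "(\<And>x y. (x, y) \<in> set l \<Longrightarrow> f x y \<in> carrier A) \<Longrightarrow> pair_sum A l f \<in> carrier A"
  by (induction l) auto

lemma pair_sum_tot: "pair_sum (tot A) l f = pair_sum A l (\<lambda>x y. rt A (f x y))"
proof (induction l)
  case (Cons p l)
  have "pair_sum A l (\<lambda>x y. rt A (f x y)) \<in> carrier A" by (rule pair_sum_closed) simp
  then show ?case using Cons by (cases p) simp
qed simp

text \<open>This connects the two notions of balance: \<open>f\<close> is balanced for all elements
  of the type, and each scalar \<open>k\<close> acts on the carrier like some \<open>r\<close>.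
  Composition with \<open>rt A\<close> makes the values carrier elements.\<close>

lemma balanced_map_tot:
  assumes f: "balanced (tot A) m n f"
    and K: "\<And>k. k \<in> K \<Longrightarrow> \<exists>r. \<forall>x\<in>carrier A. \<rho> k x = m r x \<and> \<sigma> k x = n r x"
  shows "balanced_map A K \<rho> \<sigma> (add_monoid A) (\<lambda>x y. rt A (f x y))"
proof -
  have 1: "f (x \<oplus>\<^bsub>A\<^esub> x') y = rt A (f x y) \<oplus>\<^bsub>A\<^esub> rt A (f x' y)" if "x \<in> carrier A" "x' \<in> carrier A" for x x' y
    using f that unfolding balanced_def additive_def by (metis rt_id tot_simps(3))
  have 2: "f x (y \<oplus>\<^bsub>A\<^esub> y') = rt A (f x y) \<oplus>\<^bsub>A\<^esub> rt A (f x y')" if "y \<in> carrier A" "y' \<in> carrier A" for x y y'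
    using f that unfolding balanced_def additive_def by (metis rt_id tot_simps(3))
  have 3: "f (\<rho> k x) y = f x (\<sigma> k y)" if "k \<in> K" "x \<in> carrier A" "y \<in> carrier A" for k x y
    using K[OF that(1)] that f unfolding balanced_def by metis
  show ?thesis by (simp add: balanced_map_def 1 2 3)
qed

lemma balanced_map3_tot:
  assumes f: "balanced3 (tot A) m n m' n' f"
    and K: "\<And>k. k \<in> K \<Longrightarrow> \<exists>r. \<forall>x\<in>carrier A. \<rho> k x = m r x \<and> \<sigma> k x = n r x"
    and K': "\<And>k. k \<in> K' \<Longrightarrow> \<exists>r. \<forall>x\<in>carrier A. \<rho>' k x = m' r x \<and> \<sigma>' k x = n' r x"
  shows "balanced_map3 A K \<rho> \<sigma> K' \<rho>' \<sigma>' (add_monoid A) (\<lambda>x y z. rt A (f x y z))"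
proof -
  have 1: "f (x \<oplus>\<^bsub>A\<^esub> x') y z = rt A (f x y z) \<oplus>\<^bsub>A\<^esub> rt A (f x' y z)" if "x \<in> carrier A" "x' \<in> carrier A" for x x' y z
    using f that unfolding balanced3_def additive_def by (metis rt_id tot_simps(3))
  have 2: "f x (y \<oplus>\<^bsub>A\<^esub> y') z = rt A (f x y z) \<oplus>\<^bsub>A\<^esub> rt A (f x y' z)" if "y \<in> carrier A" "y' \<in> carrier A" for x y y' z
    using f that unfolding balanced3_def additive_def by (metis rt_id tot_simps(3))
  have 3: "f x y (z \<oplus>\<^bsub>A\<^esub> z') = rt A (f x y z) \<oplus>\<^bsub>A\<^esub> rt A (f x y z')" if "z \<in> carrier A" "z' \<in> carrier A" for x y z z'
    using f that unfolding balanced3_def additive_def by (metis rt_id tot_simps(3))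
  have 4: "f (\<rho> k x) y z = f x (\<sigma> k y) z" if "k \<in> K" "x \<in> carrier A" "y \<in> carrier A" for k x y z
    using K[OF that(1)] that f unfolding balanced3_def by metis
  have 5: "f x (\<rho>' k y) z = f x y (\<sigma>' k z)" if "k \<in> K'" "y \<in> carrier A" "z \<in> carrier A" for k x y z
    using K'[OF that(1)] that f unfolding balanced3_def by metis
  show ?thesis by (simp add: balanced_map3_def 1 2 3 4 5)
qed

end

lemma ring_opp_ring:
  assumes "ring A" shows "ring (opp_ring A)"
proof -
  interpret ring A by fact
  show ?thesis
    by (rule ringI)
      (auto simp: l_distr r_distr m_assoc a_ac intro!: abelian_groupI monoidI intro: a_inv_closed l_neg)
qed

lemma (in balanced_tensor) e2_rules:
  "\<lbrakk>x \<in> carrier A; x' \<in> carrier A; y \<in> carrier A\<rbrakk> \<Longrightarrow> e2 (x \<oplus>\<^bsub>A\<^esub> x') y = e2 x y \<otimes>\<^bsub>T2\<^esub> e2 x' y"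
  "\<lbrakk>x \<in> carrier A; y \<in> carrier A; y' \<in> carrier A\<rbrakk> \<Longrightarrow> e2 x (y \<oplus>\<^bsub>A\<^esub> y') = e2 x y \<otimes>\<^bsub>T2\<^esub> e2 x y'"
  "\<lbrakk>k \<in> K; x \<in> carrier A; y \<in> carrier A\<rbrakk> \<Longrightarrow> e2 (\<rho> k x) y = e2 x (\<sigma> k y)"
  using balanced_e2 by (simp_all add: balanced_map_def)

lemma (in balanced_tensor3) e3_rules:
  "\<lbrakk>x \<in> carrier A; x' \<in> carrier A; y \<in> carrier A; z \<in> carrier A\<rbrakk> \<Longrightarrow> e3 (x \<oplus>\<^bsub>A\<^esub> x') y z = e3 x y z \<otimes>\<^bsub>T3\<^esub> e3 x' y z"
  "\<lbrakk>x \<in> carrier A; y \<in> carrier A; y' \<in> carrier A; z \<in> carrier A\<rbrakk> \<Longrightarrow> e3 x (y \<oplus>\<^bsub>A\<^esub> y') z = e3 x y z \<otimes>\<^bsub>T3\<^esub> e3 x y' z"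
  "\<lbrakk>x \<in> carrier A; y \<in> carrier A; z \<in> carrier A; z' \<in> carrier A\<rbrakk> \<Longrightarrow> e3 x y (z \<oplus>\<^bsub>A\<^esub> z') = e3 x y z \<otimes>\<^bsub>T3\<^esub> e3 x y z'"
  "\<lbrakk>k \<in> K; x \<in> carrier A; y \<in> carrier A; z \<in> carrier A\<rbrakk> \<Longrightarrow> e3 (\<rho> k x) y z = e3 x (\<sigma> k y) z"
  "\<lbrakk>h \<in> K'; x \<in> carrier A; y \<in> carrier A; z \<in> carrier A\<rbrakk> \<Longrightarrow> e3 x (\<rho>' h y) z = e3 x y (\<sigma>' h z)"
  using balanced_e3 by (simp_all add: balanced_map3_def)

text \<open>The outer lift has a specified value only if the inner one is balanced, and the
  hypothesis on \<open>\<gamma> (\<rho>' k x)\<close> provides this. The two base rings are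
  independent, so the lemma covers plain and mixed coassociativity alike;
  \<open>coprod_snd_sum\<close> is its mirror image.\<close>

lemma (in balanced_tensor3) coprod_fst_sum:
  assumes "balanced_tensor A K \<rho> \<sigma>" "balanced_tensor A K' \<rho>' \<sigma>'"
    and \<gamma>: "\<gamma> \<in> hom (add_monoid A) (tensor2 A K \<rho> \<sigma>)"
    and rep: "\<And>x. x \<in> carrier A \<Longrightarrow> set (r x) \<subseteq> carrier A \<times> carrier A \<and>
      \<gamma> x = group_sum (tensor2 A K \<rho> \<sigma>) (r x) (tens2 A K \<rho> \<sigma>)"
    and \<gamma>\<rho>: "\<And>k x. k \<in> K' \<Longrightarrow> x \<in> carrier A \<Longrightarrow>
      \<gamma> (\<rho>' k x) = group_sum (tensor2 A K \<rho> \<sigma>) (r x) (\<lambda>u v. tens2 A K \<rho> \<sigma> u (\<rho>' k v))"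
    and l: "set l \<subseteq> carrier A \<times> carrier A"
  shows "coprod_fst T3 e3 \<gamma> (group_sum (tensor2 A K' \<rho>' \<sigma>') l (tens2 A K' \<rho>' \<sigma>')) =
    group_sum T3 l (\<lambda>x y. group_sum T3 (r x) (\<lambda>u v. e3 u v y))"
proof -
  interpret I: balanced_tensor A K \<rho> \<sigma> by fact
  interpret O: balanced_tensor A K' \<rho>' \<sigma>' by fact
  interpret A: abelian_group A by (rule abelian)
  have eb: "balanced_map A K \<rho> \<sigma> T3 (\<lambda>u v. e3 u v y)" if "y \<in> carrier A" for y
    using balanced_e3 that by (auto simp: balanced_map_def balanced_map3_def)
  let ?F = "\<lambda>x y. tensor_lift T3 (\<lambda>(u, v). e3 u v y) (\<gamma> x)"
  have F: "?F x y = group_sum T3 (r x) (\<lambda>u v. e3 u v y)" if "x \<in> carrier A" "y \<in> carrier A" for x y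
    using rep[OF that(1)] I.lift_sum[OF comm_group_T3 eb[OF that(2)]] by auto
  have ruv: "u \<in> carrier A" "v \<in> carrier A" if "(u, v) \<in> set (r x)" "x \<in> carrier A" for u v x
    using rep[OF that(2)] that(1) by auto
  have ec: "e3 u v y \<in> carrier T3" if "(u, v) \<in> set (r x)" "x \<in> carrier A" "y \<in> carrier A" for u v x y
    using rep[OF that(2)] that e3_closed by auto
  have "balanced_map A K' \<rho>' \<sigma>' T3 ?F"
    unfolding balanced_map_def
  proof (intro conjI ballI)
    fix x y assume xy: "x \<in> carrier A" "y \<in> carrier A"
    show "?F x y \<in> carrier T3"
      unfolding F[OF xy] by (rule group_sum_closed) (use ec xy in \<open>auto intro: T.is_monoid\<close>)
  next
    fix x x' y assume xy: "x \<in> carrier A" "x' \<in> carrier A" "y \<in> carrier A"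
    interpret h: group_hom "tensor2 A K \<rho> \<sigma>" T3 "tensor_lift T3 (\<lambda>(u, v). e3 u v y)"
      by (rule I.lift_hom[OF comm_group_T3 eb[OF xy(3)]])
    show "?F (x \<oplus>\<^bsub>A\<^esub> x') y = ?F x y \<otimes>\<^bsub>T3\<^esub> ?F x' y"
      using \<gamma> xy h.hom_mult[of "\<gamma> x" "\<gamma> x'"] by (auto simp: hom_def Pi_iff)
  next
    fix x y y' assume xy: "x \<in> carrier A" "y \<in> carrier A" "y' \<in> carrier A"
    have "?F x (y \<oplus>\<^bsub>A\<^esub> y') = group_sum T3 (r x) (\<lambda>u v. e3 u v y \<otimes>\<^bsub>T3\<^esub> e3 u v y')"
      unfolding F[OF xy(1) A.a_closed[OF xy(2,3)]]
      by (rule group_sum_cong) (rule e3_rules; use ruv xy in blast)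
    also have "\<dots> = ?F x y \<otimes>\<^bsub>T3\<^esub> ?F x y'"
      unfolding F[OF xy(1,2)] F[OF xy(1,3)] by (rule group_sum_mult[OF comm_group_T3]) (use ec xy in auto)
    finally show "?F x (y \<oplus>\<^bsub>A\<^esub> y') = ?F x y \<otimes>\<^bsub>T3\<^esub> ?F x y'" .
  next
    fix k x y assume k: "k \<in> K'" and xy: "x \<in> carrier A" "y \<in> carrier A"
    have "?F (\<rho>' k x) y = tensor_lift T3 (\<lambda>(u, v). e3 u v y)
        (group_sum I.T2 (map (\<lambda>(u, v). (u, \<rho>' k v)) (r x)) I.e2)"
      by (simp add: \<gamma>\<rho>[OF k xy(1)])
    also have "\<dots> = group_sum T3 (r x) (\<lambda>u v. e3 u (\<rho>' k v) y)"
      by (subst I.lift_sum[OF comm_group_T3 eb[OF xy(2)]]) (use rep[OF xy(1)] \<rho>' k in auto)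
    also have "\<dots> = ?F x (\<sigma>' k y)"
      unfolding F[OF xy(1) \<sigma>'[OF k xy(2)]]
      by (rule group_sum_cong) (rule e3_rules; use ruv xy k in blast)
    finally show "?F (\<rho>' k x) y = ?F x (\<sigma>' k y)" .
  qed
  then have "coprod_fst T3 e3 \<gamma> (group_sum O.T2 l O.e2) = group_sum T3 l ?F"
    unfolding coprod_fst_def using O.lift_sum[OF comm_group_T3 _ l] by blast
  also have "\<dots> = group_sum T3 l (\<lambda>x y. group_sum T3 (r x) (\<lambda>u v. e3 u v y))"
    by (rule group_sum_cong, rule F) (use l in auto)
  finally show ?thesis .
qed

lemma (in balanced_tensor3) coprod_snd_sum:
  assumes "balanced_tensor A K \<rho> \<sigma>" "balanced_tensor A K' \<rho>' \<sigma>'"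
    and \<gamma>: "\<gamma> \<in> hom (add_monoid A) (tensor2 A K' \<rho>' \<sigma>')"
    and rep: "\<And>x. x \<in> carrier A \<Longrightarrow> set (r x) \<subseteq> carrier A \<times> carrier A \<and>
      \<gamma> x = group_sum (tensor2 A K' \<rho>' \<sigma>') (r x) (tens2 A K' \<rho>' \<sigma>')"
    and \<gamma>\<sigma>: "\<And>k x. k \<in> K \<Longrightarrow> x \<in> carrier A \<Longrightarrow>
      \<gamma> (\<sigma> k x) = group_sum (tensor2 A K' \<rho>' \<sigma>') (r x) (\<lambda>u v. tens2 A K' \<rho>' \<sigma>' (\<sigma> k u) v)"
    and l: "set l \<subseteq> carrier A \<times> carrier A"
  shows "coprod_snd T3 e3 \<gamma> (group_sum (tensor2 A K \<rho> \<sigma>) l (tens2 A K \<rho> \<sigma>)) =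
    group_sum T3 l (\<lambda>x y. group_sum T3 (r y) (\<lambda>u v. e3 x u v))"
proof -
  interpret O: balanced_tensor A K \<rho> \<sigma> by fact
  interpret I: balanced_tensor A K' \<rho>' \<sigma>' by fact
  interpret A: abelian_group A by (rule abelian)
  have eb: "balanced_map A K' \<rho>' \<sigma>' T3 (\<lambda>u v. e3 x u v)" if "x \<in> carrier A" for x
    using balanced_e3 that by (auto simp: balanced_map_def balanced_map3_def)
  let ?F = "\<lambda>x y. tensor_lift T3 (\<lambda>(u, v). e3 x u v) (\<gamma> y)"
  have F: "?F x y = group_sum T3 (r y) (\<lambda>u v. e3 x u v)" if "x \<in> carrier A" "y \<in> carrier A" for x y
    using rep[OF that(2)] I.lift_sum[OF comm_group_T3 eb[OF that(1)]] by auto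
  have ruv: "u \<in> carrier A" "v \<in> carrier A" if "(u, v) \<in> set (r x)" "x \<in> carrier A" for u v x
    using rep[OF that(2)] that(1) by auto
  have ec: "e3 x u v \<in> carrier T3" if "(u, v) \<in> set (r y)" "x \<in> carrier A" "y \<in> carrier A" for u v x y
    using rep[OF that(3)] that e3_closed by auto
  have "balanced_map A K \<rho> \<sigma> T3 ?F"
    unfolding balanced_map_def
  proof (intro conjI ballI)
    fix x y assume xy: "x \<in> carrier A" "y \<in> carrier A"
    show "?F x y \<in> carrier T3"
      unfolding F[OF xy] by (rule group_sum_closed) (use ec xy in \<open>auto intro: T.is_monoid\<close>)
  next
    fix x y y' assume xy: "x \<in> carrier A" "y \<in> carrier A" "y' \<in> carrier A"
    interpret h: group_hom "tensor2 A K' \<rho>' \<sigma>'" T3 "tensor_lift T3 (\<lambda>(u, v). e3 x u v)"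
      by (rule I.lift_hom[OF comm_group_T3 eb[OF xy(1)]])
    show "?F x (y \<oplus>\<^bsub>A\<^esub> y') = ?F x y \<otimes>\<^bsub>T3\<^esub> ?F x y'"
      using \<gamma> xy h.hom_mult[of "\<gamma> y" "\<gamma> y'"] by (auto simp: hom_def Pi_iff)
  next
    fix x x' y assume xy: "x \<in> carrier A" "x' \<in> carrier A" "y \<in> carrier A"
    have "?F (x \<oplus>\<^bsub>A\<^esub> x') y = group_sum T3 (r y) (\<lambda>u v. e3 x u v \<otimes>\<^bsub>T3\<^esub> e3 x' u v)"
      unfolding F[OF A.a_closed[OF xy(1,2)] xy(3)]
      by (rule group_sum_cong) (rule e3_rules; use ruv xy in blast)
    also have "\<dots> = ?F x y \<otimes>\<^bsub>T3\<^esub> ?F x' y"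
      unfolding F[OF xy(1,3)] F[OF xy(2,3)] by (rule group_sum_mult[OF comm_group_T3]) (use ec xy in auto)
    finally show "?F (x \<oplus>\<^bsub>A\<^esub> x') y = ?F x y \<otimes>\<^bsub>T3\<^esub> ?F x' y" .
  next
    fix k x y assume k: "k \<in> K" and xy: "x \<in> carrier A" "y \<in> carrier A"
    have "?F x (\<sigma> k y) = tensor_lift T3 (\<lambda>(u, v). e3 x u v)
        (group_sum I.T2 (map (\<lambda>(u, v). (\<sigma> k u, v)) (r y)) I.e2)"
      by (simp add: \<gamma>\<sigma>[OF k xy(2)])
    also have "\<dots> = group_sum T3 (r y) (\<lambda>u v. e3 x (\<sigma> k u) v)"
      by (subst I.lift_sum[OF comm_group_T3 eb[OF xy(1)]]) (use rep[OF xy(2)] \<sigma> k in auto)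
    also have "\<dots> = ?F (\<rho> k x) y"
      unfolding F[OF \<rho>[OF k xy(1)] xy(2)]
      by (rule group_sum_cong) (rule e3_rules(4)[symmetric]; use ruv xy k in blast)
    finally show "?F (\<rho> k x) y = ?F x (\<sigma> k y)" by simp
  qed
  then have "coprod_snd T3 e3 \<gamma> (group_sum O.T2 l O.e2) = group_sum T3 l ?F"
    unfolding coprod_snd_def using O.lift_sum[OF comm_group_T3 _ l] by blast
  also have "\<dots> = group_sum T3 l (\<lambda>x y. group_sum T3 (r y) (\<lambda>u v. e3 x u v))"
    by (rule group_sum_cong, rule F) (use l in auto)
  finally show ?thesis .
qed

section \<open>Coproducts of a right bialgebroid as explicit sums of elementary tensors\<close>

context right_bialgebroid_ops
begin

interpretation A: ring A by (rule ring_total)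
interpretation R: ring R by (rule ring_base)

lemmas tot_simps' [simp] = tot_simps[OF ring_total] rt_carrier[OF ring_total] rt_id[OF ring_total]
  rt_rt[OF ring_total]

lemma s_closed [simp]: "r \<in> carrier R \<Longrightarrow> s r \<in> carrier A"
  and t_closed [simp]: "r \<in> carrier R \<Longrightarrow> t r \<in> carrier A"
  and s_mult: "r \<in> carrier R \<Longrightarrow> r' \<in> carrier R \<Longrightarrow> s (r \<otimes>\<^bsub>R\<^esub> r') = s r \<otimes>\<^bsub>A\<^esub> s r'"
  and t_mult: "r \<in> carrier R \<Longrightarrow> r' \<in> carrier R \<Longrightarrow> t (r \<otimes>\<^bsub>R\<^esub> r') = t r' \<otimes>\<^bsub>A\<^esub> t r"
  and s_add: "r \<in> carrier R \<Longrightarrow> r' \<in> carrier R \<Longrightarrow> s (r \<oplus>\<^bsub>R\<^esub> r') = s r \<oplus>\<^bsub>A\<^esub> s r'"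
  and t_add: "r \<in> carrier R \<Longrightarrow> r' \<in> carrier R \<Longrightarrow> t (r \<oplus>\<^bsub>R\<^esub> r') = t r \<oplus>\<^bsub>A\<^esub> t r'"
  and s_one [simp]: "s \<one>\<^bsub>R\<^esub> = \<one>\<^bsub>A\<^esub>" and t_one [simp]: "t \<one>\<^bsub>R\<^esub> = \<one>\<^bsub>A\<^esub>"
  using src_hom tgt_hom by (auto simp: ring_hom_def)

lemma \<pi>_closed [simp]: "a \<in> carrier A \<Longrightarrow> \<pi> a \<in> carrier R"
  and \<pi>_add: "a \<in> carrier A \<Longrightarrow> b \<in> carrier A \<Longrightarrow> \<pi> (a \<oplus>\<^bsub>A\<^esub> b) = \<pi> a \<oplus>\<^bsub>R\<^esub> \<pi> b"
  using counit_add by (auto simp: hom_def)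

lemma zero_of_add:
  assumes "ring B" "f (\<zero>\<^bsub>A\<^esub> \<oplus>\<^bsub>A\<^esub> \<zero>\<^bsub>A\<^esub>) = f \<zero>\<^bsub>A\<^esub> \<oplus>\<^bsub>B\<^esub> f \<zero>\<^bsub>A\<^esub>" "f \<zero>\<^bsub>A\<^esub> \<in> carrier B"
  shows "f \<zero>\<^bsub>A\<^esub> = \<zero>\<^bsub>B\<^esub>"
proof -
  interpret B: ring B by fact
  show ?thesis using assms(2,3) by simp
qed

lemma \<pi>_zero [simp]: "\<pi> \<zero>\<^bsub>A\<^esub> = \<zero>\<^bsub>R\<^esub>"
  by (rule zero_of_add[OF ring_base]) (simp_all add: \<pi>_add del: A.add.r_one A.add.l_one A.r_zero A.l_zero)

lemma s_zero [simp]: "s \<zero>\<^bsub>R\<^esub> = \<zero>\<^bsub>A\<^esub>"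
  using s_add[of "\<zero>\<^bsub>R\<^esub>" "\<zero>\<^bsub>R\<^esub>"] by simp

lemma t_zero [simp]: "t \<zero>\<^bsub>R\<^esub> = \<zero>\<^bsub>A\<^esub>"
  using t_add[of "\<zero>\<^bsub>R\<^esub>" "\<zero>\<^bsub>R\<^esub>"] by simp

lemma \<pi>_mult_s: "a \<in> carrier A \<Longrightarrow> r \<in> carrier R \<Longrightarrow> \<pi> (a \<otimes>\<^bsub>A\<^esub> s r) = \<pi> a \<otimes>\<^bsub>R\<^esub> r"
  using counit_bimod[of a "\<one>\<^bsub>R\<^esub>" r] by simp

lemma \<pi>_mult_t: "a \<in> carrier A \<Longrightarrow> r \<in> carrier R \<Longrightarrow> \<pi> (a \<otimes>\<^bsub>A\<^esub> t r) = r \<otimes>\<^bsub>R\<^esub> \<pi> a"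
  using counit_bimod[of a r "\<one>\<^bsub>R\<^esub>"] by simp

lemma \<pi>_s [simp]: "r \<in> carrier R \<Longrightarrow> \<pi> (s r) = r" and \<pi>_t [simp]: "r \<in> carrier R \<Longrightarrow> \<pi> (t r) = r"
  using \<pi>_mult_s[of "\<one>\<^bsub>A\<^esub>" r] \<pi>_mult_t[of "\<one>\<^bsub>A\<^esub>" r] by (simp_all add: counit_one)

sublocale T2: balanced_tensor A "carrier R" "\<lambda>r a. a \<otimes>\<^bsub>A\<^esub> s r" "\<lambda>r a. a \<otimes>\<^bsub>A\<^esub> t r"
  by unfold_locales auto

sublocale T3: balanced_tensor3 A "carrier R" "\<lambda>r a. a \<otimes>\<^bsub>A\<^esub> s r" "\<lambda>r a. a \<otimes>\<^bsub>A\<^esub> t r"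
  "carrier R" "\<lambda>r a. a \<otimes>\<^bsub>A\<^esub> s r" "\<lambda>r a. a \<otimes>\<^bsub>A\<^esub> t r"
  by unfold_locales auto

lemma tensor_defs: "rtensor A R s t = T2.T2" "rtens A R s t = T2.e2"
  "rtensor3 A R s t = T3.T3" "rtens3 A R s t = T3.e3"
  by (simp_all add: rtensor_def rtens_def[abs_def] rtensor3_def rtens3_def[abs_def])

lemma \<gamma>_closed: "a \<in> carrier A \<Longrightarrow> \<gamma> a \<in> carrier T2.T2"
  and \<gamma>_add: "a \<in> carrier A \<Longrightarrow> b \<in> carrier A \<Longrightarrow> \<gamma> (a \<oplus>\<^bsub>A\<^esub> b) = \<gamma> a \<otimes>\<^bsub>T2.T2\<^esub> \<gamma> b"
  using coprod_add by (auto simp: hom_def tensor_defs)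

text \<open>A choice, in general not additive in \<open>a\<close>; only its images under balanced
  maps are meaningful. Projecting the argument makes the list depend on the carrier part
  alone.\<close>

definition rep :: "'a \<Rightarrow> ('a \<times> 'a) list" where
  "rep a = (SOME l. set l \<subseteq> carrier A \<times> carrier A \<and> \<gamma> (rt A a) = group_sum T2.T2 l T2.e2)"

lemma rep_set: "set (rep a) \<subseteq> carrier A \<times> carrier A"
  and rep_rt: "\<gamma> (rt A a) = group_sum T2.T2 (rep a) T2.e2"
  unfolding rep_def using someI_ex[OF T2.ex_rep[OF \<gamma>_closed[of "rt A a"]]] by auto

lemma rep: "a \<in> carrier A \<Longrightarrow> \<gamma> a = group_sum T2.T2 (rep a) T2.e2"
  using rep_rt[of a] by simp

lemma rep_carrier: "(x, y) \<in> set (rep a) \<Longrightarrow> x \<in> carrier A \<and> y \<in> carrier A"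
  using rep_set by auto

lemma lift_rep:
  assumes "a \<in> carrier A" "comm_group G" "balanced_map A (carrier R) (\<lambda>r a. a \<otimes>\<^bsub>A\<^esub> s r) (\<lambda>r a. a \<otimes>\<^bsub>A\<^esub> t r) G f"
  shows "tensor_lift G (\<lambda>(x, y). f x y) (\<gamma> a) = group_sum G (rep a) f"
  using T2.lift_sum[OF assms(2,3) rep_set] rep[OF assms(1)] by simp

lemma balanced_left_mult:
  assumes u: "u \<in> carrier A" "v \<in> carrier A"
  shows "balanced_map A (carrier R) (\<lambda>r a. a \<otimes>\<^bsub>A\<^esub> s r) (\<lambda>r a. a \<otimes>\<^bsub>A\<^esub> t r) T2.T2
    (\<lambda>x y. T2.e2 (u \<otimes>\<^bsub>A\<^esub> x) (v \<otimes>\<^bsub>A\<^esub> y))"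
  unfolding balanced_map_def
  by (simp add: u T2.e2_closed A.r_distr T2.e2_rules(1,2) T2.e2_rules(3) flip: A.m_assoc)

lemma balanced_shift:
  assumes r: "r \<in> carrier R" "r' \<in> carrier R"
  shows "balanced_map A (carrier R) (\<lambda>r a. a \<otimes>\<^bsub>A\<^esub> s r) (\<lambda>r a. a \<otimes>\<^bsub>A\<^esub> t r) T2.T2
    (\<lambda>x y. T2.e2 (x \<otimes>\<^bsub>A\<^esub> t r) (y \<otimes>\<^bsub>A\<^esub> s r'))"
proof -
  have "T2.e2 (x \<otimes>\<^bsub>A\<^esub> s k \<otimes>\<^bsub>A\<^esub> t r) (y \<otimes>\<^bsub>A\<^esub> s r') = T2.e2 (x \<otimes>\<^bsub>A\<^esub> t r) (y \<otimes>\<^bsub>A\<^esub> t k \<otimes>\<^bsub>A\<^esub> s r')"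
    if "k \<in> carrier R" "x \<in> carrier A" "y \<in> carrier A" for k x y
    using that r T2.e2_rules(3)[of k "x \<otimes>\<^bsub>A\<^esub> t r" "y \<otimes>\<^bsub>A\<^esub> s r'"] src_tgt_comm
    by (simp add: A.m_assoc)
  then show ?thesis
    unfolding balanced_map_def by (simp add: r T2.e2_closed A.l_distr T2.e2_rules(1,2))
qed

lemma coprod_mult_right:
  assumes "a \<in> carrier A" "r \<in> carrier R" "r' \<in> carrier R"
  shows "\<gamma> (a \<otimes>\<^bsub>A\<^esub> s r' \<otimes>\<^bsub>A\<^esub> t r) = group_sum T2.T2 (rep a) (\<lambda>x y. T2.e2 (x \<otimes>\<^bsub>A\<^esub> t r) (y \<otimes>\<^bsub>A\<^esub> s r'))"
  using coprod_bimod[OF assms] lift_rep[OF assms(1) T2.comm_group_T2 balanced_shift[OF assms(2,3)]]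
  by (simp add: tensor_defs)

lemma \<gamma>_mult_s:
  "a \<in> carrier A \<Longrightarrow> r \<in> carrier R \<Longrightarrow> \<gamma> (a \<otimes>\<^bsub>A\<^esub> s r) = group_sum T2.T2 (rep a) (\<lambda>x y. T2.e2 x (y \<otimes>\<^bsub>A\<^esub> s r))"
  using coprod_mult_right[of a "\<one>\<^bsub>R\<^esub>" r] by (simp, intro group_sum_cong) (simp add: rep_carrier)

lemma \<gamma>_mult_t:
  "a \<in> carrier A \<Longrightarrow> r \<in> carrier R \<Longrightarrow> \<gamma> (a \<otimes>\<^bsub>A\<^esub> t r) = group_sum T2.T2 (rep a) (\<lambda>x y. T2.e2 (x \<otimes>\<^bsub>A\<^esub> t r) y)"
  using coprod_mult_right[of a r "\<one>\<^bsub>R\<^esub>"] by (simp, intro group_sum_cong) (simp add: rep_carrier)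

lemma \<gamma>_takeuchi:
  assumes a: "a \<in> carrier A" and r: "r \<in> carrier R"
  shows "group_sum T2.T2 (rep a) (\<lambda>x y. T2.e2 (s r \<otimes>\<^bsub>A\<^esub> x) y) = group_sum T2.T2 (rep a) (\<lambda>x y. T2.e2 x (t r \<otimes>\<^bsub>A\<^esub> y))"
proof -
  have "balanced_map A (carrier R) (\<lambda>r a. a \<otimes>\<^bsub>A\<^esub> s r) (\<lambda>r a. a \<otimes>\<^bsub>A\<^esub> t r) T2.T2 (\<lambda>x y. T2.e2 (s r \<otimes>\<^bsub>A\<^esub> x) y)"
    "balanced_map A (carrier R) (\<lambda>r a. a \<otimes>\<^bsub>A\<^esub> s r) (\<lambda>r a. a \<otimes>\<^bsub>A\<^esub> t r) T2.T2 (\<lambda>x y. T2.e2 x (t r \<otimes>\<^bsub>A\<^esub> y))"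
    unfolding balanced_map_def
    by (simp_all add: r T2.e2_closed A.r_distr T2.e2_rules(1,2) T2.e2_rules(3) flip: A.m_assoc)
  then show ?thesis
    using takeuchi[OF a r] lift_rep[OF a T2.comm_group_T2] by (simp add: tensor_defs)
qed

text \<open>It justifies the outer lift in the multiplicativity axiom. Additivity is immediate;
  balancing is the Takeuchi condition for \<open>b\<close>, pushed through left multiplication by
  the pair \<open>x\<close>, \<open>y\<close>, which is well defined on the tensor product.\<close>

lemma balanced_coprod:
  assumes b: "b \<in> carrier A"
  shows "balanced_map A (carrier R) (\<lambda>r a. a \<otimes>\<^bsub>A\<^esub> s r) (\<lambda>r a. a \<otimes>\<^bsub>A\<^esub> t r) T2.T2
    (\<lambda>x y. group_sum T2.T2 (rep b) (\<lambda>x' y'. T2.e2 (x \<otimes>\<^bsub>A\<^esub> x') (y \<otimes>\<^bsub>A\<^esub> y')))"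
proof -
  have ec: "T2.e2 (x \<otimes>\<^bsub>A\<^esub> x') (y \<otimes>\<^bsub>A\<^esub> y') \<in> carrier T2.T2"
    if "x \<in> carrier A" "y \<in> carrier A" "(x', y') \<in> set (rep b)" for x y x' y'
    using that rep_carrier by (simp add: T2.e2_closed)
  show ?thesis
    unfolding balanced_map_def
  proof (intro conjI ballI)
    fix x y assume xy: "x \<in> carrier A" "y \<in> carrier A"
    show "group_sum T2.T2 (rep b) (\<lambda>x' y'. T2.e2 (x \<otimes>\<^bsub>A\<^esub> x') (y \<otimes>\<^bsub>A\<^esub> y')) \<in> carrier T2.T2"
      by (rule group_sum_closed[OF T2.T.is_monoid]) (rule ec[OF xy])
    fix z assume z: "z \<in> carrier A"
    show "group_sum T2.T2 (rep b) (\<lambda>x' y'. T2.e2 (x \<otimes>\<^bsub>A\<^esub> x') ((y \<oplus>\<^bsub>A\<^esub> z) \<otimes>\<^bsub>A\<^esub> y')) =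
      group_sum T2.T2 (rep b) (\<lambda>x' y'. T2.e2 (x \<otimes>\<^bsub>A\<^esub> x') (y \<otimes>\<^bsub>A\<^esub> y')) \<otimes>\<^bsub>T2.T2\<^esub>
      group_sum T2.T2 (rep b) (\<lambda>x' y'. T2.e2 (x \<otimes>\<^bsub>A\<^esub> x') (z \<otimes>\<^bsub>A\<^esub> y'))"
      (is "_ = ?r")
    proof -
      have "group_sum T2.T2 (rep b) (\<lambda>x' y'. T2.e2 (x \<otimes>\<^bsub>A\<^esub> x') ((y \<oplus>\<^bsub>A\<^esub> z) \<otimes>\<^bsub>A\<^esub> y')) =
        group_sum T2.T2 (rep b) (\<lambda>x' y'. T2.e2 (x \<otimes>\<^bsub>A\<^esub> x') (y \<otimes>\<^bsub>A\<^esub> y') \<otimes>\<^bsub>T2.T2\<^esub> T2.e2 (x \<otimes>\<^bsub>A\<^esub> x') (z \<otimes>\<^bsub>A\<^esub> y'))"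
        by (rule group_sum_cong) (use xy z rep_carrier in \<open>simp add: A.l_distr T2.e2_rules(2)\<close>)
      also have "\<dots> = ?r"
        by (rule group_sum_mult[OF T2.comm_group_T2]) (use ec xy z in blast)+
      finally show ?thesis .
    qed
  next
    fix x z y assume xy: "x \<in> carrier A" "z \<in> carrier A" "y \<in> carrier A"
    show "group_sum T2.T2 (rep b) (\<lambda>x' y'. T2.e2 ((x \<oplus>\<^bsub>A\<^esub> z) \<otimes>\<^bsub>A\<^esub> x') (y \<otimes>\<^bsub>A\<^esub> y')) =
      group_sum T2.T2 (rep b) (\<lambda>x' y'. T2.e2 (x \<otimes>\<^bsub>A\<^esub> x') (y \<otimes>\<^bsub>A\<^esub> y')) \<otimes>\<^bsub>T2.T2\<^esub>
      group_sum T2.T2 (rep b) (\<lambda>x' y'. T2.e2 (z \<otimes>\<^bsub>A\<^esub> x') (y \<otimes>\<^bsub>A\<^esub> y'))"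
      (is "_ = ?r")
    proof -
      have "group_sum T2.T2 (rep b) (\<lambda>x' y'. T2.e2 ((x \<oplus>\<^bsub>A\<^esub> z) \<otimes>\<^bsub>A\<^esub> x') (y \<otimes>\<^bsub>A\<^esub> y')) =
        group_sum T2.T2 (rep b) (\<lambda>x' y'. T2.e2 (x \<otimes>\<^bsub>A\<^esub> x') (y \<otimes>\<^bsub>A\<^esub> y') \<otimes>\<^bsub>T2.T2\<^esub> T2.e2 (z \<otimes>\<^bsub>A\<^esub> x') (y \<otimes>\<^bsub>A\<^esub> y'))"
        by (rule group_sum_cong) (use xy rep_carrier in \<open>simp add: A.l_distr T2.e2_rules(1)\<close>)
      also have "\<dots> = ?r"
        by (rule group_sum_mult[OF T2.comm_group_T2]) (use ec xy in blast)+
      finally show ?thesis .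
    qed
  next
    fix r x y assume r: "r \<in> carrier R" and xy: "x \<in> carrier A" "y \<in> carrier A"
    let ?h = "tensor_lift T2.T2 (\<lambda>(u, v). T2.e2 (x \<otimes>\<^bsub>A\<^esub> u) (y \<otimes>\<^bsub>A\<^esub> v))"
    have h: "?h (group_sum T2.T2 (map (\<lambda>(u, v). (p u, q v)) (rep b)) T2.e2) =
        group_sum T2.T2 (rep b) (\<lambda>u v. T2.e2 (x \<otimes>\<^bsub>A\<^esub> p u) (y \<otimes>\<^bsub>A\<^esub> q v))"
      if "\<And>u. u \<in> carrier A \<Longrightarrow> p u \<in> carrier A \<and> q u \<in> carrier A" for p q
      by (subst T2.lift_sum[OF T2.comm_group_T2 balanced_left_mult[OF xy]]) (use that rep_carrier in auto)
    have "group_sum T2.T2 (rep b) (\<lambda>x' y'. T2.e2 (x \<otimes>\<^bsub>A\<^esub> s r \<otimes>\<^bsub>A\<^esub> x') (y \<otimes>\<^bsub>A\<^esub> y')) =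
      group_sum T2.T2 (rep b) (\<lambda>u v. T2.e2 (x \<otimes>\<^bsub>A\<^esub> (s r \<otimes>\<^bsub>A\<^esub> u)) (y \<otimes>\<^bsub>A\<^esub> v))"
      by (rule group_sum_cong) (use r xy rep_carrier in \<open>simp add: A.m_assoc\<close>)
    also have "\<dots> = ?h (group_sum T2.T2 (rep b) (\<lambda>x y. T2.e2 (s r \<otimes>\<^bsub>A\<^esub> x) y))"
      using h[of "\<lambda>u. s r \<otimes>\<^bsub>A\<^esub> u" "\<lambda>v. v"] r by simp
    also have "\<dots> = ?h (group_sum T2.T2 (rep b) (\<lambda>x y. T2.e2 x (t r \<otimes>\<^bsub>A\<^esub> y)))"
      by (simp add: \<gamma>_takeuchi b r)
    also have "\<dots> = group_sum T2.T2 (rep b) (\<lambda>u v. T2.e2 (x \<otimes>\<^bsub>A\<^esub> u) (y \<otimes>\<^bsub>A\<^esub> (t r \<otimes>\<^bsub>A\<^esub> v)))"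
      using h[of "\<lambda>u. u" "\<lambda>v. t r \<otimes>\<^bsub>A\<^esub> v"] r by simp
    also have "\<dots> = group_sum T2.T2 (rep b) (\<lambda>x' y'. T2.e2 (x \<otimes>\<^bsub>A\<^esub> x') (y \<otimes>\<^bsub>A\<^esub> t r \<otimes>\<^bsub>A\<^esub> y'))"
      by (rule group_sum_cong) (use r xy rep_carrier in \<open>simp add: A.m_assoc\<close>)
    finally show "group_sum T2.T2 (rep b) (\<lambda>x' y'. T2.e2 (x \<otimes>\<^bsub>A\<^esub> s r \<otimes>\<^bsub>A\<^esub> x') (y \<otimes>\<^bsub>A\<^esub> y')) =
       group_sum T2.T2 (rep b) (\<lambda>x' y'. T2.e2 (x \<otimes>\<^bsub>A\<^esub> x') (y \<otimes>\<^bsub>A\<^esub> t r \<otimes>\<^bsub>A\<^esub> y'))" .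
  qed
qed

text \<open>The outer sum stays a lift, so that it can be evaluated at any description of the
  coproduct of \<open>a\<close>; in \<open>\<gamma>_mult_left\<close> this is a single elementary
  tensor.\<close>

lemma \<gamma>_mult_lift:
  assumes ab: "a \<in> carrier A" "b \<in> carrier A"
  shows "\<gamma> (a \<otimes>\<^bsub>A\<^esub> b) = tensor_lift T2.T2
    (\<lambda>(x, y). group_sum T2.T2 (rep b) (\<lambda>x' y'. T2.e2 (x \<otimes>\<^bsub>A\<^esub> x') (y \<otimes>\<^bsub>A\<^esub> y'))) (\<gamma> a)"
proof -
  let ?F = "\<lambda>x y. tensor_lift T2.T2 (\<lambda>(x', y'). T2.e2 (x \<otimes>\<^bsub>A\<^esub> x') (y \<otimes>\<^bsub>A\<^esub> y')) (\<gamma> b)"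
  let ?G = "\<lambda>x y. group_sum T2.T2 (rep b) (\<lambda>x' y'. T2.e2 (x \<otimes>\<^bsub>A\<^esub> x') (y \<otimes>\<^bsub>A\<^esub> y'))"
  have eq: "?F x y = ?G x y" if "x \<in> carrier A" "y \<in> carrier A" for x y
    by (rule lift_rep[OF ab(2) T2.comm_group_T2 balanced_left_mult[OF that]])
  have F: "balanced_map A (carrier R) (\<lambda>r a. a \<otimes>\<^bsub>A\<^esub> s r) (\<lambda>r a. a \<otimes>\<^bsub>A\<^esub> t r) T2.T2 ?F"
    using balanced_coprod[OF ab(2)] unfolding balanced_map_def by (simp add: eq)
  have "tensor_lift T2.T2 (\<lambda>(x, y). ?F x y) (\<gamma> a) = group_sum T2.T2 (rep a) ?F"
    by (rule lift_rep[OF ab(1) T2.comm_group_T2 F])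
  also have "\<dots> = group_sum T2.T2 (rep a) ?G"
    by (rule group_sum_cong) (use rep_carrier eq in blast)
  also have "\<dots> = tensor_lift T2.T2 (\<lambda>(x, y). ?G x y) (\<gamma> a)"
    by (rule lift_rep[OF ab(1) T2.comm_group_T2 balanced_coprod[OF ab(2)], symmetric])
  finally show ?thesis using coprod_mult[OF ab] by (simp add: tensor_defs)
qed

lemma \<gamma>_mult:
  assumes ab: "a \<in> carrier A" "b \<in> carrier A"
  shows "\<gamma> (a \<otimes>\<^bsub>A\<^esub> b) =
    group_sum T2.T2 (rep a) (\<lambda>x y. group_sum T2.T2 (rep b) (\<lambda>x' y'. T2.e2 (x \<otimes>\<^bsub>A\<^esub> x') (y \<otimes>\<^bsub>A\<^esub> y')))"
  unfolding \<gamma>_mult_lift[OF ab] by (rule lift_rep[OF ab(1) T2.comm_group_T2 balanced_coprod[OF ab(2)]])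

lemma \<gamma>_mult_left:
  assumes a: "a \<in> carrier A" and r: "r \<in> carrier R"
  shows "\<gamma> (s r \<otimes>\<^bsub>A\<^esub> a) = group_sum T2.T2 (rep a) (\<lambda>x y. T2.e2 x (s r \<otimes>\<^bsub>A\<^esub> y))"
    and "\<gamma> (t r \<otimes>\<^bsub>A\<^esub> a) = group_sum T2.T2 (rep a) (\<lambda>x y. T2.e2 (t r \<otimes>\<^bsub>A\<^esub> x) y)"
proof -
  note b = balanced_coprod[OF a]
  have one: "\<gamma> \<one>\<^bsub>A\<^esub> = group_sum T2.T2 [(\<one>\<^bsub>A\<^esub>, \<one>\<^bsub>A\<^esub>)] T2.e2"
    by (simp add: coprod_one tensor_defs T2.e2_closed)
  have e: "\<gamma> (\<one>\<^bsub>A\<^esub> \<otimes>\<^bsub>A\<^esub> s r' \<otimes>\<^bsub>A\<^esub> t r'') = T2.e2 (t r'') (s r')" if "r' \<in> carrier R" "r'' \<in> carrier R" for r' r''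
    using coprod_bimod[OF A.one_closed that(2,1)] T2.lift_e2[OF T2.comm_group_T2 balanced_shift[OF that(2,1)], of "\<one>\<^bsub>A\<^esub>" "\<one>\<^bsub>A\<^esub>"]
    by (simp add: tensor_defs coprod_one that)
  have es: "\<gamma> (s r) = T2.e2 \<one>\<^bsub>A\<^esub> (s r)" using e[of r "\<one>\<^bsub>R\<^esub>"] r by simp
  have et: "\<gamma> (t r) = T2.e2 (t r) \<one>\<^bsub>A\<^esub>" using e[of "\<one>\<^bsub>R\<^esub>" r] r by simp
  show "\<gamma> (s r \<otimes>\<^bsub>A\<^esub> a) = group_sum T2.T2 (rep a) (\<lambda>x y. T2.e2 x (s r \<otimes>\<^bsub>A\<^esub> y))"
    unfolding \<gamma>_mult_lift[OF s_closed[OF r] a] es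
    by (subst T2.lift_e2[OF T2.comm_group_T2 b]) (use r rep_carrier in \<open>auto intro!: group_sum_cong\<close>)
  show "\<gamma> (t r \<otimes>\<^bsub>A\<^esub> a) = group_sum T2.T2 (rep a) (\<lambda>x y. T2.e2 (t r \<otimes>\<^bsub>A\<^esub> x) y)"
    unfolding \<gamma>_mult_lift[OF t_closed[OF r] a] et
    by (subst T2.lift_e2[OF T2.comm_group_T2 b]) (use r rep_carrier in \<open>auto intro!: group_sum_cong\<close>)
qed

definition sproj :: "'a \<Rightarrow> 'a" where "sproj x = s (\<pi> (rt A x))"
definition tproj :: "'a \<Rightarrow> 'a" where "tproj x = t (\<pi> (rt A x))"

lemma proj_closed [simp]: "sproj x \<in> carrier A" "tproj x \<in> carrier A"
  by (simp_all add: sproj_def tproj_def)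

lemma proj_src [simp]: "r \<in> carrier R \<Longrightarrow> sproj (s r) = s r" "r \<in> carrier R \<Longrightarrow> tproj (s r) = t r"
  "r \<in> carrier R \<Longrightarrow> sproj (t r) = s r" "r \<in> carrier R \<Longrightarrow> tproj (t r) = t r"
  by (simp_all add: sproj_def tproj_def)

abbreviation tbal :: "('a \<Rightarrow> 'a \<Rightarrow> 'a) \<Rightarrow> bool" where
  "tbal \<equiv> balanced (tot A) (\<lambda>r x. x \<otimes>\<^bsub>tot A\<^esub> sproj r) (\<lambda>r y. y \<otimes>\<^bsub>tot A\<^esub> tproj r)"

lemma tbal_balanced_map:
  assumes "tbal f"
  shows "balanced_map A (carrier R) (\<lambda>r a. a \<otimes>\<^bsub>A\<^esub> s r) (\<lambda>r a. a \<otimes>\<^bsub>A\<^esub> t r) (add_monoid A) (\<lambda>x y. rt A (f x y))"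
proof (rule balanced_map_tot[OF ring_total assms])
  show "\<exists>r. \<forall>x\<in>carrier A. x \<otimes>\<^bsub>A\<^esub> s k = x \<otimes>\<^bsub>tot A\<^esub> sproj r \<and> x \<otimes>\<^bsub>A\<^esub> t k = x \<otimes>\<^bsub>tot A\<^esub> tproj r"
    if "k \<in> carrier R" for k
    \<comment> \<open>The element \<open>s k\<close> represents the scalar \<open>k\<close>, because
      its two projections are \<open>s k\<close> and \<open>t k\<close>.\<close>
    using that by (intro exI[of _ "s k"]) simp
qed

lemma lift_tot:
  assumes f: "tbal f" and l: "set l \<subseteq> carrier A \<times> carrier A"
  shows "tensor_lift (add_monoid A) (\<lambda>(x, y). rt A (f x y)) (group_sum T2.T2 l T2.e2) = pair_sum (tot A) l f"
  by (subst T2.lift_sum[OF A.a_comm_group tbal_balanced_map[OF f] l])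
    (simp add: group_sum_add_monoid pair_sum_tot[OF ring_total])

lemma lift_tot_map:
  assumes f: "tbal f" and hk: "\<And>x y. (x, y) \<in> set l \<Longrightarrow> h x \<in> carrier A \<and> k y \<in> carrier A"
  shows "tensor_lift (add_monoid A) (\<lambda>(x, y). rt A (f x y)) (group_sum T2.T2 l (\<lambda>x y. T2.e2 (h x) (k y)))
    = pair_sum (tot A) l (\<lambda>x y. f (h x) (k y))"
proof -
  have "set (map (\<lambda>(x, y). (h x, k y)) l) \<subseteq> carrier A \<times> carrier A" using hk by auto
  from lift_tot[OF f this] show ?thesis by (simp only: group_sum_map pair_sum_map)
qed

lemma lift_tot_rep:
  "tbal f \<Longrightarrow> tensor_lift (add_monoid A) (\<lambda>(x, y). rt A (f x y)) (\<gamma> (rt A a)) = pair_sum (tot A) (rep a) f"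
  by (simp only: rep_rt lift_tot[OF _ rep_set])

lemma rep_rt_arg: "rep (rt A a) = rep a"
  by (simp add: rep_def)

lemma coassoc_sum:
  assumes a: "a \<in> carrier A"
  shows "group_sum T3.T3 (rep a) (\<lambda>x y. group_sum T3.T3 (rep x) (\<lambda>u v. T3.e3 u v y)) =
    group_sum T3.T3 (rep a) (\<lambda>x y. group_sum T3.T3 (rep y) (\<lambda>u v. T3.e3 x u v))"
proof -
  have b: "balanced_tensor A (carrier R) (\<lambda>r a. a \<otimes>\<^bsub>A\<^esub> s r) (\<lambda>r a. a \<otimes>\<^bsub>A\<^esub> t r)" by unfold_locales
  note ca = coprod_add[unfolded tensor_defs]
  have r: "x \<in> carrier A \<Longrightarrow> set (rep x) \<subseteq> carrier A \<times> carrier A \<and> \<gamma> x = group_sum T2.T2 (rep x) T2.e2" for x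
    using rep rep_set by blast
  show ?thesis
    using coassoc[OF a] T3.coprod_fst_sum[OF b b ca r \<gamma>_mult_s rep_set[of a]]
      T3.coprod_snd_sum[OF b b ca r \<gamma>_mult_t rep_set[of a]]
    by (simp add: tensor_defs rep[OF a])
qed

end

text \<open>The maps \<open>p\<close>, \<open>q\<close>, \<open>w\<close> cover both iterated
  coproducts, which differ only in the slots filled by the inner pair.\<close>

lemma (in balanced_tensor3) lift3_tot:
  assumes A: "ring A" and f: "balanced_map3 A K \<rho> \<sigma> K' \<rho>' \<sigma>' (add_monoid A) (\<lambda>x y z. rt A (f x y z))"
    and l: "set l \<subseteq> carrier A \<times> carrier A"
    and r: "\<And>x y. (x, y) \<in> set l \<Longrightarrow> set (r x y) \<subseteq> carrier A \<times> carrier A"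
    and p: "\<And>x y u v. (x, y) \<in> set l \<Longrightarrow> (u, v) \<in> set (r x y) \<Longrightarrow>
      p x y u v \<in> carrier A \<and> q x y u v \<in> carrier A \<and> w x y u v \<in> carrier A"
  shows "tensor_lift (add_monoid A) (\<lambda>(x, y, z). rt A (f x y z))
      (group_sum T3 l (\<lambda>x y. group_sum T3 (r x y) (\<lambda>u v. e3 (p x y u v) (q x y u v) (w x y u v)))) =
    pair_sum (tot A) l (\<lambda>x y. pair_sum (tot A) (r x y) (\<lambda>u v. f (p x y u v) (q x y u v) (w x y u v)))"
proof -
  interpret A: ring A by fact
  note G = A.a_comm_group
  let ?h = "tensor_lift (add_monoid A) (\<lambda>(x, y, z). rt A (f x y z))"
  have c: "e3 (p x y u v) (q x y u v) (w x y u v) \<in> carrier T3" if "(x, y) \<in> set l" "(u, v) \<in> set (r x y)" for x y u v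
    using p[OF that] e3_closed by blast
  have 1: "?h (group_sum T3 (r x y) (\<lambda>u v. e3 (p x y u v) (q x y u v) (w x y u v))) =
     pair_sum A (r x y) (\<lambda>u v. rt A (f (p x y u v) (q x y u v) (w x y u v)))" if "(x, y) \<in> set l" for x y
    by (subst group_sum_hom[OF lift_hom[OF G f]])
      (use c that lift_e3[OF G f] p in \<open>auto simp: group_sum_add_monoid intro!: pair_sum_cong\<close>)
  have "?h (group_sum T3 l (\<lambda>x y. group_sum T3 (r x y) (\<lambda>u v. e3 (p x y u v) (q x y u v) (w x y u v)))) =
    pair_sum A l (\<lambda>x y. ?h (group_sum T3 (r x y) (\<lambda>u v. e3 (p x y u v) (q x y u v) (w x y u v))))"
    by (subst group_sum_hom[OF lift_hom[OF G f]])
      (use c in \<open>auto simp: group_sum_add_monoid intro!: group_sum_closed T.is_monoid\<close>)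
  also have "\<dots> = pair_sum A l (\<lambda>x y. rt A (pair_sum (tot A) (r x y) (\<lambda>u v. f (p x y u v) (q x y u v) (w x y u v))))"
    by (rule pair_sum_cong)
      (simp only: 1 pair_sum_tot[OF A] rt_id[OF A pair_sum_closed[OF A rt_carrier[OF A]]])
  finally show ?thesis by (simp add: pair_sum_tot[OF A, of l])
qed

section \<open>The calculus of functionals becomes available for concrete right bialgebroids\<close>

context right_bialgebroid_ops
begin

interpretation A: ring A by (rule ring_total)
interpretation R: ring R by (rule ring_base)

lemma sum_eq_from_\<gamma>:
  assumes "tbal f" "\<gamma> (rt A a) = group_sum T2.T2 l (\<lambda>x y. T2.e2 (h x) (k y))"
    "\<And>x y. (x, y) \<in> set l \<Longrightarrow> h x \<in> carrier A \<and> k y \<in> carrier A"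
  shows "pair_sum (tot A) (rep a) f = pair_sum (tot A) l (\<lambda>x y. f (h x) (k y))"
proof -
  have "tensor_lift (add_monoid A) (\<lambda>(x, y). rt A (f x y)) (group_sum T2.T2 l (\<lambda>x y. T2.e2 (h x) (k y))) =
    pair_sum (tot A) l (\<lambda>x y. f (h x) (k y))"
    by (rule lift_tot_map[OF assms(1)]) (erule assms(3))
  then show ?thesis using lift_tot_rep[OF assms(1), of a] by (simp only: assms(2))
qed

text \<open>The nested sums are tensors first, and the lift of \<open>f\<close> is a homomorphism on
  tensors; so it is applied to the outer sum and then to each inner one.\<close>

lemma rep_tot_mult:
  assumes f: "tbal f"
  shows "pair_sum (tot A) (rep (a \<otimes>\<^bsub>tot A\<^esub> b)) f =
    pair_sum (tot A) (rep a) (\<lambda>x y. pair_sum (tot A) (rep b) (\<lambda>x' y'. f (x \<otimes>\<^bsub>tot A\<^esub> x') (y \<otimes>\<^bsub>tot A\<^esub> y')))"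
proof -
  let ?h = "tensor_lift (add_monoid A) (\<lambda>(x, y). rt A (f x y))"
  let ?E = "\<lambda>x y. group_sum T2.T2 (rep b) (\<lambda>x' y'. T2.e2 (x \<otimes>\<^bsub>A\<^esub> x') (y \<otimes>\<^bsub>A\<^esub> y'))"
  have eq: "\<gamma> (rt A (a \<otimes>\<^bsub>tot A\<^esub> b)) = group_sum T2.T2 (rep a) ?E"
    using \<gamma>_mult[of "rt A a" "rt A b"] by (simp add: rep_rt_arg)
  have hom: "group_hom T2.T2 (add_monoid A) ?h"
    by (rule T2.lift_hom[OF A.a_comm_group tbal_balanced_map[OF f]])
  have "pair_sum (tot A) (rep (a \<otimes>\<^bsub>tot A\<^esub> b)) f = ?h (group_sum T2.T2 (rep a) ?E)"
    using lift_tot_rep[OF f, of "a \<otimes>\<^bsub>tot A\<^esub> b"] by (simp only: eq)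
  also have "\<dots> = group_sum (add_monoid A) (rep a) (\<lambda>x y. ?h (?E x y))"
    by (rule group_sum_hom[OF hom], rule group_sum_closed[OF T2.T.is_monoid])
      (use rep_carrier in \<open>simp add: T2.e2_closed\<close>)
  also have "\<dots> = pair_sum A (rep a) (\<lambda>x y. ?h (?E x y))"
    by (rule group_sum_add_monoid)
  also have "\<dots> = pair_sum A (rep a) (\<lambda>x y. rt A (pair_sum (tot A) (rep b) (\<lambda>x' y'. f (x \<otimes>\<^bsub>tot A\<^esub> x') (y \<otimes>\<^bsub>tot A\<^esub> y'))))"
  proof (rule pair_sum_cong)
    fix x y assume "(x, y) \<in> set (rep a)"
    then have xy: "x \<in> carrier A" "y \<in> carrier A" using rep_carrier by auto
    have "?h (?E x y) = pair_sum (tot A) (rep b) (\<lambda>x' y'. f (x \<otimes>\<^bsub>A\<^esub> x') (y \<otimes>\<^bsub>A\<^esub> y'))"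
      by (rule lift_tot_map[OF f]) (use xy rep_carrier in auto)
    also have "\<dots> = pair_sum (tot A) (rep b) (\<lambda>x' y'. f (x \<otimes>\<^bsub>tot A\<^esub> x') (y \<otimes>\<^bsub>tot A\<^esub> y'))"
      by (rule pair_sum_cong) (use xy rep_carrier in auto)
    also have "\<dots> = rt A \<dots>"
      by (simp add: pair_sum_tot[OF ring_total] pair_sum_closed[OF ring_total])
    finally show "?h (?E x y) = rt A (pair_sum (tot A) (rep b) (\<lambda>x' y'. f (x \<otimes>\<^bsub>tot A\<^esub> x') (y \<otimes>\<^bsub>tot A\<^esub> y')))" .
  qed
  finally show ?thesis by (simp only: pair_sum_tot[OF ring_total, of "rep a"])
qed

lemma lift_add_rep:
  assumes a: "a \<in> carrier A" and g: "\<And>x y. x \<in> carrier A \<Longrightarrow> y \<in> carrier A \<Longrightarrow> g x y \<in> carrier A"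
    "\<And>x x' y. x \<in> carrier A \<Longrightarrow> x' \<in> carrier A \<Longrightarrow> y \<in> carrier A \<Longrightarrow> g (x \<oplus>\<^bsub>A\<^esub> x') y = g x y \<oplus>\<^bsub>A\<^esub> g x' y"
    "\<And>x y y'. x \<in> carrier A \<Longrightarrow> y \<in> carrier A \<Longrightarrow> y' \<in> carrier A \<Longrightarrow> g x (y \<oplus>\<^bsub>A\<^esub> y') = g x y \<oplus>\<^bsub>A\<^esub> g x y'"
    "\<And>r x y. r \<in> carrier R \<Longrightarrow> x \<in> carrier A \<Longrightarrow> y \<in> carrier A \<Longrightarrow> g (x \<otimes>\<^bsub>A\<^esub> s r) y = g x (y \<otimes>\<^bsub>A\<^esub> t r)"
  shows "tensor_lift (add_monoid A) (\<lambda>(x, y). g x y) (\<gamma> a) = pair_sum A (rep a) g"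
proof -
  have "balanced_map A (carrier R) (\<lambda>r a. a \<otimes>\<^bsub>A\<^esub> s r) (\<lambda>r a. a \<otimes>\<^bsub>A\<^esub> t r) (add_monoid A) g"
    using g by (simp add: balanced_map_def)
  from lift_rep[OF a A.a_comm_group this] show ?thesis by (simp only: group_sum_add_monoid)
qed

theorem sweedler: "right_sweedler (tot A) sproj tproj rep"
proof -
  interpret T: total_ring "tot A" by (rule total_ring_tot[OF ring_total])
  have cadd: "\<pi> (rt A x \<oplus>\<^bsub>A\<^esub> rt A y) = \<pi> (rt A x) \<oplus>\<^bsub>R\<^esub> \<pi> (rt A y)" for x y by (simp add: \<pi>_add)
  show ?thesis
  proof (unfold_locales)
    fix x y a b
    show "sproj (x \<oplus>\<^bsub>tot A\<^esub> y) = sproj x \<oplus>\<^bsub>tot A\<^esub> sproj y" "tproj (x \<oplus>\<^bsub>tot A\<^esub> y) = tproj x \<oplus>\<^bsub>tot A\<^esub> tproj y"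
      by (simp_all add: sproj_def tproj_def \<pi>_add s_add t_add)
    show "sproj \<zero>\<^bsub>tot A\<^esub> = \<zero>\<^bsub>tot A\<^esub>" "tproj \<zero>\<^bsub>tot A\<^esub> = \<zero>\<^bsub>tot A\<^esub>" by (simp_all add: sproj_def tproj_def)
    show "sproj x \<oplus>\<^bsub>tot A\<^esub> \<zero>\<^bsub>tot A\<^esub> = sproj x" "tproj x \<oplus>\<^bsub>tot A\<^esub> \<zero>\<^bsub>tot A\<^esub> = tproj x" by simp_all
    show "sproj (sproj x) = sproj x" "sproj (tproj x) = sproj x" "tproj (sproj x) = tproj x" "tproj (tproj x) = tproj x"
      by (simp_all add: sproj_def tproj_def)
    show "sproj \<one>\<^bsub>tot A\<^esub> = \<one>\<^bsub>tot A\<^esub>" "tproj \<one>\<^bsub>tot A\<^esub> = \<one>\<^bsub>tot A\<^esub>" by (simp_all add: sproj_def tproj_def counit_one)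
    show "sproj x \<otimes>\<^bsub>tot A\<^esub> tproj y = tproj y \<otimes>\<^bsub>tot A\<^esub> sproj x"
      by (simp add: sproj_def tproj_def src_tgt_comm)
    show "sproj (a \<otimes>\<^bsub>tot A\<^esub> sproj b) = sproj a \<otimes>\<^bsub>tot A\<^esub> sproj b" "sproj (a \<otimes>\<^bsub>tot A\<^esub> tproj b) = sproj b \<otimes>\<^bsub>tot A\<^esub> sproj a"
      "tproj (a \<otimes>\<^bsub>tot A\<^esub> sproj b) = tproj b \<otimes>\<^bsub>tot A\<^esub> tproj a" "tproj (a \<otimes>\<^bsub>tot A\<^esub> tproj b) = tproj a \<otimes>\<^bsub>tot A\<^esub> tproj b"
      by (simp_all add: sproj_def tproj_def \<pi>_mult_s \<pi>_mult_t s_mult t_mult)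
    show "sproj (sproj a \<otimes>\<^bsub>tot A\<^esub> b) = sproj (a \<otimes>\<^bsub>tot A\<^esub> b)" "sproj (tproj a \<otimes>\<^bsub>tot A\<^esub> b) = sproj (a \<otimes>\<^bsub>tot A\<^esub> b)"
      by (simp_all add: sproj_def tproj_def counit_src counit_tgt)
  next
    fix a
    have "pair_sum (tot A) (rep a) (\<lambda>x y. y \<otimes>\<^bsub>tot A\<^esub> tproj x) = pair_sum A (rep a) (\<lambda>x y. y \<otimes>\<^bsub>A\<^esub> t (\<pi> x))"
      unfolding pair_sum_tot[OF ring_total] by (rule pair_sum_cong) (use rep_carrier in \<open>auto simp: tproj_def\<close>)
    also have "\<dots> = tensor_lift (add_monoid A) (\<lambda>(x, y). y \<otimes>\<^bsub>A\<^esub> t (\<pi> x)) (\<gamma> (rt A a))"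
      by (subst lift_add_rep) (auto simp: rep_rt_arg A.l_distr A.r_distr \<pi>_add t_add \<pi>_mult_s t_mult A.m_assoc)
    finally show "pair_sum (tot A) (rep a) (\<lambda>x y. y \<otimes>\<^bsub>tot A\<^esub> tproj x) = a \<oplus>\<^bsub>tot A\<^esub> \<zero>\<^bsub>tot A\<^esub>"
      using counit_left[of "rt A a"] by simp
    have "pair_sum (tot A) (rep a) (\<lambda>x y. x \<otimes>\<^bsub>tot A\<^esub> sproj y) = pair_sum A (rep a) (\<lambda>x y. x \<otimes>\<^bsub>A\<^esub> s (\<pi> y))"
      unfolding pair_sum_tot[OF ring_total] by (rule pair_sum_cong) (use rep_carrier in \<open>auto simp: sproj_def\<close>)
    also have "\<dots> = tensor_lift (add_monoid A) (\<lambda>(x, y). x \<otimes>\<^bsub>A\<^esub> s (\<pi> y)) (\<gamma> (rt A a))"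
      by (subst lift_add_rep) (auto simp: rep_rt_arg A.l_distr A.r_distr \<pi>_add s_add \<pi>_mult_t s_mult A.m_assoc)
    finally show "pair_sum (tot A) (rep a) (\<lambda>x y. x \<otimes>\<^bsub>tot A\<^esub> sproj y) = a \<oplus>\<^bsub>tot A\<^esub> \<zero>\<^bsub>tot A\<^esub>"
      using counit_right[of "rt A a"] by simp
  next
    fix g a
    assume g: "balanced3 (tot A) (\<lambda>r x. x \<otimes>\<^bsub>tot A\<^esub> sproj r) (\<lambda>r y. y \<otimes>\<^bsub>tot A\<^esub> tproj r)
       (\<lambda>r x. x \<otimes>\<^bsub>tot A\<^esub> sproj r) (\<lambda>r y. y \<otimes>\<^bsub>tot A\<^esub> tproj r) g"
    have ex: "\<exists>r. \<forall>x\<in>carrier A. x \<otimes>\<^bsub>A\<^esub> s k = x \<otimes>\<^bsub>tot A\<^esub> sproj r \<and> x \<otimes>\<^bsub>A\<^esub> t k = x \<otimes>\<^bsub>tot A\<^esub> tproj r"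
      if "k \<in> carrier R" for k
      using that by (intro exI[of _ "s k"]) simp
    have bg: "balanced_map3 A (carrier R) (\<lambda>r a. a \<otimes>\<^bsub>A\<^esub> s r) (\<lambda>r a. a \<otimes>\<^bsub>A\<^esub> t r) (carrier R) (\<lambda>r a. a \<otimes>\<^bsub>A\<^esub> s r)
        (\<lambda>r a. a \<otimes>\<^bsub>A\<^esub> t r) (add_monoid A) (\<lambda>x y z. rt A (g x y z))"
      by (rule balanced_map3_tot[OF ring_total g ex ex])
    have l: "set (rep (rt A a)) \<subseteq> carrier A \<times> carrier A" by (rule rep_set)
    have "tensor_lift (add_monoid A) (\<lambda>(x, y, z). rt A (g x y z)) (group_sum T3.T3 (rep (rt A a))
          (\<lambda>x y. group_sum T3.T3 (rep x) (\<lambda>u v. T3.e3 u v y))) =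
        pair_sum (tot A) (rep (rt A a)) (\<lambda>x y. pair_sum (tot A) (rep x) (\<lambda>u v. g u v y))"
      by (rule T3.lift3_tot[OF ring_total bg l rep_set]) (use rep_carrier in blast)
    moreover have "tensor_lift (add_monoid A) (\<lambda>(x, y, z). rt A (g x y z)) (group_sum T3.T3 (rep (rt A a))
          (\<lambda>x y. group_sum T3.T3 (rep y) (\<lambda>u v. T3.e3 x u v))) =
        pair_sum (tot A) (rep (rt A a)) (\<lambda>x y. pair_sum (tot A) (rep y) (\<lambda>u v. g x u v))"
      by (rule T3.lift3_tot[OF ring_total bg l rep_set]) (use rep_carrier in blast)
    ultimately show "pair_sum (tot A) (rep a) (\<lambda>x y. pair_sum (tot A) (rep x) (\<lambda>u v. g u v y)) =
      pair_sum (tot A) (rep a) (\<lambda>x y. pair_sum (tot A) (rep y) (\<lambda>u v. g x u v))"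
      using coassoc_sum[of "rt A a"] by (simp only: rep_rt_arg rt_carrier[OF ring_total])
  next
    fix f a b r
    assume f: "tbal f"
    show "pair_sum (tot A) (rep (a \<otimes>\<^bsub>tot A\<^esub> b)) f =
      pair_sum (tot A) (rep a) (\<lambda>x y. pair_sum (tot A) (rep b) (\<lambda>x' y'. f (x \<otimes>\<^bsub>tot A\<^esub> x') (y \<otimes>\<^bsub>tot A\<^esub> y')))"
      by (rule rep_tot_mult[OF f])
    interpret h: group_hom T2.T2 "add_monoid A" "tensor_lift (add_monoid A) (\<lambda>(x, y). rt A (f x y))"
      by (rule T2.lift_hom[OF A.a_comm_group tbal_balanced_map[OF f]])
    show "pair_sum (tot A) (rep (a \<oplus>\<^bsub>tot A\<^esub> b)) f = pair_sum (tot A) (rep a) f \<oplus>\<^bsub>tot A\<^esub> pair_sum (tot A) (rep b) f"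
    proof -
      have "\<gamma> (rt A (a \<oplus>\<^bsub>tot A\<^esub> b)) = \<gamma> (rt A a) \<otimes>\<^bsub>T2.T2\<^esub> \<gamma> (rt A b)" by (simp add: \<gamma>_add)
      then have "pair_sum (tot A) (rep (a \<oplus>\<^bsub>tot A\<^esub> b)) f = pair_sum (tot A) (rep a) f \<oplus>\<^bsub>A\<^esub> pair_sum (tot A) (rep b) f"
        using h.hom_mult[OF \<gamma>_closed[of "rt A a"] \<gamma>_closed[of "rt A b"]]
        by (simp flip: lift_tot_rep[OF f] del: tot_simps)
      then show ?thesis by (simp add: pair_sum_tot[OF ring_total] pair_sum_closed[OF ring_total])
    qed
    show "pair_sum (tot A) (rep \<zero>\<^bsub>tot A\<^esub>) f = \<zero>\<^bsub>tot A\<^esub>"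
    proof -
      have z: "\<zero>\<^bsub>A\<^esub> \<in> carrier A" by simp
      have "\<gamma> \<zero>\<^bsub>A\<^esub> = \<gamma> \<zero>\<^bsub>A\<^esub> \<otimes>\<^bsub>T2.T2\<^esub> \<gamma> \<zero>\<^bsub>A\<^esub>" using \<gamma>_add[OF z z] by simp
      then have "\<gamma> \<zero>\<^bsub>A\<^esub> = \<one>\<^bsub>T2.T2\<^esub>"
        using \<gamma>_closed[OF z] by (metis T2.T.r_cancel_one')
      then show ?thesis using lift_tot_rep[OF f, of "\<zero>\<^bsub>A\<^esub>"] h.hom_one by simp
    qed
    show "pair_sum (tot A) (rep (a \<otimes>\<^bsub>tot A\<^esub> sproj r)) f = pair_sum (tot A) (rep a) (\<lambda>x y. f x (y \<otimes>\<^bsub>tot A\<^esub> sproj r))"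
    proof -
      have "\<gamma> (rt A (a \<otimes>\<^bsub>tot A\<^esub> sproj r)) = group_sum T2.T2 (rep a) (\<lambda>x y. T2.e2 x (y \<otimes>\<^bsub>A\<^esub> sproj r))"
        using \<gamma>_mult_s[of "rt A a" "\<pi> (rt A r)"] by (simp add: sproj_def rep_rt_arg)
      from sum_eq_from_\<gamma>[OF f this] show ?thesis
        using rep_carrier by (auto intro!: pair_sum_cong)
    qed
    show "pair_sum (tot A) (rep (a \<otimes>\<^bsub>tot A\<^esub> tproj r)) f = pair_sum (tot A) (rep a) (\<lambda>x y. f (x \<otimes>\<^bsub>tot A\<^esub> tproj r) y)"
    proof -
      have "\<gamma> (rt A (a \<otimes>\<^bsub>tot A\<^esub> tproj r)) = group_sum T2.T2 (rep a) (\<lambda>x y. T2.e2 (x \<otimes>\<^bsub>A\<^esub> tproj r) y)"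
        using \<gamma>_mult_t[of "rt A a" "\<pi> (rt A r)"] by (simp add: tproj_def rep_rt_arg)
      from sum_eq_from_\<gamma>[OF f this] show ?thesis
        using rep_carrier by (auto intro!: pair_sum_cong)
    qed
    show "pair_sum (tot A) (rep a) (\<lambda>x y. f (sproj r \<otimes>\<^bsub>tot A\<^esub> x) y) = pair_sum (tot A) (rep a) (\<lambda>x y. f x (tproj r \<otimes>\<^bsub>tot A\<^esub> y))"
    proof -
      have "pair_sum (tot A) (rep a) (\<lambda>x y. f (sproj r \<otimes>\<^bsub>tot A\<^esub> x) y) =
         pair_sum (tot A) (rep a) (\<lambda>x y. f (sproj r \<otimes>\<^bsub>A\<^esub> x) y)"
        using rep_carrier by (intro pair_sum_cong) auto
      also have "\<dots> = tensor_lift (add_monoid A) (\<lambda>(x, y). rt A (f x y))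
          (group_sum T2.T2 (rep a) (\<lambda>x y. T2.e2 (sproj r \<otimes>\<^bsub>A\<^esub> x) y))"
        by (rule lift_tot_map[OF f, symmetric]) (use rep_carrier in auto)
      also have "\<dots> = tensor_lift (add_monoid A) (\<lambda>(x, y). rt A (f x y))
          (group_sum T2.T2 (rep a) (\<lambda>x y. T2.e2 x (tproj r \<otimes>\<^bsub>A\<^esub> y)))"
        using \<gamma>_takeuchi[of "rt A a" "\<pi> (rt A r)"]
        by (simp only: rep_rt_arg sproj_def tproj_def rt_carrier[OF ring_total] \<pi>_closed)
      also have "\<dots> = pair_sum (tot A) (rep a) (\<lambda>x y. f x (tproj r \<otimes>\<^bsub>A\<^esub> y))"
        by (rule lift_tot_map[OF f]) (use rep_carrier in auto)
      also have "\<dots> = pair_sum (tot A) (rep a) (\<lambda>x y. f x (tproj r \<otimes>\<^bsub>tot A\<^esub> y))"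
        using rep_carrier by (intro pair_sum_cong) auto
      finally show ?thesis .
    qed
    show "pair_sum (tot A) (rep \<one>\<^bsub>tot A\<^esub>) f = f \<one>\<^bsub>tot A\<^esub> \<one>\<^bsub>tot A\<^esub> \<oplus>\<^bsub>tot A\<^esub> \<zero>\<^bsub>tot A\<^esub>"
      using sum_eq_from_\<gamma>[OF f, of "\<one>\<^bsub>A\<^esub>" "[(\<one>\<^bsub>A\<^esub>, \<one>\<^bsub>A\<^esub>)]" "\<lambda>x. x" "\<lambda>x. x"] coprod_one
      by (simp add: tensor_defs T2.e2_closed)
  qed
qed

end

text \<open>On the opposite ring left multiplications become right multiplications. The source acts
  there as the target and conversely, while base, coproduct and counit stay the same.\<close>

lemma left_imp_right_opp:
  assumes "left_bialgebroid_ops A L s t \<gamma> \<pi>"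
  shows "right_bialgebroid_ops (opp_ring A) L t s \<gamma> \<pi>"
proof -
  interpret left_bialgebroid_ops A L s t \<gamma> \<pi> by fact
  interpret A: ring A by (rule ring_total)
  interpret L: ring L by (rule ring_base)
  \<comment> \<open>The relations use only the addition of the ring, so the tensor products of a
    ring and its opposite are equal and need no identification.\<close>
  have rels: "tensor2_rels (opp_ring A) K \<rho> \<sigma> = tensor2_rels A K \<rho> \<sigma>" for K :: "'b set" and \<rho> \<sigma>
    by (simp add: tensor2_rels_def)
  have rels3: "tensor3_rels (opp_ring A) K \<rho> \<sigma> K' \<rho>' \<sigma>' = tensor3_rels A K \<rho> \<sigma> K' \<rho>' \<sigma>'"
    for K K' :: "'b set" and \<rho> \<sigma> \<rho>' \<sigma>'
    by (simp add: tensor3_rels_def)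
  have T: "rtensor (opp_ring A) L t s = ltensor A L s t" "rtens (opp_ring A) L t s = ltens A L s t"
    "rtensor3 (opp_ring A) L t s = ltensor3 A L s t" "rtens3 (opp_ring A) L t s = ltens3 A L s t"
    by (simp_all add: rtensor_def ltensor_def rtens_def[abs_def] ltens_def[abs_def] tensor2_def tensor2_null_def
        tens2_def[abs_def] rels rels3 rtensor3_def ltensor3_def rtens3_def[abs_def] ltens3_def[abs_def]
        tensor3_def tensor3_null_def tens3_def[abs_def])
  have hom: "add_monoid (opp_ring A) = add_monoid A" by simp
  have st: "s l \<in> carrier A" "t l \<in> carrier A" if "l \<in> carrier L" for l
    using src_hom tgt_hom that by (auto simp: ring_hom_def)
  show ?thesis
  proof (rule right_bialgebroid_ops.intro, unfold T hom)
    show "ring (opp_ring A)" by (rule ring_opp_ring[OF ring_total])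
    show "ring L" by (rule ring_base)
    show "t \<in> ring_hom L (opp_ring A)" "s \<in> ring_hom (opp_ring L) (opp_ring A)"
      using src_hom tgt_hom by (auto simp: ring_hom_def)
    show "\<gamma> \<in> hom (add_monoid A) (ltensor A L s t)" by (rule coprod_add)
    show "\<pi> \<in> hom (add_monoid A) (add_monoid L)" by (rule counit_add)
    fix a b r r'
    show "\<lbrakk>r \<in> carrier L; r' \<in> carrier L\<rbrakk> \<Longrightarrow> t r \<otimes>\<^bsub>opp_ring A\<^esub> s r' = s r' \<otimes>\<^bsub>opp_ring A\<^esub> t r"
      using src_tgt_comm by simp
    show "\<lbrakk>a \<in> carrier (opp_ring A); r \<in> carrier L; r' \<in> carrier L\<rbrakk> \<Longrightarrow>
      \<gamma> (a \<otimes>\<^bsub>opp_ring A\<^esub> t r' \<otimes>\<^bsub>opp_ring A\<^esub> s r) = tensor_lift (ltensor A L s t)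
        (\<lambda>(x, y). ltens A L s t (x \<otimes>\<^bsub>opp_ring A\<^esub> s r) (y \<otimes>\<^bsub>opp_ring A\<^esub> t r')) (\<gamma> a)"
      using coprod_bimod[of a r r'] by (simp add: A.m_assoc st)
    show "\<lbrakk>a \<in> carrier (opp_ring A); r \<in> carrier L; r' \<in> carrier L\<rbrakk> \<Longrightarrow>
      \<pi> (a \<otimes>\<^bsub>opp_ring A\<^esub> t r' \<otimes>\<^bsub>opp_ring A\<^esub> s r) = r \<otimes>\<^bsub>L\<^esub> \<pi> a \<otimes>\<^bsub>L\<^esub> r'"
      using counit_bimod[of a r r'] by (simp add: A.m_assoc st)
    show "a \<in> carrier (opp_ring A) \<Longrightarrow> coprod_fst (ltensor3 A L s t) (ltens3 A L s t) \<gamma> (\<gamma> a) =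
      coprod_snd (ltensor3 A L s t) (ltens3 A L s t) \<gamma> (\<gamma> a)"
      using coassoc by simp
    show "a \<in> carrier (opp_ring A) \<Longrightarrow> tensor_lift (add_monoid A) (\<lambda>(x, y). y \<otimes>\<^bsub>opp_ring A\<^esub> s (\<pi> x)) (\<gamma> a) = a"
      using counit_left[of a] by simp
    show "a \<in> carrier (opp_ring A) \<Longrightarrow> tensor_lift (add_monoid A) (\<lambda>(x, y). x \<otimes>\<^bsub>opp_ring A\<^esub> t (\<pi> y)) (\<gamma> a) = a"
      using counit_right[of a] by simp
    show "\<lbrakk>a \<in> carrier (opp_ring A); r \<in> carrier L\<rbrakk> \<Longrightarrow>
      tensor_lift (ltensor A L s t) (\<lambda>(x, y). ltens A L s t (t r \<otimes>\<^bsub>opp_ring A\<^esub> x) y) (\<gamma> a) =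
      tensor_lift (ltensor A L s t) (\<lambda>(x, y). ltens A L s t x (s r \<otimes>\<^bsub>opp_ring A\<^esub> y)) (\<gamma> a)"
      using takeuchi by simp
    show "\<gamma> \<one>\<^bsub>opp_ring A\<^esub> = ltens A L s t \<one>\<^bsub>opp_ring A\<^esub> \<one>\<^bsub>opp_ring A\<^esub>" by (simp add: coprod_one)
    show "\<lbrakk>a \<in> carrier (opp_ring A); b \<in> carrier (opp_ring A)\<rbrakk> \<Longrightarrow> \<gamma> (a \<otimes>\<^bsub>opp_ring A\<^esub> b) =
      tensor_lift (ltensor A L s t) (\<lambda>(x, y). tensor_lift (ltensor A L s t)
        (\<lambda>(x', y'). ltens A L s t (x \<otimes>\<^bsub>opp_ring A\<^esub> x') (y \<otimes>\<^bsub>opp_ring A\<^esub> y')) (\<gamma> b)) (\<gamma> a)"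
      using coprod_mult[of b a] by simp
    show "\<pi> \<one>\<^bsub>opp_ring A\<^esub> = \<one>\<^bsub>L\<^esub>" by (simp add: counit_one)
    show "\<lbrakk>a \<in> carrier (opp_ring A); b \<in> carrier (opp_ring A)\<rbrakk> \<Longrightarrow> \<pi> (t (\<pi> a) \<otimes>\<^bsub>opp_ring A\<^esub> b) = \<pi> (a \<otimes>\<^bsub>opp_ring A\<^esub> b)"
      "\<lbrakk>a \<in> carrier (opp_ring A); b \<in> carrier (opp_ring A)\<rbrakk> \<Longrightarrow> \<pi> (s (\<pi> a) \<otimes>\<^bsub>opp_ring A\<^esub> b) = \<pi> (a \<otimes>\<^bsub>opp_ring A\<^esub> b)"
      using counit_src counit_tgt by simp_all
  qed
qed

section \<open>Left bialgebroids modelled on the functionals of a right bialgebroid\<close>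

text \<open>
  \<open>F\<close> identifies the total ring \<open>X\<close> with the functionals on \<open>T\<close>, and \<open>\<kappa>\<close> the base ring with
  the image of the source map. The coproduct of \<open>b\<close> is characterised by the rule \<open>l_eval\<close>,
  since by the dual basis a tensor is determined by its evaluations.
\<close>

locale dual_model = right_sweedler T P Q c
  for T :: "'a ring" (structure) and P Q :: "'a \<Rightarrow> 'a" and c +
  fixes A :: "'a ring" and db :: "('a \<times> ('a \<Rightarrow> 'a)) list"
    and X :: "'b ring" and K :: "'k ring" and s t :: "'k \<Rightarrow> 'b"
    and \<gamma> :: "'b \<Rightarrow> ('b \<times> 'b) frag set" and \<pi> :: "'b \<Rightarrow> 'k"
    and F :: "'b \<Rightarrow> 'a \<Rightarrow> 'a" and \<kappa> :: "'k \<Rightarrow> 'a" and l :: "'b \<Rightarrow> ('b \<times> 'b) list"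
  assumes ring_A: "ring A" and T_eq: "T = tot A"
    and db_functional: "(d, e) \<in> set db \<Longrightarrow> functional e"
    and db_sum: "ps db (\<lambda>d e. d \<otimes> e x) = x \<oplus> \<zero>"
    and F_bij: "bij_betw F (carrier X) (Collect functional)"
    and X_add: "a \<in> carrier X \<Longrightarrow> b \<in> carrier X \<Longrightarrow> a \<oplus>\<^bsub>X\<^esub> b \<in> carrier X"
    and F_add: "a \<in> carrier X \<Longrightarrow> b \<in> carrier X \<Longrightarrow> F (a \<oplus>\<^bsub>X\<^esub> b) = (\<lambda>x. F a x \<oplus> F b x)"
    and X_mult: "a \<in> carrier X \<Longrightarrow> b \<in> carrier X \<Longrightarrow> a \<otimes>\<^bsub>X\<^esub> b \<in> carrier X"
    and F_mult: "a \<in> carrier X \<Longrightarrow> b \<in> carrier X \<Longrightarrow> F (a \<otimes>\<^bsub>X\<^esub> b) = (\<lambda>x. F a (hit (F b) x))"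
    and X_one: "\<one>\<^bsub>X\<^esub> \<in> carrier X" and F_one: "F \<one>\<^bsub>X\<^esub> = P"
    and X_zero: "\<zero>\<^bsub>X\<^esub> \<in> carrier X" and F_zero: "F \<zero>\<^bsub>X\<^esub> = (\<lambda>x. \<zero>)"
    and ring_K: "ring K" and \<kappa>_bij: "bij_betw \<kappa> (carrier K) {x. P x = x}"
    and \<kappa>_add: "k \<in> carrier K \<Longrightarrow> k' \<in> carrier K \<Longrightarrow> \<kappa> (k \<oplus>\<^bsub>K\<^esub> k') = \<kappa> k \<oplus> \<kappa> k'"
    and \<kappa>_mult: "k \<in> carrier K \<Longrightarrow> k' \<in> carrier K \<Longrightarrow> \<kappa> (k \<otimes>\<^bsub>K\<^esub> k') = \<kappa> k \<otimes> \<kappa> k'"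
    and \<kappa>_one: "\<kappa> \<one>\<^bsub>K\<^esub> = \<one>"
    and s_closed [simp]: "k \<in> carrier K \<Longrightarrow> s k \<in> carrier X" and F_s: "k \<in> carrier K \<Longrightarrow> F (s k) = (\<lambda>x. \<kappa> k \<otimes> P x)"
    and t_closed [simp]: "k \<in> carrier K \<Longrightarrow> t k \<in> carrier X" and F_t: "k \<in> carrier K \<Longrightarrow> F (t k) = (\<lambda>x. P (\<kappa> k \<otimes> x))"
    and \<pi>_closed [simp]: "b \<in> carrier X \<Longrightarrow> \<pi> b \<in> carrier K" and \<kappa>_\<pi>: "b \<in> carrier X \<Longrightarrow> \<kappa> (\<pi> b) = F b \<one>"
    and \<gamma>_rep: "b \<in> carrier X \<Longrightarrow> \<gamma> b = group_sum (ltensor X K s t) (l b) (ltens X K s t)"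
    and l_set: "b \<in> carrier X \<Longrightarrow> set (l b) \<subseteq> carrier X \<times> carrier X"
    and l_eval: "b \<in> carrier X \<Longrightarrow> ps (l b) (\<lambda>u v. F u (F v x \<otimes> y)) = F b (x \<otimes> y)"
begin

interpretation A: ring A by (rule ring_A)
interpretation K: ring K by (rule ring_K)

lemma carrier_A_iff: "x \<in> carrier A \<longleftrightarrow> x \<oplus> \<zero> = x"
  by (auto simp: T_eq tot_simps[OF ring_A] rt_def)

lemma F_fun: "b \<in> carrier X \<Longrightarrow> functional (F b)"
  using F_bij by (auto simp: bij_betw_def)

lemmas FD = functionalD[OF F_fun]

lemma F_inj: "a \<in> carrier X \<Longrightarrow> b \<in> carrier X \<Longrightarrow> F a = F b \<Longrightarrow> a = b"
  using F_bij by (auto simp: bij_betw_def inj_on_def)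

lemma F_eqI: "a \<in> carrier X \<Longrightarrow> b \<in> carrier X \<Longrightarrow> (\<And>x. F a x = F b x) \<Longrightarrow> a = b"
  by (rule F_inj) auto

lemma \<kappa>_P [simp]: "k \<in> carrier K \<Longrightarrow> P (\<kappa> k) = \<kappa> k"
  using \<kappa>_bij by (auto simp: bij_betw_def)

lemma \<kappa>_inj: "k \<in> carrier K \<Longrightarrow> k' \<in> carrier K \<Longrightarrow> \<kappa> k = \<kappa> k' \<Longrightarrow> k = k'"
  using \<kappa>_bij by (auto simp: bij_betw_def inj_on_def)

lemma \<kappa>_closed [simp]: "k \<in> carrier K \<Longrightarrow> \<kappa> k \<oplus> \<zero> = \<kappa> k"
  by (metis \<kappa>_P P_closed)

definition inv_F :: "('a \<Rightarrow> 'a) \<Rightarrow> 'b" where "inv_F f = inv_into (carrier X) F f"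
definition inv_\<kappa> :: "'a \<Rightarrow> 'k" where "inv_\<kappa> x = inv_into (carrier K) \<kappa> x"

lemma inv_F: "functional f \<Longrightarrow> inv_F f \<in> carrier X" "functional f \<Longrightarrow> F (inv_F f) = f"
  using F_bij bij_betw_inv_into_right[OF F_bij] bij_betw_apply[OF bij_betw_inv_into[OF F_bij]]
  by (auto simp: inv_F_def)

lemma inv_\<kappa>: "P x = x \<Longrightarrow> inv_\<kappa> x \<in> carrier K" "P x = x \<Longrightarrow> \<kappa> (inv_\<kappa> x) = x"
  using bij_betw_inv_into_right[OF \<kappa>_bij] bij_betw_apply[OF bij_betw_inv_into[OF \<kappa>_bij]]
  by (auto simp: inv_\<kappa>_def)

lemma hit_\<kappa>: "functional f \<Longrightarrow> k \<in> carrier K \<Longrightarrow> hit f (\<kappa> k \<otimes> x) = \<kappa> k \<otimes> hit f x"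
  by (metis hit_P_mult \<kappa>_P)

lemma F_s_mult: "k \<in> carrier K \<Longrightarrow> b \<in> carrier X \<Longrightarrow> F (s k \<otimes>\<^bsub>X\<^esub> b) = (\<lambda>x. \<kappa> k \<otimes> F b x)"
  by (rule ext) (simp add: F_mult F_s P_hit F_fun)

lemma F_t_mult: "k \<in> carrier K \<Longrightarrow> b \<in> carrier X \<Longrightarrow> F (t k \<otimes>\<^bsub>X\<^esub> b) = (\<lambda>x. F b (\<kappa> k \<otimes> x))"
  by (rule ext) (simp add: F_mult F_t P_hit F_fun flip: hit_\<kappa>)

lemma hit_F_s: "k \<in> carrier K \<Longrightarrow> hit (F (s k)) x = x \<otimes> Q (\<kappa> k)"
  using hit_source[of "\<kappa> k"] by (simp add: F_s)

lemma hit_F_t: "k \<in> carrier K \<Longrightarrow> hit (F (t k)) x = Q (\<kappa> k) \<otimes> x"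
  using hit_target[of "\<kappa> k"] by (simp add: F_t)

text \<open>The abstract setting has no negation, so the negative is formed in the ring
  \<open>A\<close> that underlies \<open>T\<close>.\<close>

lemma functional_neg: "functional f \<Longrightarrow> \<exists>g. functional g \<and> (\<forall>x. g x \<oplus> f x = \<zero>)"
proof -
  assume f: "functional f"
  note fD = functionalD[OF f]
  note ts = T_eq tot_simps[OF ring_A] rt_carrier[OF ring_A] rt_id[OF ring_A] rt_rt[OF ring_A]
  let ?g = "\<lambda>x. f (\<ominus>\<^bsub>A\<^esub> rt A x)"
  have "functional ?g"
  proof (rule functionalI)
    fix x y r
    show "?g (x \<oplus> y) = ?g x \<oplus> ?g y"
      by (subst fD(1)[symmetric]) (simp add: ts A.minus_add)
    show "?g (x \<otimes> P r) = ?g x \<otimes> P r"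
      by (subst fD(4)[symmetric]) (simp add: ts A.l_minus rt_carrier[OF ring_A])
  qed (use fD in \<open>simp_all add: ts\<close>)
  moreover have "?g x \<oplus> f x = \<zero>" for x
  proof -
    have "?g x \<oplus> f x = f (\<ominus>\<^bsub>A\<^esub> rt A x \<oplus> x)" by (simp add: fD)
    also have "\<ominus>\<^bsub>A\<^esub> rt A x \<oplus> x = \<zero>" by (simp add: ts A.l_neg)
    finally show ?thesis by (simp add: fD)
  qed
  ultimately show ?thesis by blast
qed

text \<open>The ring laws are compared after applying the injection \<open>F\<close>. Associativity
  of the product is then \<open>hit_hit\<close>, the unit laws are counitality, and negatives exist
  because \<open>F\<close> is onto the functionals.\<close>

lemma ring_X: "ring X"
proof (rule ringI)
  show "abelian_group X"
  proof (rule abelian_groupI)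
    fix x assume x: "x \<in> carrier X"
    obtain g where g: "functional g" "\<And>y. g y \<oplus> F x y = \<zero>" using functional_neg[OF F_fun[OF x]] by blast
    show "\<exists>y\<in>carrier X. y \<oplus>\<^bsub>X\<^esub> x = \<zero>\<^bsub>X\<^esub>"
      by (rule bexI[of _ "inv_F g"], rule F_eqI)
        (use x g inv_F[OF g(1)] in \<open>simp_all add: F_add F_zero X_add X_zero\<close>)
  next
    fix x y z assume "x \<in> carrier X" "y \<in> carrier X" "z \<in> carrier X"
    then show "x \<oplus>\<^bsub>X\<^esub> y \<oplus>\<^bsub>X\<^esub> z = x \<oplus>\<^bsub>X\<^esub> (y \<oplus>\<^bsub>X\<^esub> z)"
      by (intro F_eqI) (simp_all add: X_add F_add add_assoc)
  next
    fix x y assume "x \<in> carrier X" "y \<in> carrier X"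
    then show "x \<oplus>\<^bsub>X\<^esub> y = y \<oplus>\<^bsub>X\<^esub> x"
      by (intro F_eqI) (simp_all add: X_add F_add add_comm[of "F x _"])
  next
    fix x assume "x \<in> carrier X"
    then show "\<zero>\<^bsub>X\<^esub> \<oplus>\<^bsub>X\<^esub> x = x"
      by (intro F_eqI) (simp_all add: X_add X_zero F_add F_zero zero_add FD)
  qed (simp_all add: X_add X_zero)
  show "Group.monoid X"
  proof (rule monoidI)
    fix x y z assume "x \<in> carrier X" "y \<in> carrier X" "z \<in> carrier X"
    then show "x \<otimes>\<^bsub>X\<^esub> y \<otimes>\<^bsub>X\<^esub> z = x \<otimes>\<^bsub>X\<^esub> (y \<otimes>\<^bsub>X\<^esub> z)"
      by (intro F_eqI) (simp_all add: X_mult F_mult hit_hit F_fun)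
  next
    fix x assume "x \<in> carrier X"
    then show "\<one>\<^bsub>X\<^esub> \<otimes>\<^bsub>X\<^esub> x = x" "x \<otimes>\<^bsub>X\<^esub> \<one>\<^bsub>X\<^esub> = x"
      by (intro F_eqI; simp add: X_mult X_one F_mult F_one P_hit F_fun hit_P functional_closed)+
  qed (simp_all add: X_mult X_one)
  fix x y z assume xyz: "x \<in> carrier X" "y \<in> carrier X" "z \<in> carrier X"
  show "(x \<oplus>\<^bsub>X\<^esub> y) \<otimes>\<^bsub>X\<^esub> z = x \<otimes>\<^bsub>X\<^esub> z \<oplus>\<^bsub>X\<^esub> y \<otimes>\<^bsub>X\<^esub> z"
    by (rule F_eqI) (simp_all add: xyz X_add X_mult F_add F_mult)
  show "z \<otimes>\<^bsub>X\<^esub> (x \<oplus>\<^bsub>X\<^esub> y) = z \<otimes>\<^bsub>X\<^esub> x \<oplus>\<^bsub>X\<^esub> z \<otimes>\<^bsub>X\<^esub> y"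
    by (rule F_eqI) (simp_all add: xyz X_add X_mult F_add F_mult hit_add_functional FD)
qed

interpretation X: ring X by (rule ring_X)

sublocale B2: balanced_tensor X "carrier K" "\<lambda>l a. t l \<otimes>\<^bsub>X\<^esub> a" "\<lambda>l a. s l \<otimes>\<^bsub>X\<^esub> a"
  by unfold_locales auto

sublocale B3: balanced_tensor3 X "carrier K" "\<lambda>l a. t l \<otimes>\<^bsub>X\<^esub> a" "\<lambda>l a. s l \<otimes>\<^bsub>X\<^esub> a"
  "carrier K" "\<lambda>l a. t l \<otimes>\<^bsub>X\<^esub> a" "\<lambda>l a. s l \<otimes>\<^bsub>X\<^esub> a"
  by unfold_locales auto

lemma ltensor_defs: "ltensor X K s t = B2.T2" "ltens X K s t = B2.e2"
  "ltensor3 X K s t = B3.T3" "ltens3 X K s t = B3.e3"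
  by (simp_all add: ltensor_def ltens_def[abs_def] ltensor3_def ltens3_def[abs_def])

lemma F_sum: "(\<And>x y. (x, y) \<in> set L \<Longrightarrow> f x y \<in> carrier X) \<Longrightarrow>
    F (pair_sum X L f) = (\<lambda>z. ps L (\<lambda>x y. F (f x y) z))"
proof (induction L)
  case (Cons p L)
  then show ?case
    by (cases p) (auto simp: F_add pair_sum_closed[OF ring_X])
qed (simp add: F_zero)

section \<open>Evaluation of tensors of functionals\<close>

definition evt :: "'a \<Rightarrow> 'a \<Rightarrow> 'b \<Rightarrow> 'b \<Rightarrow> 'a" where
  "evt x y u v = F u (F v x \<otimes> y)"

definition ev :: "'a \<Rightarrow> 'a \<Rightarrow> ('b \<times> 'b) frag set \<Rightarrow> 'a" where
  "ev x y = tensor_lift (add_monoid A) (\<lambda>(u, v). evt x y u v)"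

lemma F_carrier: "b \<in> carrier X \<Longrightarrow> F b x \<in> carrier A"
  by (simp add: carrier_A_iff FD)

lemma add_T: "x \<in> carrier A \<Longrightarrow> y \<in> carrier A \<Longrightarrow> x \<oplus>\<^bsub>A\<^esub> y = x \<oplus> y"
  by (simp add: T_eq tot_simps[OF ring_A] rt_id[OF ring_A])

text \<open>Multiplying \<open>u\<close> by a target element multiplies its argument by
  \<open>\<kappa> k\<close> from the left, and multiplying \<open>v\<close> by a source element does
  the same to its value. In the nested evaluation both put \<open>\<kappa> k\<close> at the same
  place.\<close>

lemma balanced_evt:
  "balanced_map X (carrier K) (\<lambda>l a. t l \<otimes>\<^bsub>X\<^esub> a) (\<lambda>l a. s l \<otimes>\<^bsub>X\<^esub> a) (add_monoid A) (evt x y)"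
  unfolding balanced_map_def
  by (simp add: evt_def F_carrier F_add FD add_T F_t_mult F_s_mult mult_assoc)

lemma ev_hom: "group_hom B2.T2 (add_monoid A) (ev x y)"
  unfolding ev_def by (rule B2.lift_hom[OF A.a_comm_group balanced_evt])

lemma ev_e2: "u \<in> carrier X \<Longrightarrow> v \<in> carrier X \<Longrightarrow> ev x y (B2.e2 u v) = F u (F v x \<otimes> y)"
  unfolding ev_def by (subst B2.lift_e2[OF A.a_comm_group balanced_evt]) (simp_all add: evt_def)

lemma ev_closed: "w \<in> carrier B2.T2 \<Longrightarrow> ev x y w \<in> carrier A"
  using group_hom.hom_closed[OF ev_hom] by simp

lemma ps_eq: "(\<And>u v. (u, v) \<in> set L \<Longrightarrow> f u v \<in> carrier A) \<Longrightarrow> pair_sum A L f = ps L f"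
  unfolding T_eq pair_sum_tot[OF ring_A] by (rule pair_sum_cong) (simp add: rt_id[OF ring_A])

lemma ev_sum:
  assumes "\<And>u v. (u, v) \<in> set L \<Longrightarrow> f u v \<in> carrier B2.T2"
  shows "ev x y (group_sum B2.T2 L f) = ps L (\<lambda>u v. ev x y (f u v))"
proof -
  have "ev x y (group_sum B2.T2 L f) = group_sum (add_monoid A) L (\<lambda>u v. ev x y (f u v))"
    by (rule group_sum_hom[OF ev_hom assms])
  also have "\<dots> = pair_sum A L (\<lambda>u v. ev x y (f u v))" by (rule group_sum_add_monoid)
  also have "\<dots> = ps L (\<lambda>u v. ev x y (f u v))"
    by (rule ps_eq) (use assms in \<open>simp add: ev_closed\<close>)
  finally show ?thesis .
qed

lemma ev_sum_e2:
  assumes "\<And>u v. (u, v) \<in> set L \<Longrightarrow> p u v \<in> carrier X \<and> q u v \<in> carrier X"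
  shows "ev x y (group_sum B2.T2 L (\<lambda>u v. B2.e2 (p u v) (q u v))) = ps L (\<lambda>u v. F (p u v) (F (q u v) x \<otimes> y))"
  by (subst ev_sum) (use assms in \<open>auto intro!: pair_sum_cong simp: B2.e2_closed ev_e2\<close>)

lemma e2_sum_right:
  assumes "u \<in> carrier X" "\<And>x y. (x, y) \<in> set L \<Longrightarrow> f x y \<in> carrier X"
  shows "B2.e2 u (pair_sum X L f) = group_sum B2.T2 L (\<lambda>x y. B2.e2 u (f x y))"
  using assms(2)
proof (induction L)
  case (Cons p L)
  then show ?case
    by (cases p) (auto simp: B2.e2_rules(2) assms(1) pair_sum_closed[OF ring_X])
qed (simp add: B2.e2_zero assms(1))

lemma e2_sum_left:
  assumes "u \<in> carrier X" "\<And>x y. (x, y) \<in> set L \<Longrightarrow> f x y \<in> carrier X"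
  shows "B2.e2 (pair_sum X L f) u = group_sum B2.T2 L (\<lambda>x y. B2.e2 (f x y) u)"
  using assms(2)
proof (induction L)
  case (Cons p L)
  then show ?case
    by (cases p) (auto simp: B2.e2_rules(1) assms(1) pair_sum_closed[OF ring_X])
qed (simp add: B2.e2_zero assms(1))

definition coef :: "'b \<Rightarrow> 'a \<Rightarrow> 'k" where "coef v b = inv_\<kappa> (F v b)"

lemma coef: "v \<in> carrier X \<Longrightarrow> coef v b \<in> carrier K" "v \<in> carrier X \<Longrightarrow> \<kappa> (coef v b) = F v b"
  by (simp_all add: coef_def inv_\<kappa> FD)

text \<open>A functional is the combination of the dual basis functionals with its values on the
  basis as coefficients: apply \<open>F v\<close> to the expansion of \<open>x\<close> and use
  linearity.\<close>

lemma dual_basis_expansion: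
  assumes v: "v \<in> carrier X"
  shows "v = pair_sum X db (\<lambda>b e. s (coef v b) \<otimes>\<^bsub>X\<^esub> inv_F e)"
proof (rule F_eqI)
  have c: "s (coef v b) \<otimes>\<^bsub>X\<^esub> inv_F e \<in> carrier X" if "(b, e) \<in> set db" for b e
    using that v by (simp add: coef inv_F db_functional)
  show "pair_sum X db (\<lambda>b e. s (coef v b) \<otimes>\<^bsub>X\<^esub> inv_F e) \<in> carrier X"
    by (rule pair_sum_closed[OF ring_X c])
  fix x
  have "F (pair_sum X db (\<lambda>b e. s (coef v b) \<otimes>\<^bsub>X\<^esub> inv_F e)) x = ps db (\<lambda>b e. F v b \<otimes> e x)"
    by (subst F_sum, erule c, rule pair_sum_cong) (use v in \<open>simp add: F_s_mult coef inv_F db_functional\<close>)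
  also have "\<dots> = ps db (\<lambda>b e. F v (b \<otimes> e x))"
    by (rule pair_sum_cong) (metis functionalD(3) FD(4) db_functional v)
  also have "\<dots> = F v (ps db (\<lambda>b e. b \<otimes> e x))" by (rule additive_ps[symmetric]) (rule FD[OF v])
  finally show "F v x = F (pair_sum X db (\<lambda>b e. s (coef v b) \<otimes>\<^bsub>X\<^esub> inv_F e)) x"
    by (simp add: db_sum FD v)
qed (rule v)

lemma e2_expansion:
  assumes "u \<in> carrier X" "v \<in> carrier X"
  shows "B2.e2 u v = group_sum B2.T2 db (\<lambda>b e. B2.e2 (t (coef v b) \<otimes>\<^bsub>X\<^esub> u) (inv_F e))"
proof -
  have "B2.e2 u v = B2.e2 u (pair_sum X db (\<lambda>b e. s (coef v b) \<otimes>\<^bsub>X\<^esub> inv_F e))"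
    using dual_basis_expansion[OF assms(2)] by simp
  also have "\<dots> = group_sum B2.T2 db (\<lambda>b e. B2.e2 u (s (coef v b) \<otimes>\<^bsub>X\<^esub> inv_F e))"
    by (rule e2_sum_right) (use assms in \<open>simp_all add: coef inv_F db_functional\<close>)
  also have "\<dots> = group_sum B2.T2 db (\<lambda>b e. B2.e2 (t (coef v b) \<otimes>\<^bsub>X\<^esub> u) (inv_F e))"
    by (rule group_sum_cong) (use assms in \<open>simp add: B2.e2_rules(3) coef inv_F db_functional\<close>)
  finally show ?thesis .
qed

lemma functional_sum: "(\<And>u v. (u, v) \<in> set L \<Longrightarrow> functional (f u v)) \<Longrightarrow> functional (\<lambda>x. ps L (\<lambda>u v. f u v x))"
proof (induction L)
  case (Cons p L)
  obtain u v where p: "p = (u, v)" by force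
  have "functional (f u v)" "functional (\<lambda>x. ps L (\<lambda>u v. f u v x))"
    using Cons by (simp_all add: p)
  then show ?case using functional_add by (simp add: p)
qed (simp add: functional_zero)

text \<open>Expand the second factors in the dual basis and move the coefficients across the tensor
  sign. The first factor beside a basis functional then depends on the evaluations of
  \<open>w\<close> at the corresponding basis element only, which gives a normal form.\<close>

lemma T2_canonical:
  assumes w: "w \<in> carrier B2.T2"
  shows "w = group_sum B2.T2 db (\<lambda>b e. B2.e2 (inv_F (\<lambda>y. ev b y w)) (inv_F e))"
proof -
  obtain L where L: "set L \<subseteq> carrier X \<times> carrier X" "w = group_sum B2.T2 L B2.e2"
    using B2.ex_rep[OF w] by blast
  have Lc: "u \<in> carrier X" "v \<in> carrier X" if "(u, v) \<in> set L" for u v using L that by auto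
  have tc: "t (coef v b) \<otimes>\<^bsub>X\<^esub> u \<in> carrier X" if "(u, v) \<in> set L" for u v b
    using Lc[OF that] by (simp add: coef)
  have "w = group_sum B2.T2 L (\<lambda>u v. group_sum B2.T2 db (\<lambda>b e. B2.e2 (t (coef v b) \<otimes>\<^bsub>X\<^esub> u) (inv_F e)))"
    unfolding L(2) by (rule group_sum_cong) (use Lc e2_expansion in blast)
  also have "\<dots> = group_sum B2.T2 db (\<lambda>b e. group_sum B2.T2 L (\<lambda>u v. B2.e2 (t (coef v b) \<otimes>\<^bsub>X\<^esub> u) (inv_F e)))"
    by (rule group_sum_commute[OF B2.comm_group_T2]) (use tc in \<open>simp add: B2.e2_closed inv_F db_functional\<close>)
  also have "\<dots> = group_sum B2.T2 db (\<lambda>b e. B2.e2 (pair_sum X L (\<lambda>u v. t (coef v b) \<otimes>\<^bsub>X\<^esub> u)) (inv_F e))"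
    by (rule group_sum_cong, rule e2_sum_left[symmetric]) (use tc in \<open>simp_all add: inv_F db_functional\<close>)
  also have "\<dots> = group_sum B2.T2 db (\<lambda>b e. B2.e2 (inv_F (\<lambda>y. ev b y w)) (inv_F e))"
  proof (rule group_sum_cong)
    fix b e
    have ev: "ev b y w = ps L (\<lambda>u v. F u (F v b \<otimes> y))" for y
      unfolding L(2) by (rule ev_sum_e2) (use Lc in blast)
    have f: "functional (\<lambda>y. ps L (\<lambda>u v. F u (F v b \<otimes> y)))"
      by (rule functional_sum) (use Lc in \<open>auto intro: functional_shift F_fun\<close>)
    have "pair_sum X L (\<lambda>u v. t (coef v b) \<otimes>\<^bsub>X\<^esub> u) = inv_F (\<lambda>y. ev b y w)"
    proof (rule F_eqI)
      show "pair_sum X L (\<lambda>u v. t (coef v b) \<otimes>\<^bsub>X\<^esub> u) \<in> carrier X" by (rule pair_sum_closed[OF ring_X tc])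
      show "inv_F (\<lambda>y. ev b y w) \<in> carrier X" unfolding ev by (rule inv_F[OF f])
      fix y
      show "F (pair_sum X L (\<lambda>u v. t (coef v b) \<otimes>\<^bsub>X\<^esub> u)) y = F (inv_F (\<lambda>y. ev b y w)) y"
        unfolding ev inv_F(2)[OF f]
        by (subst F_sum, erule tc, rule pair_sum_cong) (use Lc in \<open>simp add: F_t_mult coef\<close>)
    qed
    then show "B2.e2 (pair_sum X L (\<lambda>u v. t (coef v b) \<otimes>\<^bsub>X\<^esub> u)) (inv_F e) =
      B2.e2 (inv_F (\<lambda>y. ev b y w)) (inv_F e)" by simp
  qed
  finally show ?thesis .
qed

text \<open>This replaces the identification of the tensor product with a space of maps in two
  variables, and all identities between coproducts of functionals are checked by it.\<close>

lemma eval_inj: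
  assumes "w \<in> carrier B2.T2" "w' \<in> carrier B2.T2" "\<And>x y. ev x y w = ev x y w'"
  shows "w = w'"
  using T2_canonical[OF assms(1)] T2_canonical[OF assms(2)] assms(3) by simp

lemma sum_eqI:
  assumes "\<And>u v. (u, v) \<in> set L \<Longrightarrow> p u v \<in> carrier X \<and> q u v \<in> carrier X"
    "\<And>u v. (u, v) \<in> set L' \<Longrightarrow> p' u v \<in> carrier X \<and> q' u v \<in> carrier X"
    "\<And>x y. ps L (\<lambda>u v. F (p u v) (F (q u v) x \<otimes> y)) = ps L' (\<lambda>u v. F (p' u v) (F (q' u v) x \<otimes> y))"
  shows "group_sum B2.T2 L (\<lambda>u v. B2.e2 (p u v) (q u v)) = group_sum B2.T2 L' (\<lambda>u v. B2.e2 (p' u v) (q' u v))"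
proof (rule eval_inj)
  show "group_sum B2.T2 L (\<lambda>u v. B2.e2 (p u v) (q u v)) \<in> carrier B2.T2"
    "group_sum B2.T2 L' (\<lambda>u v. B2.e2 (p' u v) (q' u v)) \<in> carrier B2.T2"
    by (rule group_sum_closed[OF B2.T.is_monoid], use assms(1,2) in \<open>simp add: B2.e2_closed\<close>)+
  show "ev x y (group_sum B2.T2 L (\<lambda>u v. B2.e2 (p u v) (q u v))) =
    ev x y (group_sum B2.T2 L' (\<lambda>u v. B2.e2 (p' u v) (q' u v)))" for x y
    by (subst ev_sum_e2, erule assms(1), subst ev_sum_e2, erule assms(2), rule assms(3))
qed

lemma e3_sum:
  assumes "a \<in> carrier X" "b \<in> carrier X" "\<And>x y. (x, y) \<in> set L \<Longrightarrow> f x y \<in> carrier X"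
  shows "B3.e3 a b (pair_sum X L f) = group_sum B3.T3 L (\<lambda>x y. B3.e3 a b (f x y))"
    "B3.e3 a (pair_sum X L f) b = group_sum B3.T3 L (\<lambda>x y. B3.e3 a (f x y) b)"
    "B3.e3 (pair_sum X L f) a b = group_sum B3.T3 L (\<lambda>x y. B3.e3 (f x y) a b)"
proof -
  have z: "B3.e3 a b \<zero>\<^bsub>X\<^esub> = \<one>\<^bsub>B3.T3\<^esub>" "B3.e3 a \<zero>\<^bsub>X\<^esub> b = \<one>\<^bsub>B3.T3\<^esub>" "B3.e3 \<zero>\<^bsub>X\<^esub> a b = \<one>\<^bsub>B3.T3\<^esub>"
    using B3.e3_rules(1)[of "\<zero>\<^bsub>X\<^esub>" "\<zero>\<^bsub>X\<^esub>" a b] B3.e3_rules(2)[of a "\<zero>\<^bsub>X\<^esub>" "\<zero>\<^bsub>X\<^esub>" b]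
      B3.e3_rules(3)[of a b "\<zero>\<^bsub>X\<^esub>" "\<zero>\<^bsub>X\<^esub>"] assms(1,2) B3.e3_closed
    by (auto simp: B3.T.r_cancel_one')
  show "B3.e3 a b (pair_sum X L f) = group_sum B3.T3 L (\<lambda>x y. B3.e3 a b (f x y))"
    using assms(3)
  proof (induction L)
    case (Cons p L)
    then show ?case by (cases p) (auto simp: B3.e3_rules(3) assms(1,2) pair_sum_closed[OF ring_X])
  qed (simp add: z)
  show "B3.e3 a (pair_sum X L f) b = group_sum B3.T3 L (\<lambda>x y. B3.e3 a (f x y) b)"
    using assms(3)
  proof (induction L)
    case (Cons p L)
    then show ?case by (cases p) (auto simp: B3.e3_rules(2) assms(1,2) pair_sum_closed[OF ring_X])
  qed (simp add: z)
  show "B3.e3 (pair_sum X L f) a b = group_sum B3.T3 L (\<lambda>x y. B3.e3 (f x y) a b)"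
    using assms(3)
  proof (induction L)
    case (Cons p L)
    then show ?case by (cases p) (auto simp: B3.e3_rules(1) assms(1,2) pair_sum_closed[OF ring_X])
  qed (simp add: z)
qed

text \<open>The last factor is expanded first. Its coefficients move into the middle factor, which
  is expanded next, so that all coefficients collect in the first factor.\<close>

lemma e3_expansion:
  assumes u: "u \<in> carrier X" "v \<in> carrier X" "w \<in> carrier X"
  shows "B3.e3 u v w = group_sum B3.T3 db (\<lambda>b e. group_sum B3.T3 db (\<lambda>b' e'.
    B3.e3 (t (coef (t (coef w b) \<otimes>\<^bsub>X\<^esub> v) b') \<otimes>\<^bsub>X\<^esub> u) (inv_F e') (inv_F e)))"
proof -
  have "B3.e3 u v w = B3.e3 u v (pair_sum X db (\<lambda>b e. s (coef w b) \<otimes>\<^bsub>X\<^esub> inv_F e))"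
    using dual_basis_expansion[OF u(3)] by simp
  also have "\<dots> = group_sum B3.T3 db (\<lambda>b e. B3.e3 u v (s (coef w b) \<otimes>\<^bsub>X\<^esub> inv_F e))"
    by (rule e3_sum) (use u in \<open>simp_all add: coef inv_F db_functional\<close>)
  also have "\<dots> = group_sum B3.T3 db (\<lambda>b e. B3.e3 u (t (coef w b) \<otimes>\<^bsub>X\<^esub> v) (inv_F e))"
    by (rule group_sum_cong) (use u in \<open>simp add: B3.e3_rules(5) coef inv_F db_functional\<close>)
  also have "\<dots> = group_sum B3.T3 db (\<lambda>b e. group_sum B3.T3 db (\<lambda>b' e'.
    B3.e3 (t (coef (t (coef w b) \<otimes>\<^bsub>X\<^esub> v) b') \<otimes>\<^bsub>X\<^esub> u) (inv_F e') (inv_F e)))"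
  proof (rule group_sum_cong)
    fix b e assume be: "(b, e) \<in> set db"
    let ?v = "t (coef w b) \<otimes>\<^bsub>X\<^esub> v"
    have v: "?v \<in> carrier X" and e: "inv_F e \<in> carrier X"
      using u be by (simp_all add: coef inv_F db_functional)
    have "B3.e3 u ?v (inv_F e) = B3.e3 u (pair_sum X db (\<lambda>b e. s (coef ?v b) \<otimes>\<^bsub>X\<^esub> inv_F e)) (inv_F e)"
      using dual_basis_expansion[OF v] by simp
    also have "\<dots> = group_sum B3.T3 db (\<lambda>b' e'. B3.e3 u (s (coef ?v b') \<otimes>\<^bsub>X\<^esub> inv_F e') (inv_F e))"
      by (rule e3_sum) (use u v e in \<open>simp_all add: coef inv_F db_functional\<close>)
    also have "\<dots> = group_sum B3.T3 db (\<lambda>b' e'. B3.e3 (t (coef ?v b') \<otimes>\<^bsub>X\<^esub> u) (inv_F e') (inv_F e))"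
      by (rule group_sum_cong) (use u v e in \<open>simp add: B3.e3_rules(4) coef inv_F db_functional\<close>)
    finally show "B3.e3 u ?v (inv_F e) = group_sum B3.T3 db (\<lambda>b' e'. B3.e3 (t (coef ?v b') \<otimes>\<^bsub>X\<^esub> u) (inv_F e') (inv_F e))" .
  qed
  finally show ?thesis .
qed

text \<open>The normal form for threefold tensors. Triples are coded as nested pairs because list
  sums run over pairs.\<close>

lemma sum3_canonical:
  assumes L: "\<And>u v w. ((u, v), w) \<in> set L \<Longrightarrow> u \<in> carrier X \<and> v \<in> carrier X \<and> w \<in> carrier X"
  shows "group_sum B3.T3 L (\<lambda>(u, v) w. B3.e3 u v w) = group_sum B3.T3 db (\<lambda>b e. group_sum B3.T3 db (\<lambda>b' e'.
    B3.e3 (inv_F (\<lambda>z. ps L (\<lambda>(u, v) w. F u (F v (F w b \<otimes> b') \<otimes> z)))) (inv_F e') (inv_F e)))"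
proof -
  let ?t = "\<lambda>b b' u v w. t (coef (t (coef w b) \<otimes>\<^bsub>X\<^esub> v) b') \<otimes>\<^bsub>X\<^esub> u"
  have tc: "?t b b' u v w \<in> carrier X" if "((u, v), w) \<in> set L" for b b' u v w
    using L[OF that] by (simp add: coef)
  have ec: "B3.e3 (?t b b' u v w) (inv_F e') (inv_F e) \<in> carrier B3.T3"
    if "((u, v), w) \<in> set L" "(b, e) \<in> set db" "(b', e') \<in> set db" for u v w b e b' e'
    using that tc by (simp add: B3.e3_closed inv_F db_functional)
  have "group_sum B3.T3 L (\<lambda>(u, v) w. B3.e3 u v w) =
    group_sum B3.T3 L (\<lambda>p w. group_sum B3.T3 db (\<lambda>b e. group_sum B3.T3 db (\<lambda>b' e'.
      B3.e3 (?t b b' (fst p) (snd p) w) (inv_F e') (inv_F e))))"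
    by (rule group_sum_cong) (use L e3_expansion in force)
  also have "\<dots> = group_sum B3.T3 db (\<lambda>b e. group_sum B3.T3 L (\<lambda>p w. group_sum B3.T3 db (\<lambda>b' e'.
      B3.e3 (?t b b' (fst p) (snd p) w) (inv_F e') (inv_F e))))"
    by (rule group_sum_commute[OF B3.comm_group_T3], rule group_sum_closed[OF B3.T.is_monoid])
      (use ec in force)
  also have "\<dots> = group_sum B3.T3 db (\<lambda>b e. group_sum B3.T3 db (\<lambda>b' e'. group_sum B3.T3 L (\<lambda>p w. 
      B3.e3 (?t b b' (fst p) (snd p) w) (inv_F e') (inv_F e))))"
    by (rule group_sum_cong, rule group_sum_commute[OF B3.comm_group_T3]) (use ec in force)
  also have "\<dots> = group_sum B3.T3 db (\<lambda>b e. group_sum B3.T3 db (\<lambda>b' e'.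
    B3.e3 (inv_F (\<lambda>z. ps L (\<lambda>(u, v) w. F u (F v (F w b \<otimes> b') \<otimes> z)))) (inv_F e') (inv_F e)))"
  proof (rule group_sum_cong, rule group_sum_cong)
    fix b e b' e' assume be: "(b, e) \<in> set db" "(b', e') \<in> set db"
    have tc': "?t b b' (fst p) (snd p) w \<in> carrier X" if "(p, w) \<in> set L" for p w
      using tc[of "fst p" "snd p" w] that by simp
    have e: "inv_F e \<in> carrier X" "inv_F e' \<in> carrier X" using be by (simp_all add: inv_F db_functional)
    have f: "functional (\<lambda>z. ps L (\<lambda>p w. F (fst p) (F (snd p) (F w b \<otimes> b') \<otimes> z)))"
      by (rule functional_sum) (use L in \<open>force intro: functional_shift F_fun\<close>)
    have eq: "pair_sum X L (\<lambda>p w. ?t b b' (fst p) (snd p) w) =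
       inv_F (\<lambda>z. ps L (\<lambda>p w. F (fst p) (F (snd p) (F w b \<otimes> b') \<otimes> z)))"
    proof (rule F_eqI)
      show "pair_sum X L (\<lambda>p w. ?t b b' (fst p) (snd p) w) \<in> carrier X" by (rule pair_sum_closed[OF ring_X tc'])
      show "inv_F (\<lambda>z. ps L (\<lambda>p w. F (fst p) (F (snd p) (F w b \<otimes> b') \<otimes> z))) \<in> carrier X" by (rule inv_F[OF f])
      fix z
      show "F (pair_sum X L (\<lambda>p w. ?t b b' (fst p) (snd p) w)) z =
        F (inv_F (\<lambda>z. ps L (\<lambda>p w. F (fst p) (F (snd p) (F w b \<otimes> b') \<otimes> z)))) z"
        unfolding inv_F(2)[OF f]
      proof (subst F_sum, erule tc', rule pair_sum_cong)
        fix p w assume "(p, w) \<in> set L"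
        then have "fst p \<in> carrier X" "snd p \<in> carrier X" "w \<in> carrier X" using L[of "fst p" "snd p" w] by auto
        then show "F (?t b b' (fst p) (snd p) w) z = F (fst p) (F (snd p) (F w b \<otimes> b') \<otimes> z)"
          by (simp add: F_t_mult coef)
      qed
    qed
    have cp: "(\<lambda>(u, v) w. F u (F v (F w b \<otimes> b') \<otimes> z)) = (\<lambda>p w. F (fst p) (F (snd p) (F w b \<otimes> b') \<otimes> z))" for z
      by (auto simp: fun_eq_iff)
    have "group_sum B3.T3 L (\<lambda>p w. B3.e3 (?t b b' (fst p) (snd p) w) (inv_F e') (inv_F e)) =
      B3.e3 (pair_sum X L (\<lambda>p w. ?t b b' (fst p) (snd p) w)) (inv_F e') (inv_F e)"
      by (rule e3_sum(3)[OF e(2,1), symmetric]) (erule tc')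
    then show "group_sum B3.T3 L (\<lambda>p w. B3.e3 (?t b b' (fst p) (snd p) w) (inv_F e') (inv_F e)) =
      B3.e3 (inv_F (\<lambda>z. ps L (\<lambda>(u, v) w. F u (F v (F w b \<otimes> b') \<otimes> z)))) (inv_F e') (inv_F e)"
      unfolding eq cp .
  qed
  finally show ?thesis .
qed

end

section \<open>The bialgebroid axioms, verified by evaluation\<close>

context dual_model
begin

interpretation A: ring A by (rule ring_A)
interpretation K: ring K by (rule ring_K)
interpretation X: ring X by (rule ring_X)

lemma l_carrier: "b \<in> carrier X \<Longrightarrow> (u, v) \<in> set (l b) \<Longrightarrow> u \<in> carrier X \<and> v \<in> carrier X"
  using l_set by blast

lemma \<gamma>_eq: "b \<in> carrier X \<Longrightarrow> \<gamma> b = group_sum B2.T2 (l b) B2.e2"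
  using \<gamma>_rep by (simp add: ltensor_defs)

lemma \<gamma>_closed: "b \<in> carrier X \<Longrightarrow> \<gamma> b \<in> carrier B2.T2"
  using \<gamma>_eq l_set B2.sum_closed by simp

lemma ev_\<gamma>: "b \<in> carrier X \<Longrightarrow> ev x y (\<gamma> b) = F b (x \<otimes> y)"
proof -
  assume b: "b \<in> carrier X"
  have "ev x y (group_sum B2.T2 (l b) (\<lambda>u v. B2.e2 u v)) = ps (l b) (\<lambda>u v. F u (F v x \<otimes> y))"
    by (rule ev_sum_e2) (rule l_carrier[OF b])
  then show ?thesis using b by (simp add: \<gamma>_eq l_eval)
qed

lemma \<gamma>_eqI:
  assumes "b \<in> carrier X" "w \<in> carrier B2.T2" "\<And>x y. ev x y w = F b (x \<otimes> y)"
  shows "\<gamma> b = w"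
  by (rule eval_inj) (use assms in \<open>simp_all add: \<gamma>_closed ev_\<gamma>\<close>)

lemma \<gamma>_sum_eqI:
  assumes "b \<in> carrier X" "\<And>u v. (u, v) \<in> set L \<Longrightarrow> p u v \<in> carrier X \<and> q u v \<in> carrier X"
    "\<And>x y. ps L (\<lambda>u v. F (p u v) (F (q u v) x \<otimes> y)) = F b (x \<otimes> y)"
  shows "\<gamma> b = group_sum B2.T2 L (\<lambda>u v. B2.e2 (p u v) (q u v))"
proof (rule \<gamma>_eqI[OF assms(1)])
  show "group_sum B2.T2 L (\<lambda>u v. B2.e2 (p u v) (q u v)) \<in> carrier B2.T2"
    by (rule group_sum_closed[OF B2.T.is_monoid]) (use assms(2) in \<open>simp add: B2.e2_closed\<close>)
  show "ev x y (group_sum B2.T2 L (\<lambda>u v. B2.e2 (p u v) (q u v))) = F b (x \<otimes> y)" for x y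
    by (subst ev_sum_e2, erule assms(2), rule assms(3))
qed

lemma s_t_comm: "k \<in> carrier K \<Longrightarrow> k' \<in> carrier K \<Longrightarrow> s k \<otimes>\<^bsub>X\<^esub> t k' = t k' \<otimes>\<^bsub>X\<^esub> s k"
proof (rule F_eqI)
  fix x assume k: "k \<in> carrier K" "k' \<in> carrier K"
  show "F (s k \<otimes>\<^bsub>X\<^esub> t k') x = F (t k' \<otimes>\<^bsub>X\<^esub> s k) x"
    using k by (simp add: F_s_mult F_t_mult F_s F_t)
qed (simp_all add: X_mult)

lemma s_hom: "s \<in> ring_hom K X"
proof (rule ring_hom_memI)
  fix k k' assume k: "k \<in> carrier K" "k' \<in> carrier K"
  show "s (k \<otimes>\<^bsub>K\<^esub> k') = s k \<otimes>\<^bsub>X\<^esub> s k'"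
    by (rule F_eqI) (use k in \<open>simp_all add: X_mult F_s F_s_mult \<kappa>_mult mult_assoc\<close>)
  show "s (k \<oplus>\<^bsub>K\<^esub> k') = s k \<oplus>\<^bsub>X\<^esub> s k'"
    by (rule F_eqI) (use k in \<open>simp_all add: X_add F_s F_add \<kappa>_add\<close>)
next
  show "s \<one>\<^bsub>K\<^esub> = \<one>\<^bsub>X\<^esub>"
    by (rule F_eqI) (simp_all add: X_one F_s F_one \<kappa>_one)
qed simp

lemma t_hom: "t \<in> ring_hom (opp_ring K) X"
proof (rule ring_hom_memI)
  fix k k' assume "k \<in> carrier (opp_ring K)" "k' \<in> carrier (opp_ring K)"
  then have k: "k \<in> carrier K" "k' \<in> carrier K" by simp_all
  show "t (k \<otimes>\<^bsub>opp_ring K\<^esub> k') = t k \<otimes>\<^bsub>X\<^esub> t k'"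
    by (rule F_eqI) (use k in \<open>simp_all add: X_mult F_t F_t_mult \<kappa>_mult mult_assoc\<close>)
  show "t (k \<oplus>\<^bsub>opp_ring K\<^esub> k') = t k \<oplus>\<^bsub>X\<^esub> t k'"
    by (rule F_eqI) (use k in \<open>simp_all add: X_add F_t F_add \<kappa>_add\<close>)
next
  show "t \<one>\<^bsub>opp_ring K\<^esub> = \<one>\<^bsub>X\<^esub>"
    by (rule F_eqI) (simp_all add: X_one F_t F_one \<kappa>_one)
qed simp

lemma \<gamma>_t_mult:
  assumes "k \<in> carrier K" "b \<in> carrier X"
  shows "\<gamma> (t k \<otimes>\<^bsub>X\<^esub> b) = group_sum B2.T2 (l b) (\<lambda>u v. B2.e2 u (t k \<otimes>\<^bsub>X\<^esub> v))"
proof (rule \<gamma>_sum_eqI)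
  fix x y
  have "ps (l b) (\<lambda>u v. F u (F (t k \<otimes>\<^bsub>X\<^esub> v) x \<otimes> y)) = ps (l b) (\<lambda>u v. F u (F v (\<kappa> k \<otimes> x) \<otimes> y))"
    by (rule pair_sum_cong) (use assms l_carrier[OF assms(2)] in \<open>simp add: F_t_mult\<close>)
  then show "ps (l b) (\<lambda>u v. F u (F (t k \<otimes>\<^bsub>X\<^esub> v) x \<otimes> y)) = F (t k \<otimes>\<^bsub>X\<^esub> b) (x \<otimes> y)"
    using assms by (simp add: F_t_mult l_eval mult_assoc)
qed (use assms l_carrier[OF assms(2)] in \<open>auto intro: X_mult\<close>)

lemma \<gamma>_s_mult:
  assumes "k \<in> carrier K" "b \<in> carrier X"
  shows "\<gamma> (s k \<otimes>\<^bsub>X\<^esub> b) = group_sum B2.T2 (l b) (\<lambda>u v. B2.e2 (s k \<otimes>\<^bsub>X\<^esub> u) v)"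
proof (rule \<gamma>_sum_eqI)
  fix x y
  have "ps (l b) (\<lambda>u v. F (s k \<otimes>\<^bsub>X\<^esub> u) (F v x \<otimes> y)) = ps (l b) (\<lambda>u v. \<kappa> k \<otimes> F u (F v x \<otimes> y))"
    by (rule pair_sum_cong) (use assms l_carrier[OF assms(2)] in \<open>simp add: F_s_mult\<close>)
  then show "ps (l b) (\<lambda>u v. F (s k \<otimes>\<^bsub>X\<^esub> u) (F v x \<otimes> y)) = F (s k \<otimes>\<^bsub>X\<^esub> b) (x \<otimes> y)"
    using assms by (simp add: F_s_mult l_eval flip: ps_mult_left)
qed (use assms l_carrier[OF assms(2)] in \<open>auto intro: X_mult\<close>)

lemma lift_\<gamma>:
  assumes "b \<in> carrier X" "comm_group G"
    "balanced_map X (carrier K) (\<lambda>l a. t l \<otimes>\<^bsub>X\<^esub> a) (\<lambda>l a. s l \<otimes>\<^bsub>X\<^esub> a) G f"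
  shows "tensor_lift G (\<lambda>(x, y). f x y) (\<gamma> b) = group_sum G (l b) f"
  using B2.lift_sum[OF assms(2,3) l_set] \<gamma>_eq assms(1) by simp

lemma balanced_mult:
  assumes u: "u \<in> carrier X" "v \<in> carrier X"
  shows "balanced_map X (carrier K) (\<lambda>l a. t l \<otimes>\<^bsub>X\<^esub> a) (\<lambda>l a. s l \<otimes>\<^bsub>X\<^esub> a) B2.T2
    (\<lambda>x y. B2.e2 (x \<otimes>\<^bsub>X\<^esub> u) (y \<otimes>\<^bsub>X\<^esub> v))"
  unfolding balanced_map_def
  by (simp add: u B2.e2_closed X.l_distr B2.e2_rules(1,2) X.m_assoc B2.e2_rules(3))

lemma balanced_scale:
  assumes k: "k \<in> carrier K" "k' \<in> carrier K"
  shows "balanced_map X (carrier K) (\<lambda>l a. t l \<otimes>\<^bsub>X\<^esub> a) (\<lambda>l a. s l \<otimes>\<^bsub>X\<^esub> a) B2.T2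
    (\<lambda>x y. B2.e2 (s k \<otimes>\<^bsub>X\<^esub> x) (t k' \<otimes>\<^bsub>X\<^esub> y))"
proof -
  have "B2.e2 (s k \<otimes>\<^bsub>X\<^esub> (t h \<otimes>\<^bsub>X\<^esub> x)) (t k' \<otimes>\<^bsub>X\<^esub> y) = B2.e2 (s k \<otimes>\<^bsub>X\<^esub> x) (t k' \<otimes>\<^bsub>X\<^esub> (s h \<otimes>\<^bsub>X\<^esub> y))"
    if "h \<in> carrier K" "x \<in> carrier X" "y \<in> carrier X" for h x y
  proof -
    have "s k \<otimes>\<^bsub>X\<^esub> (t h \<otimes>\<^bsub>X\<^esub> x) = t h \<otimes>\<^bsub>X\<^esub> (s k \<otimes>\<^bsub>X\<^esub> x)"
      using that k by (simp add: s_t_comm flip: X.m_assoc)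
    moreover have "t k' \<otimes>\<^bsub>X\<^esub> (s h \<otimes>\<^bsub>X\<^esub> y) = s h \<otimes>\<^bsub>X\<^esub> (t k' \<otimes>\<^bsub>X\<^esub> y)"
      using that k by (simp add: s_t_comm[symmetric] flip: X.m_assoc)
    ultimately show ?thesis
      using that k B2.e2_rules(3)[of h "s k \<otimes>\<^bsub>X\<^esub> x" "t k' \<otimes>\<^bsub>X\<^esub> y"] by simp
  qed
  then show ?thesis
    unfolding balanced_map_def by (simp add: k B2.e2_closed X.r_distr B2.e2_rules(1,2))
qed

text \<open>A product of functionals is evaluated by letting its right factor act first. The
  operator of \<open>u'\<close> passes over the value of \<open>v\<close>, since this lies in the
  image of the source, so the two right factors act separately on \<open>x\<close> and
  \<open>y\<close>.\<close>

lemma hit_ev_mult: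
  assumes u: "u \<in> carrier X" "v \<in> carrier X" "u' \<in> carrier X" "v' \<in> carrier X"
  shows "F (u \<otimes>\<^bsub>X\<^esub> u') (F (v \<otimes>\<^bsub>X\<^esub> v') x \<otimes> y) = F u (F v (hit (F v') x) \<otimes> hit (F u') y)"
  using u by (simp add: F_mult hit_functional_mult F_fun)

lemma \<gamma>_mult_aux:
  assumes a: "a \<in> carrier X" and u: "u' \<in> carrier X" "v' \<in> carrier X"
  shows "ev x y (group_sum B2.T2 (l a) (\<lambda>u v. B2.e2 (u \<otimes>\<^bsub>X\<^esub> u') (v \<otimes>\<^bsub>X\<^esub> v'))) =
    F a (hit (F v') x \<otimes> hit (F u') y)"
proof -
  have "ev x y (group_sum B2.T2 (l a) (\<lambda>u v. B2.e2 (u \<otimes>\<^bsub>X\<^esub> u') (v \<otimes>\<^bsub>X\<^esub> v'))) =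
    ps (l a) (\<lambda>u v. F (u \<otimes>\<^bsub>X\<^esub> u') (F (v \<otimes>\<^bsub>X\<^esub> v') x \<otimes> y))"
    by (rule ev_sum_e2) (use a u l_carrier[OF a] in \<open>auto intro: X_mult\<close>)
  also have "\<dots> = ps (l a) (\<lambda>u v. F u (F v (hit (F v') x) \<otimes> hit (F u') y))"
    by (rule pair_sum_cong) (use a u l_carrier[OF a] hit_ev_mult in blast)
  finally show ?thesis by (simp add: l_eval a)
qed

lemma mult_aux_closed:
  assumes "a \<in> carrier X" "u' \<in> carrier X" "v' \<in> carrier X"
  shows "group_sum B2.T2 (l a) (\<lambda>u v. B2.e2 (u \<otimes>\<^bsub>X\<^esub> u') (v \<otimes>\<^bsub>X\<^esub> v')) \<in> carrier B2.T2"
  by (rule group_sum_closed[OF B2.T.is_monoid]) (use assms l_carrier[OF assms(1)] in \<open>auto intro!: B2.e2_closed X_mult\<close>)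

text \<open>By evaluation: multiplying \<open>u'\<close> by \<open>t k\<close> and multiplying
  \<open>v'\<close> by \<open>s k\<close> both insert \<open>Q (\<kappa> k)\<close> between the two
  arguments of \<open>F a\<close>, in one case in front of the right argument and in the other
  behind the left one.\<close>

lemma balanced_mult_aux:
  assumes a: "a \<in> carrier X"
  shows "balanced_map X (carrier K) (\<lambda>l a. t l \<otimes>\<^bsub>X\<^esub> a) (\<lambda>l a. s l \<otimes>\<^bsub>X\<^esub> a) B2.T2
    (\<lambda>u' v'. group_sum B2.T2 (l a) (\<lambda>u v. B2.e2 (u \<otimes>\<^bsub>X\<^esub> u') (v \<otimes>\<^bsub>X\<^esub> v')))"
  unfolding balanced_map_def
proof (intro conjI ballI)
  fix x y assume xy: "x \<in> carrier X" "y \<in> carrier X"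
  let ?g = "\<lambda>u' v'. group_sum B2.T2 (l a) (\<lambda>u v. B2.e2 (u \<otimes>\<^bsub>X\<^esub> u') (v \<otimes>\<^bsub>X\<^esub> v'))"
  show "?g x y \<in> carrier B2.T2" by (rule mult_aux_closed[OF a xy])
  have ev_mult: "ev p q (w \<otimes>\<^bsub>B2.T2\<^esub> w') = ev p q w \<oplus> ev p q w'"
    if "w \<in> carrier B2.T2" "w' \<in> carrier B2.T2" for p q w w'
    using group_hom.hom_mult[OF ev_hom that] by (simp add: add_T ev_closed that)
  fix x' assume x': "x' \<in> carrier X"
  show "?g (x \<oplus>\<^bsub>X\<^esub> x') y = ?g x y \<otimes>\<^bsub>B2.T2\<^esub> ?g x' y"
    by (rule eval_inj) (simp_all add: a xy x' mult_aux_closed \<gamma>_mult_aux ev_mult F_add hit_add_functional FD)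
  show "?g x (y \<oplus>\<^bsub>X\<^esub> x') = ?g x y \<otimes>\<^bsub>B2.T2\<^esub> ?g x x'"
    by (rule eval_inj) (simp_all add: a xy x' mult_aux_closed \<gamma>_mult_aux ev_mult F_add hit_add_functional FD)
next
  fix k x y assume k: "k \<in> carrier K" and xy: "x \<in> carrier X" "y \<in> carrier X"
  have h: "hit (F (t k \<otimes>\<^bsub>X\<^esub> x)) z = Q (\<kappa> k) \<otimes> hit (F x) z" for z
    using k xy by (simp add: F_mult hit_F_t F_fun flip: hit_hit)
  have h': "hit (F (s k \<otimes>\<^bsub>X\<^esub> y)) z = hit (F y) z \<otimes> Q (\<kappa> k)" for z
    using k xy by (simp add: F_mult hit_F_s F_fun flip: hit_hit)
  show "group_sum B2.T2 (l a) (\<lambda>u v. B2.e2 (u \<otimes>\<^bsub>X\<^esub> (t k \<otimes>\<^bsub>X\<^esub> x)) (v \<otimes>\<^bsub>X\<^esub> y)) =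
    group_sum B2.T2 (l a) (\<lambda>u v. B2.e2 (u \<otimes>\<^bsub>X\<^esub> x) (v \<otimes>\<^bsub>X\<^esub> (s k \<otimes>\<^bsub>X\<^esub> y)))"
    by (rule eval_inj) (simp_all add: a xy k X_mult mult_aux_closed \<gamma>_mult_aux h h' mult_assoc)
qed

text \<open>Both iterated coproducts have the evaluation
  \<open>F a (x \<otimes> (y \<otimes> z))\<close>, so coassociativity reduces to associativity of
  the product. The nested sums are flattened to one list of triples to apply the normal
  form.\<close>

lemma coassoc_aux:
  assumes a: "a \<in> carrier X"
  shows "group_sum B3.T3 (l a) (\<lambda>x y. group_sum B3.T3 (l x) (\<lambda>u v. B3.e3 u v y)) =
    group_sum B3.T3 (l a) (\<lambda>x y. group_sum B3.T3 (l y) (\<lambda>u v. B3.e3 x u v))"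
proof -
  let ?L = "concat (map (\<lambda>(x, y). map (\<lambda>(u, v). ((u, v), y)) (l x)) (l a))"
  let ?R = "concat (map (\<lambda>(x, y). map (\<lambda>(u, v). ((x, u), v)) (l y)) (l a))"
  have lx: "u \<in> carrier X \<and> v \<in> carrier X" if "(u, v) \<in> set (l x)" "(x, y) \<in> set (l a)" for x y u v
    using l_carrier[OF _ that(1)] l_carrier[OF a that(2)] by blast
  have ly: "u \<in> carrier X \<and> v \<in> carrier X" if "(u, v) \<in> set (l y)" "(x, y) \<in> set (l a)" for x y u v
    using l_carrier[OF _ that(1)] l_carrier[OF a that(2)] by blast
  have Lc: "\<And>u v w. ((u, v), w) \<in> set ?L \<Longrightarrow> u \<in> carrier X \<and> v \<in> carrier X \<and> w \<in> carrier X"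
    and Rc: "\<And>u v w. ((u, v), w) \<in> set ?R \<Longrightarrow> u \<in> carrier X \<and> v \<in> carrier X \<and> w \<in> carrier X"
    by (auto dest: l_carrier[OF a] lx ly)
  have gm: "group_sum G (map (\<lambda>(u, v). ((u, v), y)) m) f = group_sum G m (\<lambda>u v. f (u, v) y)"
    "group_sum G (map (\<lambda>(u, v). ((x, u), v)) m) f = group_sum G m (\<lambda>u v. f (x, u) v)"
    for G :: "'g monoid" and m and x y :: 'b and f
    by (induction m) auto
  have pm: "ps (map (\<lambda>(u, v). ((u, v), y)) m) f = ps m (\<lambda>u v. f (u, v) y)"
    "ps (map (\<lambda>(u, v). ((x, u), v)) m) f = ps m (\<lambda>u v. f (x, u) v)"
    for m and x y :: 'b and f
    by (induction m) auto
  have L: "group_sum B3.T3 (l a) (\<lambda>x y. group_sum B3.T3 (l x) (\<lambda>u v. B3.e3 u v y)) =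
     group_sum B3.T3 ?L (\<lambda>(u, v) w. B3.e3 u v w)"
    by (subst group_sum_concat[OF B3.T.is_monoid])
      (auto intro!: B3.e3_closed dest: l_carrier[OF a] lx ly simp: gm)
  have R: "group_sum B3.T3 (l a) (\<lambda>x y. group_sum B3.T3 (l y) (\<lambda>u v. B3.e3 x u v)) =
     group_sum B3.T3 ?R (\<lambda>(u, v) w. B3.e3 u v w)"
    by (subst group_sum_concat[OF B3.T.is_monoid])
      (auto intro!: B3.e3_closed dest: l_carrier[OF a] lx ly simp: gm)
  have eqL: "ps ?L (\<lambda>(u, v) w. F u (F v (F w x \<otimes> y) \<otimes> z)) = F a (x \<otimes> (y \<otimes> z))" for x y z
  proof -
    have "ps ?L (\<lambda>(u, v) w. F u (F v (F w x \<otimes> y) \<otimes> z)) =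
      ps (l a) (\<lambda>x' y'. ps (l x') (\<lambda>u v. F u (F v (F y' x \<otimes> y) \<otimes> z)))"
      by (simp add: ps_concat pm)
    also have "\<dots> = ps (l a) (\<lambda>x' y'. F x' (F y' x \<otimes> (y \<otimes> z)))"
      by (rule pair_sum_cong) (use a l_carrier[OF a] in \<open>simp add: l_eval mult_assoc\<close>)
    finally show ?thesis by (simp add: l_eval a)
  qed
  have eqR: "ps ?R (\<lambda>(u, v) w. F u (F v (F w x \<otimes> y) \<otimes> z)) = F a (x \<otimes> (y \<otimes> z))" for x y z
  proof -
    have "ps ?R (\<lambda>(u, v) w. F u (F v (F w x \<otimes> y) \<otimes> z)) =
      ps (l a) (\<lambda>x' y'. ps (l y') (\<lambda>u v. F x' (F u (F v x \<otimes> y) \<otimes> z)))"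
      by (simp add: ps_concat pm)
    also have "\<dots> = ps (l a) (\<lambda>x' y'. F x' (F y' (x \<otimes> y) \<otimes> z))"
    proof (rule pair_sum_cong)
      fix x' y' assume "(x', y') \<in> set (l a)"
      then have xy: "x' \<in> carrier X" "y' \<in> carrier X" using l_carrier[OF a] by auto
      have "ps (l y') (\<lambda>u v. F x' (F u (F v x \<otimes> y) \<otimes> z)) = F x' (ps (l y') (\<lambda>u v. F u (F v x \<otimes> y)) \<otimes> z)"
        by (rule additive_ps[of "\<lambda>w. F x' (w \<otimes> z)", symmetric]) (simp add: additive_def FD xy)
      then show "ps (l y') (\<lambda>u v. F x' (F u (F v x \<otimes> y) \<otimes> z)) = F x' (F y' (x \<otimes> y) \<otimes> z)"
        by (simp add: l_eval xy)
    qed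
    finally show ?thesis by (simp add: l_eval a mult_assoc)
  qed
  show ?thesis
    unfolding L R
    by (subst sum3_canonical, erule Lc, subst sum3_canonical, erule Rc) (simp only: eqL eqR)
qed

theorem left_bialgebroid: "left_bialgebroid_ops X K s t \<gamma> \<pi>"
proof (rule left_bialgebroid_ops.intro, unfold ltensor_defs)
  show "ring X" "ring K" "s \<in> ring_hom K X" "t \<in> ring_hom (opp_ring K) X"
    by (rule ring_X ring_K s_hom t_hom)+
  have b: "balanced_tensor X (carrier K) (\<lambda>l a. t l \<otimes>\<^bsub>X\<^esub> a) (\<lambda>l a. s l \<otimes>\<^bsub>X\<^esub> a)" by unfold_locales
  show \<gamma>_hom: "\<gamma> \<in> hom (add_monoid X) B2.T2"
  proof (rule homI)
    fix x y assume "x \<in> carrier (add_monoid X)" "y \<in> carrier (add_monoid X)"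
    then have xy: "x \<in> carrier X" "y \<in> carrier X" by simp_all
    then have "ev p q (\<gamma> x \<otimes>\<^bsub>B2.T2\<^esub> \<gamma> y) = F (x \<oplus>\<^bsub>X\<^esub> y) (p \<otimes> q)" for p q
      using group_hom.hom_mult[OF ev_hom \<gamma>_closed[OF xy(1)] \<gamma>_closed[OF xy(2)]]
      by (simp add: ev_\<gamma> F_add add_T F_carrier)
    with xy show "\<gamma> (x \<otimes>\<^bsub>add_monoid X\<^esub> y) = \<gamma> x \<otimes>\<^bsub>B2.T2\<^esub> \<gamma> y"
      by (simp, intro \<gamma>_eqI) (simp_all add: \<gamma>_closed)
  qed (simp add: \<gamma>_closed)
  show "\<pi> \<in> hom (add_monoid X) (add_monoid K)"
    by (rule homI) (auto intro!: \<kappa>_inj simp: \<kappa>_add \<kappa>_\<pi> F_add X_add)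
  show "s k \<otimes>\<^bsub>X\<^esub> t k' = t k' \<otimes>\<^bsub>X\<^esub> s k" if "k \<in> carrier K" "k' \<in> carrier K" for k k'
    using that by (rule s_t_comm)
  show "\<pi> \<one>\<^bsub>X\<^esub> = \<one>\<^bsub>K\<^esub>"
    by (rule \<kappa>_inj) (simp_all add: X_one \<kappa>_\<pi> F_one \<kappa>_one)
  show "\<gamma> \<one>\<^bsub>X\<^esub> = B2.e2 \<one>\<^bsub>X\<^esub> \<one>\<^bsub>X\<^esub>"
    by (rule \<gamma>_eqI) (simp_all add: X_one B2.e2_closed ev_e2 F_one P_P_mult)
  fix a b assume a: "a \<in> carrier X"
  show "coprod_fst B3.T3 B3.e3 \<gamma> (\<gamma> a) = coprod_snd B3.T3 B3.e3 \<gamma> (\<gamma> a)"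
  proof -
    have r: "x \<in> carrier X \<Longrightarrow> set (l x) \<subseteq> carrier X \<times> carrier X \<and> \<gamma> x = group_sum B2.T2 (l x) B2.e2" for x
      using \<gamma>_eq l_set by blast
    show ?thesis
      using B3.coprod_fst_sum[OF b b \<gamma>_hom r \<gamma>_t_mult l_set[OF a]]
        B3.coprod_snd_sum[OF b b \<gamma>_hom r \<gamma>_s_mult l_set[OF a]] coassoc_aux[OF a]
      by (simp add: \<gamma>_eq[OF a])
  qed
  have bal1: "balanced_map X (carrier K) (\<lambda>l a. t l \<otimes>\<^bsub>X\<^esub> a) (\<lambda>l a. s l \<otimes>\<^bsub>X\<^esub> a) (add_monoid X)
      (\<lambda>x y. s (\<pi> x) \<otimes>\<^bsub>X\<^esub> y)"
    and bal2: "balanced_map X (carrier K) (\<lambda>l a. t l \<otimes>\<^bsub>X\<^esub> a) (\<lambda>l a. s l \<otimes>\<^bsub>X\<^esub> a) (add_monoid X)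
      (\<lambda>x y. t (\<pi> y) \<otimes>\<^bsub>X\<^esub> x)"
  proof -
    have F\<kappa>: "F x (\<kappa> k) = F x \<one> \<otimes> \<kappa> k" if "x \<in> carrier X" "k \<in> carrier K" for x k
      using FD(4)[OF that(1), of \<one> "\<kappa> k"] that by (simp add: FD)
    show "balanced_map X (carrier K) (\<lambda>l a. t l \<otimes>\<^bsub>X\<^esub> a) (\<lambda>l a. s l \<otimes>\<^bsub>X\<^esub> a) (add_monoid X) (\<lambda>x y. s (\<pi> x) \<otimes>\<^bsub>X\<^esub> y)"
      unfolding balanced_map_def
    proof (intro conjI ballI)
      fix x y x' assume "x \<in> carrier X" "y \<in> carrier X" "x' \<in> carrier X"
      then show "s (\<pi> (x \<oplus>\<^bsub>X\<^esub> y)) \<otimes>\<^bsub>X\<^esub> x' = (s (\<pi> x) \<otimes>\<^bsub>X\<^esub> x') \<otimes>\<^bsub>add_monoid X\<^esub> (s (\<pi> y) \<otimes>\<^bsub>X\<^esub> x')"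
        "s (\<pi> x) \<otimes>\<^bsub>X\<^esub> (y \<oplus>\<^bsub>X\<^esub> x') = (s (\<pi> x) \<otimes>\<^bsub>X\<^esub> y) \<otimes>\<^bsub>add_monoid X\<^esub> (s (\<pi> x) \<otimes>\<^bsub>X\<^esub> x')"
        by (auto intro!: F_eqI simp: X_mult X_add F_add F_s_mult \<kappa>_\<pi>)
    next
      fix k x y assume k: "k \<in> carrier K" and xy: "x \<in> carrier X" "y \<in> carrier X"
      then show "s (\<pi> (t k \<otimes>\<^bsub>X\<^esub> x)) \<otimes>\<^bsub>X\<^esub> y = s (\<pi> x) \<otimes>\<^bsub>X\<^esub> (s k \<otimes>\<^bsub>X\<^esub> y)"
        by (intro F_eqI) (simp_all add: X_mult F_s_mult F_t_mult \<kappa>_\<pi> F\<kappa> mult_assoc FD)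
    qed (simp add: X_mult)
    show "balanced_map X (carrier K) (\<lambda>l a. t l \<otimes>\<^bsub>X\<^esub> a) (\<lambda>l a. s l \<otimes>\<^bsub>X\<^esub> a) (add_monoid X) (\<lambda>x y. t (\<pi> y) \<otimes>\<^bsub>X\<^esub> x)"
      unfolding balanced_map_def
    proof (intro conjI ballI)
      fix x y x' assume "x \<in> carrier X" "y \<in> carrier X" "x' \<in> carrier X"
      then show "t (\<pi> x') \<otimes>\<^bsub>X\<^esub> (x \<oplus>\<^bsub>X\<^esub> y) = (t (\<pi> x') \<otimes>\<^bsub>X\<^esub> x) \<otimes>\<^bsub>add_monoid X\<^esub> (t (\<pi> x') \<otimes>\<^bsub>X\<^esub> y)"
        "t (\<pi> (y \<oplus>\<^bsub>X\<^esub> x')) \<otimes>\<^bsub>X\<^esub> x = (t (\<pi> y) \<otimes>\<^bsub>X\<^esub> x) \<otimes>\<^bsub>add_monoid X\<^esub> (t (\<pi> x') \<otimes>\<^bsub>X\<^esub> x)"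
        by (auto intro!: F_eqI simp: X_mult X_add F_add F_t_mult \<kappa>_\<pi> FD)
    next
      fix k x y assume k: "k \<in> carrier K" and xy: "x \<in> carrier X" "y \<in> carrier X"
      then show "t (\<pi> y) \<otimes>\<^bsub>X\<^esub> (t k \<otimes>\<^bsub>X\<^esub> x) = t (\<pi> (s k \<otimes>\<^bsub>X\<^esub> y)) \<otimes>\<^bsub>X\<^esub> x"
        by (intro F_eqI) (simp_all add: X_mult F_s_mult F_t_mult \<kappa>_\<pi> mult_assoc)
    qed (simp add: X_mult)
  qed
  \<comment> \<open>Both counit laws are the evaluation rule with one of its two arguments equal to
    \<open>\<one>\<close>.\<close>
  show "tensor_lift (add_monoid X) (\<lambda>(x, y). s (\<pi> x) \<otimes>\<^bsub>X\<^esub> y) (\<gamma> a) = a"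
    unfolding lift_\<gamma>[OF a X.a_comm_group bal1] group_sum_add_monoid
  proof (rule F_eqI[OF _ a])
    show "pair_sum X (l a) (\<lambda>x y. s (\<pi> x) \<otimes>\<^bsub>X\<^esub> y) \<in> carrier X"
      by (rule pair_sum_closed[OF ring_X]) (use a l_carrier[OF a] in \<open>auto intro: X_mult\<close>)
    fix x
    have "F (pair_sum X (l a) (\<lambda>x y. s (\<pi> x) \<otimes>\<^bsub>X\<^esub> y)) x = ps (l a) (\<lambda>u v. F (s (\<pi> u) \<otimes>\<^bsub>X\<^esub> v) x)"
      by (subst F_sum) (use a l_carrier[OF a] in \<open>auto intro: X_mult\<close>)
    also have "\<dots> = ps (l a) (\<lambda>u v. F u (F v x \<otimes> \<one>))"
    proof (rule pair_sum_cong)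
      fix u v assume "(u, v) \<in> set (l a)"
      then have uv: "u \<in> carrier X" "v \<in> carrier X" using l_carrier[OF a] by auto
      have "F u (\<one> \<otimes> P (F v x)) = F u \<one> \<otimes> P (F v x)" by (rule FD(4)[OF uv(1)])
      then show "F (s (\<pi> u) \<otimes>\<^bsub>X\<^esub> v) x = F u (F v x \<otimes> \<one>)"
        using uv by (simp add: F_s_mult \<kappa>_\<pi> FD)
    qed
    finally show "F (pair_sum X (l a) (\<lambda>x y. s (\<pi> x) \<otimes>\<^bsub>X\<^esub> y)) x = F a x"
      using l_eval[OF a, of x \<one>] by (simp add: FD a)
  qed
  show "tensor_lift (add_monoid X) (\<lambda>(x, y). t (\<pi> y) \<otimes>\<^bsub>X\<^esub> x) (\<gamma> a) = a"
    unfolding lift_\<gamma>[OF a X.a_comm_group bal2] group_sum_add_monoid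
  proof (rule F_eqI[OF _ a])
    show "pair_sum X (l a) (\<lambda>x y. t (\<pi> y) \<otimes>\<^bsub>X\<^esub> x) \<in> carrier X"
      by (rule pair_sum_closed[OF ring_X]) (use a l_carrier[OF a] in \<open>auto intro: X_mult\<close>)
    fix x
    have "F (pair_sum X (l a) (\<lambda>x y. t (\<pi> y) \<otimes>\<^bsub>X\<^esub> x)) x = ps (l a) (\<lambda>u v. F (t (\<pi> v) \<otimes>\<^bsub>X\<^esub> u) x)"
      by (subst F_sum) (use a l_carrier[OF a] in \<open>auto intro: X_mult\<close>)
    also have "\<dots> = ps (l a) (\<lambda>u v. F u (F v \<one> \<otimes> x))"
      by (rule pair_sum_cong) (use a l_carrier[OF a] in \<open>auto simp: F_t_mult \<kappa>_\<pi>\<close>)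
    finally show "F (pair_sum X (l a) (\<lambda>x y. t (\<pi> y) \<otimes>\<^bsub>X\<^esub> x)) x = F a x"
      by (simp add: l_eval a FD)
  qed
  show "\<gamma> (s k \<otimes>\<^bsub>X\<^esub> t k' \<otimes>\<^bsub>X\<^esub> a) =
      tensor_lift B2.T2 (\<lambda>(x, y). B2.e2 (s k \<otimes>\<^bsub>X\<^esub> x) (t k' \<otimes>\<^bsub>X\<^esub> y)) (\<gamma> a)"
    if k: "k \<in> carrier K" "k' \<in> carrier K" for k k'
    unfolding lift_\<gamma>[OF a B2.comm_group_T2 balanced_scale[OF k]]
  proof (rule \<gamma>_sum_eqI)
    show "s k \<otimes>\<^bsub>X\<^esub> t k' \<otimes>\<^bsub>X\<^esub> a \<in> carrier X" using a k by (simp add: X_mult)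
    fix x y
    have "ps (l a) (\<lambda>u v. F (s k \<otimes>\<^bsub>X\<^esub> u) (F (t k' \<otimes>\<^bsub>X\<^esub> v) x \<otimes> y)) =
      ps (l a) (\<lambda>u v. \<kappa> k \<otimes> F u (F v (\<kappa> k' \<otimes> x) \<otimes> y))"
      by (rule pair_sum_cong) (use k a l_carrier[OF a] in \<open>auto simp: F_t_mult F_s_mult\<close>)
    then show "ps (l a) (\<lambda>u v. F (s k \<otimes>\<^bsub>X\<^esub> u) (F (t k' \<otimes>\<^bsub>X\<^esub> v) x \<otimes> y)) = F (s k \<otimes>\<^bsub>X\<^esub> t k' \<otimes>\<^bsub>X\<^esub> a) (x \<otimes> y)"
      using a k by (simp add: F_t_mult F_s_mult l_eval X_mult X.m_assoc mult_assoc flip: ps_mult_left)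
  qed (use a k l_carrier[OF a] in \<open>auto intro: X_mult\<close>)
  show "\<pi> (s k \<otimes>\<^bsub>X\<^esub> t k' \<otimes>\<^bsub>X\<^esub> a) = k \<otimes>\<^bsub>K\<^esub> \<pi> a \<otimes>\<^bsub>K\<^esub> k'"
    if k: "k \<in> carrier K" "k' \<in> carrier K" for k k'
  proof (rule \<kappa>_inj)
    have "F a (\<one> \<otimes> P (\<kappa> k')) = F a \<one> \<otimes> P (\<kappa> k')" by (rule FD(4)[OF a])
    then show "\<kappa> (\<pi> (s k \<otimes>\<^bsub>X\<^esub> t k' \<otimes>\<^bsub>X\<^esub> a)) = \<kappa> (k \<otimes>\<^bsub>K\<^esub> \<pi> a \<otimes>\<^bsub>K\<^esub> k')"
      using a k by (simp add: \<kappa>_\<pi> X_mult X.m_assoc F_s_mult F_t_mult \<kappa>_mult mult_assoc FD)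
  qed (use a k in \<open>simp_all add: X_mult\<close>)
  show "tensor_lift B2.T2 (\<lambda>(x, y). B2.e2 (x \<otimes>\<^bsub>X\<^esub> t k) y) (\<gamma> a) =
      tensor_lift B2.T2 (\<lambda>(x, y). B2.e2 x (y \<otimes>\<^bsub>X\<^esub> s k)) (\<gamma> a)" if k: "k \<in> carrier K" for k
  proof -
    have b1: "balanced_map X (carrier K) (\<lambda>l a. t l \<otimes>\<^bsub>X\<^esub> a) (\<lambda>l a. s l \<otimes>\<^bsub>X\<^esub> a) B2.T2 (\<lambda>x y. B2.e2 (x \<otimes>\<^bsub>X\<^esub> t k) y)"
      and b2: "balanced_map X (carrier K) (\<lambda>l a. t l \<otimes>\<^bsub>X\<^esub> a) (\<lambda>l a. s l \<otimes>\<^bsub>X\<^esub> a) B2.T2 (\<lambda>x y. B2.e2 x (y \<otimes>\<^bsub>X\<^esub> s k))"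
      unfolding balanced_map_def
      by (simp_all add: k B2.e2_closed X.l_distr B2.e2_rules(1,2) X.m_assoc B2.e2_rules(3))
    have "group_sum B2.T2 (l a) (\<lambda>x y. B2.e2 (x \<otimes>\<^bsub>X\<^esub> t k) y) = group_sum B2.T2 (l a) (\<lambda>x y. B2.e2 x (y \<otimes>\<^bsub>X\<^esub> s k))"
    proof (rule sum_eqI)
      fix x y
      \<comment> \<open>The functional \<open>t k\<close> acts as left multiplication by
        \<open>Q (\<kappa> k)\<close>, which commutes with the value of \<open>v\<close>, and
        \<open>s k\<close> acts as right multiplication by it. Both put it between \<open>x\<close>
        and \<open>y\<close>.\<close>
      have "ps (l a) (\<lambda>u v. F (u \<otimes>\<^bsub>X\<^esub> t k) (F v x \<otimes> y)) = ps (l a) (\<lambda>u v. F u (F v x \<otimes> (Q (\<kappa> k) \<otimes> y)))"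
      proof (rule pair_sum_cong)
        fix u v assume "(u, v) \<in> set (l a)"
        then have uv: "u \<in> carrier X" "v \<in> carrier X" using l_carrier[OF a] by auto
        have "Q (\<kappa> k) \<otimes> P (F v x) = P (F v x) \<otimes> Q (\<kappa> k)" by (rule P_Q_comm[symmetric])
        then have "Q (\<kappa> k) \<otimes> (F v x \<otimes> y) = F v x \<otimes> (Q (\<kappa> k) \<otimes> y)"
          using uv by (simp add: FD flip: mult_assoc)
        then show "F (u \<otimes>\<^bsub>X\<^esub> t k) (F v x \<otimes> y) = F u (F v x \<otimes> (Q (\<kappa> k) \<otimes> y))"
          using uv k by (simp add: F_mult hit_F_t)
      qed
      moreover have "ps (l a) (\<lambda>u v. F u (F (v \<otimes>\<^bsub>X\<^esub> s k) x \<otimes> y)) = ps (l a) (\<lambda>u v. F u (F v (x \<otimes> Q (\<kappa> k)) \<otimes> y))"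
        by (rule pair_sum_cong) (use a k l_carrier[OF a] in \<open>auto simp: F_mult hit_F_s\<close>)
      ultimately show "ps (l a) (\<lambda>u v. F (u \<otimes>\<^bsub>X\<^esub> t k) (F v x \<otimes> y)) = ps (l a) (\<lambda>u v. F u (F (v \<otimes>\<^bsub>X\<^esub> s k) x \<otimes> y))"
        by (simp add: l_eval a mult_assoc)
    qed (use a k l_carrier[OF a] in \<open>auto intro: X_mult\<close>)
    then show ?thesis
      unfolding lift_\<gamma>[OF a B2.comm_group_T2 b1] lift_\<gamma>[OF a B2.comm_group_T2 b2] .
  qed
  assume b: "b \<in> carrier X"
  show "\<pi> (a \<otimes>\<^bsub>X\<^esub> s (\<pi> b)) = \<pi> (a \<otimes>\<^bsub>X\<^esub> b)" "\<pi> (a \<otimes>\<^bsub>X\<^esub> t (\<pi> b)) = \<pi> (a \<otimes>\<^bsub>X\<^esub> b)"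
  proof -
    \<comment> \<open>At \<open>\<one>\<close> the operators of \<open>b\<close>, of the source of
      \<open>\<pi> b\<close> and of its target all give this element, which yields both counit
      axioms.\<close>
    have h: "hit (F b) \<one> = Q (F b \<one>)"
      by (simp add: hit_def cop_one[OF bal_hit[OF F_fun[OF b]]])
    show "\<pi> (a \<otimes>\<^bsub>X\<^esub> s (\<pi> b)) = \<pi> (a \<otimes>\<^bsub>X\<^esub> b)" "\<pi> (a \<otimes>\<^bsub>X\<^esub> t (\<pi> b)) = \<pi> (a \<otimes>\<^bsub>X\<^esub> b)"
      by (rule \<kappa>_inj; use a b in \<open>simp add: \<kappa>_\<pi> X_mult F_mult hit_F_s hit_F_t h\<close>)+
  qed
  show "\<gamma> (a \<otimes>\<^bsub>X\<^esub> b) = tensor_lift B2.T2 (\<lambda>(x', y'). tensor_lift B2.T2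
      (\<lambda>(x, y). B2.e2 (x \<otimes>\<^bsub>X\<^esub> x') (y \<otimes>\<^bsub>X\<^esub> y')) (\<gamma> a)) (\<gamma> b)"
  proof -
    let ?G = "\<lambda>x' y'. group_sum B2.T2 (l a) (\<lambda>x y. B2.e2 (x \<otimes>\<^bsub>X\<^esub> x') (y \<otimes>\<^bsub>X\<^esub> y'))"
    let ?F = "\<lambda>x' y'. tensor_lift B2.T2 (\<lambda>(x, y). B2.e2 (x \<otimes>\<^bsub>X\<^esub> x') (y \<otimes>\<^bsub>X\<^esub> y')) (\<gamma> a)"
    have eq: "?F x' y' = ?G x' y'" if "x' \<in> carrier X" "y' \<in> carrier X" for x' y'
      by (rule lift_\<gamma>[OF a B2.comm_group_T2 balanced_mult[OF that]])
    have "balanced_map X (carrier K) (\<lambda>l a. t l \<otimes>\<^bsub>X\<^esub> a) (\<lambda>l a. s l \<otimes>\<^bsub>X\<^esub> a) B2.T2 ?F"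
      using balanced_mult_aux[OF a] unfolding balanced_map_def by (simp add: eq X_mult)
    then have "tensor_lift B2.T2 (\<lambda>(x', y'). ?F x' y') (\<gamma> b) = group_sum B2.T2 (l b) ?F"
      by (rule lift_\<gamma>[OF b B2.comm_group_T2])
    also have "\<dots> = group_sum B2.T2 (l b) ?G"
      by (rule group_sum_cong) (use l_carrier[OF b] eq in blast)
    also have "\<gamma> (a \<otimes>\<^bsub>X\<^esub> b) = \<dots>"
    proof (rule \<gamma>_eqI)
      have c: "?G u v \<in> carrier B2.T2" if "(u, v) \<in> set (l b)" for u v
        using mult_aux_closed[OF a] l_carrier[OF b that] by blast
      show "group_sum B2.T2 (l b) ?G \<in> carrier B2.T2"
        by (rule group_sum_closed[OF B2.T.is_monoid c])
      fix x y
      have "ev x y (group_sum B2.T2 (l b) ?G) = ps (l b) (\<lambda>u v. ev x y (?G u v))"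
        by (rule ev_sum[OF c])
      also have "\<dots> = ps (l b) (\<lambda>u v. F a (hit (F v) x \<otimes> hit (F u) y))"
        by (rule pair_sum_cong) (use a l_carrier[OF b] \<gamma>_mult_aux in blast)
      also have "\<dots> = F a (ps (l b) (\<lambda>u v. hit (F v) x \<otimes> hit (F u) y))"
        by (rule additive_ps[symmetric]) (rule FD[OF a])
      \<comment> \<open>Multiplicativity of the dual coproduct reflects that of \<open>c\<close>:
        the coproduct of \<open>x \<otimes> y\<close> splits into legs, the evaluation rule
        separates the two arguments of \<open>F b\<close>, and the Takeuchi condition for
        \<open>y\<close> sorts the factors by \<open>x\<close> and \<open>y\<close>.\<close>
      also have "ps (l b) (\<lambda>u v. hit (F v) x \<otimes> hit (F u) y) = hit (F b) (x \<otimes> y)"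
      proof -
        have "hit (F b) (x \<otimes> y) = ps (c x) (\<lambda>x1 x2. ps (c y) (\<lambda>y1 y2. x2 \<otimes> y2 \<otimes> Q (F b (x1 \<otimes> y1))))"
          unfolding hit_def by (rule cop_mult[OF bal_hit[OF F_fun[OF b]]])
        also have "\<dots> = ps (c x) (\<lambda>x1 x2. ps (c y) (\<lambda>y1 y2. ps (l b) (\<lambda>u v. x2 \<otimes> y2 \<otimes> Q (F u (F v x1 \<otimes> y1)))))"
          using b by (simp add: additive_ps[of Q] additive_def ps_mult_left flip: l_eval)
        also have "\<dots> = ps (l b) (\<lambda>u v. ps (c x) (\<lambda>x1 x2. ps (c y) (\<lambda>y1 y2. x2 \<otimes> y2 \<otimes> Q (F u (F v x1 \<otimes> y1)))))"
          by (simp only: ps_commute[of "l b"])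
        also have "\<dots> = ps (l b) (\<lambda>u v. hit (F v) x \<otimes> hit (F u) y)"
        proof (rule pair_sum_cong)
          fix u v assume "(u, v) \<in> set (l b)"
          then have uv: "u \<in> carrier X" "v \<in> carrier X" using l_carrier[OF b] by auto
          have "ps (c y) (\<lambda>y1 y2. x2 \<otimes> y2 \<otimes> Q (F u (F v x1 \<otimes> y1))) =
            ps (c y) (\<lambda>y1 y2. x2 \<otimes> (Q (F v x1) \<otimes> y2) \<otimes> Q (F u y1))" for x1 x2
            using cop_takeuchi[OF bal_hit_left[OF F_fun[OF uv(1)], of x2], of y "F v x1"]
            by (simp add: FD uv)
          then have "ps (c x) (\<lambda>x1 x2. ps (c y) (\<lambda>y1 y2. x2 \<otimes> y2 \<otimes> Q (F u (F v x1 \<otimes> y1)))) =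
            ps (c x) (\<lambda>x1 x2. ps (c y) (\<lambda>y1 y2. x2 \<otimes> Q (F v x1) \<otimes> (y2 \<otimes> Q (F u y1))))"
            by (simp add: mult_assoc)
          then show "ps (c x) (\<lambda>x1 x2. ps (c y) (\<lambda>y1 y2. x2 \<otimes> y2 \<otimes> Q (F u (F v x1 \<otimes> y1)))) =
            hit (F v) x \<otimes> hit (F u) y"
            by (simp add: hit_def ps_mult_left ps_mult_right) (rule ps_commute)
        qed
        finally show ?thesis by simp
      qed
      finally show "ev x y (group_sum B2.T2 (l b) ?G) = F (a \<otimes>\<^bsub>X\<^esub> b) (x \<otimes> y)"
        using a b by (simp add: F_mult)
    qed (use a b X_mult in auto)
    finally show ?thesis by simp
  qed
qed

end

text \<open>Two models over the same functionals are compared through these functionals, so a pair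
  of maps respecting \<open>F\<close> and \<open>\<kappa>\<close> respects all structure. For the
  coproduct this holds because it is determined by its evaluations.\<close>

theorem dual_model_iso:
  assumes M: "dual_model T P Q c A db (Tot B) (Bas B) (src B) (tgt B) (cop B) (cou B) F \<kappa> l"
    and M': "dual_model T P Q c A db' (Tot B') (Bas B') (src B') (tgt B') (cop B') (cou B') F' \<kappa>' l'"
    and \<Phi>: "\<And>b. b \<in> carrier (Tot B) \<Longrightarrow> \<Phi> b \<in> carrier (Tot B')" "\<And>b. b \<in> carrier (Tot B) \<Longrightarrow> F' (\<Phi> b) = F b"
    and \<phi>: "\<And>k. k \<in> carrier (Bas B) \<Longrightarrow> \<phi> k \<in> carrier (Bas B')" "\<And>k. k \<in> carrier (Bas B) \<Longrightarrow> \<kappa>' (\<phi> k) = \<kappa> k"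
  shows "left_bialgebroid_iso B B' \<Phi> \<phi>"
proof -
  interpret M: dual_model T P Q c A db "Tot B" "Bas B" "src B" "tgt B" "cop B" "cou B" F \<kappa> l by fact
  interpret M': dual_model T P Q c A db' "Tot B'" "Bas B'" "src B'" "tgt B'" "cop B'" "cou B'" F' \<kappa>' l' by fact
  have add: "\<Phi> (a \<oplus>\<^bsub>Tot B\<^esub> b) = \<Phi> a \<oplus>\<^bsub>Tot B'\<^esub> \<Phi> b" if "a \<in> carrier (Tot B)" "b \<in> carrier (Tot B)" for a b
    by (rule M'.F_eqI) (use that in \<open>simp_all add: \<Phi> M.X_add M'.X_add M.F_add M'.F_add\<close>)
  have mult: "\<Phi> (a \<otimes>\<^bsub>Tot B\<^esub> b) = \<Phi> a \<otimes>\<^bsub>Tot B'\<^esub> \<Phi> b" if "a \<in> carrier (Tot B)" "b \<in> carrier (Tot B)" for a b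
    by (rule M'.F_eqI) (use that in \<open>simp_all add: \<Phi> M.X_mult M'.X_mult M.F_mult M'.F_mult\<close>)
  have one: "\<Phi> \<one>\<^bsub>Tot B\<^esub> = \<one>\<^bsub>Tot B'\<^esub>"
    by (rule M'.F_eqI) (simp_all add: \<Phi> M.X_one M'.X_one M.F_one M'.F_one)
  have \<Phi>_iso: "\<Phi> \<in> ring_iso (Tot B) (Tot B')"
  proof (rule ring_iso_memI)
    show "bij_betw \<Phi> (carrier (Tot B)) (carrier (Tot B'))"
    proof (rule bij_betwI[where g = "\<lambda>b'. M.inv_F (F' b')"])
      fix b' assume b': "b' \<in> carrier (Tot B')"
      then show "\<Phi> (M.inv_F (F' b')) = b'"
        by (intro M'.F_eqI) (simp_all add: \<Phi> M.inv_F M'.F_fun)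
    next
      fix b assume b: "b \<in> carrier (Tot B)"
      then show "M.inv_F (F' (\<Phi> b)) = b"
        by (intro M.F_eqI) (simp_all add: \<Phi> M.inv_F M.F_fun)
    qed (use \<Phi> M.inv_F M'.F_fun in auto)
  qed (use \<Phi> add mult one in auto)
  have \<phi>_iso: "\<phi> \<in> ring_iso (Bas B) (Bas B')"
  proof (rule ring_iso_memI)
    interpret K: ring "Bas B" by (rule M.ring_K)
    interpret K': ring "Bas B'" by (rule M'.ring_K)
    show "bij_betw \<phi> (carrier (Bas B)) (carrier (Bas B'))"
    proof (rule bij_betwI[where g = "\<lambda>k'. M.inv_\<kappa> (\<kappa>' k')"])
      fix k' assume k': "k' \<in> carrier (Bas B')"
      then show "\<phi> (M.inv_\<kappa> (\<kappa>' k')) = k'"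
        by (intro M'.\<kappa>_inj) (simp_all add: \<phi> M.inv_\<kappa>)
    next
      fix k assume k: "k \<in> carrier (Bas B)"
      then show "M.inv_\<kappa> (\<kappa>' (\<phi> k)) = k"
        by (intro M.\<kappa>_inj) (simp_all add: \<phi> M.inv_\<kappa>)
    qed (use \<phi> M.inv_\<kappa> in auto)
    show "\<phi> \<one>\<^bsub>Bas B\<^esub> = \<one>\<^bsub>Bas B'\<^esub>"
      by (rule M'.\<kappa>_inj) (simp_all add: \<phi> M.\<kappa>_one M'.\<kappa>_one)
    fix k k' assume k: "k \<in> carrier (Bas B)" "k' \<in> carrier (Bas B)"
    show "\<phi> (k \<otimes>\<^bsub>Bas B\<^esub> k') = \<phi> k \<otimes>\<^bsub>Bas B'\<^esub> \<phi> k'" "\<phi> (k \<oplus>\<^bsub>Bas B\<^esub> k') = \<phi> k \<oplus>\<^bsub>Bas B'\<^esub> \<phi> k'"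
      by (rule M'.\<kappa>_inj; use k in \<open>simp add: \<phi> M.\<kappa>_mult M'.\<kappa>_mult M.\<kappa>_add M'.\<kappa>_add\<close>)+
  qed (use \<phi> in auto)
  have src: "src B' (\<phi> k) = \<Phi> (src B k)" and tgt: "tgt B' (\<phi> k) = \<Phi> (tgt B k)" if "k \<in> carrier (Bas B)" for k
    by (rule M'.F_eqI; use that in \<open>simp add: \<Phi> \<phi> M.F_s M'.F_s M.F_t M'.F_t\<close>)+
  have cou: "cou B' (\<Phi> a) = \<phi> (cou B a)" if "a \<in> carrier (Tot B)" for a
    by (rule M'.\<kappa>_inj) (use that in \<open>simp_all add: \<Phi> \<phi> M.\<kappa>_\<pi> M'.\<kappa>_\<pi>\<close>)
  have cop: "cop B' (\<Phi> a) = tensor_lift (ltensor (Tot B') (Bas B') (src B') (tgt B'))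
      (\<lambda>(x, y). ltens (Tot B') (Bas B') (src B') (tgt B') (\<Phi> x) (\<Phi> y)) (cop B a)" if a: "a \<in> carrier (Tot B)" for a
  proof -
    have "balanced_map (Tot B) (carrier (Bas B)) (\<lambda>l a. tgt B l \<otimes>\<^bsub>Tot B\<^esub> a) (\<lambda>l a. src B l \<otimes>\<^bsub>Tot B\<^esub> a)
       M'.B2.T2 (\<lambda>x y. M'.B2.e2 (\<Phi> x) (\<Phi> y))"
      unfolding balanced_map_def
      by (simp add: \<Phi> \<phi> add mult M'.B2.e2_closed M'.B2.e2_rules(1,2) M'.B2.e2_rules(3) flip: src tgt)
    then have "tensor_lift M'.B2.T2 (\<lambda>(x, y). M'.B2.e2 (\<Phi> x) (\<Phi> y)) (cop B a) =
        group_sum M'.B2.T2 (l a) (\<lambda>x y. M'.B2.e2 (\<Phi> x) (\<Phi> y))"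
      by (rule M.lift_\<gamma>[OF a M'.B2.comm_group_T2])
    \<comment> \<open>The images of the entries evaluate like the coproduct of
      \<open>\<Phi> a\<close> in the second model, which identifies the tensor although the entries
      chosen there may differ.\<close>
    also have "\<dots> = cop B' (\<Phi> a)"
    proof (rule M'.\<gamma>_sum_eqI[symmetric])
      fix x y
      have "M.ps (l a) (\<lambda>u v. F' (\<Phi> u) (F' (\<Phi> v) x \<otimes>\<^bsub>T\<^esub> y)) = M.ps (l a) (\<lambda>u v. F u (F v x \<otimes>\<^bsub>T\<^esub> y))"
        by (rule pair_sum_cong) (use M.l_carrier[OF a] \<Phi> in auto)
      then show "M.ps (l a) (\<lambda>u v. F' (\<Phi> u) (F' (\<Phi> v) x \<otimes>\<^bsub>T\<^esub> y)) = F' (\<Phi> a) (x \<otimes>\<^bsub>T\<^esub> y)"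
        by (simp add: M.l_eval a \<Phi>)
    qed (use \<Phi> a M.l_carrier[OF a] in auto)
    finally show ?thesis by (simp add: M'.ltensor_defs)
  qed
  show ?thesis
    unfolding left_bialgebroid_iso_def left_bialgebroid_def
    using M.left_bialgebroid M'.left_bialgebroid \<Phi>_iso \<phi>_iso src tgt cou cop by blast
qed

section \<open>Hopf algebroids in Sweedler form\<close>

lemma tensor_opp_ring:
  "tensor2 (opp_ring A) = tensor2 A" "tens2 (opp_ring A) = tens2 A"
  by (simp_all add: fun_eq_iff tensor2_def tensor2_null_def tens2_def tensor2_rels_def)

lemma rt_opp_ring [simp]: "rt (opp_ring A) = rt A"
  by (simp add: fun_eq_iff rt_def)

context symmetrized_hopf_algebroid
begin

abbreviation "A \<equiv> Tot AL"

sublocale R: right_bialgebroid_ops A "Bas AR" "src AR" "tgt AR" "cop AR" "cou AR"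
  using right same_total by (simp add: right_bialgebroid_def)

sublocale L: right_bialgebroid_ops "opp_ring A" "Bas AL" "tgt AL" "src AL" "cop AL" "cou AL"
  by (rule left_imp_right_opp) (use left in \<open>simp add: left_bialgebroid_def\<close>)

interpretation A: ring A by (rule R.ring_total)
interpretation LL: left_bialgebroid_ops A "Bas AL" "src AL" "tgt AL" "cop AL" "cou AL"
  using left by (simp add: left_bialgebroid_def)

lemmas LA = L.s_closed[simplified] L.t_closed[simplified]

abbreviation "T \<equiv> tot A"

lemma ex_R: "l \<in> carrier (Bas AL) \<Longrightarrow> \<exists>r\<in>carrier (Bas AR). src AL l = tgt AR r"
  "l \<in> carrier (Bas AL) \<Longrightarrow> \<exists>r\<in>carrier (Bas AR). tgt AL l = src AR r"
  using src_left_tgt_right tgt_left_src_right by blast+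

lemma ex_L: "r \<in> carrier (Bas AR) \<Longrightarrow> \<exists>l\<in>carrier (Bas AL). tgt AR r = src AL l"
  "r \<in> carrier (Bas AR) \<Longrightarrow> \<exists>l\<in>carrier (Bas AL). src AR r = tgt AL l"
  using src_left_tgt_right tgt_left_src_right by blast+

lemma sproj_mem: "\<exists>k\<in>carrier (Bas AR). R.sproj x = src AR k \<and> R.tproj x = tgt AR k"
  "\<exists>k\<in>carrier (Bas AL). L.sproj x = tgt AL k \<and> L.tproj x = src AL k"
  by (auto simp: R.sproj_def R.tproj_def L.sproj_def L.tproj_def
      intro!: bexI[of _ "cou AR (rt A x)"] bexI[of _ "cou AL (rt A x)"])

lemma rep_L: "x \<in> carrier A \<Longrightarrow> set (L.rep x) \<subseteq> carrier A \<times> carrier A \<and> cop AL x =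
    group_sum (tensor2 A (carrier (Bas AL)) (\<lambda>l a. tgt AL l \<otimes>\<^bsub>A\<^esub> a) (\<lambda>l a. src AL l \<otimes>\<^bsub>A\<^esub> a)) (L.rep x)
      (tens2 A (carrier (Bas AL)) (\<lambda>l a. tgt AL l \<otimes>\<^bsub>A\<^esub> a) (\<lambda>l a. src AL l \<otimes>\<^bsub>A\<^esub> a))"
  using L.rep[of x] L.rep_set[of x] by (simp add: tensor_opp_ring)

lemma rep_R: "x \<in> carrier A \<Longrightarrow> set (R.rep x) \<subseteq> carrier A \<times> carrier A \<and> cop AR x =
    group_sum (tensor2 A (carrier (Bas AR)) (\<lambda>r a. a \<otimes>\<^bsub>A\<^esub> src AR r) (\<lambda>r a. a \<otimes>\<^bsub>A\<^esub> tgt AR r)) (R.rep x)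
      (tens2 A (carrier (Bas AR)) (\<lambda>r a. a \<otimes>\<^bsub>A\<^esub> src AR r) (\<lambda>r a. a \<otimes>\<^bsub>A\<^esub> tgt AR r))"
  using R.rep[of x] R.rep_set[of x] by simp

lemma bt_L: "balanced_tensor A (carrier (Bas AL)) (\<lambda>l a. tgt AL l \<otimes>\<^bsub>A\<^esub> a) (\<lambda>l a. src AL l \<otimes>\<^bsub>A\<^esub> a)"
  and bt_R: "balanced_tensor A (carrier (Bas AR)) (\<lambda>r a. a \<otimes>\<^bsub>A\<^esub> src AR r) (\<lambda>r a. a \<otimes>\<^bsub>A\<^esub> tgt AR r)"
  by (unfold_locales; simp add: LA)+

lemma cop_L_hom: "cop AL \<in> hom (add_monoid A)
    (tensor2 A (carrier (Bas AL)) (\<lambda>l a. tgt AL l \<otimes>\<^bsub>A\<^esub> a) (\<lambda>l a. src AL l \<otimes>\<^bsub>A\<^esub> a))"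
  using LL.coprod_add by (simp only: ltensor_def)

lemma cop_R_hom: "cop AR \<in> hom (add_monoid A)
    (tensor2 A (carrier (Bas AR)) (\<lambda>r a. a \<otimes>\<^bsub>A\<^esub> src AR r) (\<lambda>r a. a \<otimes>\<^bsub>A\<^esub> tgt AR r))"
  using R.coprod_add by (simp only: rtensor_def)

sublocale LR: balanced_tensor3 A "carrier (Bas AL)" "\<lambda>l a. tgt AL l \<otimes>\<^bsub>A\<^esub> a" "\<lambda>l a. src AL l \<otimes>\<^bsub>A\<^esub> a"
    "carrier (Bas AR)" "\<lambda>r a. a \<otimes>\<^bsub>A\<^esub> src AR r" "\<lambda>r a. a \<otimes>\<^bsub>A\<^esub> tgt AR r"
  by unfold_locales (simp_all add: LA)

sublocale RL: balanced_tensor3 A "carrier (Bas AR)" "\<lambda>r a. a \<otimes>\<^bsub>A\<^esub> src AR r" "\<lambda>r a. a \<otimes>\<^bsub>A\<^esub> tgt AR r"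
    "carrier (Bas AL)" "\<lambda>l a. tgt AL l \<otimes>\<^bsub>A\<^esub> a" "\<lambda>l a. src AL l \<otimes>\<^bsub>A\<^esub> a"
  by unfold_locales (simp_all add: LA)

text \<open>Scalars of the right base are scalars of the left base with source and target exchanged,
  so the left coproduct is linear for them as well. The mixed iterated coproducts are well defined
  for this reason.\<close>

lemma cop_L_mult:
  assumes "x \<in> carrier A" "r \<in> carrier (Bas AR)"
  shows "cop AL (x \<otimes>\<^bsub>A\<^esub> src AR r) =
    group_sum (tensor2 A (carrier (Bas AL)) (\<lambda>l a. tgt AL l \<otimes>\<^bsub>A\<^esub> a) (\<lambda>l a. src AL l \<otimes>\<^bsub>A\<^esub> a)) (L.rep x)
      (\<lambda>u v. tens2 A (carrier (Bas AL)) (\<lambda>l a. tgt AL l \<otimes>\<^bsub>A\<^esub> a) (\<lambda>l a. src AL l \<otimes>\<^bsub>A\<^esub> a) u (v \<otimes>\<^bsub>A\<^esub> src AR r))"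
    "cop AL (x \<otimes>\<^bsub>A\<^esub> tgt AR r) =
    group_sum (tensor2 A (carrier (Bas AL)) (\<lambda>l a. tgt AL l \<otimes>\<^bsub>A\<^esub> a) (\<lambda>l a. src AL l \<otimes>\<^bsub>A\<^esub> a)) (L.rep x)
      (\<lambda>u v. tens2 A (carrier (Bas AL)) (\<lambda>l a. tgt AL l \<otimes>\<^bsub>A\<^esub> a) (\<lambda>l a. src AL l \<otimes>\<^bsub>A\<^esub> a) (u \<otimes>\<^bsub>A\<^esub> tgt AR r) v)"
proof -
  obtain l where "l \<in> carrier (Bas AL)" "src AR r = tgt AL l" using ex_L assms by blast
  then show "cop AL (x \<otimes>\<^bsub>A\<^esub> src AR r) =
    group_sum (tensor2 A (carrier (Bas AL)) (\<lambda>l a. tgt AL l \<otimes>\<^bsub>A\<^esub> a) (\<lambda>l a. src AL l \<otimes>\<^bsub>A\<^esub> a)) (L.rep x)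
      (\<lambda>u v. tens2 A (carrier (Bas AL)) (\<lambda>l a. tgt AL l \<otimes>\<^bsub>A\<^esub> a) (\<lambda>l a. src AL l \<otimes>\<^bsub>A\<^esub> a) u (v \<otimes>\<^bsub>A\<^esub> src AR r))"
    using L.\<gamma>_mult_left(1)[of x l] assms by (simp add: tensor_opp_ring)
  obtain l where "l \<in> carrier (Bas AL)" "tgt AR r = src AL l" using ex_L assms by blast
  then show "cop AL (x \<otimes>\<^bsub>A\<^esub> tgt AR r) =
    group_sum (tensor2 A (carrier (Bas AL)) (\<lambda>l a. tgt AL l \<otimes>\<^bsub>A\<^esub> a) (\<lambda>l a. src AL l \<otimes>\<^bsub>A\<^esub> a)) (L.rep x)
      (\<lambda>u v. tens2 A (carrier (Bas AL)) (\<lambda>l a. tgt AL l \<otimes>\<^bsub>A\<^esub> a) (\<lambda>l a. src AL l \<otimes>\<^bsub>A\<^esub> a) (u \<otimes>\<^bsub>A\<^esub> tgt AR r) v)"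
    using L.\<gamma>_mult_left(2)[of x l] assms by (simp add: tensor_opp_ring)
qed

lemma cop_R_mult:
  assumes "x \<in> carrier A" "l \<in> carrier (Bas AL)"
  shows "cop AR (tgt AL l \<otimes>\<^bsub>A\<^esub> x) =
    group_sum (tensor2 A (carrier (Bas AR)) (\<lambda>r a. a \<otimes>\<^bsub>A\<^esub> src AR r) (\<lambda>r a. a \<otimes>\<^bsub>A\<^esub> tgt AR r)) (R.rep x)
      (\<lambda>u v. tens2 A (carrier (Bas AR)) (\<lambda>r a. a \<otimes>\<^bsub>A\<^esub> src AR r) (\<lambda>r a. a \<otimes>\<^bsub>A\<^esub> tgt AR r) u (tgt AL l \<otimes>\<^bsub>A\<^esub> v))"
    "cop AR (src AL l \<otimes>\<^bsub>A\<^esub> x) =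
    group_sum (tensor2 A (carrier (Bas AR)) (\<lambda>r a. a \<otimes>\<^bsub>A\<^esub> src AR r) (\<lambda>r a. a \<otimes>\<^bsub>A\<^esub> tgt AR r)) (R.rep x)
      (\<lambda>u v. tens2 A (carrier (Bas AR)) (\<lambda>r a. a \<otimes>\<^bsub>A\<^esub> src AR r) (\<lambda>r a. a \<otimes>\<^bsub>A\<^esub> tgt AR r) (src AL l \<otimes>\<^bsub>A\<^esub> u) v)"
proof -
  obtain r where "r \<in> carrier (Bas AR)" "tgt AL l = src AR r" using ex_R assms by blast
  then show "cop AR (tgt AL l \<otimes>\<^bsub>A\<^esub> x) =
    group_sum (tensor2 A (carrier (Bas AR)) (\<lambda>r a. a \<otimes>\<^bsub>A\<^esub> src AR r) (\<lambda>r a. a \<otimes>\<^bsub>A\<^esub> tgt AR r)) (R.rep x)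
      (\<lambda>u v. tens2 A (carrier (Bas AR)) (\<lambda>r a. a \<otimes>\<^bsub>A\<^esub> src AR r) (\<lambda>r a. a \<otimes>\<^bsub>A\<^esub> tgt AR r) u (tgt AL l \<otimes>\<^bsub>A\<^esub> v))"
    using R.\<gamma>_mult_left(1)[of x r] assms by simp
  obtain r where "r \<in> carrier (Bas AR)" "src AL l = tgt AR r" using ex_R assms by blast
  then show "cop AR (src AL l \<otimes>\<^bsub>A\<^esub> x) =
    group_sum (tensor2 A (carrier (Bas AR)) (\<lambda>r a. a \<otimes>\<^bsub>A\<^esub> src AR r) (\<lambda>r a. a \<otimes>\<^bsub>A\<^esub> tgt AR r)) (R.rep x)
      (\<lambda>u v. tens2 A (carrier (Bas AR)) (\<lambda>r a. a \<otimes>\<^bsub>A\<^esub> src AR r) (\<lambda>r a. a \<otimes>\<^bsub>A\<^esub> tgt AR r) (src AL l \<otimes>\<^bsub>A\<^esub> u) v)"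
    using R.\<gamma>_mult_left(2)[of x r] assms by simp
qed

lemma mixed_lr_sum:
  assumes a: "a \<in> carrier A"
  shows "group_sum LR.T3 (R.rep a) (\<lambda>x y. group_sum LR.T3 (L.rep x) (\<lambda>u v. LR.e3 u v y)) =
    group_sum LR.T3 (L.rep a) (\<lambda>x y. group_sum LR.T3 (R.rep y) (\<lambda>u v. LR.e3 x u v))"
  using mixed_coassoc_lr[OF a]
    LR.coprod_fst_sum[OF bt_L bt_R cop_L_hom rep_L cop_L_mult(1) R.rep_set[of a]]
    LR.coprod_snd_sum[OF bt_L bt_R cop_R_hom rep_R cop_R_mult(2) conjunct1[OF rep_L[OF a]]]
  by (simp only: lr_tensor3_def lr_tens3_def[abs_def] Let_def conjunct2[OF rep_R[OF a]] conjunct2[OF rep_L[OF a]])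

lemma mixed_rl_sum:
  assumes a: "a \<in> carrier A"
  shows "group_sum RL.T3 (L.rep a) (\<lambda>x y. group_sum RL.T3 (R.rep x) (\<lambda>u v. RL.e3 u v y)) =
    group_sum RL.T3 (R.rep a) (\<lambda>x y. group_sum RL.T3 (L.rep y) (\<lambda>u v. RL.e3 x u v))"
  using mixed_coassoc_rl[OF a]
    RL.coprod_fst_sum[OF bt_R bt_L cop_R_hom rep_R cop_R_mult(1) conjunct1[OF rep_L[OF a]]]
    RL.coprod_snd_sum[OF bt_R bt_L cop_L_hom rep_L cop_L_mult(2) R.rep_set[of a]]
  by (simp only: rl_tensor3_def rl_tens3_def[abs_def] Let_def conjunct2[OF rep_R[OF a]] conjunct2[OF rep_L[OF a]])

lemma ex_mr: "\<exists>r. \<forall>x\<in>carrier A. x \<otimes>\<^bsub>A\<^esub> src AR k = x \<otimes>\<^bsub>T\<^esub> R.sproj r \<and> x \<otimes>\<^bsub>A\<^esub> tgt AR k = x \<otimes>\<^bsub>T\<^esub> R.tproj r"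
  if "k \<in> carrier (Bas AR)"
  using that by (intro exI[of _ "src AR k"]) simp

lemma ex_ml: "\<exists>r. \<forall>x\<in>carrier A. tgt AL k \<otimes>\<^bsub>A\<^esub> x = L.sproj r \<otimes>\<^bsub>T\<^esub> x \<and> src AL k \<otimes>\<^bsub>A\<^esub> x = L.tproj r \<otimes>\<^bsub>T\<^esub> x"
  if "k \<in> carrier (Bas AL)"
  using that LA by (intro exI[of _ "tgt AL k"]) simp

lemma L_rep_set: "set (L.rep a) \<subseteq> carrier A \<times> carrier A"
  using L.rep_set by simp

lemma R_rep_set: "set (R.rep a) \<subseteq> carrier A \<times> carrier A"
  by (rule R.rep_set)

theorem sweedler_pair: "sweedler_pair T R.sproj R.tproj R.rep L.sproj L.tproj L.rep"
proof -
  interpret SR: right_sweedler T R.sproj R.tproj R.rep by (rule R.sweedler)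
  have SL: "right_sweedler (opp_ring T) L.sproj L.tproj L.rep"
    using L.sweedler by (simp add: tot_opp_ring)
  show ?thesis
  proof (intro sweedler_pair.intro sweedler_pair_axioms.intro R.sweedler SL)
    fix x
    obtain k where k: "k \<in> carrier (Bas AL)" "L.sproj x = tgt AL k" "L.tproj x = src AL k" using sproj_mem by blast
    show "R.sproj (L.sproj x) = L.sproj x" "R.tproj (L.tproj x) = L.tproj x"
      using ex_R[OF k(1)] k by auto
    obtain k where k: "k \<in> carrier (Bas AR)" "R.sproj x = src AR k" "R.tproj x = tgt AR k" using sproj_mem by blast
    show "L.sproj (R.sproj x) = R.sproj x" "L.tproj (R.tproj x) = R.tproj x"
      using ex_L[OF k(1)] k by auto
  next
    fix g a
    assume g: "balanced3 T (\<lambda>r x. L.sproj r \<otimes>\<^bsub>T\<^esub> x) (\<lambda>r y. L.tproj r \<otimes>\<^bsub>T\<^esub> y) (\<lambda>r y. y \<otimes>\<^bsub>T\<^esub> R.sproj r) (\<lambda>r z. z \<otimes>\<^bsub>T\<^esub> R.tproj r) g"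
    have bg: "balanced_map3 A (carrier (Bas AL)) (\<lambda>l a. tgt AL l \<otimes>\<^bsub>A\<^esub> a) (\<lambda>l a. src AL l \<otimes>\<^bsub>A\<^esub> a)
      (carrier (Bas AR)) (\<lambda>r a. a \<otimes>\<^bsub>A\<^esub> src AR r) (\<lambda>r a. a \<otimes>\<^bsub>A\<^esub> tgt AR r) (add_monoid A) (\<lambda>x y z. rt A (g x y z))"
      by (rule balanced_map3_tot[OF R.ring_total g ex_ml ex_mr])
    have "tensor_lift (add_monoid A) (\<lambda>(x, y, z). rt A (g x y z)) (group_sum LR.T3 (R.rep (rt A a))
          (\<lambda>x y. group_sum LR.T3 (L.rep x) (\<lambda>u v. LR.e3 u v y))) =
        pair_sum T (R.rep (rt A a)) (\<lambda>x y. pair_sum T (L.rep x) (\<lambda>u v. g u v y))"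
      by (rule LR.lift3_tot[OF R.ring_total bg R_rep_set L_rep_set]) (use R_rep_set L_rep_set in blast)
    moreover have "tensor_lift (add_monoid A) (\<lambda>(x, y, z). rt A (g x y z)) (group_sum LR.T3 (L.rep (rt A a))
          (\<lambda>x y. group_sum LR.T3 (R.rep y) (\<lambda>u v. LR.e3 x u v))) =
        pair_sum T (L.rep (rt A a)) (\<lambda>x y. pair_sum T (R.rep y) (\<lambda>u v. g x u v))"
      by (rule LR.lift3_tot[OF R.ring_total bg L_rep_set R_rep_set]) (use R_rep_set L_rep_set in blast)
    ultimately show "pair_sum T (R.rep a) (\<lambda>x y. pair_sum T (L.rep x) (\<lambda>u v. g u v y)) =
      pair_sum T (L.rep a) (\<lambda>x y. pair_sum T (R.rep y) (\<lambda>u v. g x u v))"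
      using mixed_lr_sum[of "rt A a"] L.rep_rt_arg[of a]
      by (simp only: R.rep_rt_arg rt_carrier[OF R.ring_total] rt_opp_ring)
  next
    fix g a
    assume g: "balanced3 T (\<lambda>r x. x \<otimes>\<^bsub>T\<^esub> R.sproj r) (\<lambda>r y. y \<otimes>\<^bsub>T\<^esub> R.tproj r) (\<lambda>r y. L.sproj r \<otimes>\<^bsub>T\<^esub> y) (\<lambda>r z. L.tproj r \<otimes>\<^bsub>T\<^esub> z) g"
    have bg: "balanced_map3 A (carrier (Bas AR)) (\<lambda>r a. a \<otimes>\<^bsub>A\<^esub> src AR r) (\<lambda>r a. a \<otimes>\<^bsub>A\<^esub> tgt AR r)
      (carrier (Bas AL)) (\<lambda>l a. tgt AL l \<otimes>\<^bsub>A\<^esub> a) (\<lambda>l a. src AL l \<otimes>\<^bsub>A\<^esub> a) (add_monoid A) (\<lambda>x y z. rt A (g x y z))"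
      by (rule balanced_map3_tot[OF R.ring_total g ex_mr ex_ml])
    have "tensor_lift (add_monoid A) (\<lambda>(x, y, z). rt A (g x y z)) (group_sum RL.T3 (L.rep (rt A a))
          (\<lambda>x y. group_sum RL.T3 (R.rep x) (\<lambda>u v. RL.e3 u v y))) =
        pair_sum T (L.rep (rt A a)) (\<lambda>x y. pair_sum T (R.rep x) (\<lambda>u v. g u v y))"
      by (rule RL.lift3_tot[OF R.ring_total bg L_rep_set R_rep_set]) (use R_rep_set L_rep_set in blast)
    moreover have "tensor_lift (add_monoid A) (\<lambda>(x, y, z). rt A (g x y z)) (group_sum RL.T3 (R.rep (rt A a))
          (\<lambda>x y. group_sum RL.T3 (L.rep y) (\<lambda>u v. RL.e3 x u v))) =
        pair_sum T (R.rep (rt A a)) (\<lambda>x y. pair_sum T (L.rep y) (\<lambda>u v. g x u v))"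
      by (rule RL.lift3_tot[OF R.ring_total bg R_rep_set L_rep_set]) (use R_rep_set L_rep_set in blast)
    ultimately show "pair_sum T (L.rep a) (\<lambda>x y. pair_sum T (R.rep x) (\<lambda>u v. g u v y)) =
      pair_sum T (R.rep a) (\<lambda>x y. pair_sum T (L.rep y) (\<lambda>u v. g x u v))"
      using mixed_rl_sum[of "rt A a"] L.rep_rt_arg[of a]
      by (simp only: R.rep_rt_arg rt_carrier[OF R.ring_total] rt_opp_ring)
  qed
qed

lemma S_closed: "a \<in> carrier A \<Longrightarrow> S a \<in> carrier A"
  and S_add: "a \<in> carrier A \<Longrightarrow> b \<in> carrier A \<Longrightarrow> S (a \<oplus>\<^bsub>A\<^esub> b) = S a \<oplus>\<^bsub>A\<^esub> S b"
  and S_bij: "bij_betw S (carrier A) (carrier A)"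
  using antipode_bij by (auto simp: iso_def hom_def)

lemma S_zero: "S \<zero>\<^bsub>A\<^esub> = \<zero>\<^bsub>A\<^esub>"
  using S_add[of "\<zero>\<^bsub>A\<^esub>" "\<zero>\<^bsub>A\<^esub>"] S_closed[of "\<zero>\<^bsub>A\<^esub>"] by simp

lemma S_mult_base:
  assumes a: "a \<in> carrier A"
  shows "l \<in> carrier (Bas AL) \<Longrightarrow> S (tgt AL l \<otimes>\<^bsub>A\<^esub> a) = S a \<otimes>\<^bsub>A\<^esub> src AL l"
    "l \<in> carrier (Bas AL) \<Longrightarrow> S (a \<otimes>\<^bsub>A\<^esub> tgt AL l) = src AL l \<otimes>\<^bsub>A\<^esub> S a"
    "r \<in> carrier (Bas AR) \<Longrightarrow> S (tgt AR r \<otimes>\<^bsub>A\<^esub> a) = S a \<otimes>\<^bsub>A\<^esub> src AR r"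
    "r \<in> carrier (Bas AR) \<Longrightarrow> S (a \<otimes>\<^bsub>A\<^esub> tgt AR r) = src AR r \<otimes>\<^bsub>A\<^esub> S a"
proof -
  interpret BL: ring "Bas AL" by (rule L.ring_base)
  interpret BR: ring "Bas AR" by (rule R.ring_base)
  have "src AL \<one>\<^bsub>Bas AL\<^esub> = \<one>\<^bsub>A\<^esub>" "tgt AL \<one>\<^bsub>Bas AL\<^esub> = \<one>\<^bsub>A\<^esub>" using L.s_one L.t_one by simp_all
  then show "l \<in> carrier (Bas AL) \<Longrightarrow> S (tgt AL l \<otimes>\<^bsub>A\<^esub> a) = S a \<otimes>\<^bsub>A\<^esub> src AL l"
    "l \<in> carrier (Bas AL) \<Longrightarrow> S (a \<otimes>\<^bsub>A\<^esub> tgt AL l) = src AL l \<otimes>\<^bsub>A\<^esub> S a"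
    using antipode_left[OF a, of l "\<one>\<^bsub>Bas AL\<^esub>"] antipode_left[OF a, of "\<one>\<^bsub>Bas AL\<^esub>" l]
    by (simp_all add: a S_closed LA)
  show "r \<in> carrier (Bas AR) \<Longrightarrow> S (tgt AR r \<otimes>\<^bsub>A\<^esub> a) = S a \<otimes>\<^bsub>A\<^esub> src AR r"
    "r \<in> carrier (Bas AR) \<Longrightarrow> S (a \<otimes>\<^bsub>A\<^esub> tgt AR r) = src AR r \<otimes>\<^bsub>A\<^esub> S a"
    using antipode_right[OF a, of r "\<one>\<^bsub>Bas AR\<^esub>"] antipode_right[OF a, of "\<one>\<^bsub>Bas AR\<^esub>" r]
    by (simp_all add: a S_closed)
qed

theorem sweedler_hopf: "sweedler_hopf T R.sproj R.tproj R.rep L.sproj L.tproj L.rep (\<lambda>x. S (rt A x))"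
proof (intro sweedler_hopf.intro sweedler_pair sweedler_hopf_axioms.intro)
  note ts = tot_simps[OF R.ring_total] rt_carrier[OF R.ring_total] rt_id[OF R.ring_total]
  fix x y r a
  show "S (rt A (x \<oplus>\<^bsub>T\<^esub> y)) = S (rt A x) \<oplus>\<^bsub>T\<^esub> S (rt A y)" by (simp add: ts S_add S_closed)
  show "S (rt A \<zero>\<^bsub>T\<^esub>) = \<zero>\<^bsub>T\<^esub>" by (simp add: ts S_zero)
  show "S (rt A x) \<oplus>\<^bsub>T\<^esub> \<zero>\<^bsub>T\<^esub> = S (rt A x)" by (simp add: ts S_closed)
  show "x \<oplus>\<^bsub>T\<^esub> \<zero>\<^bsub>T\<^esub> = y \<oplus>\<^bsub>T\<^esub> \<zero>\<^bsub>T\<^esub>" if "S (rt A x) = S (rt A y)"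
  proof -
    have "rt A x = rt A y"
      using bij_betw_imp_inj_on[OF S_bij] that by (rule inj_onD) (simp_all add: ts)
    then show ?thesis by (simp add: ts)
  qed
  show "\<exists>x. S (rt A x) = y \<oplus>\<^bsub>T\<^esub> \<zero>\<^bsub>T\<^esub>"
  proof -
    obtain z where "z \<in> carrier A" "S z = rt A y"
      using S_bij by (metis bij_betw_iff_bijections rt_carrier[OF R.ring_total])
    then show ?thesis by (intro exI[of _ z]) (simp add: ts)
  qed
  obtain k where k: "k \<in> carrier (Bas AL)" "L.sproj r = tgt AL k" "L.tproj r = src AL k" using sproj_mem by blast
  show "S (rt A (L.sproj r \<otimes>\<^bsub>T\<^esub> a)) = S (rt A a) \<otimes>\<^bsub>T\<^esub> L.tproj r" "S (rt A (a \<otimes>\<^bsub>T\<^esub> L.sproj r)) = L.tproj r \<otimes>\<^bsub>T\<^esub> S (rt A a)"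
    by (simp_all add: ts k LA S_mult_base S_closed)
  obtain k where k: "k \<in> carrier (Bas AR)" "R.sproj r = src AR k" "R.tproj r = tgt AR k" using sproj_mem by blast
  show "S (rt A (R.tproj r \<otimes>\<^bsub>T\<^esub> a)) = S (rt A a) \<otimes>\<^bsub>T\<^esub> R.sproj r" "S (rt A (a \<otimes>\<^bsub>T\<^esub> R.tproj r)) = R.sproj r \<otimes>\<^bsub>T\<^esub> S (rt A a)"
    by (simp_all add: ts k S_mult_base S_closed)
  have hom: "add_monoid (opp_ring A) = add_monoid A" by simp
  have "pair_sum T (L.rep a) (\<lambda>x y. S (rt A x) \<otimes>\<^bsub>T\<^esub> y) = pair_sum A (L.rep a) (\<lambda>x y. S x \<otimes>\<^bsub>A\<^esub> y)"
    unfolding pair_sum_tot[OF R.ring_total] by (rule pair_sum_cong) (use L_rep_set[of a] in \<open>auto simp: ts S_closed\<close>)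
  also have "\<dots> = tensor_lift (add_monoid A) (\<lambda>(x, y). S x \<otimes>\<^bsub>A\<^esub> y) (cop AL (rt A a))"
    using L.lift_add_rep[of "rt A a" "\<lambda>x y. S x \<otimes>\<^bsub>A\<^esub> y"] L.rep_rt_arg[of a] unfolding hom
    by (simp add: ts S_closed S_add A.l_distr A.r_distr S_mult_base A.m_assoc LA)
  also have "\<dots> = R.sproj a"
    unfolding R.sproj_def by (rule antipode_counit_right[OF rt_carrier[OF R.ring_total]])
  finally show "pair_sum T (L.rep a) (\<lambda>x y. S (rt A x) \<otimes>\<^bsub>T\<^esub> y) = R.sproj a" .
  have "pair_sum T (R.rep a) (\<lambda>x y. x \<otimes>\<^bsub>T\<^esub> S (rt A y)) = pair_sum A (R.rep a) (\<lambda>x y. x \<otimes>\<^bsub>A\<^esub> S y)"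
    unfolding pair_sum_tot[OF R.ring_total] by (rule pair_sum_cong) (use R_rep_set[of a] in \<open>auto simp: ts S_closed\<close>)
  also have "\<dots> = tensor_lift (add_monoid A) (\<lambda>(x, y). x \<otimes>\<^bsub>A\<^esub> S y) (cop AR (rt A a))"
    using R.lift_add_rep[of "rt A a" "\<lambda>x y. x \<otimes>\<^bsub>A\<^esub> S y"] R.rep_rt_arg[of a]
    by (simp add: ts S_closed S_add A.l_distr A.r_distr S_mult_base A.m_assoc)
  also have "\<dots> = L.tproj a"
    unfolding L.tproj_def rt_opp_ring by (rule antipode_counit_left[OF rt_carrier[OF R.ring_total]])
  finally show "pair_sum T (R.rep a) (\<lambda>x y. x \<otimes>\<^bsub>T\<^esub> S (rt A y)) = L.tproj a" .
qed

end

section \<open>Dual rings as rings of functionals\<close>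

text \<open>One description for all four duals. \<open>e\<close> is the structure map whose module
  structure the functionals respect and \<open>q\<close> is the counit; \<open>ss\<close> and
  \<open>tt\<close> are the source and target in this orientation. The other duals fit after passing
  to opposite rings or flipping the coproduct.\<close>

locale functional_space = right_sweedler T P Q c
  for T :: "'a ring" (structure) and P Q :: "'a \<Rightarrow> 'a" and c +
  fixes A :: "'a ring" and K :: "'k ring" and e :: "'k \<Rightarrow> 'a" and q :: "'a \<Rightarrow> 'k"
    and X :: "('a \<Rightarrow> 'k) ring" and ss tt :: "'k \<Rightarrow> 'a \<Rightarrow> 'k"
  assumes ring_A: "ring A" and T_eq: "T = tot A" and ring_K: "ring K"
    and e_hom: "e \<in> ring_hom K A" and q_closed: "a \<in> carrier A \<Longrightarrow> q a \<in> carrier K"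
    and q_e: "k \<in> carrier K \<Longrightarrow> q (e k) = k" and P_eq: "P x = e (q (rt A x))"
    and X_carrier: "carrier X = {\<phi> \<in> carrier A \<rightarrow>\<^sub>E carrier K. \<phi> \<in> hom (add_monoid A) (add_monoid K) \<and>
      (\<forall>a\<in>carrier A. \<forall>k\<in>carrier K. \<phi> (a \<otimes>\<^bsub>A\<^esub> e k) = \<phi> a \<otimes>\<^bsub>K\<^esub> k)}"
    and X_add_eq: "\<phi> \<oplus>\<^bsub>X\<^esub> \<psi> = (\<lambda>a\<in>carrier A. \<phi> a \<oplus>\<^bsub>K\<^esub> \<psi> a)"
    and X_mult_eq: "\<phi> \<in> carrier X \<Longrightarrow> \<psi> \<in> carrier X \<Longrightarrow>
      \<phi> \<otimes>\<^bsub>X\<^esub> \<psi> = (\<lambda>a\<in>carrier A. \<phi> (hit (\<lambda>x. e (\<psi> (rt A x))) a))"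
    and X_one_eq: "\<one>\<^bsub>X\<^esub> = (\<lambda>a\<in>carrier A. q a)" and X_zero_eq: "\<zero>\<^bsub>X\<^esub> = (\<lambda>a\<in>carrier A. \<zero>\<^bsub>K\<^esub>)"
    and ss_eq: "k \<in> carrier K \<Longrightarrow> ss k = (\<lambda>a\<in>carrier A. k \<otimes>\<^bsub>K\<^esub> q a)"
    and tt_eq: "k \<in> carrier K \<Longrightarrow> tt k = (\<lambda>a\<in>carrier A. q (e k \<otimes>\<^bsub>A\<^esub> a))"
begin

interpretation A: ring A by (rule ring_A)
interpretation K: ring K by (rule ring_K)

lemmas ts = T_eq tot_simps[OF ring_A] rt_carrier[OF ring_A] rt_id[OF ring_A] rt_rt[OF ring_A]

lemma T_carrier: "x \<in> carrier A \<longleftrightarrow> x \<oplus> \<zero> = x"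
  by (auto simp: ts rt_def)

lemma T_closed: "x \<otimes> y \<in> carrier A" "x \<oplus> y \<in> carrier A" "hit f x \<in> carrier A" "P x \<in> carrier A" "Q x \<in> carrier A"
  by (simp_all add: T_carrier)

lemma T_ops: "x \<in> carrier A \<Longrightarrow> y \<in> carrier A \<Longrightarrow> x \<oplus>\<^bsub>A\<^esub> y = x \<oplus> y"
  "x \<in> carrier A \<Longrightarrow> y \<in> carrier A \<Longrightarrow> x \<otimes>\<^bsub>A\<^esub> y = x \<otimes> y" "\<zero>\<^bsub>A\<^esub> = \<zero>" "\<one>\<^bsub>A\<^esub> = \<one>"
  by (simp_all add: ts)

lemma rt_eq: "rt A x = x \<oplus> \<zero>"
  by (simp add: ts)

lemma e_closed: "k \<in> carrier K \<Longrightarrow> e k \<in> carrier A"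
  and e_add: "k \<in> carrier K \<Longrightarrow> k' \<in> carrier K \<Longrightarrow> e (k \<oplus>\<^bsub>K\<^esub> k') = e k \<oplus> e k'"
  and e_mult: "k \<in> carrier K \<Longrightarrow> k' \<in> carrier K \<Longrightarrow> e (k \<otimes>\<^bsub>K\<^esub> k') = e k \<otimes> e k'"
  and e_one: "e \<one>\<^bsub>K\<^esub> = \<one>"
proof -
  show c: "e k \<in> carrier A" if "k \<in> carrier K" for k using e_hom that by (auto simp: ring_hom_def)
  show "k \<in> carrier K \<Longrightarrow> k' \<in> carrier K \<Longrightarrow> e (k \<oplus>\<^bsub>K\<^esub> k') = e k \<oplus> e k'"
    "k \<in> carrier K \<Longrightarrow> k' \<in> carrier K \<Longrightarrow> e (k \<otimes>\<^bsub>K\<^esub> k') = e k \<otimes> e k'" "e \<one>\<^bsub>K\<^esub> = \<one>"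
    using e_hom c by (auto simp: ring_hom_def T_ops[symmetric])
qed

lemma e_zero: "e \<zero>\<^bsub>K\<^esub> = \<zero>"
proof -
  have "e \<zero>\<^bsub>K\<^esub> = e \<zero>\<^bsub>K\<^esub> \<oplus>\<^bsub>A\<^esub> e \<zero>\<^bsub>K\<^esub>"
    using ring_hom_add[OF e_hom K.zero_closed K.zero_closed] by simp
  then have "e \<zero>\<^bsub>K\<^esub> = \<zero>\<^bsub>A\<^esub>" using e_closed[OF K.zero_closed] A.add.r_cancel_one' by metis
  then show ?thesis by (simp add: T_ops(3))
qed

lemma P_e: "k \<in> carrier K \<Longrightarrow> P (e k) = e k"
  by (simp add: P_eq e_closed rt_id[OF ring_A] q_e)

lemma e_q: "P x = x \<Longrightarrow> e (q x) = x"
  by (metis P_eq P_closed T_carrier rt_id[OF ring_A])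

lemma e_inj: "k \<in> carrier K \<Longrightarrow> k' \<in> carrier K \<Longrightarrow> e k = e k' \<Longrightarrow> k = k'"
  by (metis q_e)

lemma e_bij: "bij_betw e (carrier K) {x. P x = x}"
proof (rule bij_betwI[where g = q])
  show "e \<in> carrier K \<rightarrow> {x. P x = x}" by (auto simp: P_e)
  show "q \<in> {x. P x = x} \<rightarrow> carrier K" using q_closed T_carrier P_closed by (auto, metis)
qed (simp_all add: q_e e_q)

lemma P_ex: "\<exists>k\<in>carrier K. P x = e k"
  using P_eq q_closed rt_carrier[OF ring_A] by blast

definition func :: "('a \<Rightarrow> 'k) \<Rightarrow> 'a \<Rightarrow> 'a" where "func \<phi> x = e (\<phi> (rt A x))"

lemma X_D:
  assumes "\<phi> \<in> carrier X"
  shows "\<phi> \<in> extensional (carrier A)" "a \<in> carrier A \<Longrightarrow> \<phi> a \<in> carrier K"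
    "a \<in> carrier A \<Longrightarrow> b \<in> carrier A \<Longrightarrow> \<phi> (a \<oplus>\<^bsub>A\<^esub> b) = \<phi> a \<oplus>\<^bsub>K\<^esub> \<phi> b"
    "a \<in> carrier A \<Longrightarrow> k \<in> carrier K \<Longrightarrow> \<phi> (a \<otimes>\<^bsub>A\<^esub> e k) = \<phi> a \<otimes>\<^bsub>K\<^esub> k"
  using assms by (auto simp: X_carrier hom_def PiE_def)

lemma X_zero_val: "\<phi> \<in> carrier X \<Longrightarrow> \<phi> \<zero>\<^bsub>A\<^esub> = \<zero>\<^bsub>K\<^esub>"
  using X_D(3)[of \<phi> "\<zero>\<^bsub>A\<^esub>" "\<zero>\<^bsub>A\<^esub>"] X_D(2)[of \<phi> "\<zero>\<^bsub>A\<^esub>"] by simp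

lemma func_functional:
  assumes \<phi>: "\<phi> \<in> carrier X" shows "functional (func \<phi>)"
proof (rule functionalI)
  fix x y r
  have "func \<phi> (x \<oplus> y) = e (\<phi> (rt A x \<oplus>\<^bsub>A\<^esub> rt A y))" unfolding func_def by (simp add: ts)
  then show "func \<phi> (x \<oplus> y) = func \<phi> x \<oplus> func \<phi> y"
    by (simp add: func_def X_D[OF \<phi>] rt_carrier[OF ring_A] e_add)
  show "func \<phi> \<zero> = \<zero>"
    by (simp add: func_def rt_eq, simp add: T_ops(3)[symmetric] X_zero_val[OF \<phi>] e_zero[unfolded T_ops(3)[symmetric]])
  show "P (func \<phi> x) = func \<phi> x"
    by (simp add: func_def P_e X_D[OF \<phi>] rt_carrier[OF ring_A])
  obtain k where k: "k \<in> carrier K" "P r = e k" using P_ex by blast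
  have "rt A (x \<otimes> e k) = rt A x \<otimes>\<^bsub>A\<^esub> e k" using k by (simp add: ts e_closed)
  then show "func \<phi> (x \<otimes> P r) = func \<phi> x \<otimes> P r"
    by (simp add: func_def k X_D[OF \<phi>] rt_carrier[OF ring_A] e_mult)
qed

text \<open>Any map whose values have the form \<open>q (f a)\<close> is identified in this way with
  an element of the dual. The operations of \<open>X\<close> are handled by bringing them into this
  form.\<close>

lemma of_functional:
  assumes f: "functional f" and \<chi>: "\<chi> = (\<lambda>a\<in>carrier A. q (f a))"
  shows "\<chi> \<in> carrier X" "func \<chi> = f"
proof -
  note fD = functionalD[OF f]
  have ec: "e (q (f a)) = f a" for a by (rule e_q[OF fD(3)])
  have fa: "f a \<in> carrier A" for a by (simp add: T_carrier fD)
  have qc: "q (f a) \<in> carrier K" for a by (rule q_closed[OF fa])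
  show "\<chi> \<in> carrier X"
    unfolding X_carrier \<chi>
  proof (intro CollectI conjI ballI)
    show "(\<lambda>a\<in>carrier A. q (f a)) \<in> carrier A \<rightarrow>\<^sub>E carrier K" using qc by auto
    show "(\<lambda>a\<in>carrier A. q (f a)) \<in> hom (add_monoid A) (add_monoid K)"
    proof (rule homI)
      fix x y assume "x \<in> carrier (add_monoid A)" "y \<in> carrier (add_monoid A)"
      then have xy: "x \<in> carrier A" "y \<in> carrier A" by simp_all
      have "q (f (x \<oplus>\<^bsub>A\<^esub> y)) = q (f x) \<oplus>\<^bsub>K\<^esub> q (f y)"
        by (rule e_inj[OF qc K.a_closed[OF qc qc]], subst ec) (simp add: qc e_add ec T_ops xy fD)
      then show "(\<lambda>a\<in>carrier A. q (f a)) (x \<otimes>\<^bsub>add_monoid A\<^esub> y) =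
        (\<lambda>a\<in>carrier A. q (f a)) x \<otimes>\<^bsub>add_monoid K\<^esub> (\<lambda>a\<in>carrier A. q (f a)) y" using xy by simp
    qed (simp add: qc)
    fix a k assume ak: "a \<in> carrier A" "k \<in> carrier K"
    have "f (a \<otimes> P (e k)) = f a \<otimes> P (e k)" by (rule fD(4))
    then have "q (f (a \<otimes>\<^bsub>A\<^esub> e k)) = q (f a) \<otimes>\<^bsub>K\<^esub> k"
      by (intro e_inj[OF qc K.m_closed[OF qc ak(2)]], subst ec)
        (simp add: qc e_mult ec T_ops ak e_closed P_e)
    then show "(\<lambda>a\<in>carrier A. q (f a)) (a \<otimes>\<^bsub>A\<^esub> e k) = (\<lambda>a\<in>carrier A. q (f a)) a \<otimes>\<^bsub>K\<^esub> k"
      using ak by (simp add: e_closed)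
  qed
  show "func \<chi> = f"
    by (rule ext) (simp add: func_def \<chi> rt_carrier[OF ring_A] ec, simp add: rt_eq fD)
qed

lemma func_inj: "\<phi> \<in> carrier X \<Longrightarrow> \<psi> \<in> carrier X \<Longrightarrow> func \<phi> = func \<psi> \<Longrightarrow> \<phi> = \<psi>"
proof (rule extensionalityI)
  fix x assume *: "\<phi> \<in> carrier X" "\<psi> \<in> carrier X" "func \<phi> = func \<psi>" "x \<in> carrier A"
  then have "e (\<phi> x) = e (\<psi> x)" by (metis func_def rt_id[OF ring_A])
  then show "\<phi> x = \<psi> x" using e_inj * X_D(2) by blast
qed (use X_D in auto)

lemma func_bij: "bij_betw func (carrier X) (Collect functional)"
  unfolding bij_betw_def
proof
  show "inj_on func (carrier X)" by (rule inj_onI) (rule func_inj)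
  have "f \<in> func ` carrier X" if "functional f" for f
    using of_functional[OF that refl] by (metis imageI)
  then show "func ` carrier X = Collect functional" using func_functional by blast
qed

lemma q_func: "\<phi> \<in> carrier X \<Longrightarrow> a \<in> carrier A \<Longrightarrow> q (func \<phi> a) = \<phi> a"
  by (simp add: func_def rt_id[OF ring_A] q_e X_D)

lemma X_add: "\<phi> \<in> carrier X \<Longrightarrow> \<psi> \<in> carrier X \<Longrightarrow> \<phi> \<oplus>\<^bsub>X\<^esub> \<psi> \<in> carrier X \<and> func (\<phi> \<oplus>\<^bsub>X\<^esub> \<psi>) = (\<lambda>x. func \<phi> x \<oplus> func \<psi> x)"
proof -
  assume *: "\<phi> \<in> carrier X" "\<psi> \<in> carrier X"
  have f: "functional (\<lambda>x. func \<phi> x \<oplus> func \<psi> x)" by (intro functional_add func_functional *)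
  have "\<phi> \<oplus>\<^bsub>X\<^esub> \<psi> = (\<lambda>a\<in>carrier A. q (func \<phi> a \<oplus> func \<psi> a))"
    unfolding X_add_eq by (rule restrict_ext) (simp add: func_def rt_id[OF ring_A] q_e X_D * flip: e_add)
  from of_functional[OF f this] show ?thesis by simp
qed

lemma X_mult: "\<phi> \<in> carrier X \<Longrightarrow> \<psi> \<in> carrier X \<Longrightarrow>
    \<phi> \<otimes>\<^bsub>X\<^esub> \<psi> \<in> carrier X \<and> func (\<phi> \<otimes>\<^bsub>X\<^esub> \<psi>) = (\<lambda>x. func \<phi> (hit (func \<psi>) x))"
proof -
  assume *: "\<phi> \<in> carrier X" "\<psi> \<in> carrier X"
  have f: "functional (\<lambda>x. func \<phi> (hit (func \<psi>) x))" by (intro functional_comp func_functional *)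
  have h: "(\<lambda>x. e (\<psi> (rt A x))) = func \<psi>" by (rule ext) (simp add: func_def)
  have "\<phi> \<otimes>\<^bsub>X\<^esub> \<psi> = (\<lambda>a\<in>carrier A. q (func \<phi> (hit (func \<psi>) a)))"
    unfolding X_mult_eq[OF *] h by (rule restrict_ext) (simp add: q_func * T_closed)
  from of_functional[OF f this] show ?thesis by simp
qed

lemma X_one: "\<one>\<^bsub>X\<^esub> \<in> carrier X \<and> func \<one>\<^bsub>X\<^esub> = P"
proof -
  have "\<one>\<^bsub>X\<^esub> = (\<lambda>a\<in>carrier A. q (P a))"
    unfolding X_one_eq by (rule restrict_ext) (simp add: P_eq rt_id[OF ring_A] q_e q_closed)
  from of_functional[OF functional_P this] show ?thesis by simp
qed

lemma X_zero: "\<zero>\<^bsub>X\<^esub> \<in> carrier X \<and> func \<zero>\<^bsub>X\<^esub> = (\<lambda>x. \<zero>)"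
proof -
  have "\<zero>\<^bsub>X\<^esub> = (\<lambda>a\<in>carrier A. q \<zero>)"
    unfolding X_zero_eq by (rule restrict_ext) (metis e_zero q_e K.zero_closed)
  from of_functional[OF functional_zero this] show ?thesis by simp
qed

lemma ss: "k \<in> carrier K \<Longrightarrow> ss k \<in> carrier X \<and> func (ss k) = (\<lambda>x. e k \<otimes> P x)"
proof -
  assume k: "k \<in> carrier K"
  have f: "functional (\<lambda>x. e k \<otimes> P x)" using functional_source[of "e k"] k by (simp add: P_e)
  have "ss k = (\<lambda>a\<in>carrier A. q (e k \<otimes> P a))"
    unfolding ss_eq[OF k] by (rule restrict_ext) (simp add: P_eq rt_id[OF ring_A] q_e q_closed k flip: e_mult)
  from of_functional[OF f this] show ?thesis by simp
qed

lemma tt: "k \<in> carrier K \<Longrightarrow> tt k \<in> carrier X \<and> func (tt k) = (\<lambda>x. P (e k \<otimes> x))"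
proof -
  assume k: "k \<in> carrier K"
  have f: "functional (\<lambda>x. P (e k \<otimes> x))" using functional_target[of "e k"] k by (simp add: P_e)
  have "tt k = (\<lambda>a\<in>carrier A. q (P (e k \<otimes> a)))"
    unfolding tt_eq[OF k]
    by (rule restrict_ext) (simp add: P_eq T_ops(2) e_closed k, simp add: rt_eq q_e q_closed T_carrier)
  from of_functional[OF f this] show ?thesis by simp
qed

text \<open>It carries bijectivity over from the extensional functions in \<open>X\<close> to the
  functionals with values in the ring, in the two parts required by
  \<open>nondegenerate_sweedler\<close>.\<close>

lemma nondegenerate_hitI:
  assumes b: "bij_betw (\<lambda>\<phi>. hit (func \<phi>) ell) (carrier X) (carrier A)"
  shows "\<exists>f. functional f \<and> hit f ell = a \<oplus> \<zero>"
    and "functional f \<Longrightarrow> functional f' \<Longrightarrow> hit f ell = hit f' ell \<Longrightarrow> f = f'"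
proof -
  have "a \<oplus> \<zero> \<in> carrier A" by (rule T_closed)
  then have "a \<oplus> \<zero> \<in> (\<lambda>\<phi>. hit (func \<phi>) ell) ` carrier X" using b by (simp add: bij_betw_def)
  then obtain \<phi> where "a \<oplus> \<zero> = hit (func \<phi>) ell" "\<phi> \<in> carrier X" by (rule imageE)
  then show "\<exists>f. functional f \<and> hit f ell = a \<oplus> \<zero>"
    by (intro exI[of _ "func \<phi>"]) (simp add: func_functional)
  assume f: "functional f" "functional f'" "hit f ell = hit f' ell"
  define \<phi> where "\<phi> = (\<lambda>a\<in>carrier A. q (f a))"
  define \<phi>' where "\<phi>' = (\<lambda>a\<in>carrier A. q (f' a))"
  note o = of_functional[OF f(1) \<phi>_def] of_functional[OF f(2) \<phi>'_def]
  have "hit (func \<phi>) ell = hit (func \<phi>') ell" using f(3) o by simp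
  then have "\<phi> = \<phi>'" by (rule inj_onD[OF bij_betw_imp_inj_on[OF b]]) (use o in simp_all)
  then show "f = f'" using o by simp
qed

end

section \<open>Coproducts of the dual rings in terms of the integral\<close>

locale integral_space = functional_space T P Q c A K e q X ss tt + nondegenerate_sweedler T P Q c ell
  for T :: "'a ring" (structure) and P Q :: "'a \<Rightarrow> 'a" and c and A :: "'a ring" and K :: "'k ring"
    and e :: "'k \<Rightarrow> 'a" and q :: "'a \<Rightarrow> 'k" and X :: "('a \<Rightarrow> 'k) ring" and ss tt :: "'k \<Rightarrow> 'a \<Rightarrow> 'k" and ell +
  assumes c_ell: "set (c ell) \<subseteq> carrier A \<times> carrier A"
begin

interpretation A: ring A by (rule ring_A)
interpretation K: ring K by (rule ring_K)

definition shift :: "'a \<Rightarrow> ('a \<Rightarrow> 'k) \<Rightarrow> 'a \<Rightarrow> 'k" where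
  "shift x \<phi> = (\<lambda>b\<in>carrier A. \<phi> (x \<otimes>\<^bsub>A\<^esub> b))"

definition dinv :: "'a \<Rightarrow> 'a \<Rightarrow> 'k" where
  "dinv y = inv_into (carrier X) (\<lambda>\<phi>. hit (func \<phi>) ell) y"

lemma shift: "\<phi> \<in> carrier X \<Longrightarrow> x \<in> carrier A \<Longrightarrow> shift x \<phi> \<in> carrier X \<and> func (shift x \<phi>) = (\<lambda>a. func \<phi> (x \<otimes> a))"
proof -
  assume *: "\<phi> \<in> carrier X" "x \<in> carrier A"
  have "shift x \<phi> = (\<lambda>a\<in>carrier A. q (func \<phi> (x \<otimes> a)))"
    unfolding shift_def
    by (rule restrict_ext) (simp add: * T_ops(2) q_func T_closed)
  from of_functional[OF functional_shift[OF func_functional[OF *(1)]] this] show ?thesis by simp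
qed

lemma hit_bij: "bij_betw (\<lambda>\<phi>. hit (func \<phi>) ell) (carrier X) (carrier A)"
  unfolding bij_betw_def
proof
  show "inj_on (\<lambda>\<phi>. hit (func \<phi>) ell) (carrier X)"
    by (rule inj_onI) (metis hit_inj func_functional func_inj)
  have "a \<in> (\<lambda>\<phi>. hit (func \<phi>) ell) ` carrier X" if a: "a \<in> carrier A" for a
  proof -
  have "hit (func (\<lambda>x\<in>carrier A. q (hit_inv a x))) ell = a"
    using of_functional(2)[OF functional_hit_inv[of a] refl] hit_hit_inv[of a] a by (simp add: T_carrier)
    then show ?thesis
      using of_functional(1)[OF functional_hit_inv[of a] refl]
      by (intro image_eqI[of _ _ "\<lambda>x\<in>carrier A. q (hit_inv a x)"]) simp_all
  qed
  then show "(\<lambda>\<phi>. hit (func \<phi>) ell) ` carrier X = carrier A" by (auto simp: T_carrier)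
qed

lemma dinv: "y \<in> carrier A \<Longrightarrow> dinv y \<in> carrier X \<and> func (dinv y) = hit_inv y"
proof -
  assume y: "y \<in> carrier A"
  have c: "dinv y \<in> carrier X" unfolding dinv_def
    using bij_betw_apply[OF bij_betw_inv_into[OF hit_bij] y] .
  have "hit (func (dinv y)) ell = y"
    unfolding dinv_def using bij_betw_inv_into_right[OF hit_bij y] .
  then show ?thesis using c y hit_inv_eqI[OF func_functional[OF c], of y] by (simp add: T_carrier)
qed

definition entries :: "('a \<Rightarrow> 'k) \<Rightarrow> (('a \<Rightarrow> 'k) \<times> ('a \<Rightarrow> 'k)) list" where
  "entries \<phi> = map (\<lambda>(x, y). (shift x \<phi>, dinv y)) (c ell)"

lemma c_ell_carrier: "(x, y) \<in> set (c ell) \<Longrightarrow> x \<in> carrier A \<and> y \<in> carrier A"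
  using c_ell by blast

lemma entries_set: "\<phi> \<in> carrier X \<Longrightarrow> set (entries \<phi>) \<subseteq> carrier X \<times> carrier X"
  using shift dinv c_ell by (auto simp: entries_def)

text \<open>After evaluation the entries contain the sum over
  \<open>u \<otimes> hit_inv v x\<close>, which the dual basis property collapses to
  \<open>x\<close>. This is the point where the formulas for the dual coproducts meet their
  characterisation by evaluation.\<close>

lemma entries_eval:
  assumes \<phi>: "\<phi> \<in> carrier X"
  shows "ps (entries \<phi>) (\<lambda>u v. func u (func v x \<otimes> y)) = func \<phi> (x \<otimes> y)"
proof -
  have "ps (entries \<phi>) (\<lambda>u v. func u (func v x \<otimes> y)) = ps (c ell) (\<lambda>u v. func \<phi> (u \<otimes> hit_inv v x \<otimes> y))"
    unfolding entries_def pair_sum_map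
    by (rule pair_sum_cong) (drule c_ell_carrier, simp add: shift[OF \<phi>] dinv mult_assoc)
  also have "\<dots> = func \<phi> (ps (c ell) (\<lambda>u v. u \<otimes> hit_inv v x) \<otimes> y)"
    by (rule additive_ps[of "\<lambda>z. func \<phi> (z \<otimes> y)", symmetric])
      (simp add: additive_def functionalD[OF func_functional[OF \<phi>]])
  finally show ?thesis by (simp add: dual_basis)
qed

text \<open>Needed for the lift over the coproduct of \<open>ell\<close> in the definition of a dual
  coproduct to have its intended value. The map \<open>E\<close> is kept abstract because the duals
  form elementary tensors in either order of the factors.\<close>

lemma entries_balanced:
  assumes \<phi>: "\<phi> \<in> carrier X"
    and E: "\<And>u v. u \<in> carrier X \<Longrightarrow> v \<in> carrier X \<Longrightarrow> E u v \<in> carrier G"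
      "\<And>u u' v. u \<in> carrier X \<Longrightarrow> u' \<in> carrier X \<Longrightarrow> v \<in> carrier X \<Longrightarrow> E (u \<oplus>\<^bsub>X\<^esub> u') v = E u v \<otimes>\<^bsub>G\<^esub> E u' v"
      "\<And>u v v'. u \<in> carrier X \<Longrightarrow> v \<in> carrier X \<Longrightarrow> v' \<in> carrier X \<Longrightarrow> E u (v \<oplus>\<^bsub>X\<^esub> v') = E u v \<otimes>\<^bsub>G\<^esub> E u v'"
      "\<And>k u v. k \<in> carrier K \<Longrightarrow> u \<in> carrier X \<Longrightarrow> v \<in> carrier X \<Longrightarrow> E (tt k \<otimes>\<^bsub>X\<^esub> u) v = E u (ss k \<otimes>\<^bsub>X\<^esub> v)"
  shows "balanced_map A (carrier K) (\<lambda>k a. a \<otimes>\<^bsub>A\<^esub> e k) (\<lambda>k a. a \<otimes>\<^bsub>A\<^esub> Q (e k)) G (\<lambda>x y. E (shift x \<phi>) (dinv y))"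
  unfolding balanced_map_def
proof (intro conjI ballI)
  fix x y assume xy: "x \<in> carrier A" "y \<in> carrier A"
  show "E (shift x \<phi>) (dinv y) \<in> carrier G" using E(1) shift[OF \<phi>] dinv xy by blast
  fix z assume z: "z \<in> carrier A"
  have "dinv (y \<oplus>\<^bsub>A\<^esub> z) = dinv y \<oplus>\<^bsub>X\<^esub> dinv z"
    by (rule func_inj) (use xy z dinv[OF A.a_closed[OF xy(2) z]] in \<open>simp_all add: dinv X_add T_ops hit_inv_add\<close>)
  then show "E (shift x \<phi>) (dinv (y \<oplus>\<^bsub>A\<^esub> z)) = E (shift x \<phi>) (dinv y) \<otimes>\<^bsub>G\<^esub> E (shift x \<phi>) (dinv z)"
    using E(3) shift[OF \<phi>] dinv xy z by metis
next
  fix x x' y assume xy: "x \<in> carrier A" "x' \<in> carrier A" "y \<in> carrier A"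
  have "shift (x \<oplus>\<^bsub>A\<^esub> x') \<phi> = shift x \<phi> \<oplus>\<^bsub>X\<^esub> shift x' \<phi>"
    by (rule func_inj) (use xy shift[OF \<phi> A.a_closed[OF xy(1,2)]] in
        \<open>simp_all add: shift \<phi> X_add T_ops functionalD[OF func_functional[OF \<phi>]]\<close>)
  then show "E (shift (x \<oplus>\<^bsub>A\<^esub> x') \<phi>) (dinv y) = E (shift x \<phi>) (dinv y) \<otimes>\<^bsub>G\<^esub> E (shift x' \<phi>) (dinv y)"
    using E(2) shift[OF \<phi>] dinv xy by metis
next
  fix k x y assume k: "k \<in> carrier K" and xy: "x \<in> carrier A" "y \<in> carrier A"
  have Qc: "Q (e k) \<in> carrier A" by (simp add: T_carrier)
  have h: "hit f (e k \<otimes> a) = e k \<otimes> hit f a" if "functional f" for f a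
    using hit_P_mult[OF that, of "e k" a] k by (simp add: P_e)
  \<comment> \<open>The scalar acts on the first entry as the target and, in the next fact, on the
    second entry as the source of the dual. These are exactly the two sides of its balancing
    relation.\<close>
  have 1: "shift (x \<otimes>\<^bsub>A\<^esub> e k) \<phi> = tt k \<otimes>\<^bsub>X\<^esub> shift x \<phi>"
  proof (rule func_inj)
    show "func (shift (x \<otimes>\<^bsub>A\<^esub> e k) \<phi>) = func (tt k \<otimes>\<^bsub>X\<^esub> shift x \<phi>)"
      using shift[OF \<phi> xy(1)] tt[OF k] X_mult[of "tt k" "shift x \<phi>"] shift[OF \<phi> A.m_closed[OF xy(1) e_closed[OF k]]]
      by (simp add: fun_eq_iff T_ops xy e_closed[OF k] mult_assoc P_hit func_functional flip: h)
  qed (use shift[OF \<phi> xy(1)] tt[OF k] X_mult[of "tt k" "shift x \<phi>"]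
      shift[OF \<phi> A.m_closed[OF xy(1) e_closed[OF k]]] in auto)
  have 2: "dinv (y \<otimes>\<^bsub>A\<^esub> Q (e k)) = ss k \<otimes>\<^bsub>X\<^esub> dinv y"
  proof (rule func_inj)
    have "func (dinv y) = hit_inv y" "func (dinv (y \<otimes>\<^bsub>A\<^esub> Q (e k))) = hit_inv (y \<otimes> Q (e k))"
      using dinv[OF xy(2)] dinv[OF A.m_closed[OF xy(2) Qc]] by (simp_all add: T_ops xy Qc)
    moreover have "func (ss k \<otimes>\<^bsub>X\<^esub> dinv y) = (\<lambda>x. func (ss k) (hit (func (dinv y)) x))"
      using dinv[OF xy(2)] ss[OF k] X_mult by blast
    ultimately show "func (dinv (y \<otimes>\<^bsub>A\<^esub> Q (e k))) = func (ss k \<otimes>\<^bsub>X\<^esub> dinv y)"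
      using ss[OF k] hit_inv_mult_Q[of y "e k"] k by (simp add: P_hit functional_hit_inv P_e)
  qed (use dinv[OF xy(2)] ss[OF k] X_mult[of "ss k" "dinv y"] dinv[OF A.m_closed[OF xy(2) Qc]] in auto)
  show "E (shift (x \<otimes>\<^bsub>A\<^esub> e k) \<phi>) (dinv y) = E (shift x \<phi>) (dinv (y \<otimes>\<^bsub>A\<^esub> Q (e k)))"
    unfolding 1 2 using E(4) k shift[OF \<phi> xy(1)] dinv[OF xy(2)] by blast
qed

end

section \<open>Concrete dual rings as spaces of functionals\<close>

context right_bialgebroid_ops
begin

interpretation A: ring A by (rule ring_total)
interpretation R: ring R by (rule ring_base)

lemma act_eq_hit:
  assumes a: "a \<in> carrier A" and \<phi>: "\<And>x. x \<in> carrier A \<Longrightarrow> \<phi> x \<in> carrier R"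
    "\<And>x y. x \<in> carrier A \<Longrightarrow> y \<in> carrier A \<Longrightarrow> \<phi> (x \<oplus>\<^bsub>A\<^esub> y) = \<phi> x \<oplus>\<^bsub>R\<^esub> \<phi> y"
    "\<And>x r. x \<in> carrier A \<Longrightarrow> r \<in> carrier R \<Longrightarrow> \<phi> (x \<otimes>\<^bsub>A\<^esub> s r) = \<phi> x \<otimes>\<^bsub>R\<^esub> r"
  shows "tensor_lift (add_monoid A) (\<lambda>(x, y). y \<otimes>\<^bsub>A\<^esub> t (\<phi> x)) (\<gamma> a) =
    right_sweedler.hit (tot A) tproj rep (\<lambda>x. s (\<phi> (rt A x))) a"
proof -
  interpret S: right_sweedler "tot A" sproj tproj rep by (rule sweedler)
  have "tensor_lift (add_monoid A) (\<lambda>(x, y). y \<otimes>\<^bsub>A\<^esub> t (\<phi> x)) (\<gamma> a) = pair_sum A (rep a) (\<lambda>x y. y \<otimes>\<^bsub>A\<^esub> t (\<phi> x))"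
    by (rule lift_add_rep[OF a]) (simp_all add: \<phi> t_add t_mult A.l_distr A.r_distr A.m_assoc)
  also have "\<dots> = S.hit (\<lambda>x. s (\<phi> (rt A x))) a"
    unfolding S.hit_def pair_sum_tot[OF ring_total]
    by (rule pair_sum_cong) (drule rep_carrier, simp add: \<phi>)
  finally show ?thesis .
qed

lemma act_eq_cohit:
  assumes a: "a \<in> carrier A" and \<phi>: "\<And>x. x \<in> carrier A \<Longrightarrow> \<phi> x \<in> carrier R"
    "\<And>x y. x \<in> carrier A \<Longrightarrow> y \<in> carrier A \<Longrightarrow> \<phi> (x \<oplus>\<^bsub>A\<^esub> y) = \<phi> x \<oplus>\<^bsub>R\<^esub> \<phi> y"
    "\<And>x r. x \<in> carrier A \<Longrightarrow> r \<in> carrier R \<Longrightarrow> \<phi> (x \<otimes>\<^bsub>A\<^esub> t r) = r \<otimes>\<^bsub>R\<^esub> \<phi> x"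
  shows "tensor_lift (add_monoid A) (\<lambda>(x, y). x \<otimes>\<^bsub>A\<^esub> s (\<phi> y)) (\<gamma> a) =
    right_sweedler.hit (tot A) sproj (\<lambda>a. map prod.swap (rep a)) (\<lambda>x. t (\<phi> (rt A x))) a"
proof -
  interpret S: right_sweedler "tot A" sproj tproj rep by (rule sweedler)
  have "tensor_lift (add_monoid A) (\<lambda>(x, y). x \<otimes>\<^bsub>A\<^esub> s (\<phi> y)) (\<gamma> a) = pair_sum A (rep a) (\<lambda>x y. x \<otimes>\<^bsub>A\<^esub> s (\<phi> y))"
    by (rule lift_add_rep[OF a]) (simp_all add: \<phi> s_add s_mult A.l_distr A.r_distr A.m_assoc)
  also have "\<dots> = S.cohit (\<lambda>x. t (\<phi> (rt A x))) a"
    unfolding S.cohit_def pair_sum_tot[OF ring_total]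
    by (rule pair_sum_cong) (drule rep_carrier, simp add: \<phi>)
  finally show ?thesis .
qed

lemma functional_space_src:
  fixes X :: "('a \<Rightarrow> 'r) ring"
  assumes X: "carrier X = {\<phi> \<in> carrier A \<rightarrow>\<^sub>E carrier R. \<phi> \<in> hom (add_monoid A) (add_monoid R) \<and>
      (\<forall>a\<in>carrier A. \<forall>k\<in>carrier R. \<phi> (a \<otimes>\<^bsub>A\<^esub> s k) = \<phi> a \<otimes>\<^bsub>R\<^esub> k)}"
    and ops: "\<And>\<phi> \<psi>. \<phi> \<oplus>\<^bsub>X\<^esub> \<psi> = (\<lambda>a\<in>carrier A. \<phi> a \<oplus>\<^bsub>R\<^esub> \<psi> a)"
      "\<And>\<phi> \<psi>. \<phi> \<in> carrier X \<Longrightarrow> \<psi> \<in> carrier X \<Longrightarrow>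
        \<phi> \<otimes>\<^bsub>X\<^esub> \<psi> = (\<lambda>a\<in>carrier A. \<phi> (tensor_lift (add_monoid A) (\<lambda>(x, y). y \<otimes>\<^bsub>A\<^esub> t (\<psi> x)) (\<gamma> a)))"
      "\<one>\<^bsub>X\<^esub> = (\<lambda>a\<in>carrier A. \<pi> a)" "\<zero>\<^bsub>X\<^esub> = (\<lambda>a\<in>carrier A. \<zero>\<^bsub>R\<^esub>)"
    and st: "\<And>k. k \<in> carrier R \<Longrightarrow> ss k = (\<lambda>a\<in>carrier A. k \<otimes>\<^bsub>R\<^esub> \<pi> a)"
      "\<And>k. k \<in> carrier R \<Longrightarrow> tt k = (\<lambda>a\<in>carrier A. \<pi> (s k \<otimes>\<^bsub>A\<^esub> a))"
  shows "functional_space (tot A) sproj tproj rep A R s \<pi> X ss tt"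
proof (intro functional_space.intro functional_space_axioms.intro)
  fix \<phi> \<psi> assume \<phi>: "\<phi> \<in> carrier X" "\<psi> \<in> carrier X"
  have \<psi>D: "\<And>x. x \<in> carrier A \<Longrightarrow> \<psi> x \<in> carrier R"
    "\<And>x y. x \<in> carrier A \<Longrightarrow> y \<in> carrier A \<Longrightarrow> \<psi> (x \<oplus>\<^bsub>A\<^esub> y) = \<psi> x \<oplus>\<^bsub>R\<^esub> \<psi> y"
    "\<And>x r. x \<in> carrier A \<Longrightarrow> r \<in> carrier R \<Longrightarrow> \<psi> (x \<otimes>\<^bsub>A\<^esub> s r) = \<psi> x \<otimes>\<^bsub>R\<^esub> r"
    using \<phi>(2) by (auto simp: X hom_def)
  show "\<phi> \<otimes>\<^bsub>X\<^esub> \<psi> = (\<lambda>a\<in>carrier A. \<phi> (right_sweedler.hit (tot A) tproj rep (\<lambda>x. s (\<psi> (rt A x))) a))"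
    unfolding ops(2)[OF \<phi>] by (rule restrict_ext) (simp only: act_eq_hit[OF _ \<psi>D])
qed (use sweedler src_hom in \<open>simp_all add: ring_total ring_base X ops st sproj_def\<close>)

text \<open>Functionals that are left linear along the target become right linear over the opposite
  base once the coproduct is flipped.\<close>

lemma functional_space_tgt:
  fixes X :: "('a \<Rightarrow> 'r) ring"
  assumes X: "carrier X = {\<phi> \<in> carrier A \<rightarrow>\<^sub>E carrier R. \<phi> \<in> hom (add_monoid A) (add_monoid R) \<and>
      (\<forall>a\<in>carrier A. \<forall>k\<in>carrier R. \<phi> (a \<otimes>\<^bsub>A\<^esub> t k) = k \<otimes>\<^bsub>R\<^esub> \<phi> a)}"
    and ops: "\<And>\<phi> \<psi>. \<phi> \<oplus>\<^bsub>X\<^esub> \<psi> = (\<lambda>a\<in>carrier A. \<phi> a \<oplus>\<^bsub>R\<^esub> \<psi> a)"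
      "\<And>\<phi> \<psi>. \<phi> \<in> carrier X \<Longrightarrow> \<psi> \<in> carrier X \<Longrightarrow>
        \<phi> \<otimes>\<^bsub>X\<^esub> \<psi> = (\<lambda>a\<in>carrier A. \<phi> (tensor_lift (add_monoid A) (\<lambda>(x, y). x \<otimes>\<^bsub>A\<^esub> s (\<psi> y)) (\<gamma> a)))"
      "\<one>\<^bsub>X\<^esub> = (\<lambda>a\<in>carrier A. \<pi> a)" "\<zero>\<^bsub>X\<^esub> = (\<lambda>a\<in>carrier A. \<zero>\<^bsub>R\<^esub>)"
    and st: "\<And>k. k \<in> carrier R \<Longrightarrow> ss k = (\<lambda>a\<in>carrier A. \<pi> a \<otimes>\<^bsub>R\<^esub> k)"
      "\<And>k. k \<in> carrier R \<Longrightarrow> tt k = (\<lambda>a\<in>carrier A. \<pi> (t k \<otimes>\<^bsub>A\<^esub> a))"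
  shows "functional_space (tot A) tproj sproj (\<lambda>a. map prod.swap (rep a)) A (opp_ring R) t \<pi> X ss tt"
proof (intro functional_space.intro functional_space_axioms.intro)
  have hom: "add_monoid (opp_ring R) = add_monoid R" by simp
  show "carrier X = {\<phi> \<in> carrier A \<rightarrow>\<^sub>E carrier (opp_ring R). \<phi> \<in> hom (add_monoid A) (add_monoid (opp_ring R)) \<and>
      (\<forall>a\<in>carrier A. \<forall>k\<in>carrier (opp_ring R). \<phi> (a \<otimes>\<^bsub>A\<^esub> t k) = \<phi> a \<otimes>\<^bsub>opp_ring R\<^esub> k)}"
    unfolding X hom by simp
  fix \<phi> \<psi> assume \<phi>: "\<phi> \<in> carrier X" "\<psi> \<in> carrier X"
  have \<psi>D: "\<And>x. x \<in> carrier A \<Longrightarrow> \<psi> x \<in> carrier R"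
    "\<And>x y. x \<in> carrier A \<Longrightarrow> y \<in> carrier A \<Longrightarrow> \<psi> (x \<oplus>\<^bsub>A\<^esub> y) = \<psi> x \<oplus>\<^bsub>R\<^esub> \<psi> y"
    "\<And>x r. x \<in> carrier A \<Longrightarrow> r \<in> carrier R \<Longrightarrow> \<psi> (x \<otimes>\<^bsub>A\<^esub> t r) = r \<otimes>\<^bsub>R\<^esub> \<psi> x"
    using \<phi>(2) by (auto simp: X hom_def)
  show "\<phi> \<otimes>\<^bsub>X\<^esub> \<psi> = (\<lambda>a\<in>carrier A. \<phi> (right_sweedler.hit (tot A) sproj (\<lambda>a. map prod.swap (rep a)) (\<lambda>x. t (\<psi> (rt A x))) a))"
    unfolding ops(2)[OF \<phi>] by (rule restrict_ext) (simp only: act_eq_cohit[OF _ \<psi>D])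
qed (use right_sweedler.swap[OF sweedler] tgt_hom in
    \<open>simp_all add: ring_total ring_opp_ring[OF ring_base] ops st tproj_def\<close>)

end

section \<open>The four duals of a Hopf algebroid with a non-degenerate integral\<close>

locale integral_hopf_algebroid = symmetrized_hopf_algebroid +
  fixes ell
  assumes nondegenerate: "nondegenerate_left_integral AL AR ell"
begin

interpretation A: ring A by (rule R.ring_total)

lemma ell_carrier: "ell \<in> carrier A"
  using nondegenerate by (simp add: nondegenerate_left_integral_def left_integral_def)

sublocale pair: sweedler_pair T R.sproj R.tproj R.rep L.sproj L.tproj L.rep
  by (rule sweedler_pair)

lemma add_monoid_opp: "add_monoid (opp_ring A) = add_monoid A" by simp

lemma space_ur: "functional_space T R.sproj R.tproj R.rep A (Bas AR) (src AR) (cou AR)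
    (ring_ur AR) (src_ur AR) (tgt_ur AR)"
  by (rule R.functional_space_src)
    (auto simp: ring_ur_def dual_ring_def hom_ur_def same_total src_ur_def tgt_ur_def act_ur_def)

text \<open>Over the opposite base source and target change places, so \<open>tgt_ul\<close> takes
  the position of the source.\<close>

lemma space_ul: "functional_space T R.tproj R.sproj (\<lambda>a. map prod.swap (R.rep a)) A (opp_ring (Bas AR)) (tgt AR) (cou AR)
    (ring_ul AR) (tgt_ul AR) (src_ul AR)"
  by (rule R.functional_space_tgt)
    (auto simp: ring_ul_def dual_ring_def hom_ul_def same_total src_ul_def tgt_ul_def act_ul_def)

text \<open>The lower duals define one of their structure maps by multiplication with
  \<open>src AL\<close> or \<open>tgt AL\<close>, where the description on the opposite ring
  multiplies by the other one. The counit does not see the difference.\<close>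

lemma cou_AL_swap:
  assumes "a \<in> carrier A" "l \<in> carrier (Bas AL)"
  shows "cou AL (a \<otimes>\<^bsub>A\<^esub> src AL l) = cou AL (a \<otimes>\<^bsub>A\<^esub> tgt AL l)"
  using L.counit_src[of "tgt AL l" a] L.counit_tgt[of "tgt AL l" a] assms L.\<pi>_s[OF assms(2)] LA by simp

text \<open>The product of this dual lets its left factor act first, so its opposite ring is the one
  given by composition with the action.\<close>

lemma space_lr: "functional_space (opp_ring T) L.sproj L.tproj L.rep (opp_ring A) (Bas AL) (tgt AL) (cou AL)
    (opp_ring (ring_lr AL)) (tgt_lr AL) (src_lr AL)"
  unfolding tot_opp_ring[symmetric]
  by (rule L.functional_space_src, unfold add_monoid_opp)
    (auto simp: ring_lr_def dual_ring_def hom_lr_def src_lr_def tgt_lr_def act_lr_def cou_AL_swap intro!: restrict_ext)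

lemma space_ll: "functional_space (opp_ring T) L.tproj L.sproj (\<lambda>a. map prod.swap (L.rep a)) (opp_ring A)
    (opp_ring (Bas AL)) (src AL) (cou AL) (opp_ring (ring_ll AL)) (src_ll AL) (tgt_ll AL)"
  unfolding tot_opp_ring[symmetric]
  by (rule L.functional_space_tgt, unfold add_monoid_opp)
    (auto simp: ring_ll_def dual_ring_def hom_ll_def src_ll_def tgt_ll_def act_ll_def cou_AL_swap intro!: restrict_ext)

sublocale ur0: functional_space T R.sproj R.tproj R.rep A "Bas AR" "src AR" "cou AR"
    "ring_ur AR" "src_ur AR" "tgt_ur AR"
  by (rule space_ur)

interpretation ul0: functional_space T R.tproj R.sproj "\<lambda>a. map prod.swap (R.rep a)" A "opp_ring (Bas AR)" "tgt AR" "cou AR"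
    "ring_ul AR" "tgt_ul AR" "src_ul AR"
  by (rule space_ul)

interpretation lr0: functional_space "opp_ring T" L.sproj L.tproj L.rep "opp_ring A" "Bas AL" "tgt AL" "cou AL"
    "opp_ring (ring_lr AL)" "tgt_lr AL" "src_lr AL"
  by (rule space_lr)

interpretation ll0: functional_space "opp_ring T" L.tproj L.sproj "\<lambda>a. map prod.swap (L.rep a)" "opp_ring A"
    "opp_ring (Bas AL)" "src AL" "cou AL" "opp_ring (ring_ll AL)" "src_ll AL" "tgt_ll AL"
  by (rule space_ll)

lemma ring_carrier: "carrier (ring_ur AR) = hom_ur AR" "carrier (ring_ul AR) = hom_ul AR"
  "carrier (ring_lr AL) = hom_lr AL" "carrier (ring_ll AL) = hom_ll AL"
  by (simp_all add: ring_ur_def ring_ul_def ring_lr_def ring_ll_def dual_ring_def)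

lemma act_ur_eq: "\<phi> \<in> hom_ur AR \<Longrightarrow> a \<in> carrier A \<Longrightarrow>
    act_ur AR \<phi> a = right_sweedler.hit T R.tproj R.rep (ur0.func \<phi>) a"
  using R.act_eq_hit[of a \<phi>] ur0.X_D[of \<phi>]
  by (simp add: act_ur_def same_total ring_carrier ur0.func_def[abs_def])

lemma act_ul_eq: "\<phi> \<in> hom_ul AR \<Longrightarrow> a \<in> carrier A \<Longrightarrow>
    act_ul AR \<phi> a = right_sweedler.hit T R.sproj (\<lambda>a. map prod.swap (R.rep a)) (ul0.func \<phi>) a"
  using R.act_eq_cohit[of a \<phi>] ul0.X_D[of \<phi>]
  by (simp add: act_ul_def same_total ring_carrier ul0.func_def[abs_def])

lemma act_lr_eq:
  assumes "\<phi> \<in> hom_lr AL" "a \<in> carrier A"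
  shows "act_lr AL a \<phi> = right_sweedler.hit (opp_ring T) L.tproj L.rep (lr0.func \<phi>) a"
proof -
  have "tensor_lift (add_monoid A) (\<lambda>(x, y). y \<otimes>\<^bsub>opp_ring A\<^esub> src AL (\<phi> x)) (cop AL a) =
      right_sweedler.hit (opp_ring T) L.tproj L.rep (lr0.func \<phi>) a"
    using L.act_eq_hit[of a \<phi>, unfolded add_monoid_opp tot_opp_ring] lr0.X_D[of \<phi>] assms
    by (simp add: ring_carrier lr0.func_def[abs_def])
  then show ?thesis by (simp add: act_lr_def)
qed

lemma act_ll_eq:
  assumes "\<phi> \<in> hom_ll AL" "a \<in> carrier A"
  shows "act_ll AL a \<phi> = right_sweedler.hit (opp_ring T) L.sproj (\<lambda>a. map prod.swap (L.rep a)) (ll0.func \<phi>) a"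
proof -
  have "tensor_lift (add_monoid A) (\<lambda>(x, y). x \<otimes>\<^bsub>opp_ring A\<^esub> tgt AL (\<phi> y)) (cop AL a) =
      right_sweedler.hit (opp_ring T) L.sproj (\<lambda>a. map prod.swap (L.rep a)) (ll0.func \<phi>) a"
    using L.act_eq_cohit[of a \<phi>, unfolded add_monoid_opp tot_opp_ring] ll0.X_D[of \<phi>] assms
    by (simp add: ring_carrier ll0.func_def[abs_def])
  then show ?thesis by (simp add: act_ll_def)
qed

lemma nondegenerate_R: "nondegenerate_sweedler T R.sproj R.tproj R.rep ell"
proof -
  have "bij_betw (ell_ur AR ell) (hom_ur AR) (carrier A)" "bij_betw (ell_ul AR ell) (hom_ul AR) (carrier A)"
    using nondegenerate by (simp_all add: nondegenerate_left_integral_def same_total)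
  moreover have "ell_ur AR ell \<phi> = pair.hit (ur0.func \<phi>) ell" if "\<phi> \<in> hom_ur AR" for \<phi>
    using act_ur_eq[OF that ell_carrier] by (simp add: ell_ur_def)
  moreover have "ell_ul AR ell \<phi> = ul0.hit (ul0.func \<phi>) ell" if "\<phi> \<in> hom_ul AR" for \<phi>
    using act_ul_eq[OF that ell_carrier] by (simp add: ell_ul_def)
  ultimately have b: "bij_betw (\<lambda>\<phi>. pair.hit (ur0.func \<phi>) ell) (carrier (ring_ur AR)) (carrier A)"
    "bij_betw (\<lambda>\<phi>. ul0.hit (ul0.func \<phi>) ell) (carrier (ring_ul AR)) (carrier A)"
    unfolding ring_carrier by (simp_all cong: bij_betw_cong)
  show ?thesis
    by (intro nondegenerate_sweedler.intro nondegenerate_sweedler_axioms.intro R.sweedler)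
      (rule ur0.nondegenerate_hitI[OF b(1)] ul0.nondegenerate_hitI[OF b(2)]; assumption)+
qed

sublocale H: integral_hopf T R.sproj R.tproj R.rep L.sproj L.tproj L.rep "\<lambda>x. S (rt A x)" ell
proof (intro integral_hopf.intro sweedler_hopf nondegenerate_R integral_hopf_axioms.intro)
  fix a
  have "rt A a \<otimes>\<^bsub>A\<^esub> ell = src AL (cou AL (rt A a)) \<otimes>\<^bsub>A\<^esub> ell"
    using nondegenerate by (simp add: nondegenerate_left_integral_def left_integral_def rt_carrier[OF R.ring_total])
  then show "a \<otimes>\<^bsub>T\<^esub> ell = L.tproj a \<otimes>\<^bsub>T\<^esub> ell"
    using ell_carrier LA by (simp add: L.tproj_def)
qed

sublocale ur: integral_space T R.sproj R.tproj R.rep A "Bas AR" "src AR" "cou AR"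
    "ring_ur AR" "src_ur AR" "tgt_ur AR" ell
  by (intro integral_space.intro space_ur nondegenerate_R integral_space_axioms.intro R_rep_set)

sublocale ul: integral_space T R.tproj R.sproj "\<lambda>a. map prod.swap (R.rep a)" A "opp_ring (Bas AR)" "tgt AR" "cou AR"
    "ring_ul AR" "tgt_ul AR" "src_ul AR" ell
  using R_rep_set[of ell]
  by (intro integral_space.intro space_ul H.nondegenerate_swap integral_space_axioms.intro) auto

sublocale lr: integral_space "opp_ring T" L.sproj L.tproj L.rep "opp_ring A" "Bas AL" "tgt AL" "cou AL"
    "opp_ring (ring_lr AL)" "tgt_lr AL" "src_lr AL" ell
  using L_rep_set[of ell]
  by (intro integral_space.intro space_lr pair.nondegenerate_left nondegenerate_R integral_space_axioms.intro) simp

sublocale ll: integral_space "opp_ring T" L.tproj L.sproj "\<lambda>a. map prod.swap (L.rep a)" "opp_ring A"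
    "opp_ring (Bas AL)" "src AL" "cou AL" "opp_ring (ring_ll AL)" "src_ll AL" "tgt_ll AL" ell
  using L_rep_set[of ell]
  by (intro integral_space.intro space_ll integral_space_axioms.intro
      nondegenerate_sweedler.nondegenerate_swap[OF pair.nondegenerate_left[OF nondegenerate_R]]) auto

end

section \<open>The four dual bialgebroids\<close>

text \<open>The ring part of \<open>dual_model\<close>, isolated so that it can be carried along
  \<open>raise\<close> and \<open>twist\<close> by \<open>functional_ring_comp\<close>.\<close>

definition functional_ring :: "'a ring \<Rightarrow> ('a \<Rightarrow> 'a) \<Rightarrow> ('a \<Rightarrow> 'a) \<Rightarrow> ('a \<Rightarrow> ('a \<times> 'a) list) \<Rightarrow>
    'b ring \<Rightarrow> ('b \<Rightarrow> 'a \<Rightarrow> 'a) \<Rightarrow> bool" where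
  "functional_ring T P Q c X F \<longleftrightarrow> bij_betw F (carrier X) (Collect (right_sweedler.functional T P)) \<and>
    (\<forall>a\<in>carrier X. \<forall>b\<in>carrier X. a \<oplus>\<^bsub>X\<^esub> b \<in> carrier X \<and> F (a \<oplus>\<^bsub>X\<^esub> b) = (\<lambda>x. F a x \<oplus>\<^bsub>T\<^esub> F b x)) \<and>
    (\<forall>a\<in>carrier X. \<forall>b\<in>carrier X. a \<otimes>\<^bsub>X\<^esub> b \<in> carrier X \<and>
      F (a \<otimes>\<^bsub>X\<^esub> b) = (\<lambda>x. F a (right_sweedler.hit T Q c (F b) x))) \<and>
    \<one>\<^bsub>X\<^esub> \<in> carrier X \<and> F \<one>\<^bsub>X\<^esub> = P \<and> \<zero>\<^bsub>X\<^esub> \<in> carrier X \<and> F \<zero>\<^bsub>X\<^esub> = (\<lambda>x. \<zero>\<^bsub>T\<^esub>)"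

lemma (in functional_space) functional_ring_func: "functional_ring T P Q c X func"
  using func_bij X_add X_mult X_one X_zero by (auto simp: functional_ring_def)

lemma functional_ring_comp:
  assumes F: "functional_ring T P Q c X F"
    and G: "bij_betw G (Collect (right_sweedler.functional T P)) (Collect (right_sweedler.functional T' P'))"
    and add: "\<And>f g. G (\<lambda>x. f x \<oplus>\<^bsub>T\<^esub> g x) = (\<lambda>x. G f x \<oplus>\<^bsub>T'\<^esub> G g x)"
    and mult: "\<And>f g. right_sweedler.functional T P f \<Longrightarrow> right_sweedler.functional T P g \<Longrightarrow>
      G (\<lambda>x. f (right_sweedler.hit T Q c g x)) = (\<lambda>x. G f (right_sweedler.hit T' Q' c' (G g) x))"
    and "G P = P'" "G (\<lambda>x. \<zero>\<^bsub>T\<^esub>) = (\<lambda>x. \<zero>\<^bsub>T'\<^esub>)"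
  shows "functional_ring T' P' Q' c' X (\<lambda>b. G (F b))"
proof -
  have "bij_betw (\<lambda>b. G (F b)) (carrier X) (Collect (right_sweedler.functional T' P'))"
    using bij_betw_trans[OF _ G, of F "carrier X"] F by (simp add: functional_ring_def comp_def)
  moreover have "right_sweedler.functional T P (F b)" if "b \<in> carrier X" for b
    using F that by (auto simp: functional_ring_def bij_betw_def)
  ultimately show ?thesis
    using F assms(5,6) by (simp add: functional_ring_def add mult)
qed

context sweedler_pair
begin

lemma raise_bij: "bij_betw raise (Collect lfunctional) (Collect functional)"
  by (rule bij_betwI[where g = lower]) (auto simp: functional_raise lfunctional_lower raise_lower lower_raise)

lemma raise_counit: "raise P' = P"
  by (rule ext) (simp add: raise_def L.hit_P)

lemma raise_zero: "raise (\<lambda>x. \<zero>) = (\<lambda>x. \<zero>)"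
  by (rule ext) (simp add: raise_def L.hit_def)

lemma raise_ring: "functional_ring (opp_ring A) P' Q' c' X F \<Longrightarrow> functional_ring A P Q c X (\<lambda>b. raise (F b))"
  by (erule functional_ring_comp) (simp_all add: raise_bij raise_add raise_comp raise_counit raise_zero)

text \<open>The results are brought to the form that \<open>dual_model\<close> prescribes for source
  and target, with \<open>P (Q' d)\<close> as the base element in both.\<close>

lemma raise_base:
  assumes "P' d = d"
  shows "raise (\<lambda>x. P' (x \<otimes> d)) = (\<lambda>x. P (Q' d) \<otimes> P x)" "raise (\<lambda>x. P' x \<otimes> d) = (\<lambda>x. P (P (Q' d) \<otimes> x))"
proof -
  have "P' (x \<otimes> d) = P' (x \<otimes> Q' d)" for x by (metis L.P_P_mult L.P_Q_mult assms)
  then show "raise (\<lambda>x. P' (x \<otimes> d)) = (\<lambda>x. P (Q' d) \<otimes> P x)" using raise_source[of d] by simp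
  show "raise (\<lambda>x. P' x \<otimes> d) = (\<lambda>x. P (P (Q' d) \<otimes> x))"
    using raise_target[of d] by (simp add: assms P_P_mult)
qed

lemma raise_one: "lfunctional f \<Longrightarrow> raise f \<one> = P (Q' (f \<one>))"
  by (simp add: raise_def L.hit_def L.cop_one[OF L.bal_hit])

end

context sweedler_hopf
begin

lemma twist_bij: "bij_betw twist (Collect cofunctional) (Collect lfunctional)"
  by (rule bij_betwI[where g = untwist])
    (auto simp: lfunctional_twist cofunctional_untwist twist_untwist untwist_twist)

lemma twist_ring:
  "functional_ring A Q P (\<lambda>a. map prod.swap (c a)) X F \<Longrightarrow> functional_ring (opp_ring A) P' Q' c' X (\<lambda>b. twist (F b))"
  by (erule functional_ring_comp)
    (simp_all add: twist_bij twist_add twist_comp, simp_all add: twist_def[abs_def] P_S_inv)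

lemma twist_base:
  assumes "Q d = d"
  shows "twist (\<lambda>x. Q (d \<otimes> x)) = (\<lambda>y. P' (y \<otimes> P d))" "twist (\<lambda>x. d \<otimes> Q x) = (\<lambda>y. P' y \<otimes> P d)"
proof -
  have "P' (y \<otimes> Q' (P d)) = P' (y \<otimes> P d)" for y by (metis L.P_P_mult L.P_Q_mult P'P)
  then show "twist (\<lambda>x. Q (d \<otimes> x)) = (\<lambda>y. P' (y \<otimes> P d))" using twist_source[of d] assms by simp
  show "twist (\<lambda>x. d \<otimes> Q x) = (\<lambda>y. P' y \<otimes> P d)" using twist_target[of d] assms by (simp add: P'P)
qed

lemma twist_one: "twist g \<one> = P (g \<one>)"
  using S_inv_S[of \<one>] by (simp add: twist_def del: S_inv_S)

end

context dual_model
begin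

interpretation X: ring X by (rule ring_X)

sublocale BR: balanced_tensor X "carrier K" "\<lambda>l a. s l \<otimes>\<^bsub>X\<^esub> a" "\<lambda>l a. t l \<otimes>\<^bsub>X\<^esub> a"
  by unfold_locales auto

text \<open>The tensor product over a right bialgebroid becomes, on the opposite total ring, the one
  with the two actions exchanged. This computes the flip that \<open>op_cop\<close> applies to
  it.\<close>

lemma flip_lift:
  assumes "set L \<subseteq> carrier X \<times> carrier X"
  shows "tensor_lift B2.T2 (\<lambda>(x, y). B2.e2 y x) (group_sum BR.T2 L BR.e2) = group_sum B2.T2 (map prod.swap L) B2.e2"
proof -
  have "balanced_map X (carrier K) (\<lambda>l a. s l \<otimes>\<^bsub>X\<^esub> a) (\<lambda>l a. t l \<otimes>\<^bsub>X\<^esub> a) B2.T2 (\<lambda>x y. B2.e2 y x)"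
    unfolding balanced_map_def by (simp add: B2.e2_closed B2.e2_rules(1,2) B2.e2_rules(3))
  from BR.lift_sum[OF B2.comm_group_T2 this assms] show ?thesis by simp
qed

end

lemma balanced_map_flip: "balanced_map A K \<rho> \<sigma> G f \<Longrightarrow> balanced_map A K \<sigma> \<rho> G (\<lambda>x y. f y x)"
  by (simp add: balanced_map_def)

lemma inv_into_cong: "(\<And>x. x \<in> H \<Longrightarrow> f x = g x) \<Longrightarrow> inv_into H f = inv_into H g"
  by (rule ext) (simp add: inv_into_def cong: conj_cong)

context integral_hopf_algebroid
begin

interpretation A: ring A by (rule R.ring_total)
interpretation BL: ring "Bas AL" by (rule L.ring_base)
interpretation BR: ring "Bas AR" by (rule R.ring_base)

lemma pair_swap: "sweedler_pair T R.tproj R.sproj (\<lambda>a. map prod.swap (R.rep a)) L.tproj L.sproj (\<lambda>a. map prod.swap (L.rep a))"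
  by (rule pair.pair_swap)

sublocale co: sweedler_pair T R.tproj R.sproj "\<lambda>a. map prod.swap (R.rep a)" L.tproj L.sproj "\<lambda>a. map prod.swap (L.rep a)"
  by (rule pair_swap)

definition dbasis :: "('a \<times> ('a \<Rightarrow> 'a)) list" where
  "dbasis = map (\<lambda>(x, y). (x, H.hit_inv y)) (R.rep ell)"

definition base_iso :: "'k ring \<Rightarrow> ('k \<Rightarrow> 'a) \<Rightarrow> bool" where
  "base_iso K \<kappa> \<longleftrightarrow> ring K \<and> bij_betw \<kappa> (carrier K) {x. R.sproj x = x} \<and> \<kappa> \<one>\<^bsub>K\<^esub> = \<one>\<^bsub>T\<^esub> \<and>
    (\<forall>k\<in>carrier K. \<forall>k'\<in>carrier K. \<kappa> (k \<oplus>\<^bsub>K\<^esub> k') = \<kappa> k \<oplus>\<^bsub>T\<^esub> \<kappa> k' \<and> \<kappa> (k \<otimes>\<^bsub>K\<^esub> k') = \<kappa> k \<otimes>\<^bsub>T\<^esub> \<kappa> k')"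

lemma dual_modelI:
  assumes F: "functional_ring T R.sproj R.tproj R.rep X F" and K: "base_iso K \<kappa>"
    and s: "\<And>k. k \<in> carrier K \<Longrightarrow> s k \<in> carrier X \<and> F (s k) = (\<lambda>x. \<kappa> k \<otimes>\<^bsub>T\<^esub> R.sproj x)"
    and t: "\<And>k. k \<in> carrier K \<Longrightarrow> t k \<in> carrier X \<and> F (t k) = (\<lambda>x. R.sproj (\<kappa> k \<otimes>\<^bsub>T\<^esub> x))"
    and \<pi>: "\<And>b. b \<in> carrier X \<Longrightarrow> \<pi> b \<in> carrier K \<and> \<kappa> (\<pi> b) = F b \<one>\<^bsub>T\<^esub>"
    and \<gamma>: "\<And>b. b \<in> carrier X \<Longrightarrow> \<gamma> b = group_sum (ltensor X K s t) (l b) (ltens X K s t)"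
    and l: "\<And>b. b \<in> carrier X \<Longrightarrow> set (l b) \<subseteq> carrier X \<times> carrier X"
      "\<And>b x y. b \<in> carrier X \<Longrightarrow> pair_sum T (l b) (\<lambda>u v. F u (F v x \<otimes>\<^bsub>T\<^esub> y)) = F b (x \<otimes>\<^bsub>T\<^esub> y)"
  shows "dual_model T R.sproj R.tproj R.rep A dbasis X K s t \<gamma> \<pi> F \<kappa> l"
proof (intro dual_model.intro dual_model_axioms.intro)
  show "right_sweedler T R.sproj R.tproj R.rep" by (rule R.sweedler)
  show "ring A" "T = tot A" by (rule R.ring_total) simp
  show "pair.functional e" if "(d, e) \<in> set dbasis" for d e
    using that by (auto simp: dbasis_def H.functional_hit_inv)
  show "pair.ps dbasis (\<lambda>d e. d \<otimes>\<^bsub>T\<^esub> e x) = x \<oplus>\<^bsub>T\<^esub> \<zero>\<^bsub>T\<^esub>" for x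
    using H.dual_basis[of x] by (simp only: dbasis_def pair_sum_map)
qed (use F K s t \<pi> \<gamma> l in \<open>simp_all add: functional_ring_def base_iso_def\<close>)

lemma proj_one [simp]: "R.sproj \<one>\<^bsub>A\<^esub> = \<one>\<^bsub>A\<^esub>" "R.tproj \<one>\<^bsub>A\<^esub> = \<one>\<^bsub>A\<^esub>" "L.sproj \<one>\<^bsub>A\<^esub> = \<one>\<^bsub>A\<^esub>" "L.tproj \<one>\<^bsub>A\<^esub> = \<one>\<^bsub>A\<^esub>"
  using pair.P_one pair.Q_one pair.L.P_one pair.L.Q_one by simp_all

lemma twist_one': "H.twist g \<one>\<^bsub>A\<^esub> = R.sproj (g \<one>\<^bsub>A\<^esub>)"
  using H.twist_one[of g] by simp

lemma tgt_AL_proj: "k \<in> carrier (Bas AL) \<Longrightarrow> R.sproj (tgt AL k) = tgt AL k"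
  "k \<in> carrier (Bas AL) \<Longrightarrow> L.sproj (tgt AL k) = tgt AL k" "k \<in> carrier (Bas AL) \<Longrightarrow> L.tproj (tgt AL k) = src AL k"
  "k \<in> carrier (Bas AL) \<Longrightarrow> L.sproj (src AL k) = tgt AL k" "k \<in> carrier (Bas AL) \<Longrightarrow> L.tproj (src AL k) = src AL k"
  "k \<in> carrier (Bas AL) \<Longrightarrow> R.tproj (src AL k) = src AL k"
  using ex_R[of k] L.proj_src[of k] by auto

lemma src_AR_proj: "k \<in> carrier (Bas AR) \<Longrightarrow> L.sproj (src AR k) = src AR k"
  "k \<in> carrier (Bas AR) \<Longrightarrow> L.tproj (tgt AR k) = tgt AR k"
  using ex_L[of k] L.proj_src by auto

lemma T_ops: "x \<in> carrier A \<Longrightarrow> y \<in> carrier A \<Longrightarrow> x \<oplus>\<^bsub>A\<^esub> y = x \<oplus>\<^bsub>T\<^esub> y"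
  "x \<in> carrier A \<Longrightarrow> y \<in> carrier A \<Longrightarrow> x \<otimes>\<^bsub>A\<^esub> y = x \<otimes>\<^bsub>T\<^esub> y"
  by simp_all

lemma base_ur: "base_iso (Bas AR) (src AR)"
  unfolding base_iso_def
  using ur0.e_bij ur0.e_add ur0.e_mult ur0.e_one R.ring_base by blast

text \<open>The embedding is \<open>s_R \<circ> \<nu>\<close>. On the image of \<open>s_L\<close>,
  which is that of \<open>t_R\<close>, the projection \<open>R.sproj\<close> reverses products, so
  the opposite of \<open>L\<close> appears.\<close>

lemma base_lr: "base_iso (opp_ring (Bas AL)) (\<lambda>k. R.sproj (src AL k))"
  unfolding base_iso_def
proof (intro conjI ballI)
  show "ring (opp_ring (Bas AL))" by (rule ring_opp_ring[OF L.ring_base])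
  have tp: "src AL (cou AL (R.tproj x)) = R.tproj x" for x
  proof -
    have "src AL (cou AL (R.tproj x)) = L.tproj (R.tproj x)" by (simp add: L.tproj_def)
    then show ?thesis by (simp add: pair.Q'Q)
  qed
  show "bij_betw (\<lambda>k. R.sproj (src AL k)) (carrier (opp_ring (Bas AL))) {x. R.sproj x = x}"
  proof (rule bij_betwI[where g = "\<lambda>x. cou AL (R.tproj x)"])
    show "(\<lambda>x. cou AL (R.tproj x)) \<in> {x. R.sproj x = x} \<rightarrow> carrier (opp_ring (Bas AL))"
      using L.\<pi>_closed by auto
    fix k assume "k \<in> carrier (opp_ring (Bas AL))"
    then show "cou AL (R.tproj (R.sproj (src AL k))) = k" using tgt_AL_proj(6)[of k] L.\<pi>_t[of k] by simp
  qed (auto simp: tp)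
  show "R.sproj (src AL \<one>\<^bsub>opp_ring (Bas AL)\<^esub>) = \<one>\<^bsub>T\<^esub>" using L.t_one by simp
  fix k k' assume "k \<in> carrier (opp_ring (Bas AL))" "k' \<in> carrier (opp_ring (Bas AL))"
  then have k: "k \<in> carrier (Bas AL)" "k' \<in> carrier (Bas AL)" by simp_all
  then have c: "src AL k \<in> carrier A" "src AL k' \<in> carrier A" using LA by simp_all
  have "src AL (k \<oplus>\<^bsub>Bas AL\<^esub> k') = src AL k \<oplus>\<^bsub>T\<^esub> src AL k'"
    using L.t_add[OF k] by (simp add: c)
  then show "R.sproj (src AL (k \<oplus>\<^bsub>opp_ring (Bas AL)\<^esub> k')) = R.sproj (src AL k) \<oplus>\<^bsub>T\<^esub> R.sproj (src AL k')"
    using pair.P_add by (metis opp_ring_simps(4))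
  have "src AL (k' \<otimes>\<^bsub>Bas AL\<^esub> k) = src AL k' \<otimes>\<^bsub>T\<^esub> R.tproj (src AL k)"
    using L.t_mult[OF k(2,1)] by (simp add: c tgt_AL_proj k)
  then show "R.sproj (src AL (k \<otimes>\<^bsub>opp_ring (Bas AL)\<^esub> k')) = R.sproj (src AL k) \<otimes>\<^bsub>T\<^esub> R.sproj (src AL k')"
    using pair.P_mult_Q by (metis opp_ring_simps(5))
qed

text \<open>The embedding is \<open>s_R \<circ> \<theta>_R\<close>, which arises because the inverse
  antipode twists the base. Two projections each reverse products here, so the base is
  \<open>R\<close> and not its opposite.\<close>

lemma base_ul: "base_iso (Bas AR) (\<lambda>k. R.sproj (L.tproj (src AR k)))"
  unfolding base_iso_def
proof (intro conjI ballI)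
  show "ring (Bas AR)" by (rule R.ring_base)
  have sp: "src AR (cou AR (L.sproj x)) = L.sproj x" for x
  proof -
    have "src AR (cou AR (L.sproj x)) = R.sproj (L.sproj x)" using L.proj_closed by (simp add: R.sproj_def)
    then show ?thesis by (simp add: pair.PP')
  qed
  show "bij_betw (\<lambda>k. R.sproj (L.tproj (src AR k))) (carrier (Bas AR)) {x. R.sproj x = x}"
  proof (rule bij_betwI[where g = "\<lambda>x. cou AR (L.sproj (R.tproj x))"])
    show "(\<lambda>x. cou AR (L.sproj (R.tproj x))) \<in> {x. R.sproj x = x} \<rightarrow> carrier (Bas AR)"
      using L.proj_closed by auto
    fix k assume k: "k \<in> carrier (Bas AR)"
    then have "L.sproj (R.tproj (R.sproj (L.tproj (src AR k)))) = src AR k"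
      by (metis pair.QP pair.QQ' pair.L.PQ src_AR_proj(1))
    then show "cou AR (L.sproj (R.tproj (R.sproj (L.tproj (src AR k))))) = k" using k by simp
  next
    fix x assume "x \<in> {x. R.sproj x = x}"
    then show "R.sproj (L.tproj (src AR (cou AR (L.sproj (R.tproj x))))) = x"
      by (simp add: sp pair.L.QP pair.Q'Q)
  qed auto
  show "R.sproj (L.tproj (src AR \<one>\<^bsub>Bas AR\<^esub>)) = \<one>\<^bsub>T\<^esub>" using pair.L.Q_one by simp
  fix k k' assume k: "k \<in> carrier (Bas AR)" "k' \<in> carrier (Bas AR)"
  show "R.sproj (L.tproj (src AR (k \<oplus>\<^bsub>Bas AR\<^esub> k'))) = R.sproj (L.tproj (src AR k)) \<oplus>\<^bsub>T\<^esub> R.sproj (L.tproj (src AR k'))"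
    by (simp only: ur0.e_add k pair.L.Q_add pair.P_add)
  have "L.tproj (src AR (k \<otimes>\<^bsub>Bas AR\<^esub> k')) = L.tproj (src AR k') \<otimes>\<^bsub>T\<^esub> L.tproj (src AR k)"
    using pair.L.Q_mult_P[of "src AR k" "src AR k'"] by (simp only: ur0.e_mult k src_AR_proj)
  then show "R.sproj (L.tproj (src AR (k \<otimes>\<^bsub>Bas AR\<^esub> k'))) = R.sproj (L.tproj (src AR k)) \<otimes>\<^bsub>T\<^esub> R.sproj (L.tproj (src AR k'))"
    using pair.P_mult_Q[of "L.tproj (src AR k')" "L.tproj (src AR k)"] by (metis pair.QQ')
qed

definition F_lr where "F_lr \<psi> = pair.raise (lr.func \<psi>)"
definition F_ul where "F_ul \<chi> = pair.raise (H.twist (ul.func \<chi>))"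
text \<open>The route is from \<open>_*\<A>\<close> to \<open>^*\<A>\<close> by the coopposite
  version of \<open>raise\<close>, to \<open>\<A>_*\<close> by the inverse antipode, and to
  \<open>\<A>^*\<close> by \<open>raise\<close>.\<close>

definition F_ll where "F_ll \<omega> = pair.raise (H.twist (co.raise (ll.func \<omega>)))"

lemma ring_F_ur: "functional_ring T R.sproj R.tproj R.rep (ring_ur AR) ur0.func"
  by (rule ur0.functional_ring_func)

lemma ring_F_lr: "functional_ring T R.sproj R.tproj R.rep (opp_ring (ring_lr AL)) F_lr"
  unfolding F_lr_def[abs_def] by (rule pair.raise_ring[OF lr.functional_ring_func])

lemma ring_F_ul: "functional_ring T R.sproj R.tproj R.rep (ring_ul AR) F_ul"
  unfolding F_ul_def[abs_def] by (rule pair.raise_ring[OF H.twist_ring[OF ul.functional_ring_func]])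

lemma ring_F_ll: "functional_ring T R.sproj R.tproj R.rep (opp_ring (ring_ll AL)) F_ll"
  unfolding F_ll_def[abs_def]
  by (rule pair.raise_ring[OF H.twist_ring[OF co.raise_ring[OF ll.functional_ring_func]]])

lemma F_lr_base:
  assumes k: "k \<in> carrier (Bas AL)"
  shows "F_lr (src_lr AL k) = (\<lambda>x. R.sproj (src AL k) \<otimes>\<^bsub>T\<^esub> R.sproj x)"
    "F_lr (tgt_lr AL k) = (\<lambda>x. R.sproj (R.sproj (src AL k) \<otimes>\<^bsub>T\<^esub> x))"
  using pair.raise_base[of "tgt AL k"] lr.ss[of k] lr.tt[of k] k
  by (simp_all add: F_lr_def tgt_AL_proj)

lemma F_ul_base:
  assumes k: "k \<in> carrier (Bas AR)"
  shows "F_ul (src_ul AR k) = (\<lambda>x. R.sproj (L.tproj (src AR k)) \<otimes>\<^bsub>T\<^esub> R.sproj x)"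
    "F_ul (tgt_ul AR k) = (\<lambda>x. R.sproj (R.sproj (L.tproj (src AR k)) \<otimes>\<^bsub>T\<^esub> x))"
  using pair.raise_base[of "src AR k"] H.twist_base[of "tgt AR k"] ul.ss[of k] ul.tt[of k] k
  by (simp_all add: F_ul_def src_AR_proj)

lemma F_ll_base:
  assumes k: "k \<in> carrier (Bas AL)"
  shows "F_ll (src_ll AL k) = (\<lambda>x. R.sproj (src AL k) \<otimes>\<^bsub>T\<^esub> R.sproj x)"
    "F_ll (tgt_ll AL k) = (\<lambda>x. R.sproj (R.sproj (src AL k) \<otimes>\<^bsub>T\<^esub> x))"
  using pair.raise_base[of "tgt AL k"] H.twist_base[of "R.tproj (tgt AL k)"] co.raise_base[of "src AL k"]
    ll.ss[of k] ll.tt[of k] k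
  by (simp_all add: F_ll_def tgt_AL_proj)

lemma F_counit:
  "\<phi> \<in> carrier (ring_ur AR) \<Longrightarrow> \<phi> \<one>\<^bsub>A\<^esub> \<in> carrier (Bas AR) \<and> src AR (\<phi> \<one>\<^bsub>A\<^esub>) = ur0.func \<phi> \<one>\<^bsub>T\<^esub>"
  "\<psi> \<in> carrier (opp_ring (ring_lr AL)) \<Longrightarrow> \<psi> \<one>\<^bsub>A\<^esub> \<in> carrier (Bas AL) \<and> R.sproj (src AL (\<psi> \<one>\<^bsub>A\<^esub>)) = F_lr \<psi> \<one>\<^bsub>T\<^esub>"
  "\<chi> \<in> carrier (ring_ul AR) \<Longrightarrow> \<chi> \<one>\<^bsub>A\<^esub> \<in> carrier (Bas AR) \<and> R.sproj (L.tproj (src AR (\<chi> \<one>\<^bsub>A\<^esub>))) = F_ul \<chi> \<one>\<^bsub>T\<^esub>"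
  "\<omega> \<in> carrier (opp_ring (ring_ll AL)) \<Longrightarrow> \<omega> \<one>\<^bsub>A\<^esub> \<in> carrier (Bas AL) \<and> R.sproj (src AL (\<omega> \<one>\<^bsub>A\<^esub>)) = F_ll \<omega> \<one>\<^bsub>T\<^esub>"
proof -
  show "\<phi> \<in> carrier (ring_ur AR) \<Longrightarrow> \<phi> \<one>\<^bsub>A\<^esub> \<in> carrier (Bas AR) \<and> src AR (\<phi> \<one>\<^bsub>A\<^esub>) = ur0.func \<phi> \<one>\<^bsub>T\<^esub>"
    by (simp add: ur0.func_def ur0.X_D(2))
  show "\<psi> \<one>\<^bsub>A\<^esub> \<in> carrier (Bas AL) \<and> R.sproj (src AL (\<psi> \<one>\<^bsub>A\<^esub>)) = F_lr \<psi> \<one>\<^bsub>T\<^esub>" if "\<psi> \<in> carrier (opp_ring (ring_lr AL))"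
  proof -
    have "\<psi> \<one>\<^bsub>A\<^esub> \<in> carrier (Bas AL)" using lr.X_D(2)[OF that, of "\<one>\<^bsub>A\<^esub>"] by simp
    then show ?thesis
      using pair.raise_one[OF lr.func_functional[OF that]] by (simp add: F_lr_def lr.func_def tgt_AL_proj)
  qed
  show "\<chi> \<one>\<^bsub>A\<^esub> \<in> carrier (Bas AR) \<and> R.sproj (L.tproj (src AR (\<chi> \<one>\<^bsub>A\<^esub>))) = F_ul \<chi> \<one>\<^bsub>T\<^esub>" if "\<chi> \<in> carrier (ring_ul AR)"
  proof -
    have "\<chi> \<one>\<^bsub>A\<^esub> \<in> carrier (Bas AR)" using ul.X_D(2)[OF that, of "\<one>\<^bsub>A\<^esub>"] by simp
    then show ?thesis
      using pair.raise_one[OF H.lfunctional_twist[OF ul.func_functional[OF that]]]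
      by (simp add: F_ul_def ul.func_def twist_one')
  qed
  show "\<omega> \<one>\<^bsub>A\<^esub> \<in> carrier (Bas AL) \<and> R.sproj (src AL (\<omega> \<one>\<^bsub>A\<^esub>)) = F_ll \<omega> \<one>\<^bsub>T\<^esub>" if "\<omega> \<in> carrier (opp_ring (ring_ll AL))"
  proof -
    have "\<omega> \<one>\<^bsub>A\<^esub> \<in> carrier (Bas AL)" using ll.X_D(2)[OF that, of "\<one>\<^bsub>A\<^esub>"] by simp
    then show ?thesis
      using pair.raise_one[OF H.lfunctional_twist[OF co.functional_raise[OF ll.func_functional[OF that]]]]
        co.raise_one[OF ll.func_functional[OF that]]
      by (simp add: F_ll_def ll.func_def twist_one' tgt_AL_proj)
  qed
qed

text \<open>The entries describe evaluation on the opposite ring, so raising them exchanges the two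
  factors. The coopposite coproduct has its factors in this same order.\<close>

lemma eval_lr:
  assumes "\<psi> \<in> carrier (opp_ring (ring_lr AL))"
  shows "pair_sum T (map prod.swap (lr.entries \<psi>)) (\<lambda>u v. F_lr u (F_lr v x \<otimes>\<^bsub>T\<^esub> y)) = F_lr \<psi> (x \<otimes>\<^bsub>T\<^esub> y)"
proof -
  let ?l = "map (\<lambda>(u, v). (lr.func v, lr.func u)) (lr.entries \<psi>)"
  have "pair_sum T ?l (\<lambda>f g. pair.raise f (pair.raise g x \<otimes>\<^bsub>T\<^esub> y)) = pair.raise (lr.func \<psi>) (x \<otimes>\<^bsub>T\<^esub> y)"
  proof (rule pair.raise_eval)
    show "pair.lfunctional f \<and> pair.lfunctional g" if "(f, g) \<in> set ?l" for f g
      using that lr.entries_set[OF assms] lr.func_functional by auto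
    show "pair_sum T ?l (\<lambda>f g. g (x \<otimes>\<^bsub>T\<^esub> f y)) = lr.func \<psi> (x \<otimes>\<^bsub>T\<^esub> y)" for x y
      using lr.entries_eval[OF assms, of y x] by (simp add: pair_sum_map[of _ "\<lambda>u v. _ v" "\<lambda>u v. _ u"] pair_sum_map)
  qed (rule lr.func_functional[OF assms])
  then show ?thesis by (simp add: F_lr_def pair_sum_map)
qed

end

context integral_hopf_algebroid
begin

interpretation A: ring A by (rule R.ring_total)

lemma eval_ul:
  assumes "\<chi> \<in> carrier (ring_ul AR)"
  shows "pair_sum T (map prod.swap (ul.entries \<chi>)) (\<lambda>u v. F_ul u (F_ul v x \<otimes>\<^bsub>T\<^esub> y)) = F_ul \<chi> (x \<otimes>\<^bsub>T\<^esub> y)"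
proof -
  let ?l = "map (\<lambda>(u, v). (ul.func v, ul.func u)) (ul.entries \<chi>)"
  let ?l' = "map (\<lambda>(u, v). (H.twist (ul.func v), H.twist (ul.func u))) (ul.entries \<chi>)"
  have l: "pair.cofunctional f \<and> pair.cofunctional g" if "(f, g) \<in> set ?l" for f g
    using that ul.entries_set[OF assms] ul.func_functional by auto
  have "pair_sum T ?l (\<lambda>f g. H.twist g (x \<otimes>\<^bsub>T\<^esub> H.twist f y)) = H.twist (ul.func \<chi>) (x \<otimes>\<^bsub>T\<^esub> y)" for x y
  proof (rule H.twist_eval[OF l ul.func_functional[OF assms]])
    show "pair_sum T ?l (\<lambda>f g. g (f x \<otimes>\<^bsub>T\<^esub> y)) = ul.func \<chi> (x \<otimes>\<^bsub>T\<^esub> y)" for x y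
      using ul.entries_eval[OF assms, of x y] by (simp add: pair_sum_map)
  qed
  then have e: "pair_sum T ?l' (\<lambda>f g. g (x \<otimes>\<^bsub>T\<^esub> f y)) = H.twist (ul.func \<chi>) (x \<otimes>\<^bsub>T\<^esub> y)" for x y
    by (simp add: pair_sum_map)
  have "pair_sum T ?l' (\<lambda>f g. pair.raise f (pair.raise g x \<otimes>\<^bsub>T\<^esub> y)) = pair.raise (H.twist (ul.func \<chi>)) (x \<otimes>\<^bsub>T\<^esub> y)"
  proof (rule pair.raise_eval[OF _ _ e])
    show "pair.lfunctional f \<and> pair.lfunctional g" if "(f, g) \<in> set ?l'" for f g
      using that ul.entries_set[OF assms] by (auto intro!: H.lfunctional_twist ul.func_functional)
  qed (rule H.lfunctional_twist[OF ul.func_functional[OF assms]])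
  then show ?thesis by (simp add: F_ul_def pair_sum_map)
qed

text \<open>Two exchanges of the factors, one on the way to \<open>^*\<A>\<close> and one on the way
  from there to \<open>\<A>^*\<close>, cancel each other, so the entries keep their order.\<close>

lemma eval_ll:
  assumes "\<omega> \<in> carrier (opp_ring (ring_ll AL))"
  shows "pair_sum T (ll.entries \<omega>) (\<lambda>u v. F_ll u (F_ll v x \<otimes>\<^bsub>T\<^esub> y)) = F_ll \<omega> (x \<otimes>\<^bsub>T\<^esub> y)"
proof -
  let ?l = "map (\<lambda>(u, v). (ll.func v, ll.func u)) (ll.entries \<omega>)"
  let ?l1 = "map (\<lambda>(u, v). (co.raise (ll.func u), co.raise (ll.func v))) (ll.entries \<omega>)"
  let ?l2 = "map (\<lambda>(u, v). (H.twist (co.raise (ll.func u)), H.twist (co.raise (ll.func v)))) (ll.entries \<omega>)"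
  have "pair_sum T ?l (\<lambda>f g. co.raise f (co.raise g x \<otimes>\<^bsub>T\<^esub> y)) = co.raise (ll.func \<omega>) (x \<otimes>\<^bsub>T\<^esub> y)" for x y
  proof (rule co.raise_eval)
    show "co.lfunctional f \<and> co.lfunctional g" if "(f, g) \<in> set ?l" for f g
      using that ll.entries_set[OF assms] ll.func_functional by auto
    show "pair_sum T ?l (\<lambda>f g. g (x \<otimes>\<^bsub>T\<^esub> f y)) = ll.func \<omega> (x \<otimes>\<^bsub>T\<^esub> y)" for x y
      using ll.entries_eval[OF assms, of y x] by (simp add: pair_sum_map)
  qed (rule ll.func_functional[OF assms])
  then have e1: "pair_sum T ?l1 (\<lambda>f g. g (f x \<otimes>\<^bsub>T\<^esub> y)) = co.raise (ll.func \<omega>) (x \<otimes>\<^bsub>T\<^esub> y)" for x y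
    by (simp add: pair_sum_map)
  have l1: "pair.cofunctional f \<and> pair.cofunctional g" if "(f, g) \<in> set ?l1" for f g
    using that ll.entries_set[OF assms] by (auto intro!: co.functional_raise ll.func_functional)
  note c = co.functional_raise[OF ll.func_functional[OF assms]]
  have "pair_sum T ?l1 (\<lambda>f g. H.twist g (x \<otimes>\<^bsub>T\<^esub> H.twist f y)) = H.twist (co.raise (ll.func \<omega>)) (x \<otimes>\<^bsub>T\<^esub> y)" for x y
    by (rule H.twist_eval[OF l1 c e1])
  then have e2: "pair_sum T ?l2 (\<lambda>f g. g (x \<otimes>\<^bsub>T\<^esub> f y)) = H.twist (co.raise (ll.func \<omega>)) (x \<otimes>\<^bsub>T\<^esub> y)" for x y
    by (simp add: pair_sum_map)
  have "pair_sum T ?l2 (\<lambda>f g. pair.raise f (pair.raise g x \<otimes>\<^bsub>T\<^esub> y)) =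
    pair.raise (H.twist (co.raise (ll.func \<omega>))) (x \<otimes>\<^bsub>T\<^esub> y)"
  proof (rule pair.raise_eval[OF _ H.lfunctional_twist[OF c] e2])
    show "pair.lfunctional f \<and> pair.lfunctional g" if "(f, g) \<in> set ?l2" for f g
      using that ll.entries_set[OF assms]
      by (auto intro!: H.lfunctional_twist co.functional_raise ll.func_functional)
  qed
  then show ?thesis by (simp add: F_ll_def pair_sum_map)
qed

lemma swap_set: "set l \<subseteq> Y \<times> Y \<Longrightarrow> set (map prod.swap l) \<subseteq> Y \<times> Y"
  by auto

text \<open>The coproduct is left open to break a circle: facts about the tensor product of the dual
  ring belong to \<open>dual_model\<close>, yet identifying the actual coproduct with the sum of its
  entries requires them. The model is first taken with that sum itself as coproduct, and afterwards
  with the actual one. The other three duals are treated likewise.\<close>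

lemma model_ur_aux:
  assumes "\<And>b. b \<in> carrier (ring_ur AR) \<Longrightarrow> \<gamma> b = group_sum (ltensor (ring_ur AR) (Bas AR) (src_ur AR) (tgt_ur AR))
    (ur.entries b) (ltens (ring_ur AR) (Bas AR) (src_ur AR) (tgt_ur AR))"
  shows "dual_model T R.sproj R.tproj R.rep A dbasis (ring_ur AR) (Bas AR) (src_ur AR) (tgt_ur AR) \<gamma>
    (\<lambda>\<phi>. \<phi> \<one>\<^bsub>A\<^esub>) ur0.func (src AR) ur.entries"
  by (rule dual_modelI[OF ring_F_ur base_ur])
    (simp_all only: ur0.ss ur0.tt F_counit simp_thms assms ur.entries_set ur.entries_eval)

lemma model_ul_aux:
  assumes "\<And>b. b \<in> carrier (ring_ul AR) \<Longrightarrow> \<gamma> b = group_sum (ltensor (ring_ul AR) (Bas AR) (src_ul AR) (tgt_ul AR))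
    (map prod.swap (ul.entries b)) (ltens (ring_ul AR) (Bas AR) (src_ul AR) (tgt_ul AR))"
  shows "dual_model T R.sproj R.tproj R.rep A dbasis (ring_ul AR) (Bas AR) (src_ul AR) (tgt_ul AR) \<gamma>
    (\<lambda>\<phi>. \<phi> \<one>\<^bsub>A\<^esub>) F_ul (\<lambda>k. R.sproj (L.tproj (src AR k))) (\<lambda>b. map prod.swap (ul.entries b))"
proof (rule dual_modelI[OF ring_F_ul base_ul])
  show "k \<in> carrier (Bas AR) \<Longrightarrow> src_ul AR k \<in> carrier (ring_ul AR) \<and>
      F_ul (src_ul AR k) = (\<lambda>x. R.sproj (L.tproj (src AR k)) \<otimes>\<^bsub>T\<^esub> R.sproj x)" for k
    using ul.tt[of k] F_ul_base by simp
  show "k \<in> carrier (Bas AR) \<Longrightarrow> tgt_ul AR k \<in> carrier (ring_ul AR) \<and>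
      F_ul (tgt_ul AR k) = (\<lambda>x. R.sproj (R.sproj (L.tproj (src AR k)) \<otimes>\<^bsub>T\<^esub> x))" for k
    using ul.ss[of k] F_ul_base by simp
  show "set (map prod.swap (ul.entries b)) \<subseteq> carrier (ring_ul AR) \<times> carrier (ring_ul AR)"
    if "b \<in> carrier (ring_ul AR)" for b
    by (rule swap_set[OF ul.entries_set[OF that]])
qed (simp_all only: F_counit simp_thms assms eval_ul)

lemma model_lr_aux:
  assumes "\<And>b. b \<in> carrier (opp_ring (ring_lr AL)) \<Longrightarrow> \<gamma> b =
    group_sum (ltensor (opp_ring (ring_lr AL)) (opp_ring (Bas AL)) (src_lr AL) (tgt_lr AL))
    (map prod.swap (lr.entries b)) (ltens (opp_ring (ring_lr AL)) (opp_ring (Bas AL)) (src_lr AL) (tgt_lr AL))"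
  shows "dual_model T R.sproj R.tproj R.rep A dbasis (opp_ring (ring_lr AL)) (opp_ring (Bas AL)) (src_lr AL) (tgt_lr AL) \<gamma>
    (\<lambda>\<phi>. \<phi> \<one>\<^bsub>A\<^esub>) F_lr (\<lambda>k. R.sproj (src AL k)) (\<lambda>b. map prod.swap (lr.entries b))"
proof (rule dual_modelI[OF ring_F_lr base_lr])
  show "k \<in> carrier (opp_ring (Bas AL)) \<Longrightarrow> src_lr AL k \<in> carrier (opp_ring (ring_lr AL)) \<and>
      F_lr (src_lr AL k) = (\<lambda>x. R.sproj (src AL k) \<otimes>\<^bsub>T\<^esub> R.sproj x)" for k
    using lr.tt[of k] F_lr_base by simp
  show "k \<in> carrier (opp_ring (Bas AL)) \<Longrightarrow> tgt_lr AL k \<in> carrier (opp_ring (ring_lr AL)) \<and>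
      F_lr (tgt_lr AL k) = (\<lambda>x. R.sproj (R.sproj (src AL k) \<otimes>\<^bsub>T\<^esub> x))" for k
    using lr.ss[of k] F_lr_base by simp
  show "set (map prod.swap (lr.entries b)) \<subseteq> carrier (opp_ring (ring_lr AL)) \<times> carrier (opp_ring (ring_lr AL))"
    if "b \<in> carrier (opp_ring (ring_lr AL))" for b
    by (rule swap_set[OF lr.entries_set[OF that]])
qed (simp_all only: F_counit simp_thms assms eval_lr opp_ring_simps(1)[of "Bas AL"])

lemma model_ll_aux:
  assumes "\<And>b. b \<in> carrier (opp_ring (ring_ll AL)) \<Longrightarrow> \<gamma> b =
    group_sum (ltensor (opp_ring (ring_ll AL)) (opp_ring (Bas AL)) (src_ll AL) (tgt_ll AL))
    (ll.entries b) (ltens (opp_ring (ring_ll AL)) (opp_ring (Bas AL)) (src_ll AL) (tgt_ll AL))"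
  shows "dual_model T R.sproj R.tproj R.rep A dbasis (opp_ring (ring_ll AL)) (opp_ring (Bas AL)) (src_ll AL) (tgt_ll AL) \<gamma>
    (\<lambda>\<phi>. \<phi> \<one>\<^bsub>A\<^esub>) F_ll (\<lambda>k. R.sproj (src AL k)) ll.entries"
proof (rule dual_modelI[OF ring_F_ll base_lr])
  show "k \<in> carrier (opp_ring (Bas AL)) \<Longrightarrow> src_ll AL k \<in> carrier (opp_ring (ring_ll AL)) \<and>
      F_ll (src_ll AL k) = (\<lambda>x. R.sproj (src AL k) \<otimes>\<^bsub>T\<^esub> R.sproj x)" for k
    using ll.ss[of k] F_ll_base by simp
  show "k \<in> carrier (opp_ring (Bas AL)) \<Longrightarrow> tgt_ll AL k \<in> carrier (opp_ring (ring_ll AL)) \<and>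
      F_ll (tgt_ll AL k) = (\<lambda>x. R.sproj (R.sproj (src AL k) \<otimes>\<^bsub>T\<^esub> x))" for k
    using ll.tt[of k] F_ll_base by simp
qed (simp_all only: F_counit simp_thms assms eval_ll opp_ring_simps(1)[of "Bas AL"] ll.entries_set)

lemma inv_ell_eq: "inv_ell_ur AR ell = ur.dinv" "inv_ell_ul AR ell = ul.dinv"
  "inv_ell_lr AL ell = lr.dinv" "inv_ell_ll AL ell = ll.dinv"
proof -
  note * = ell_carrier ell_ur_def ell_ul_def ell_lr_def ell_ll_def
  show "inv_ell_ur AR ell = ur.dinv"
    unfolding inv_ell_ur_def ur.dinv_def[abs_def] ring_carrier
    by (rule inv_into_cong) (simp add: * act_ur_eq)
  show "inv_ell_ul AR ell = ul.dinv"
    unfolding inv_ell_ul_def ul.dinv_def[abs_def] ring_carrier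
    by (rule inv_into_cong) (simp add: * act_ul_eq)
  show "inv_ell_lr AL ell = lr.dinv"
    unfolding inv_ell_lr_def lr.dinv_def[abs_def] opp_ring_simps(1) ring_carrier
    by (rule inv_into_cong) (simp add: * act_lr_eq)
  show "inv_ell_ll AL ell = ll.dinv"
    unfolding inv_ell_ll_def ll.dinv_def[abs_def] opp_ring_simps(1) ring_carrier
    by (rule inv_into_cong) (simp add: * act_ll_eq)
qed

lemma shift_eq: "shift_upper AR \<phi> x = ur.shift x \<phi>" "shift_upper AR \<phi> x = ul.shift x \<phi>"
  "shift_lower AL x \<psi> = lr.shift x \<psi>" "shift_lower AL x \<psi> = ll.shift x \<psi>"
  by (simp_all add: shift_upper_def shift_lower_def same_total ur.shift_def ul.shift_def lr.shift_def ll.shift_def)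

theorem model_ur: "dual_model T R.sproj R.tproj R.rep A dbasis (Tot (dual_ur AR ell)) (Bas (dual_ur AR ell))
    (src (dual_ur AR ell)) (tgt (dual_ur AR ell)) (cop (dual_ur AR ell)) (cou (dual_ur AR ell))
    ur0.func (src AR) ur.entries"
proof -
  interpret M: dual_model T R.sproj R.tproj R.rep A dbasis "ring_ur AR" "Bas AR" "src_ur AR" "tgt_ur AR"
    "\<lambda>b. group_sum (ltensor (ring_ur AR) (Bas AR) (src_ur AR) (tgt_ur AR))
      (ur.entries b) (ltens (ring_ur AR) (Bas AR) (src_ur AR) (tgt_ur AR))"
    "\<lambda>\<phi>. \<phi> \<one>\<^bsub>A\<^esub>" ur0.func "src AR" ur.entries
    by (rule model_ur_aux) (rule refl)
  have "tensor_lift M.B2.T2 (\<lambda>(x, y). M.B2.e2 (ur.shift x \<phi>) (ur.dinv y)) (cop AR ell) =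
      group_sum M.B2.T2 (ur.entries \<phi>) M.B2.e2" if \<phi>: "\<phi> \<in> carrier (ring_ur AR)" for \<phi>
  proof -
    have "balanced_map A (carrier (Bas AR)) (\<lambda>k a. a \<otimes>\<^bsub>A\<^esub> src AR k) (\<lambda>k a. a \<otimes>\<^bsub>A\<^esub> R.tproj (src AR k)) M.B2.T2
        (\<lambda>x y. M.B2.e2 (ur.shift x \<phi>) (ur.dinv y))"
      by (rule ur.entries_balanced[OF \<phi>]) (simp_all add: M.B2.e2_closed M.B2.e2_rules)
    then have "balanced_map A (carrier (Bas AR)) (\<lambda>k a. a \<otimes>\<^bsub>A\<^esub> src AR k) (\<lambda>k a. a \<otimes>\<^bsub>A\<^esub> tgt AR k) M.B2.T2
        (\<lambda>x y. M.B2.e2 (ur.shift x \<phi>) (ur.dinv y))"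
      by (simp add: balanced_map_def)
    from R.lift_rep[OF ell_carrier M.B2.comm_group_T2 this] show ?thesis
      by (simp add: ur.entries_def)
  qed
  then show ?thesis
    unfolding dual_ur_def bialgebroid.simps inv_ell_eq shift_eq(1) same_total
    by (intro model_ur_aux) (simp add: M.ltensor_defs)
qed

text \<open>The coproducts of \<open>^*\<A>\<close> and \<open>_*\<A>\<close> have the shifted
  functional as their second factor, opposite to the order of \<open>entries\<close>.\<close>

lemma swap_entries:
  "map prod.swap (ul.entries \<phi>) = map (\<lambda>(x, y). (ul.dinv x, ul.shift y \<phi>)) (R.rep ell)"
  "map prod.swap (ll.entries \<psi>) = map (\<lambda>(x, y). (ll.dinv x, ll.shift y \<psi>)) (L.rep ell)"
  by (auto simp: ul.entries_def ll.entries_def)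

theorem model_ul: "dual_model T R.sproj R.tproj R.rep A dbasis (Tot (dual_ul AR ell)) (Bas (dual_ul AR ell))
    (src (dual_ul AR ell)) (tgt (dual_ul AR ell)) (cop (dual_ul AR ell)) (cou (dual_ul AR ell))
    F_ul (\<lambda>k. R.sproj (L.tproj (src AR k))) (\<lambda>b. map prod.swap (ul.entries b))"
proof -
  interpret M: dual_model T R.sproj R.tproj R.rep A dbasis "ring_ul AR" "Bas AR" "src_ul AR" "tgt_ul AR"
    "\<lambda>b. group_sum (ltensor (ring_ul AR) (Bas AR) (src_ul AR) (tgt_ul AR))
      (map prod.swap (ul.entries b)) (ltens (ring_ul AR) (Bas AR) (src_ul AR) (tgt_ul AR))"
    "\<lambda>\<phi>. \<phi> \<one>\<^bsub>A\<^esub>" F_ul "\<lambda>k. R.sproj (L.tproj (src AR k))" "\<lambda>b. map prod.swap (ul.entries b)"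
    by (rule model_ul_aux) (rule refl)
  have "tensor_lift M.B2.T2 (\<lambda>(x, y). M.B2.e2 (ul.dinv x) (ul.shift y \<phi>)) (cop AR ell) =
      group_sum M.B2.T2 (map prod.swap (ul.entries \<phi>)) M.B2.e2" if \<phi>: "\<phi> \<in> carrier (ring_ul AR)" for \<phi>
  proof -
    have "balanced_map A (carrier (opp_ring (Bas AR))) (\<lambda>k a. a \<otimes>\<^bsub>A\<^esub> tgt AR k) (\<lambda>k a. a \<otimes>\<^bsub>A\<^esub> R.sproj (tgt AR k)) M.B2.T2
        (\<lambda>x y. M.B2.e2 (ul.dinv y) (ul.shift x \<phi>))"
      by (rule ul.entries_balanced[OF \<phi>, of "\<lambda>u v. M.B2.e2 v u"])
        (simp_all add: M.B2.e2_closed M.B2.e2_rules(1,2), simp add: M.B2.e2_rules(3))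
    then have "balanced_map A (carrier (Bas AR)) (\<lambda>k a. a \<otimes>\<^bsub>A\<^esub> tgt AR k) (\<lambda>k a. a \<otimes>\<^bsub>A\<^esub> src AR k) M.B2.T2
        (\<lambda>x y. M.B2.e2 (ul.dinv y) (ul.shift x \<phi>))"
      by (simp add: balanced_map_def)
    \<comment> \<open>The space is built on the flipped coproduct while the definition lifts over
      the original one, so the balanced map is flipped as well.\<close>
    from R.lift_rep[OF ell_carrier M.B2.comm_group_T2 balanced_map_flip[OF this]] show ?thesis
      by (simp only: swap_entries group_sum_map)
  qed
  then show ?thesis
    unfolding dual_ul_def bialgebroid.simps inv_ell_eq shift_eq(2) same_total
    by (intro model_ul_aux) (simp add: M.ltensor_defs)
qed

lemma rtensor_opp: "rtensor (ring_lr AL) K s t = tensor2 (opp_ring (ring_lr AL)) (carrier K)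
      (\<lambda>l a. s l \<otimes>\<^bsub>opp_ring (ring_lr AL)\<^esub> a) (\<lambda>l a. t l \<otimes>\<^bsub>opp_ring (ring_lr AL)\<^esub> a)"
    "rtens (ring_lr AL) K s t = tens2 (opp_ring (ring_lr AL)) (carrier K)
      (\<lambda>l a. s l \<otimes>\<^bsub>opp_ring (ring_lr AL)\<^esub> a) (\<lambda>l a. t l \<otimes>\<^bsub>opp_ring (ring_lr AL)\<^esub> a)"
    "rtensor (ring_ll AL) K s t = tensor2 (opp_ring (ring_ll AL)) (carrier K)
      (\<lambda>l a. s l \<otimes>\<^bsub>opp_ring (ring_ll AL)\<^esub> a) (\<lambda>l a. t l \<otimes>\<^bsub>opp_ring (ring_ll AL)\<^esub> a)"
    "rtens (ring_ll AL) K s t = tens2 (opp_ring (ring_ll AL)) (carrier K)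
      (\<lambda>l a. s l \<otimes>\<^bsub>opp_ring (ring_ll AL)\<^esub> a) (\<lambda>l a. t l \<otimes>\<^bsub>opp_ring (ring_ll AL)\<^esub> a)"
  by (simp_all add: rtensor_def rtens_def[abs_def] tensor_opp_ring)

theorem model_lr: "dual_model T R.sproj R.tproj R.rep A dbasis (Tot (op_cop (dual_lr AL ell))) (Bas (op_cop (dual_lr AL ell)))
    (src (op_cop (dual_lr AL ell))) (tgt (op_cop (dual_lr AL ell))) (cop (op_cop (dual_lr AL ell)))
    (cou (op_cop (dual_lr AL ell))) F_lr (\<lambda>k. R.sproj (src AL k)) (\<lambda>b. map prod.swap (lr.entries b))"
proof -
  interpret M: dual_model T R.sproj R.tproj R.rep A dbasis "opp_ring (ring_lr AL)" "opp_ring (Bas AL)" "src_lr AL" "tgt_lr AL"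
    "\<lambda>b. group_sum (ltensor (opp_ring (ring_lr AL)) (opp_ring (Bas AL)) (src_lr AL) (tgt_lr AL))
    (map prod.swap (lr.entries b)) (ltens (opp_ring (ring_lr AL)) (opp_ring (Bas AL)) (src_lr AL) (tgt_lr AL))"
    "\<lambda>\<phi>. \<phi> \<one>\<^bsub>A\<^esub>" F_lr "\<lambda>k. R.sproj (src AL k)" "\<lambda>b. map prod.swap (lr.entries b)"
    by (rule model_lr_aux) (rule refl)
  \<comment> \<open>The tensor product used before the passage to the opposite ring is one over the
    opposite ring with the actions exchanged, so both lifts can be computed within one
    model.\<close>
  have rt: "rtensor (ring_lr AL) (Bas AL) (src_lr AL) (tgt_lr AL) = M.BR.T2"
    "rtens (ring_lr AL) (Bas AL) (src_lr AL) (tgt_lr AL) = M.BR.e2"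
    by (simp_all only: rtensor_opp opp_ring_simps(1))
  have "tensor_lift M.BR.T2 (\<lambda>(x, y). M.BR.e2 (lr.shift x \<phi>) (lr.dinv y)) (cop AL ell) =
      group_sum M.BR.T2 (lr.entries \<phi>) M.BR.e2" if \<phi>: "\<phi> \<in> carrier (opp_ring (ring_lr AL))" for \<phi>
  proof -
    have "balanced_map (opp_ring A) (carrier (Bas AL)) (\<lambda>k a. a \<otimes>\<^bsub>opp_ring A\<^esub> tgt AL k)
        (\<lambda>k a. a \<otimes>\<^bsub>opp_ring A\<^esub> L.tproj (tgt AL k)) M.BR.T2 (\<lambda>x y. M.BR.e2 (lr.shift x \<phi>) (lr.dinv y))"
      by (rule lr.entries_balanced[OF \<phi>, of M.BR.e2])
        (rule M.BR.e2_closed M.BR.e2_rules; simp only: opp_ring_simps(1))+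
    then have "balanced_map (opp_ring A) (carrier (Bas AL)) (\<lambda>k a. a \<otimes>\<^bsub>opp_ring A\<^esub> tgt AL k)
        (\<lambda>k a. a \<otimes>\<^bsub>opp_ring A\<^esub> src AL k) M.BR.T2 (\<lambda>x y. M.BR.e2 (lr.shift x \<phi>) (lr.dinv y))"
      by (simp add: balanced_map_def tgt_AL_proj)
    from L.lift_rep[OF _ M.BR.comm_group_T2 this, of ell] show ?thesis
      using ell_carrier by (simp add: lr.entries_def)
  qed
  then have "tensor_lift M.B2.T2 (\<lambda>(x, y). M.B2.e2 y x)
      (tensor_lift M.BR.T2 (\<lambda>(x, y). M.BR.e2 (lr.shift x \<phi>) (lr.dinv y)) (cop AL ell)) =
    group_sum M.B2.T2 (map prod.swap (lr.entries \<phi>)) M.B2.e2" if \<phi>: "\<phi> \<in> carrier (opp_ring (ring_lr AL))" for \<phi>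
    using M.flip_lift[OF lr.entries_set[OF \<phi>]] \<phi> by simp
  then show ?thesis
    unfolding op_cop_def dual_lr_def bialgebroid.simps inv_ell_eq shift_eq(3)
    by (intro model_lr_aux) (simp only: M.ltensor_defs rt)
qed

theorem model_ll: "dual_model T R.sproj R.tproj R.rep A dbasis (Tot (op_cop (dual_ll AL ell))) (Bas (op_cop (dual_ll AL ell)))
    (src (op_cop (dual_ll AL ell))) (tgt (op_cop (dual_ll AL ell))) (cop (op_cop (dual_ll AL ell)))
    (cou (op_cop (dual_ll AL ell))) F_ll (\<lambda>k. R.sproj (src AL k)) ll.entries"
proof -
  interpret M: dual_model T R.sproj R.tproj R.rep A dbasis "opp_ring (ring_ll AL)" "opp_ring (Bas AL)" "src_ll AL" "tgt_ll AL"
    "\<lambda>b. group_sum (ltensor (opp_ring (ring_ll AL)) (opp_ring (Bas AL)) (src_ll AL) (tgt_ll AL))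
    (ll.entries b) (ltens (opp_ring (ring_ll AL)) (opp_ring (Bas AL)) (src_ll AL) (tgt_ll AL))"
    "\<lambda>\<phi>. \<phi> \<one>\<^bsub>A\<^esub>" F_ll "\<lambda>k. R.sproj (src AL k)" ll.entries
    by (rule model_ll_aux) (rule refl)
  have rt: "rtensor (ring_ll AL) (Bas AL) (src_ll AL) (tgt_ll AL) = M.BR.T2"
    "rtens (ring_ll AL) (Bas AL) (src_ll AL) (tgt_ll AL) = M.BR.e2"
    by (simp_all only: rtensor_opp opp_ring_simps(1))
  have "tensor_lift M.BR.T2 (\<lambda>(x, y). M.BR.e2 (ll.dinv x) (ll.shift y \<phi>)) (cop AL ell) =
      group_sum M.BR.T2 (map prod.swap (ll.entries \<phi>)) M.BR.e2" if \<phi>: "\<phi> \<in> carrier (opp_ring (ring_ll AL))" for \<phi>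
  proof -
    have "balanced_map (opp_ring A) (carrier (opp_ring (Bas AL))) (\<lambda>k a. a \<otimes>\<^bsub>opp_ring A\<^esub> src AL k)
        (\<lambda>k a. a \<otimes>\<^bsub>opp_ring A\<^esub> L.sproj (src AL k)) M.BR.T2 (\<lambda>x y. M.BR.e2 (ll.dinv y) (ll.shift x \<phi>))"
      by (rule ll.entries_balanced[OF \<phi>, of "\<lambda>u v. M.BR.e2 v u"])
        (rule M.BR.e2_closed M.BR.e2_rules M.BR.e2_rules(3)[symmetric]; simp only: opp_ring_simps(1))+
    then have "balanced_map (opp_ring A) (carrier (Bas AL)) (\<lambda>k a. a \<otimes>\<^bsub>opp_ring A\<^esub> src AL k)
        (\<lambda>k a. a \<otimes>\<^bsub>opp_ring A\<^esub> tgt AL k) M.BR.T2 (\<lambda>x y. M.BR.e2 (ll.dinv y) (ll.shift x \<phi>))"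
      by (simp add: balanced_map_def tgt_AL_proj)
    from L.lift_rep[OF _ M.BR.comm_group_T2 balanced_map_flip[OF this], of ell] show ?thesis
      using ell_carrier by (simp only: swap_entries group_sum_map opp_ring_simps)
  qed
  then have "tensor_lift M.B2.T2 (\<lambda>(x, y). M.B2.e2 y x)
      (tensor_lift M.BR.T2 (\<lambda>(x, y). M.BR.e2 (ll.dinv x) (ll.shift y \<phi>)) (cop AL ell)) =
    group_sum M.B2.T2 (ll.entries \<phi>) M.B2.e2" if \<phi>: "\<phi> \<in> carrier (opp_ring (ring_ll AL))" for \<phi>
    using M.flip_lift[OF swap_set[OF ll.entries_set[OF \<phi>]]] \<phi> by (simp add: comp_def)
  then show ?thesis
    unfolding op_cop_def dual_ll_def bialgebroid.simps inv_ell_eq shift_eq(4)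
    by (intro model_ll_aux) (simp only: M.ltensor_defs rt)
qed

end

section \<open>The comparison isomorphisms\<close>

context integral_hopf_algebroid
begin

interpretation A: ring A by (rule R.ring_total)

lemma ell_eq:
  "\<phi> \<in> hom_ur AR \<Longrightarrow> ell_ur AR ell \<phi> = pair.hit (ur0.func \<phi>) ell"
  "\<psi> \<in> hom_lr AL \<Longrightarrow> ell_lr AL ell \<psi> = pair.lhit (lr.func \<psi>) ell"
  "\<omega> \<in> hom_ll AL \<Longrightarrow> ell_ll AL ell \<omega> = co.lhit (ll.func \<omega>) ell"
  by (simp_all add: ell_ur_def ell_lr_def ell_ll_def act_ur_eq act_lr_eq act_ll_eq ell_carrier)

lemma T_carrier: "x \<in> carrier A \<longleftrightarrow> rt A x = x"
  using ur0.T_carrier[of x] by simp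

lemma hit_carrier: "pair.hit f a \<in> carrier A" "pair.lhit f a \<in> carrier A" "pair.cohit g a \<in> carrier A" "co.lhit g a \<in> carrier A"
  using pair.hit_closed[of f a] pair.L.hit_closed[of f a] right_sweedler.hit_closed[OF pair.swap, of g a]
    right_sweedler.hit_closed[OF co.left, of g a] unfolding T_carrier by simp_all

lemma ur_dinv_hit: "pair.functional f \<Longrightarrow> ur.dinv (pair.hit f ell) \<in> hom_ur AR \<and> ur0.func (ur.dinv (pair.hit f ell)) = f"
  using ur.dinv[OF hit_carrier(1)[of f ell]] H.hit_inv_hit by (simp add: ring_carrier)

lemma ul_dinv_cohit: "pair.cofunctional g \<Longrightarrow> ul.dinv (pair.cohit g ell) \<in> hom_ul AR \<and> ul.func (ul.dinv (pair.cohit g ell)) = g"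
  using ul.dinv[OF hit_carrier(3)[of g ell]] ul.hit_inv_hit by (simp add: ring_carrier)

lemma ll_dinv_hit: "co.lfunctional h \<Longrightarrow> ll.dinv (co.lhit h ell) \<in> hom_ll AL \<and> ll.func (ll.dinv (co.lhit h ell)) = h"
  using ll.dinv[of "co.lhit h ell"] hit_carrier(4)[of h ell] ll.hit_inv_hit[of h] by (simp add: ring_carrier)

lemma xi_eq:
  assumes a: "a \<in> carrier A" shows "xi AR S ell a = H.xi_map a"
proof -
  have d: "ur.dinv \<one>\<^bsub>A\<^esub> \<in> carrier (ring_ur AR)" "ur0.func (ur.dinv \<one>\<^bsub>A\<^esub>) = H.lam"
    using ur.dinv[of "\<one>\<^bsub>A\<^esub>"] by (simp_all add: H.lam_def)
  have s: "ur.shift ell (ur.dinv \<one>\<^bsub>A\<^esub>) \<in> hom_ur AR"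
    "ur0.func (ur.shift ell (ur.dinv \<one>\<^bsub>A\<^esub>)) = H.alpha"
    using ur.shift[OF d(1) ell_carrier] by (simp_all add: d(2) ring_carrier H.alpha_def[abs_def])
  have "xi AR S ell a = S (pair.hit H.alpha a)"
    using act_ur_eq[OF s(1) a] by (simp add: xi_def inv_ell_eq shift_eq(1) same_total s(2))
  then show ?thesis using hit_carrier(1)[of H.alpha a] by (simp add: H.xi_map_def)
qed

lemma xi_cohit: "pair.cofunctional g \<Longrightarrow> xi AR S ell (pair.cohit g ell) = pair.lhit (H.twist g) ell"
  by (simp add: xi_eq hit_carrier H.xi_map_cohit)

lemma lhit_inj: "pair.lfunctional f \<Longrightarrow> pair.lfunctional f' \<Longrightarrow> pair.lhit f ell = pair.lhit f' ell \<Longrightarrow> f = f'"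
  by (rule lr.hit_inj)

text \<open>Bijectivity is read off from \<open>xi_cohit\<close>: through the bijections given by
  \<open>ell\<close>, the map becomes \<open>twist\<close>, whose inverse is
  \<open>untwist\<close>.\<close>

lemma xi_bij: "bij_betw (xi AR S ell) (carrier A) (carrier A)"
  unfolding bij_betw_def
proof
  have ex: "\<exists>g. pair.cofunctional g \<and> pair.cohit g ell = a" if "a \<in> carrier A" for a
    using H.cohit_surj[of a] that by simp
  show "inj_on (xi AR S ell) (carrier A)"
  proof (rule inj_onI)
    fix a b assume a: "a \<in> carrier A" and b: "b \<in> carrier A" and eq: "xi AR S ell a = xi AR S ell b"
    obtain g where g: "pair.cofunctional g" "pair.cohit g ell = a" using ex[OF a] by blast
    obtain h where h: "pair.cofunctional h" "pair.cohit h ell = b" using ex[OF b] by blast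
    have "pair.lhit (H.twist g) ell = pair.lhit (H.twist h) ell"
      using eq unfolding g(2)[symmetric] h(2)[symmetric] xi_cohit[OF g(1)] xi_cohit[OF h(1)] .
    then have "H.twist g = H.twist h"
      by (intro lhit_inj) (simp_all add: H.lfunctional_twist g h)
    then have "g = h" using H.untwist_twist g(1) h(1) by metis
    then show "a = b" using g h by simp
  qed
  have "b \<in> xi AR S ell ` carrier A" if b: "b \<in> carrier A" for b
  proof -
    obtain f where f: "pair.functional f" "pair.hit f ell = b" using H.hit_surj[of b] b by auto
    note l = pair.lfunctional_lower[OF f(1)]
    have "xi AR S ell (pair.cohit (H.untwist (pair.lower f)) ell) = b"
      by (simp add: xi_cohit H.cofunctional_untwist l H.twist_untwist pair.lhit_lower f)
    then show ?thesis using hit_carrier(3) by blast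
  qed
  moreover have "xi AR S ell a \<in> carrier A" if "a \<in> carrier A" for a
    using ex[OF that] xi_cohit hit_carrier(2) by metis
  ultimately show "xi AR S ell ` carrier A = carrier A" by blast
qed

text \<open>The formula through which the inverse of \<open>\<xi>\<close> enters the last two
  isomorphisms: on functionals it is composition with the antipode.\<close>

lemma inv_xi_lhit: "pair.lfunctional f \<Longrightarrow> inv_xi AR S ell (pair.lhit f ell) = pair.cohit (H.untwist f) ell"
  unfolding inv_xi_def same_total
  by (rule inv_into_f_eq[OF bij_betw_imp_inj_on[OF xi_bij] hit_carrier(3)])
    (simp add: xi_cohit H.cofunctional_untwist H.twist_untwist)

theorem xi_ring_iso: "xi AR S ell \<in> ring_iso A (opp_ring A)"
proof (rule ring_iso_memI)
  fix a b assume ab: "a \<in> carrier A" "b \<in> carrier A"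
  have c: "H.xi_map x \<in> carrier A" if "x \<in> carrier A" for x
    using xi_bij that by (auto simp: bij_betw_def xi_eq)
  show "xi AR S ell a \<in> carrier (opp_ring A)" using c ab by (simp add: xi_eq)
  show "xi AR S ell (a \<otimes>\<^bsub>A\<^esub> b) = xi AR S ell a \<otimes>\<^bsub>opp_ring A\<^esub> xi AR S ell b"
    using H.xi_map_mult[of a b] ab c by (simp add: xi_eq)
  show "xi AR S ell (a \<oplus>\<^bsub>A\<^esub> b) = xi AR S ell a \<oplus>\<^bsub>opp_ring A\<^esub> xi AR S ell b"
    using H.xi_map_add[of a b] ab c by (simp add: xi_eq)
next
  show "xi AR S ell \<one>\<^bsub>A\<^esub> = \<one>\<^bsub>opp_ring A\<^esub>" using H.xi_map_one by (simp add: xi_eq)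
  show "bij_betw (xi AR S ell) (carrier A) (carrier (opp_ring A))" using xi_bij by simp
qed

lemma nu: "l \<in> carrier (Bas AL) \<Longrightarrow> nu AL AR l \<in> carrier (Bas AR)"
  "l \<in> carrier (Bas AL) \<Longrightarrow> src AR (nu AL AR l) = R.sproj (src AL l)"
  using LA by (simp_all add: nu_def R.sproj_def)

lemma mu: "l \<in> carrier (Bas AL) \<Longrightarrow> mu AL AR l \<in> carrier (Bas AR)"
  "l \<in> carrier (Bas AL) \<Longrightarrow> src AR (mu AL AR l) = tgt AL l"
proof -
  show "l \<in> carrier (Bas AL) \<Longrightarrow> mu AL AR l \<in> carrier (Bas AR)" using LA by (simp add: mu_def)
  have "src AR (mu AL AR l) = R.sproj (tgt AL l)" if "l \<in> carrier (Bas AL)"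
    using LA that by (simp add: mu_def R.sproj_def)
  then show "l \<in> carrier (Bas AL) \<Longrightarrow> src AR (mu AL AR l) = tgt AL l" by (simp add: tgt_AL_proj)
qed

text \<open>The equation forces \<open>\<phi>\<close> to be the composite of \<open>\<kappa>\<close>
  with the inverse of \<open>\<kappa>'\<close>.\<close>

lemma bij_of_base_iso:
  assumes \<kappa>: "bij_betw \<kappa> K C" and \<kappa>': "bij_betw \<kappa>' K' C" and \<phi>: "\<And>k. k \<in> K \<Longrightarrow> \<phi> k \<in> K'"
    "\<And>k. k \<in> K \<Longrightarrow> \<kappa>' (\<phi> k) = \<kappa> k"
  shows "bij_betw \<phi> K K'"
proof -
  have "bij_betw (inv_into K' \<kappa>' \<circ> \<kappa>) K K'"
    by (rule bij_betw_trans[OF \<kappa> bij_betw_inv_into[OF \<kappa>']])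
  moreover have "(inv_into K' \<kappa>' \<circ> \<kappa>) k = \<phi> k" if "k \<in> K" for k
    using \<phi> that inv_into_f_f[OF bij_betw_imp_inj_on[OF \<kappa>']] by (simp flip: \<phi>(2))
  ultimately show ?thesis by (simp cong: bij_betw_cong)
qed

text \<open>Computing \<open>\<theta>_R\<close> through \<open>\<mu>\<close> and
  \<open>\<nu>\<close> shows that \<open>s_R \<circ> \<theta>_R\<close> is the base embedding of
  \<open>^*\<A>\<close>. Its inverse therefore matches that embedding with \<open>s_R\<close>, the
  one of \<open>\<A>^*\<close>.\<close>

lemma theta:
  "r \<in> carrier (Bas AR) \<Longrightarrow> inv_into (carrier (Bas AR)) (theta_R AL AR) r \<in> carrier (Bas AR)"
  "r \<in> carrier (Bas AR) \<Longrightarrow> R.sproj (L.tproj (src AR (inv_into (carrier (Bas AR)) (theta_R AL AR) r))) = src AR r"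
proof -
  note b = base_ur base_lr base_ul
  have \<kappa>: "bij_betw (src AR) (carrier (Bas AR)) {x. R.sproj x = x}"
    "bij_betw (\<lambda>k. R.sproj (src AL k)) (carrier (Bas AL)) {x. R.sproj x = x}"
    "bij_betw (\<lambda>k. R.sproj (L.tproj (src AR k))) (carrier (Bas AR)) {x. R.sproj x = x}"
    using b by (auto simp: base_iso_def)
  have mu_bij: "bij_betw (mu AL AR) (carrier (Bas AL)) (carrier (Bas AR))"
    by (rule bij_of_base_iso[OF \<kappa>(2,3)]) (simp_all add: mu tgt_AL_proj)
  have th: "theta_R AL AR k \<in> carrier (Bas AR) \<and> src AR (theta_R AL AR k) = R.sproj (L.tproj (src AR k))"
    if k: "k \<in> carrier (Bas AR)" for k
  proof -
    let ?l = "inv_into (carrier (Bas AL)) (mu AL AR) k"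
    have l: "?l \<in> carrier (Bas AL)" "mu AL AR ?l = k"
      using bij_betw_apply[OF bij_betw_inv_into[OF mu_bij] k] bij_betw_inv_into_right[OF mu_bij k] by auto
    have "R.sproj (src AL ?l) = R.sproj (L.tproj (src AR k))"
      using mu(2)[OF l(1)] l by (simp add: tgt_AL_proj)
    then show ?thesis using nu[OF l(1)] by (simp add: theta_R_def)
  qed
  have th_bij: "bij_betw (theta_R AL AR) (carrier (Bas AR)) (carrier (Bas AR))"
    by (rule bij_of_base_iso[OF \<kappa>(3,1)]) (use th in auto)
  fix r assume r: "r \<in> carrier (Bas AR)"
  show i: "inv_into (carrier (Bas AR)) (theta_R AL AR) r \<in> carrier (Bas AR)"
    by (rule bij_betw_apply[OF bij_betw_inv_into[OF th_bij] r])
  show "R.sproj (L.tproj (src AR (inv_into (carrier (Bas AR)) (theta_R AL AR) r))) = src AR r"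
    using th[OF i] bij_betw_inv_into_right[OF th_bij r] by simp
qed

lemma dual_simps: "Tot (dual_ur AR ell) = ring_ur AR" "Bas (dual_ur AR ell) = Bas AR"
  "Tot (dual_ul AR ell) = ring_ul AR" "Bas (dual_ul AR ell) = Bas AR"
  "Tot (op_cop (dual_lr AL ell)) = opp_ring (ring_lr AL)" "Bas (op_cop (dual_lr AL ell)) = opp_ring (Bas AL)"
  "Tot (op_cop (dual_ll AL ell)) = opp_ring (ring_ll AL)" "Bas (op_cop (dual_ll AL ell)) = opp_ring (Bas AL)"
  by (simp_all add: dual_ur_def dual_ul_def dual_lr_def dual_ll_def op_cop_def)

lemma funcD:
  "\<phi> \<in> hom_ur AR \<Longrightarrow> pair.functional (ur0.func \<phi>)"
  "\<psi> \<in> hom_lr AL \<Longrightarrow> pair.lfunctional (lr.func \<psi>)"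
  "\<omega> \<in> hom_ll AL \<Longrightarrow> co.lfunctional (ll.func \<omega>)"
  using ur0.func_functional[of \<phi>] lr.func_functional[of \<psi>] ll.func_functional[of \<omega>] by (simp_all add: ring_carrier)

text \<open>The value of a functional under \<open>ell_L\<close> is also the value of its raised
  functional under \<open>ell_R\<close>, because the two have the same operator. So the comparison
  map is \<open>raise\<close>, which is how \<open>F_lr\<close> is defined.\<close>

lemma iso_lr_ur: "left_bialgebroid_iso (op_cop (dual_lr AL ell)) (dual_ur AR ell)
    (inv_ell_ur AR ell \<circ> ell_lr AL ell) (nu AL AR)"
proof (rule dual_model_iso[OF model_lr model_ur]; unfold dual_simps opp_ring_simps(1) ring_carrier)
  fix \<psi> assume \<psi>: "\<psi> \<in> hom_lr AL"
  note f = funcD(2)[OF \<psi>]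
  have "(inv_ell_ur AR ell \<circ> ell_lr AL ell) \<psi> = ur.dinv (pair.hit (pair.raise (lr.func \<psi>)) ell)"
    by (simp add: inv_ell_eq ell_eq \<psi> pair.hit_raise f)
  then show "(inv_ell_ur AR ell \<circ> ell_lr AL ell) \<psi> \<in> hom_ur AR"
    "ur0.func ((inv_ell_ur AR ell \<circ> ell_lr AL ell) \<psi>) = F_lr \<psi>"
    using ur_dinv_hit[OF pair.functional_raise[OF f]] by (simp_all add: F_lr_def)
qed (simp_all add: nu)

text \<open>The coopposite version of the previous argument; what remains of the route of
  \<open>F_ll\<close> is precisely \<open>F_ul\<close>.\<close>

lemma iso_ll_ul: "left_bialgebroid_iso (op_cop (dual_ll AL ell)) (dual_ul AR ell)
    (inv_ell_ul AR ell \<circ> ell_ll AL ell) (mu AL AR)"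
proof (rule dual_model_iso[OF model_ll model_ul]; unfold dual_simps opp_ring_simps(1) ring_carrier)
  fix \<omega> assume \<omega>: "\<omega> \<in> hom_ll AL"
  note f = funcD(3)[OF \<omega>]
  have "(inv_ell_ul AR ell \<circ> ell_ll AL ell) \<omega> = ul.dinv (pair.cohit (co.raise (ll.func \<omega>)) ell)"
    by (simp add: inv_ell_eq ell_eq \<omega> co.hit_raise f)
  then show "(inv_ell_ul AR ell \<circ> ell_ll AL ell) \<omega> \<in> hom_ul AR"
    "F_ul ((inv_ell_ul AR ell \<circ> ell_ll AL ell) \<omega>) = F_ll \<omega>"
    using ul_dinv_cohit[OF co.functional_raise[OF f]] by (simp_all add: F_ul_def F_ll_def)
qed (simp_all add: mu tgt_AL_proj)

text \<open>The functional is lowered without changing its value on \<open>ell\<close>, and the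
  inverse of \<open>\<xi>\<close> then composes it with the antipode. The route of
  \<open>F_ul\<close> undoes both.\<close>

lemma iso_ur_ul: "left_bialgebroid_iso (dual_ur AR ell) (dual_ul AR ell)
    (inv_ell_ul AR ell \<circ> inv_xi AR S ell \<circ> ell_ur AR ell) (inv_into (carrier (Bas AR)) (theta_R AL AR))"
proof (rule dual_model_iso[OF model_ur model_ul]; unfold dual_simps opp_ring_simps(1) ring_carrier)
  fix \<phi> assume \<phi>: "\<phi> \<in> hom_ur AR"
  note f = funcD(1)[OF \<phi>]
  note l = pair.lfunctional_lower[OF f]
  have "(inv_ell_ul AR ell \<circ> inv_xi AR S ell \<circ> ell_ur AR ell) \<phi> =
      ul.dinv (pair.cohit (H.untwist (pair.lower (ur0.func \<phi>))) ell)"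
    using inv_xi_lhit[OF l] by (simp add: inv_ell_eq ell_eq \<phi> pair.lhit_lower f)
  then show "(inv_ell_ul AR ell \<circ> inv_xi AR S ell \<circ> ell_ur AR ell) \<phi> \<in> hom_ul AR"
    "F_ul ((inv_ell_ul AR ell \<circ> inv_xi AR S ell \<circ> ell_ur AR ell) \<phi>) = ur0.func \<phi>"
    using ul_dinv_cohit[OF H.cofunctional_untwist[OF l]]
    by (simp_all add: F_ul_def H.twist_untwist l pair.raise_lower f)
qed (simp_all only: theta)

text \<open>Here the inverse of \<open>\<xi>\<close> leads to \<open>^*\<A>\<close> and the
  coopposite lowering continues to \<open>_*\<A>\<close>. Both duals embed the base by
  \<open>s_R \<circ> \<nu>\<close>, which explains the identity on \<open>L\<close>.\<close>

lemma iso_lr_ll: "left_bialgebroid_iso (op_cop (dual_lr AL ell)) (op_cop (dual_ll AL ell))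
    (inv_ell_ll AL ell \<circ> inv_xi AR S ell \<circ> ell_lr AL ell) id"
proof (rule dual_model_iso[OF model_lr model_ll]; unfold dual_simps opp_ring_simps(1) ring_carrier)
  fix \<psi> assume \<psi>: "\<psi> \<in> hom_lr AL"
  note f = funcD(2)[OF \<psi>]
  note u = H.cofunctional_untwist[OF f]
  have "(inv_ell_ll AL ell \<circ> inv_xi AR S ell \<circ> ell_lr AL ell) \<psi> =
      ll.dinv (co.lhit (co.lower (H.untwist (lr.func \<psi>))) ell)"
    using inv_xi_lhit[OF f] by (simp add: inv_ell_eq ell_eq \<psi> co.lhit_lower[OF u])
  then show "(inv_ell_ll AL ell \<circ> inv_xi AR S ell \<circ> ell_lr AL ell) \<psi> \<in> hom_ll AL"
    "F_ll ((inv_ell_ll AL ell \<circ> inv_xi AR S ell \<circ> ell_lr AL ell) \<psi>) = F_lr \<psi>"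
    using ll_dinv_hit[OF co.lfunctional_lower[OF u]]
    by (simp_all add: F_ll_def F_lr_def co.raise_lower[OF u] H.twist_untwist f)
qed simp_all

end

theorem theorem5p16:
  fixes AL :: "('a, 'l) bialgebroid" and AR :: "('a, 'r) bialgebroid"
    and S :: "'a \<Rightarrow> 'a" and ell :: 'a
  assumes "symmetrized_hopf_algebroid AL AR S"
    and "nondegenerate_left_integral AL AR ell"
  shows "xi AR S ell \<in> ring_iso (Tot AL) (opp_ring (Tot AL)) \<and>
    left_bialgebroid_iso (op_cop (dual_lr AL ell)) (dual_ur AR ell)
      (inv_ell_ur AR ell \<circ> ell_lr AL ell) (nu AL AR) \<and>
    left_bialgebroid_iso (op_cop (dual_ll AL ell)) (dual_ul AR ell)
      (inv_ell_ul AR ell \<circ> ell_ll AL ell) (mu AL AR) \<and>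
    left_bialgebroid_iso (dual_ur AR ell) (dual_ul AR ell)
      (inv_ell_ul AR ell \<circ> inv_xi AR S ell \<circ> ell_ur AR ell)
      (inv_into (carrier (Bas AR)) (theta_R AL AR)) \<and>
    left_bialgebroid_iso (op_cop (dual_lr AL ell)) (op_cop (dual_ll AL ell))
      (inv_ell_ll AL ell \<circ> inv_xi AR S ell \<circ> ell_lr AL ell) id"
proof -
  interpret integral_hopf_algebroid AL AR S ell
    using assms by (simp add: integral_hopf_algebroid_def integral_hopf_algebroid_axioms_def)
  show ?thesis
    using xi_ring_iso iso_lr_ur iso_ll_ul iso_ur_ul iso_lr_ll by blast
qed

end
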